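(* Let $m\ge 1$, let $\sigma\in B_{m+1}$ be a braid on $m+1$ strands, let $\mathcal{M}^{Kh}_\sigma$ be the associated Khovanov–Seidel $A_\infty$ bimodule over $B^{Kh}$, and let $\mathcal{M}^{HF}_\sigma$ be the associated ($1$-moving-strand) bordered Floer $A_\infty$ bimodule over $B^{HF}$. There exists a filtration on $\mathcal{M}^{HF}_\sigma$, making it a filtered $A_\infty$ bimodule over the filtered algebra $B^{HF}$, whose associated graded bimodule is quasi-isomorphic, as an ungraded $A_\infty$ bimodule over $\mathrm{gr}(B^{HF})\cong B^{Kh}$, to $\mathcal{M}^{Kh}_\sigma$. Accordingly, one obtains a spectral sequence whose $E^1$ page is isomorphic (in $D_\infty(B^{Kh})$) to $\mathcal{M}^{Kh}_\sigma$ and whose $E^\infty$ page is isomorphic (in $D_\infty(B^{HF})$) to $\mathcal{M}^{HF}_\sigma$.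
   Context: **General conventions.** $\mathbb{F}=\mathbb{Z}/2\mathbb{Z}$; all algebras and modules are over $\mathbb{F}$. $A_\infty$ bimodules have structure maps $m_{(n_1|1|n_2)}$ ($n_1$ left algebra inputs, $n_2$ right algebra inputs), and $A_\infty$ bimodule morphisms have terms $f_{(n_1|1|n_2)}$. $D_\infty(\mathbf{A})$ has as objects homologically unital $A_\infty$ (bi)modules over $\mathbf{A}$ and as morphisms $A_\infty$ homotopy classes of $A_\infty$ morphisms (so quasi-isomorphisms are invertible). "Ungraded" means homological gradings are forgotten. A filtered $A_\infty$ algebra is an $A_\infty$ algebra with an increasing family of subspaces $\mathcal{F}_i$, $i\in\mathbb{Z}$, with $m_n(\mathcal{F}_{i_1}\otimes\dots\otimes\mathcal{F}_{i_n})\subseteq\mathcal{F}_{i_1+\dots+i_n}$; filtered $A_\infty$ bimodules over a filtered $A_\infty$ algebra are defined analogously; $\mathrm{gr}$ denotes $\bigoplus_i\mathcal{F}_i/\mathcal{F}_{i-1}$ with the induced structure. The $E^1$ page of the spectral sequence of a filtered object is the homology of the associated graded, and by convention its $E^\infty$ page means the homology of the total complex, each carrying its minimal-model $A_\infty$ structure (transferred by homological perturbation). The mapping cone $MC(f)$ of an $A_\infty$ morphism $f:\mathbf{M}\to\mathbf{N}$ of bimodules is $\mathbf{M}[1]\oplus\mathbf{N}$ with $m_{(n_1|1|n_2)}=\begin{pmatrix} m^M_{(n_1|1|n_2)}&0\\ f_{(n_1|1|n_2)}&m^N_{(n_1|1|n_2)}\end{pmatrix}$. The $A_\infty$ tensor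 product of $\mathbf{A}$-bimodules is $\mathbf{M}\widetilde\otimes_{\mathbf{A}}\mathbf{N}=\bigoplus_{n\ge0}\mathbf{M}\otimes\mathbf{A}^{\otimes n}\otimes\mathbf{N}$, with differential the sum of all ways of applying $m^M_{(0|1|i)}$ to $\mathbf{M}$ and the first $i$ algebra factors, $m^A_i$ to $i$ consecutive algebra factors, or $m^N_{(i|1|0)}$ to the last $i$ algebra factors and $\mathbf{N}$; for $n_1>0$ the operation $m_{(n_1|1|0)}$ is the sum over $i$ of $m^M_{(n_1|1|i)}$ applied to the $n_1$ inputs, $\mathbf{M}$ and the first $i$ algebra factors; symmetrically for $m_{(0|1|n_2)}$; operations with both $n_1,n_2>0$ vanish. **Algebras.** $B^{Kh}=\bigoplus_{i,j=0}^m {}_iB^{Kh}_j$, where ${}_iB_j^{Kh}$ is $0$ for $i<j$, spanned by ${}_i\mathbb{1}_i$ for $i=j$, and spanned by ${}_i\mathbb{1}_j,{}_i\mathbf{x}_j$ for $i>j$; the product is ${}_i\mathbb 1_j\,{}_j\mathbb 1_k={}_i\mathbb 1_k$, ${}_i\mathbb 1_j\,{}_j\mathbf x_k={}_i\mathbf x_j\,{}_j\mathbb 1_k={}_i\mathbf x_k$, ${}_i\mathbf x_j\,{}_j\mathbf x_k=0$, and products with mismatched inner indices vanish. $B^{HF}=\bigoplus_{i,j=0}^m{}_iB^{HF}_j$ (the $1$-moving strands algebra) has ${}_iB^{HF}_j$ equal to $0$ for $i<j$, spanned by ${}_i\mathbb 1_i$ for $i=j$, and spanned by ${}_i\rho_j,{}_i\sigma_j$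 for $i>j$; the ${}_i\mathbb 1_i$ act as local units, ${}_i\rho_j\,{}_j\rho_k={}_i\rho_k$, ${}_i\sigma_j\,{}_j\sigma_k={}_i\sigma_k$, ${}_i\rho_j\,{}_j\sigma_k={}_i\sigma_j\,{}_j\rho_k=0$, mismatched products vanish. All operations $m_n$, $n\ne2$, vanish on both algebras. $B^{HF}$ is filtered by $\mathcal{F}_{-1}=0$, $\mathcal{F}_0=\mathrm{Span}\{{}_i\mathbb 1_i,\ {}_i\rho_j+{}_i\sigma_j\ (i>j)\}$, $\mathcal{F}_1=B^{HF}$, and $\mathrm{gr}(B^{HF})\cong B^{Kh}$ via ${}_i\mathbb 1_i\mapsto{}_i\mathbb 1_i$, $[{}_i\rho_j+{}_i\sigma_j]\mapsto{}_i\mathbb 1_j$, $[{}_i\rho_j]\mapsto{}_i\mathbf x_j$. **The bimodules $\mathcal{M}^{Kh}_\sigma$.** For $k\in\{1,\dots,m\}$ let $P^{Kh}_k=\mathrm{Span}\langle\mathbf u^*,\mathbf v^*\rangle$ be the left $B^{Kh}$-module in which the only nonzero products of basis elements are ${}_k\mathbb 1_k\mathbf u^*=\mathbf u^*$, ${}_{k-1}\mathbb 1_{k-1}\mathbf v^*=\mathbf v^*$, ${}_k\mathbf x_{k-1}\mathbf v^*=\mathbf u^*$, and let ${}_kP^{Kh}=\mathrm{Span}\langle\mathbf u,\mathbf v\rangle$ be the right module with only nonzero products $\mathbf u\,{}_k\mathbb 1_k=\mathbf u$, $\mathbf u\,{}_k\mathbf x_{k-1}=\mathbf v$, $\mathbf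 v\,{}_{k-1}\mathbb 1_{k-1}=\mathbf v$. Then $\mathcal{M}^{Kh}_{\sigma_k^-}=MC(\gamma_k^{Kh}:B^{Kh}\to P_k^{Kh}\otimes{}_kP^{Kh})$, with $\gamma_k^{Kh}$ the bimodule map with ${}_{k-1}\mathbb 1_{k-1}\mapsto\mathbf v^*\otimes\mathbf v$, ${}_k\mathbb 1_k\mapsto\mathbf u^*\otimes\mathbf u$, and ${}_i\mathbb 1_i\mapsto0$ otherwise; and $\mathcal{M}^{Kh}_{\sigma_k^+}=MC(\beta_k^{Kh}:P_k^{Kh}\otimes{}_kP^{Kh}\to B^{Kh})$, where the only nonzero terms of $\beta_k^{Kh}$ on basis elements are, for $(1|1|0)$: ${}_i\mathbb 1_k\otimes(\mathbf u^*\otimes\mathbf u)\mapsto{}_i\mathbf x_k$ ($i\ge k+1$), ${}_i\mathbb 1_{k-1}\otimes(\mathbf v^*\otimes\mathbf u)\mapsto{}_i\mathbb 1_k$ ($i\ge k$), ${}_i\mathbf x_{k-1}\otimes(\mathbf v^*\otimes\mathbf u)\mapsto{}_i\mathbf x_k$ ($i\ge k+1$), ${}_i\mathbb 1_{k-1}\otimes(\mathbf v^*\otimes\mathbf v)\mapsto{}_i\mathbf x_{k-1}$ ($i\ge k$); and for $(0|1|1)$: $(\mathbf u^*\otimes\mathbf u)\otimes{}_k\mathbb 1_j\mapsto{}_k\mathbf x_j$ ($j\le k-1$), $(\mathbf v^*\otimes\mathbf u)\otimes{}_k\mathbb 1_j\mapsto{}_{k-1}\mathbb 1_j$ ($j\le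 k-1$), $(\mathbf v^*\otimes\mathbf u)\otimes{}_k\mathbf x_j\mapsto{}_{k-1}\mathbf x_j$ ($j\le k-2$), $(\mathbf v^*\otimes\mathbf v)\otimes{}_{k-1}\mathbb 1_j\mapsto{}_{k-1}\mathbf x_j$ ($j\le k-2$). For $\sigma=\sigma_{k_1}^\pm\cdots\sigma_{k_n}^\pm$ written in the elementary Artin generators, $\mathcal{M}^{Kh}_\sigma=\mathcal{M}^{Kh}_{\sigma_{k_1}^\pm}\widetilde\otimes_{B^{Kh}}\cdots\widetilde\otimes_{B^{Kh}}\mathcal{M}^{Kh}_{\sigma_{k_n}^\pm}$ (and $\mathcal{M}^{Kh}_{\mathrm{Id}}=B^{Kh}$); its class in $D_\infty(B^{Kh})$ depends only on $\sigma$. **The bimodules $\mathcal{M}^{HF}_\sigma$.** Let $\Sigma$ be the double cover of the disk branched at $m+1$ points and $\hat\sigma$ the mapping class of $\Sigma$ lifting $\sigma$. $\mathcal{M}^{HF}_\sigma$ is the $1$-moving-strand part of the Lipshitz–Ozsváth–Thurston bimodule $\widehat{CFDA}(\hat\sigma)$, an $A_\infty$ bimodule over $B^{HF}$ well defined up to quasi-isomorphism; it is represented by the following model, which is what $\mathcal{M}^{HF}_\sigma$ means in the statement. For $k\in\{1,\dots,m\}$ let $P_k^{HF}=\mathrm{Span}\langle\mathbf u^*,\mathbf v^*\rangle$ be the left $B^{HF}$-module with only nonzero products ${}_k\mathbb 1_k\mathbf u^*=\mathbf u^*$, ${}_{k-1}\mathbb 1_{k-1}\mathbf v^*=\mathbf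 v^*$, ${}_k\rho_{k-1}\mathbf v^*={}_k\sigma_{k-1}\mathbf v^*=\mathbf u^*$, and ${}_kP^{HF}=\mathrm{Span}\langle\mathbf u,\mathbf v\rangle$ the right module with only nonzero products $\mathbf u\,{}_k\mathbb 1_k=\mathbf u$, $\mathbf u\,{}_k\rho_{k-1}=\mathbf u\,{}_k\sigma_{k-1}=\mathbf v$, $\mathbf v\,{}_{k-1}\mathbb 1_{k-1}=\mathbf v$. Then $\mathcal{M}^{HF}_{\sigma_k^-}=MC(\gamma_k^{HF}:B^{HF}\to P_k^{HF}\otimes{}_kP^{HF})$, with $\gamma_k^{HF}$ the bimodule map with ${}_{k-1}\mathbb 1_{k-1}\mapsto\mathbf v^*\otimes\mathbf v$, ${}_k\mathbb 1_k\mapsto\mathbf u^*\otimes\mathbf u$, other ${}_i\mathbb 1_i\mapsto0$; and $\mathcal{M}^{HF}_{\sigma_k^+}=MC(\beta_k^{HF}:P_k^{HF}\otimes{}_kP^{HF}\to B^{HF})$, where the only nonzero terms of $\beta_k^{HF}$ on basis elements are, for $(1|1|0)$: $({}_i\rho_k,\mathbf u^*\otimes\mathbf u)\mapsto{}_i\rho_k$ ($i\ge k+1$), $({}_k\sigma_{k-1},\mathbf v^*\otimes\mathbf u)\mapsto{}_k\mathbb 1_k$, $({}_i\rho_{k-1},\mathbf v^*\otimes\mathbf u)\mapsto{}_i\rho_k$ ($i\ge k+1$), $({}_i\sigma_{k-1},\mathbf v^*\otimes\mathbf u)\mapsto{}_i\sigma_k$ ($i\ge k+1$), $({}_i\rho_{k-1},\mathbf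 v^*\otimes\mathbf v)\mapsto{}_i\rho_{k-1}$ ($i\ge k$); and for $(0|1|1)$: $(\mathbf u^*\otimes\mathbf u,{}_k\rho_j)\mapsto{}_k\rho_j$ ($j\le k-1$), $(\mathbf v^*\otimes\mathbf u,{}_k\sigma_{k-1})\mapsto{}_{k-1}\mathbb 1_{k-1}$, $(\mathbf v^*\otimes\mathbf u,{}_k\rho_j)\mapsto{}_{k-1}\rho_j$ ($j\le k-2$), $(\mathbf v^*\otimes\mathbf u,{}_k\sigma_j)\mapsto{}_{k-1}\sigma_j$ ($j\le k-2$), $(\mathbf v^*\otimes\mathbf v,{}_{k-1}\rho_j)\mapsto{}_{k-1}\rho_j$ ($j\le k-2$). For $\sigma=\sigma_{k_1}^\pm\cdots\sigma_{k_n}^\pm$, $\mathcal{M}^{HF}_\sigma=\mathcal{M}^{HF}_{\sigma_{k_1}^\pm}\widetilde\otimes_{B^{HF}}\cdots\widetilde\otimes_{B^{HF}}\mathcal{M}^{HF}_{\sigma_{k_n}^\pm}$ (and $\mathcal{M}^{HF}_{\mathrm{Id}}=B^{HF}$). *)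

theory Defs
  imports
    "HOL-Algebra.FiniteProduct"
    "HOL-Algebra.Product_Groups"
    "HOL-Library.Poly_Mapping"
    "HOL-Library.Z2"
begin

section \<open>Vector spaces over the field with two elements\<close>

text \<open>
  A vector space over F = Z/2Z is a commutative group of exponent two: the scalar action is
  determined, additive maps are linear (\<^const>\<open>hom\<close>) and subgroups are subspaces.
  The group record of HOL-Algebra is multiplicative, so its product, unit and finite products are the
  vector addition, zero and finite sums; the following abbreviations restore additive names.
  The library quotient \<^const>\<open>FactGroup\<close> and direct sum \<^const>\<open>sum_group\<close> then are the ones of vector
  spaces. No gradings are carried along, and there are no signs.
\<close>

abbreviation (input) vadd :: "('v, 'e) monoid_scheme \<Rightarrow> 'v \<Rightarrow> 'v \<Rightarrow> 'v" where
  "vadd V x y \<equiv> x \<otimes>\<^bsub>V\<^esub> y"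

abbreviation (input) vzero :: "('v, 'e) monoid_scheme \<Rightarrow> 'v" where
  "vzero V \<equiv> \<one>\<^bsub>V\<^esub>"

abbreviation (input) vsum :: "('v, 'e) monoid_scheme \<Rightarrow> ('i \<Rightarrow> 'v) \<Rightarrow> 'i set \<Rightarrow> 'v" where
  "vsum V f I \<equiv> finprod V f I"

definition f2_space :: "('v, 'e) monoid_scheme \<Rightarrow> bool" where
  "f2_space V \<longleftrightarrow> comm_group V \<and> (\<forall>x\<in>carrier V. vadd V x x = vzero V)"


section \<open>\<open>A\<^sub>\<infinity>\<close> algebras, bimodules and morphisms\<close>

text \<open>
  \<open>aop A [a\<^sub>1, \<dots>, a\<^sub>n]\<close> is \<open>m\<^sub>n(a\<^sub>1 \<otimes> \<dots> \<otimes> a\<^sub>n)\<close> for \<open>n \<ge> 1\<close> (the value on the empty list is irrelevant), and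
  \<open>bop M as x bs\<close> is \<open>m\<^bsub>(n\<^sub>1|1|n\<^sub>2)\<^esub>(as \<otimes> x \<otimes> bs)\<close> with \<open>n\<^sub>1 = length as\<close>, \<open>n\<^sub>2 = length bs\<close>. Linear maps out of
  tensor products of abstract spaces are given as multilinear functions.
\<close>

record 'a ainf_alg = "'a monoid" +
  aop :: "'a list \<Rightarrow> 'a"

record ('a, 'm) ainf_bimod = "'m monoid" +
  bop :: "'a list \<Rightarrow> 'm \<Rightarrow> 'a list \<Rightarrow> 'm"

text \<open>Apply \<open>m\<^bsub>j-i\<^esub>\<close> to the consecutive entries at positions \<open>i, \<dots>, j - 1\<close>.\<close>
definition contract :: "'a ainf_alg \<Rightarrow> 'a list \<Rightarrow> nat \<Rightarrow> nat \<Rightarrow> 'a list" where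
  "contract A as i j = take i as @ aop A (drop i (take j as)) # drop j as"

definition segments :: "'a list \<Rightarrow> (nat \<times> nat) set" where
  "segments as = {(i, j). i < j \<and> j \<le> length as}"

definition ainf_algebra :: "'a ainf_alg \<Rightarrow> bool" where
  "ainf_algebra A \<longleftrightarrow>
     f2_space A \<and>
     (\<forall>as\<in>lists (carrier A). \<forall>bs\<in>lists (carrier A). (\<lambda>a. aop A (as @ a # bs)) \<in> hom A A) \<and>
     (\<forall>as\<in>lists (carrier A). as \<noteq> [] \<longrightarrow>
        vsum A (\<lambda>(i, j). aop A (contract A as i j)) (segments as) = vzero A)"

text \<open>Families of multilinear maps \<open>A\<^bsup>\<otimes>n\<^sub>1\<^esup> \<otimes> M \<otimes> A\<^bsup>\<otimes>n\<^sub>2\<^esup> \<rightarrow> N\<close>, without compatibility with the operations.\<close>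
definition premorphism ::
  "'a ainf_alg \<Rightarrow> ('a, 'm) ainf_bimod \<Rightarrow> ('a, 'n) ainf_bimod \<Rightarrow>
     ('a list \<Rightarrow> 'm \<Rightarrow> 'a list \<Rightarrow> 'n) \<Rightarrow> bool" where
  "premorphism A M N f \<longleftrightarrow>
     (\<forall>as\<in>lists (carrier A). \<forall>bs\<in>lists (carrier A). (\<lambda>x. f as x bs) \<in> hom M N) \<and>
     (\<forall>as\<in>lists (carrier A). \<forall>as'\<in>lists (carrier A). \<forall>bs\<in>lists (carrier A). \<forall>x\<in>carrier M.
        (\<lambda>a. f (as @ a # as') x bs) \<in> hom A N \<and> (\<lambda>a. f bs x (as @ a # as')) \<in> hom A N)"

text \<open>The terms \<open>g(\<dots>, f(\<dots>, x, \<dots>), \<dots>)\<close>, with \<open>N\<close> the target of \<open>g\<close>.\<close>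
definition compose_terms ::
  "('a, 'n) ainf_bimod \<Rightarrow> ('a list \<Rightarrow> 'k \<Rightarrow> 'a list \<Rightarrow> 'n) \<Rightarrow> ('a list \<Rightarrow> 'm \<Rightarrow> 'a list \<Rightarrow> 'k) \<Rightarrow>
     'a list \<Rightarrow> 'm \<Rightarrow> 'a list \<Rightarrow> 'n" where
  "compose_terms N g f as x bs =
     vsum N (\<lambda>(i, j). g (take i as) (f (drop i as) x (take j bs)) (drop j bs))
       ({..length as} \<times> {..length bs})"

text \<open>The terms in which an operation of the algebra is applied before \<open>f\<close>.\<close>
definition algebra_terms ::
  "'a ainf_alg \<Rightarrow> ('a, 'n) ainf_bimod \<Rightarrow> ('a list \<Rightarrow> 'm \<Rightarrow> 'a list \<Rightarrow> 'n) \<Rightarrow>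
     'a list \<Rightarrow> 'm \<Rightarrow> 'a list \<Rightarrow> 'n" where
  "algebra_terms A N f as x bs =
     vadd N (vsum N (\<lambda>(i, j). f (contract A as i j) x bs) (segments as))
            (vsum N (\<lambda>(i, j). f as x (contract A bs i j)) (segments bs))"

definition ainf_bimodule :: "'a ainf_alg \<Rightarrow> ('a, 'm) ainf_bimod \<Rightarrow> bool" where
  "ainf_bimodule A M \<longleftrightarrow>
     ainf_algebra A \<and> f2_space M \<and> premorphism A M M (bop M) \<and>
     (\<forall>as\<in>lists (carrier A). \<forall>x\<in>carrier M. \<forall>bs\<in>lists (carrier A).
        vadd M (compose_terms M (bop M) (bop M) as x bs) (algebra_terms A M (bop M) as x bs)
          = vzero M)"

text \<open>The differential on the space of premorphisms; its cycles are the \<open>A\<^sub>\<infinity>\<close> morphisms.\<close>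
definition premorphism_diff ::
  "'a ainf_alg \<Rightarrow> ('a, 'm) ainf_bimod \<Rightarrow> ('a, 'n) ainf_bimod \<Rightarrow>
     ('a list \<Rightarrow> 'm \<Rightarrow> 'a list \<Rightarrow> 'n) \<Rightarrow> 'a list \<Rightarrow> 'm \<Rightarrow> 'a list \<Rightarrow> 'n" where
  "premorphism_diff A M N f as x bs =
     vadd N (vadd N (compose_terms N (bop N) f as x bs) (compose_terms N f (bop M) as x bs))
            (algebra_terms A N f as x bs)"

definition ainf_morphism ::
  "'a ainf_alg \<Rightarrow> ('a, 'm) ainf_bimod \<Rightarrow> ('a, 'n) ainf_bimod \<Rightarrow>
     ('a list \<Rightarrow> 'm \<Rightarrow> 'a list \<Rightarrow> 'n) \<Rightarrow> bool" where
  "ainf_morphism A M N f \<longleftrightarrow>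
     premorphism A M N f \<and>
     (\<forall>as\<in>lists (carrier A). \<forall>x\<in>carrier M. \<forall>bs\<in>lists (carrier A).
        premorphism_diff A M N f as x bs = vzero N)"

definition ainf_homotopic ::
  "'a ainf_alg \<Rightarrow> ('a, 'm) ainf_bimod \<Rightarrow> ('a, 'n) ainf_bimod \<Rightarrow>
     ('a list \<Rightarrow> 'm \<Rightarrow> 'a list \<Rightarrow> 'n) \<Rightarrow> ('a list \<Rightarrow> 'm \<Rightarrow> 'a list \<Rightarrow> 'n) \<Rightarrow> bool" where
  "ainf_homotopic A M N f g \<longleftrightarrow>
     (\<exists>h. premorphism A M N h \<and>
        (\<forall>as\<in>lists (carrier A). \<forall>x\<in>carrier M. \<forall>bs\<in>lists (carrier A).
           vadd N (f as x bs) (g as x bs) = premorphism_diff A M N h as x bs))"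

definition ainf_id :: "('a, 'm) ainf_bimod \<Rightarrow> 'a list \<Rightarrow> 'm \<Rightarrow> 'a list \<Rightarrow> 'm" where
  "ainf_id M as x bs = (if as = [] \<and> bs = [] then x else vzero M)"


section \<open>Homology, quasi-isomorphisms and the category \<open>D\<^sub>\<infinity>\<close>\<close>

definition bdiff :: "('a, 'm) ainf_bimod \<Rightarrow> 'm \<Rightarrow> 'm" where
  "bdiff M x = bop M [] x []"

definition cycles :: "('a, 'm) ainf_bimod \<Rightarrow> 'm set" where
  "cycles M = kernel M M (bdiff M)"

definition boundaries :: "('a, 'm) ainf_bimod \<Rightarrow> 'm set" where
  "boundaries M = bdiff M ` carrier M"

definition homology :: "('a, 'm) ainf_bimod \<Rightarrow> 'm set monoid" where
  "homology M = (M\<lparr>carrier := cycles M\<rparr>) Mod boundaries M"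

text \<open>For a chain map \<open>\<phi>\<close>, the class of \<open>z\<close> is sent to the class of \<open>\<phi> z\<close>.\<close>
definition homology_map ::
  "('a, 'n) ainf_bimod \<Rightarrow> ('m \<Rightarrow> 'n) \<Rightarrow> 'm set \<Rightarrow> 'n set" where
  "homology_map N \<phi> C = boundaries N <#>\<^bsub>N\<^esub> (\<phi> ` C)"

definition quasi_isomorphism ::
  "'a ainf_alg \<Rightarrow> ('a, 'm) ainf_bimod \<Rightarrow> ('a, 'n) ainf_bimod \<Rightarrow>
     ('a list \<Rightarrow> 'm \<Rightarrow> 'a list \<Rightarrow> 'n) \<Rightarrow> bool" where
  "quasi_isomorphism A M N f \<longleftrightarrow>
     ainf_morphism A M N f \<and>
     homology_map N (\<lambda>x. f [] x []) \<in> iso (homology M) (homology N)"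

definition quasi_isomorphic ::
  "'a ainf_alg \<Rightarrow> ('a, 'm) ainf_bimod \<Rightarrow> ('a, 'n) ainf_bimod \<Rightarrow> bool" where
  "quasi_isomorphic A M N \<longleftrightarrow>
     ainf_bimodule A M \<and> ainf_bimodule A N \<and> (\<exists>f. quasi_isomorphism A M N f)"

definition homology_unit :: "'a ainf_alg \<Rightarrow> 'a \<Rightarrow> bool" where
  "homology_unit A e \<longleftrightarrow>
     e \<in> carrier A \<and> aop A [e] = vzero A \<and>
     (\<forall>a\<in>carrier A. aop A [a] = vzero A \<longrightarrow>
        vadd A (aop A [e, a]) a \<in> (\<lambda>b. aop A [b]) ` carrier A \<and>
        vadd A (aop A [a, e]) a \<in> (\<lambda>b. aop A [b]) ` carrier A)"

definition homologically_unital :: "'a ainf_alg \<Rightarrow> ('a, 'm) ainf_bimod \<Rightarrow> bool" where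
  "homologically_unital A M \<longleftrightarrow>
     (\<exists>e. homology_unit A e \<and>
        (\<forall>x\<in>cycles M. vadd M (bop M [e] x []) x \<in> boundaries M \<and>
                       vadd M (bop M [] x [e]) x \<in> boundaries M))"

definition D_inf_object :: "'a ainf_alg \<Rightarrow> ('a, 'm) ainf_bimod \<Rightarrow> bool" where
  "D_inf_object A M \<longleftrightarrow> ainf_bimodule A M \<and> homologically_unital A M"

text \<open>Isomorphism in \<open>D\<^sub>\<infinity>(A)\<close>, whose morphisms are homotopy classes of \<open>A\<^sub>\<infinity>\<close> morphisms.\<close>
definition D_inf_isomorphic ::
  "'a ainf_alg \<Rightarrow> ('a, 'm) ainf_bimod \<Rightarrow> ('a, 'n) ainf_bimod \<Rightarrow> bool" where
  "D_inf_isomorphic A M N \<longleftrightarrow>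
     D_inf_object A M \<and> D_inf_object A N \<and>
     (\<exists>f g. ainf_morphism A M N f \<and> ainf_morphism A N M g \<and>
        ainf_homotopic A M M (compose_terms M g f) (ainf_id M) \<and>
        ainf_homotopic A N N (compose_terms N f g) (ainf_id N))"


section \<open>Minimal models by homological perturbation\<close>

text \<open>Contraction of the underlying complex onto its homology: \<open>\<iota>\<close> picks cycle representatives.\<close>
definition homology_contraction ::
  "('a, 'm) ainf_bimod \<Rightarrow> ('m set \<Rightarrow> 'm) \<Rightarrow> ('m \<Rightarrow> 'm set) \<Rightarrow> ('m \<Rightarrow> 'm) \<Rightarrow> bool" where
  "homology_contraction M \<iota> \<pi> h \<longleftrightarrow>
     \<iota> \<in> hom (homology M) M \<and> \<pi> \<in> hom M (homology M) \<and> h \<in> hom M M \<and>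
     (\<forall>C\<in>carrier (homology M). \<iota> C \<in> C \<and> \<pi> (\<iota> C) = C) \<and>
     (\<forall>x\<in>carrier M. \<pi> (bdiff M x) = vzero (homology M)) \<and>
     (\<forall>x\<in>carrier M. vadd M (\<iota> (\<pi> x)) x = vadd M (bdiff M (h x)) (h (bdiff M x)))"

text \<open>
  The perturbation \<open>\<delta>\<close> collects the module operations \<open>m\<^bsub>(n\<^sub>1|1|n\<^sub>2)\<^esub>\<close> with \<open>(n\<^sub>1, n\<^sub>2) \<noteq> (0, 0)\<close>;
  \<open>pert_iterate M \<iota> h n\<close> is \<open>(h \<delta>)\<^sup>n \<iota>\<close>, and the transferred operations are \<open>\<Sum>\<^sub>n \<pi> \<delta> (h \<delta>)\<^sup>n \<iota>\<close>. Each factor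
  \<open>\<delta>\<close> uses up an algebra input, so the sum is finite. The algebra is left untouched: this is the
  minimal model over an algebra with \<open>m\<^sub>1 = 0\<close>, which equals its own homology.
\<close>
definition perturbation ::
  "('a, 'm) ainf_bimod \<Rightarrow> ('a list \<Rightarrow> 'k \<Rightarrow> 'a list \<Rightarrow> 'm) \<Rightarrow> 'a list \<Rightarrow> 'k \<Rightarrow> 'a list \<Rightarrow> 'm" where
  "perturbation M f as x bs =
     vsum M (\<lambda>(i, j). bop M (take i as) (f (drop i as) x (take j bs)) (drop j bs))
       ({..length as} \<times> {..length bs} - {(0, length bs)})"

primrec pert_iterate ::
  "('a, 'm) ainf_bimod \<Rightarrow> ('m set \<Rightarrow> 'm) \<Rightarrow> ('m \<Rightarrow> 'm) \<Rightarrow> nat \<Rightarrow> 'a list \<Rightarrow> 'm set \<Rightarrow> 'a list \<Rightarrow> 'm"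
  where
  "pert_iterate M \<iota> h 0 = (\<lambda>as C bs. if as = [] \<and> bs = [] then \<iota> C else vzero M)"
| "pert_iterate M \<iota> h (Suc n) = (\<lambda>as C bs. h (perturbation M (pert_iterate M \<iota> h n) as C bs))"

definition transferred_bimod ::
  "('a, 'm) ainf_bimod \<Rightarrow> ('m set \<Rightarrow> 'm) \<Rightarrow> ('m \<Rightarrow> 'm set) \<Rightarrow> ('m \<Rightarrow> 'm) \<Rightarrow> ('a, 'm set) ainf_bimod"
  where
  "transferred_bimod M \<iota> \<pi> h =
     \<lparr>carrier = carrier (homology M), monoid.mult = monoid.mult (homology M), one = one (homology M),
      bop = (\<lambda>as C bs. \<pi> (vsum M (\<lambda>n. perturbation M (pert_iterate M \<iota> h n) as C bs)
                            {..length as + length bs}))\<rparr>"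

text \<open>A minimal model depends on the contraction only up to isomorphism, so there is one for each.\<close>
definition minimal_models :: "('a, 'm) ainf_bimod \<Rightarrow> ('a, 'm set) ainf_bimod set" where
  "minimal_models M = {transferred_bimod M \<iota> \<pi> h | \<iota> \<pi> h. homology_contraction M \<iota> \<pi> h}"


section \<open>Filtrations and associated graded objects\<close>

definition filtered_algebra :: "'a ainf_alg \<Rightarrow> (int \<Rightarrow> 'a set) \<Rightarrow> bool" where
  "filtered_algebra A F \<longleftrightarrow>
     ainf_algebra A \<and> (\<forall>i. subgroup (F i) A) \<and> (\<forall>i. F i \<subseteq> F (i + 1)) \<and>
     (\<forall>is as. as \<noteq> [] \<and> list_all2 (\<lambda>i a. a \<in> F i) is as \<longrightarrow> aop A as \<in> F (sum_list is))"

definition filtered_bimodule ::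
  "'a ainf_alg \<Rightarrow> (int \<Rightarrow> 'a set) \<Rightarrow> ('a, 'm) ainf_bimod \<Rightarrow> (int \<Rightarrow> 'm set) \<Rightarrow> bool" where
  "filtered_bimodule A F M G \<longleftrightarrow>
     filtered_algebra A F \<and> ainf_bimodule A M \<and>
     (\<forall>i. subgroup (G i) M) \<and> (\<forall>i. G i \<subseteq> G (i + 1)) \<and>
     (\<forall>is as j x ks bs.
        list_all2 (\<lambda>i a. a \<in> F i) is as \<and> x \<in> G j \<and> list_all2 (\<lambda>i b. b \<in> F i) ks bs \<longrightarrow>
        bop M as x bs \<in> G (sum_list is + j + sum_list ks))"

text \<open>The conditions under which the spectral sequence of the filtration converges.\<close>
definition exhaustive :: "('v, 'e) monoid_scheme \<Rightarrow> (int \<Rightarrow> 'v set) \<Rightarrow> bool" where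
  "exhaustive V F \<longleftrightarrow> (\<Union>i. F i) = carrier V"

definition bounded_below :: "('v, 'e) monoid_scheme \<Rightarrow> (int \<Rightarrow> 'v set) \<Rightarrow> bool" where
  "bounded_below V F \<longleftrightarrow> (\<exists>i. F i = {vzero V})"

definition gr_piece :: "('v, 'e) monoid_scheme \<Rightarrow> (int \<Rightarrow> 'v set) \<Rightarrow> int \<Rightarrow> 'v set monoid" where
  "gr_piece V F i = (V\<lparr>carrier := F i\<rparr>) Mod F (i - 1)"

definition gr_space :: "('v, 'e) monoid_scheme \<Rightarrow> (int \<Rightarrow> 'v set) \<Rightarrow> (int \<Rightarrow> 'v set) monoid" where
  "gr_space V F = sum_group UNIV (gr_piece V F)"

text \<open>The class of \<open>v \<in> F d\<close> in degree \<open>d\<close>; the zero of the piece in degree \<open>i\<close> is \<open>F (i - 1)\<close>.\<close>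
definition gr_class :: "('v, 'e) monoid_scheme \<Rightarrow> (int \<Rightarrow> 'v set) \<Rightarrow> int \<Rightarrow> 'v \<Rightarrow> int \<Rightarrow> 'v set" where
  "gr_class V F d v = (\<lambda>i. if i = d then F (d - 1) #>\<^bsub>V\<^esub> v else F (i - 1))"

text \<open>
  Multidegrees in which all the components of \<open>\<alpha>s\<close> (a list of elements of \<open>gr\<close>) are nonzero.
  An operation on \<open>gr\<close> is the sum over these of the operation on homogeneous components, and the
  latter applies the original operation to the representatives: the set of all values obtained
  from representatives, plus \<open>F (k - 1)\<close>, is a single coset.
\<close>
definition multidegrees :: "(int \<Rightarrow> 'v set) \<Rightarrow> (int \<Rightarrow> 'v set) list \<Rightarrow> int list set" where
  "multidegrees F \<alpha>s = {ds. list_all2 (\<lambda>d \<alpha>. \<alpha> d \<noteq> F (d - 1)) ds \<alpha>s}"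

definition components :: "int list \<Rightarrow> (int \<Rightarrow> 'v set) list \<Rightarrow> 'v list set" where
  "components ds \<alpha>s = listset (map2 (\<lambda>d \<alpha>. \<alpha> d) ds \<alpha>s)"

definition gr_alg :: "'a ainf_alg \<Rightarrow> (int \<Rightarrow> 'a set) \<Rightarrow> (int \<Rightarrow> 'a set) ainf_alg" where
  "gr_alg A F =
     \<lparr>carrier = carrier (gr_space A F), monoid.mult = monoid.mult (gr_space A F),
      one = one (gr_space A F),
      aop = (\<lambda>\<alpha>s k. vsum (gr_piece A F k)
         (\<lambda>ds. F (k - 1) <#>\<^bsub>A\<^esub> (aop A ` components ds \<alpha>s))
         {ds \<in> multidegrees F \<alpha>s. sum_list ds = k})\<rparr>"

definition gr_bimod ::
  "'a ainf_alg \<Rightarrow> (int \<Rightarrow> 'a set) \<Rightarrow> ('a, 'm) ainf_bimod \<Rightarrow> (int \<Rightarrow> 'm set) \<Rightarrow>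
     (int \<Rightarrow> 'a set, int \<Rightarrow> 'm set) ainf_bimod" where
  "gr_bimod A F M G =
     \<lparr>carrier = carrier (gr_space M G), monoid.mult = monoid.mult (gr_space M G),
      one = one (gr_space M G),
      bop = (\<lambda>\<alpha>s \<xi> \<beta>s k. vsum (gr_piece M G k)
         (\<lambda>(ds, d, es). G (k - 1) <#>\<^bsub>M\<^esub>
            {bop M as x bs | as x bs. as \<in> components ds \<alpha>s \<and> x \<in> \<xi> d \<and> bs \<in> components es \<beta>s})
         {(ds, d, es). ds \<in> multidegrees F \<alpha>s \<and> \<xi> d \<noteq> G (d - 1) \<and> es \<in> multidegrees F \<beta>s \<and>
            sum_list ds + d + sum_list es = k})\<rparr>"

definition strict_ainf_iso :: "'a ainf_alg \<Rightarrow> 'b ainf_alg \<Rightarrow> ('a \<Rightarrow> 'b) \<Rightarrow> bool" where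
  "strict_ainf_iso A B \<phi> \<longleftrightarrow>
     ainf_algebra A \<and> ainf_algebra B \<and> \<phi> \<in> iso A B \<and>
     (\<forall>as\<in>lists (carrier A). as \<noteq> [] \<longrightarrow> \<phi> (aop A as) = aop B (map \<phi> as))"

definition restrict_scalars :: "('a \<Rightarrow> 'b) \<Rightarrow> ('b, 'm) ainf_bimod \<Rightarrow> ('a, 'm) ainf_bimod" where
  "restrict_scalars \<phi> M =
     \<lparr>carrier = carrier M, monoid.mult = monoid.mult M, one = one M,
      bop = (\<lambda>as x bs. bop M (map \<phi> as) x (map \<phi> bs))\<rparr>"


section \<open>Algebras and bimodules with a basis\<close>

text \<open>
  The concrete objects all come with a basis. The free space on a set of generators is the space of
  finitely supported functions from it to the field \<^typ>\<open>bit\<close>, and operations are given by their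
  values on generators. Tensor products are then the free spaces on tuples of generators.
\<close>

type_synonym 'x vec = "'x \<Rightarrow>\<^sub>0 bit"

abbreviation bas :: "'x \<Rightarrow> 'x vec" where
  "bas x \<equiv> Poly_Mapping.single x 1"

text \<open>Linear extension; the coefficient of a vector at each of its keys is \<open>1\<close>.\<close>
definition lin :: "('x \<Rightarrow> 'y vec) \<Rightarrow> 'x vec \<Rightarrow> 'y vec" where
  "lin f v = (\<Sum>x\<in>Poly_Mapping.keys v. f x)"

record 'g based_alg =
  agens :: "'g set"
  acoef :: "'g list \<Rightarrow> 'g vec"

record ('g, 'x) based_bimod =
  gens :: "'x set"
  coef :: "'g list \<Rightarrow> 'x \<Rightarrow> 'g list \<Rightarrow> 'x vec"

definition lin_alg :: "'g based_alg \<Rightarrow> 'g vec ainf_alg" where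
  "lin_alg B =
     \<lparr>carrier = {v. Poly_Mapping.keys v \<subseteq> agens B}, monoid.mult = (+), one = 0,
      aop = (\<lambda>vs. \<Sum>gs\<in>listset (map Poly_Mapping.keys vs). acoef B gs)\<rparr>"

definition lin_bimod :: "('g, 'x) based_bimod \<Rightarrow> ('g vec, 'x vec) ainf_bimod" where
  "lin_bimod M =
     \<lparr>carrier = {v. Poly_Mapping.keys v \<subseteq> gens M}, monoid.mult = (+), one = 0,
      bop = (\<lambda>vs z ws. \<Sum>(as, x, bs) \<in> listset (map Poly_Mapping.keys vs) \<times> Poly_Mapping.keys z \<times>
               listset (map Poly_Mapping.keys ws). coef M as x bs)\<rparr>"

datatype left_gen = Ustar | Vstar
datatype right_gen = U | V

text \<open>
  Generators of all the bimodules: those of the algebra itself, \<open>p \<otimes> q\<close> for generators of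
  \<open>P\<^sub>k \<otimes> \<^sub>kP\<close>, and \<open>x \<otimes> a\<^sub>1 \<otimes> \<dots> \<otimes> a\<^sub>n \<otimes> y\<close> in an \<open>A\<^sub>\<infinity>\<close> tensor product. A single type is needed because
  tensor products of arbitrary length occur.
\<close>
datatype 'g mgen = Alg 'g | PP left_gen right_gen | Tens "'g mgen" "'g list" "'g mgen"

definition diagonal :: "'g based_alg \<Rightarrow> ('g, 'g mgen) based_bimod" where
  "diagonal B =
     \<lparr>gens = Alg ` agens B,
      coef = (\<lambda>as x bs. case x of Alg b \<Rightarrow> lin (\<lambda>c. bas (Alg c)) (acoef B (as @ b # bs)) | _ \<Rightarrow> 0)\<rparr>"

text \<open>The direct sum underlying the cone is an internal one: the generators of \<open>M\<close> and \<open>N\<close> must be disjoint.\<close>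
definition mapping_cone ::
  "('g, 'x) based_bimod \<Rightarrow> ('g, 'x) based_bimod \<Rightarrow> ('g list \<Rightarrow> 'x \<Rightarrow> 'g list \<Rightarrow> 'x vec) \<Rightarrow>
     ('g, 'x) based_bimod" where
  "mapping_cone M N f =
     \<lparr>gens = gens M \<union> gens N,
      coef = (\<lambda>as x bs. if x \<in> gens M then coef M as x bs + f as x bs else coef N as x bs)\<rparr>"

definition tensor_coef ::
  "'g based_alg \<Rightarrow> ('g, 'g mgen) based_bimod \<Rightarrow> ('g, 'g mgen) based_bimod \<Rightarrow>
     'g list \<Rightarrow> 'g mgen \<Rightarrow> 'g list \<Rightarrow> 'g mgen vec" where
  "tensor_coef B M N cs z ds = (case z of
     Tens x as y \<Rightarrow>
       (if cs = [] \<and> ds = [] then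
          (\<Sum>i\<le>length as. lin (\<lambda>x'. bas (Tens x' (drop i as) y)) (coef M [] x (take i as))) +
          (\<Sum>(i, j)\<in>segments as. lin (\<lambda>a. bas (Tens x (take i as @ a # drop j as) y))
                                     (acoef B (drop i (take j as)))) +
          (\<Sum>i\<le>length as. lin (\<lambda>y'. bas (Tens x (take i as) y')) (coef N (drop i as) y []))
        else if ds = [] then
          (\<Sum>i\<le>length as. lin (\<lambda>x'. bas (Tens x' (drop i as) y)) (coef M cs x (take i as)))
        else if cs = [] then
          (\<Sum>i\<le>length as. lin (\<lambda>y'. bas (Tens x (take i as) y')) (coef N (drop i as) y ds))
        else 0)
   | _ \<Rightarrow> 0)"

definition ainf_tensor ::
  "'g based_alg \<Rightarrow> ('g, 'g mgen) based_bimod \<Rightarrow> ('g, 'g mgen) based_bimod \<Rightarrow>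
     ('g, 'g mgen) based_bimod" where
  "ainf_tensor B M N =
     \<lparr>gens = {Tens x as y | x as y. x \<in> gens M \<and> as \<in> lists (agens B) \<and> y \<in> gens N},
      coef = tensor_coef B M N\<rparr>"

text \<open>The tensor product \<open>P\<^sub>k \<otimes> \<^sub>kP\<close> of a left and a right module with the given actions on generators.\<close>
definition outer_bimod ::
  "('g \<Rightarrow> left_gen \<Rightarrow> left_gen vec) \<Rightarrow> (right_gen \<Rightarrow> 'g \<Rightarrow> right_gen vec) \<Rightarrow>
     ('g, 'g mgen) based_bimod" where
  "outer_bimod l r =
     \<lparr>gens = range (case_prod PP),
      coef = (\<lambda>as x bs. case (as, x, bs) of
          ([a], PP p q, []) \<Rightarrow> lin (\<lambda>p'. bas (PP p' q)) (l a p)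
        | ([], PP p q, [b]) \<Rightarrow> lin (\<lambda>q'. bas (PP p q')) (r q b)
        | _ \<Rightarrow> 0)\<rparr>"

text \<open>
  The strict bimodule map with \<open>\<^sub>k1\<^sub>k \<mapsto> u\<^sup>* \<otimes> u\<close>, \<open>\<^bsub>k-1\<^esub>1\<^bsub>k-1\<^esub> \<mapsto> v\<^sup>* \<otimes> v\<close> and the other idempotents sent to \<open>0\<close>.
  It maps the unit, the sum of all idempotents, to \<open>u\<^sup>* \<otimes> u + v\<^sup>* \<otimes> v\<close>, hence \<open>b\<close> to \<open>b(u\<^sup>* \<otimes> u + v\<^sup>* \<otimes> v)\<close>.
\<close>
definition gamma ::
  "('g \<Rightarrow> left_gen \<Rightarrow> left_gen vec) \<Rightarrow> 'g list \<Rightarrow> 'g mgen \<Rightarrow> 'g list \<Rightarrow> 'g mgen vec" where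
  "gamma l as x bs = (case (as, x, bs) of
      ([], Alg b, []) \<Rightarrow> lin (\<lambda>p. bas (PP p U)) (l b Ustar) + lin (\<lambda>p. bas (PP p V)) (l b Vstar)
    | _ \<Rightarrow> 0)"

definition beta ::
  "('g \<Rightarrow> left_gen \<Rightarrow> right_gen \<Rightarrow> 'g vec) \<Rightarrow> (left_gen \<Rightarrow> right_gen \<Rightarrow> 'g \<Rightarrow> 'g vec) \<Rightarrow>
     'g list \<Rightarrow> 'g mgen \<Rightarrow> 'g list \<Rightarrow> 'g mgen vec" where
  "beta bl br as x bs = (case (as, x, bs) of
      ([a], PP p q, []) \<Rightarrow> lin (\<lambda>c. bas (Alg c)) (bl a p q)
    | ([], PP p q, [b]) \<Rightarrow> lin (\<lambda>c. bas (Alg c)) (br p q b)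
    | _ \<Rightarrow> 0)"


section \<open>Braids\<close>

text \<open>\<open>Sg k\<close> and \<open>SgInv k\<close> stand for \<open>\<sigma>\<^sub>k\<^sup>+\<close> and \<open>\<sigma>\<^sub>k\<^sup>-\<close>.\<close>
datatype artin = Sg nat | SgInv nat

definition braid_words :: "nat \<Rightarrow> artin list set" where
  "braid_words m = lists (Sg ` {1..m} \<union> SgInv ` {1..m})"

text \<open>Equality in the braid group on \<open>m + 1\<close> strands (Artin presentation).\<close>
inductive_set braid_rel :: "nat \<Rightarrow> (artin list \<times> artin list) set" for m :: nat where
  refl: "w \<in> braid_words m \<Longrightarrow> (w, w) \<in> braid_rel m"
| sym: "(w, w') \<in> braid_rel m \<Longrightarrow> (w', w) \<in> braid_rel m"
| trans: "(w, w') \<in> braid_rel m \<Longrightarrow> (w', w'') \<in> braid_rel m \<Longrightarrow> (w, w'') \<in> braid_rel m"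
| cancel: "x \<in> braid_words m \<Longrightarrow> y \<in> braid_words m \<Longrightarrow> k \<in> {1..m} \<Longrightarrow>
    (x @ [Sg k, SgInv k] @ y, x @ y) \<in> braid_rel m"
| cancel': "x \<in> braid_words m \<Longrightarrow> y \<in> braid_words m \<Longrightarrow> k \<in> {1..m} \<Longrightarrow>
    (x @ [SgInv k, Sg k] @ y, x @ y) \<in> braid_rel m"
| far: "x \<in> braid_words m \<Longrightarrow> y \<in> braid_words m \<Longrightarrow> k \<in> {1..m} \<Longrightarrow> l \<in> {1..m} \<Longrightarrow> k + 2 \<le> l \<Longrightarrow>
    (x @ [Sg k, Sg l] @ y, x @ [Sg l, Sg k] @ y) \<in> braid_rel m"
| braid: "x \<in> braid_words m \<Longrightarrow> y \<in> braid_words m \<Longrightarrow> k \<in> {1..m} \<Longrightarrow> k + 1 \<in> {1..m} \<Longrightarrow>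
    (x @ [Sg k, Sg (k + 1), Sg k] @ y, x @ [Sg (k + 1), Sg k, Sg (k + 1)] @ y) \<in> braid_rel m"

definition braid_group :: "nat \<Rightarrow> artin list set set" where
  "braid_group m = braid_words m // braid_rel m"

text \<open>Iterated \<open>A\<^sub>\<infinity>\<close> tensor product along a word, bracketed to the right.\<close>
fun word_bimod ::
  "'g based_alg \<Rightarrow> (artin \<Rightarrow> ('g, 'g mgen) based_bimod) \<Rightarrow> artin list \<Rightarrow> ('g, 'g mgen) based_bimod"
  where
  "word_bimod B E [] = diagonal B"
| "word_bimod B E [s] = E s"
| "word_bimod B E (s # t # w) = ainf_tensor B (E s) (word_bimod B E (t # w))"


section \<open>The Khovanov--Seidel side\<close>

text \<open>\<open>One i j\<close> is \<open>\<^sub>i1\<^sub>j\<close> for \<open>i \<ge> j\<close> and \<open>X i j\<close> is \<open>\<^sub>ix\<^sub>j\<close> for \<open>i > j\<close>.\<close>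
datatype kh_gen = One nat nat | X nat nat

fun kh_mul :: "kh_gen \<Rightarrow> kh_gen \<Rightarrow> kh_gen vec" where
  "kh_mul (One i j) (One j' k) = (if j = j' then bas (One i k) else 0)"
| "kh_mul (One i j) (X j' k) = (if j = j' then bas (X i k) else 0)"
| "kh_mul (X i j) (One j' k) = (if j = j' then bas (X i k) else 0)"
| "kh_mul (X i j) (X j' k) = 0"

definition kh_alg :: "nat \<Rightarrow> kh_gen based_alg" where
  "kh_alg m =
     \<lparr>agens = {One i j | i j. j \<le> i \<and> i \<le> m} \<union> {X i j | i j. j < i \<and> i \<le> m},
      acoef = (\<lambda>gs. case gs of [a, b] \<Rightarrow> kh_mul a b | _ \<Rightarrow> 0)\<rparr>"

fun kh_left :: "nat \<Rightarrow> kh_gen \<Rightarrow> left_gen \<Rightarrow> left_gen vec" where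
  "kh_left k (One i j) Ustar = (if i = k \<and> j = k then bas Ustar else 0)"
| "kh_left k (One i j) Vstar = (if i = k - 1 \<and> j = k - 1 then bas Vstar else 0)"
| "kh_left k (X i j) Ustar = 0"
| "kh_left k (X i j) Vstar = (if i = k \<and> j = k - 1 then bas Ustar else 0)"

fun kh_right :: "nat \<Rightarrow> right_gen \<Rightarrow> kh_gen \<Rightarrow> right_gen vec" where
  "kh_right k U (One i j) = (if i = k \<and> j = k then bas U else 0)"
| "kh_right k V (One i j) = (if i = k - 1 \<and> j = k - 1 then bas V else 0)"
| "kh_right k U (X i j) = (if i = k \<and> j = k - 1 then bas V else 0)"
| "kh_right k V (X i j) = 0"

fun kh_beta_left :: "nat \<Rightarrow> kh_gen \<Rightarrow> left_gen \<Rightarrow> right_gen \<Rightarrow> kh_gen vec" where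
  "kh_beta_left k (One i j) Ustar U = (if j = k \<and> i \<ge> k + 1 then bas (X i k) else 0)"
| "kh_beta_left k (One i j) Vstar U = (if j = k - 1 \<and> i \<ge> k then bas (One i k) else 0)"
| "kh_beta_left k (X i j) Vstar U = (if j = k - 1 \<and> i \<ge> k + 1 then bas (X i k) else 0)"
| "kh_beta_left k (One i j) Vstar V = (if j = k - 1 \<and> i \<ge> k then bas (X i (k - 1)) else 0)"
| "kh_beta_left k _ _ _ = 0"

fun kh_beta_right :: "nat \<Rightarrow> left_gen \<Rightarrow> right_gen \<Rightarrow> kh_gen \<Rightarrow> kh_gen vec" where
  "kh_beta_right k Ustar U (One i j) = (if i = k \<and> j + 1 \<le> k then bas (X k j) else 0)"
| "kh_beta_right k Vstar U (One i j) = (if i = k \<and> j + 1 \<le> k then bas (One (k - 1) j) else 0)"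
| "kh_beta_right k Vstar U (X i j) = (if i = k \<and> j + 2 \<le> k then bas (X (k - 1) j) else 0)"
| "kh_beta_right k Vstar V (One i j) = (if i = k - 1 \<and> j + 2 \<le> k then bas (X (k - 1) j) else 0)"
| "kh_beta_right k _ _ _ = 0"

fun kh_elementary :: "nat \<Rightarrow> artin \<Rightarrow> (kh_gen, kh_gen mgen) based_bimod" where
  "kh_elementary m (SgInv k) =
     mapping_cone (diagonal (kh_alg m)) (outer_bimod (kh_left k) (kh_right k)) (gamma (kh_left k))"
| "kh_elementary m (Sg k) =
     mapping_cone (outer_bimod (kh_left k) (kh_right k)) (diagonal (kh_alg m))
       (beta (kh_beta_left k) (kh_beta_right k))"

definition B_Kh :: "nat \<Rightarrow> kh_gen vec ainf_alg" where
  "B_Kh m = lin_alg (kh_alg m)"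

definition M_Kh :: "nat \<Rightarrow> artin list \<Rightarrow> (kh_gen vec, kh_gen mgen vec) ainf_bimod" where
  "M_Kh m w = lin_bimod (word_bimod (kh_alg m) (kh_elementary m) w)"


section \<open>The bordered Floer side\<close>

text \<open>\<open>HOne i\<close> is \<open>\<^sub>i1\<^sub>i\<close>, and \<open>Rho i j\<close>, \<open>Sig i j\<close> are \<open>\<^sub>i\<rho>\<^sub>j\<close>, \<open>\<^sub>i\<sigma>\<^sub>j\<close> for \<open>i > j\<close>.\<close>
datatype hf_gen = HOne nat | Rho nat nat | Sig nat nat

fun hf_mul :: "hf_gen \<Rightarrow> hf_gen \<Rightarrow> hf_gen vec" where
  "hf_mul (HOne i) (HOne j) = (if i = j then bas (HOne i) else 0)"
| "hf_mul (HOne i) (Rho j k) = (if i = j then bas (Rho j k) else 0)"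
| "hf_mul (HOne i) (Sig j k) = (if i = j then bas (Sig j k) else 0)"
| "hf_mul (Rho i j) (HOne k) = (if j = k then bas (Rho i j) else 0)"
| "hf_mul (Sig i j) (HOne k) = (if j = k then bas (Sig i j) else 0)"
| "hf_mul (Rho i j) (Rho j' k) = (if j = j' then bas (Rho i k) else 0)"
| "hf_mul (Sig i j) (Sig j' k) = (if j = j' then bas (Sig i k) else 0)"
| "hf_mul (Rho i j) (Sig j' k) = 0"
| "hf_mul (Sig i j) (Rho j' k) = 0"

definition hf_alg :: "nat \<Rightarrow> hf_gen based_alg" where
  "hf_alg m =
     \<lparr>agens = {HOne i | i. i \<le> m} \<union> {Rho i j | i j. j < i \<and> i \<le> m} \<union> {Sig i j | i j. j < i \<and> i \<le> m},
      acoef = (\<lambda>gs. case gs of [a, b] \<Rightarrow> hf_mul a b | _ \<Rightarrow> 0)\<rparr>"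

fun hf_left :: "nat \<Rightarrow> hf_gen \<Rightarrow> left_gen \<Rightarrow> left_gen vec" where
  "hf_left k (HOne i) Ustar = (if i = k then bas Ustar else 0)"
| "hf_left k (HOne i) Vstar = (if i = k - 1 then bas Vstar else 0)"
| "hf_left k (Rho i j) Vstar = (if i = k \<and> j = k - 1 then bas Ustar else 0)"
| "hf_left k (Sig i j) Vstar = (if i = k \<and> j = k - 1 then bas Ustar else 0)"
| "hf_left k _ Ustar = 0"

fun hf_right :: "nat \<Rightarrow> right_gen \<Rightarrow> hf_gen \<Rightarrow> right_gen vec" where
  "hf_right k U (HOne i) = (if i = k then bas U else 0)"
| "hf_right k V (HOne i) = (if i = k - 1 then bas V else 0)"
| "hf_right k U (Rho i j) = (if i = k \<and> j = k - 1 then bas V else 0)"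
| "hf_right k U (Sig i j) = (if i = k \<and> j = k - 1 then bas V else 0)"
| "hf_right k V _ = 0"

fun hf_beta_left :: "nat \<Rightarrow> hf_gen \<Rightarrow> left_gen \<Rightarrow> right_gen \<Rightarrow> hf_gen vec" where
  "hf_beta_left k (Rho i j) Ustar U = (if j = k \<and> i \<ge> k + 1 then bas (Rho i k) else 0)"
| "hf_beta_left k (Sig i j) Vstar U =
     (if j = k - 1 \<and> i = k then bas (HOne k)
      else if j = k - 1 \<and> i \<ge> k + 1 then bas (Sig i k) else 0)"
| "hf_beta_left k (Rho i j) Vstar U = (if j = k - 1 \<and> i \<ge> k + 1 then bas (Rho i k) else 0)"
| "hf_beta_left k (Rho i j) Vstar V = (if j = k - 1 \<and> i \<ge> k then bas (Rho i (k - 1)) else 0)"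
| "hf_beta_left k _ _ _ = 0"

fun hf_beta_right :: "nat \<Rightarrow> left_gen \<Rightarrow> right_gen \<Rightarrow> hf_gen \<Rightarrow> hf_gen vec" where
  "hf_beta_right k Ustar U (Rho i j) = (if i = k \<and> j + 1 \<le> k then bas (Rho k j) else 0)"
| "hf_beta_right k Vstar U (Sig i j) =
     (if i = k \<and> j = k - 1 then bas (HOne (k - 1))
      else if i = k \<and> j + 2 \<le> k then bas (Sig (k - 1) j) else 0)"
| "hf_beta_right k Vstar U (Rho i j) = (if i = k \<and> j + 2 \<le> k then bas (Rho (k - 1) j) else 0)"
| "hf_beta_right k Vstar V (Rho i j) = (if i = k - 1 \<and> j + 2 \<le> k then bas (Rho (k - 1) j) else 0)"
| "hf_beta_right k _ _ _ = 0"

fun hf_elementary :: "nat \<Rightarrow> artin \<Rightarrow> (hf_gen, hf_gen mgen) based_bimod" where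
  "hf_elementary m (SgInv k) =
     mapping_cone (diagonal (hf_alg m)) (outer_bimod (hf_left k) (hf_right k)) (gamma (hf_left k))"
| "hf_elementary m (Sg k) =
     mapping_cone (outer_bimod (hf_left k) (hf_right k)) (diagonal (hf_alg m))
       (beta (hf_beta_left k) (hf_beta_right k))"

definition B_HF :: "nat \<Rightarrow> hf_gen vec ainf_alg" where
  "B_HF m = lin_alg (hf_alg m)"

definition M_HF :: "nat \<Rightarrow> artin list \<Rightarrow> (hf_gen vec, hf_gen mgen vec) ainf_bimod" where
  "M_HF m w = lin_bimod (word_bimod (hf_alg m) (hf_elementary m) w)"

text \<open>Over the field with two elements the span is the subgroup generated.\<close>
definition F_HF :: "nat \<Rightarrow> int \<Rightarrow> hf_gen vec set" where
  "F_HF m i =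
     (if i < 0 then {0}
      else if i = 0 then
        generate (B_HF m) ({bas (HOne i) | i. i \<le> m} \<union>
                           {bas (Rho i j) + bas (Sig i j) | i j. j < i \<and> i \<le> m})
      else carrier (B_HF m))"

fun gr_iso_gen :: "nat \<Rightarrow> kh_gen \<Rightarrow> int \<Rightarrow> hf_gen vec set" where
  "gr_iso_gen m (One i j) =
     gr_class (B_HF m) (F_HF m) 0 (if i = j then bas (HOne i) else bas (Rho i j) + bas (Sig i j))"
| "gr_iso_gen m (X i j) = gr_class (B_HF m) (F_HF m) 1 (bas (Rho i j))"

text \<open>The identification \<open>B\<^bsup>Kh\<^esup> \<cong> gr(B\<^bsup>HF\<^esup>)\<close>.\<close>
definition gr_iso :: "nat \<Rightarrow> kh_gen vec \<Rightarrow> int \<Rightarrow> hf_gen vec set" where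
  "gr_iso m v = vsum (gr_space (B_HF m) (F_HF m)) (gr_iso_gen m) (Poly_Mapping.keys v)"

definition gr_M_HF ::
  "nat \<Rightarrow> artin list \<Rightarrow> (int \<Rightarrow> hf_gen mgen vec set) \<Rightarrow>
     (kh_gen vec, int \<Rightarrow> hf_gen mgen vec set) ainf_bimod" where
  "gr_M_HF m w G = restrict_scalars (gr_iso m) (gr_bimod (B_HF m) (F_HF m) (M_HF m w) G)"

text \<open>
  The pages of the spectral sequence of the filtration \<open>G\<close>: \<open>E\<^sup>1\<close> is the homology of the associated
  graded and, by convention, \<open>E\<^sup>\<infinity>\<close> is the homology of the total complex, both with their minimal
  model structure.
\<close>
definition E1_page ::
  "nat \<Rightarrow> artin list \<Rightarrow> (int \<Rightarrow> hf_gen mgen vec set) \<Rightarrow>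
     (kh_gen vec, (int \<Rightarrow> hf_gen mgen vec set) set) ainf_bimod \<Rightarrow> bool" where
  "E1_page m w G E \<longleftrightarrow> E \<in> minimal_models (gr_M_HF m w G)"

definition Einf_page ::
  "nat \<Rightarrow> artin list \<Rightarrow> (hf_gen vec, hf_gen mgen vec set) ainf_bimod \<Rightarrow> bool" where
  "Einf_page m w E \<longleftrightarrow> E \<in> minimal_models (M_HF m w)"

end

theory Submission
  imports Defs "HOL.Vector_Spaces"
begin

text \<open>
  Idea. Replace the basis of \<open>B\<^bsup>HF\<^esup>\<close> by \<open>1 = \<rho> + \<sigma>\<close> in degree \<open>0\<close> and \<open>x = \<rho>\<close> in degree \<open>1\<close>. In this basis the
  algebra and the elementary bimodules of the Floer side have the structure constants of the
  Khovanov side plus terms of strictly lower degree, and this persists in tensor products. The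
  degree therefore filters \<open>\<M>\<^bsup>HF\<^esup>\<close> with an associated graded that is strictly isomorphic to \<open>\<M>\<^bsup>Kh\<^esup>\<close>. Over the field
  with two elements a contraction onto homology always exists, and homological perturbation makes the
  minimal model isomorphic in \<open>D\<^sub>\<infinity>\<close> to the bimodule it comes from.
\<close>

section \<open>Vectors over the field with two elements\<close>

text \<open>Every bimodule here has operations with at most one algebra input in total. The
  A-infinity relations then are those of a differential bimodule, and tensor products inherit the
  property. Genuine higher operations arise only in minimal models. Their sums over splittings of
  input lists are hard to compose directly, hence such families become elements of one ring, in
  which transfer is a computation with geometric series. Carriers are subsets, so a bimodule enters
  the ring through an embedding into a free space and a projection; its homology is a smaller corner
  of the same ring. The strict isomorphism of the associated graded with \<open>M_Kh\<close> is used
  in the form that both are presented by the same ring element, which yields the quasi-isomorphism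
  and the first page alike. The contraction onto homology carries no side conditions, so projection
  after inclusion need not be the identity; its inverse, again a geometric series, enters one of the
  homotopies.\<close>

abbreviation keys :: "'x vec \<Rightarrow> 'x set" where
  "keys \<equiv> Poly_Mapping.keys"

abbreviation lookup :: "'x vec \<Rightarrow> 'x \<Rightarrow> bit" where
  "lookup \<equiv> Poly_Mapping.lookup"

lemma vec_add_self [simp]: "v + v = (0 :: 'x vec)"
  by (rule poly_mapping_eqI) (simp add: lookup_add)

lemma vec_add_self_left [simp]: "v + (v + w) = (w :: 'x vec)"
  by (simp flip: add.assoc)

lemma vec_uminus [simp]: "- v = (v :: 'x vec)"
  by (rule minus_unique) simp

lemma vec_diff_eq_add [simp]: "v - w = v + (w :: 'x vec)"
  using vec_uminus[of w] by (simp only: diff_conv_add_uminus)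

lemma vec_add_eq_0_iff: "v + w = 0 \<longleftrightarrow> v = (w :: 'x vec)"
  by (metis vec_add_self vec_add_self_left add.right_neutral)

lemma vec_eq_add_iff: "v = w + u \<longleftrightarrow> v + w = (u :: 'x vec)"
  by (metis add.commute vec_add_self_left)

lemma lookup_bit_eq: "lookup v x = (if x \<in> keys v then 1 else 0)" for v :: "'x vec"
  by (auto simp: in_keys_iff)

lemma keys_add_bit: "keys (v + w) = (keys v - keys w) \<union> (keys w - keys v)" for v w :: "'x vec"
  by (auto simp: in_keys_iff lookup_add)

lemma bas_nonzero [simp]: "bas x \<noteq> 0"
  by (metis lookup_single_eq lookup_zero zero_neq_one)

lemma vec_sum_bas: "(\<Sum>x\<in>keys v. bas x) = (v :: 'x vec)"
proof (rule poly_mapping_eqI)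
  fix k
  have "lookup (\<Sum>x\<in>keys v. bas x) k = (\<Sum>x\<in>keys v. if x = k then 1 else 0 :: bit)"
    by (simp add: lookup_sum lookup_single when_def)
  also have "\<dots> = lookup v k"
    by (simp add: lookup_bit_eq)
  finally show "lookup (\<Sum>x\<in>keys v. bas x) k = lookup v k" .
qed


definition span_of :: "'x set \<Rightarrow> 'x vec set" where
  "span_of S = {v. keys v \<subseteq> S}"

lemma span_of_zero [simp, intro]: "0 \<in> span_of S"
  by (simp add: span_of_def)

lemma span_of_bas [simp]: "bas x \<in> span_of S \<longleftrightarrow> x \<in> S"
  by (simp add: span_of_def)

lemma span_of_add [intro]: "v \<in> span_of S \<Longrightarrow> w \<in> span_of S \<Longrightarrow> v + w \<in> span_of S"
  by (auto simp: span_of_def keys_add_bit)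

lemma span_of_sum [intro]: "(\<And>i. i \<in> I \<Longrightarrow> f i \<in> span_of S) \<Longrightarrow> (\<Sum>i\<in>I. f i) \<in> span_of S"
  by (induction I rule: infinite_finite_induct) auto

lemma span_of_mono: "S \<subseteq> T \<Longrightarrow> v \<in> span_of S \<Longrightarrow> v \<in> span_of T"
  by (auto simp: span_of_def)

text \<open>Over the field with two elements a vector is the sum of the basis vectors in its
  support, so adding one basis vector at a time reaches everything and no scalars occur. Most
  identities between linear extensions below are proved by this induction.\<close>

lemma span_of_induct [consumes 1, case_names zero bas_add]:
  assumes "v \<in> span_of S" "P 0" "\<And>x v. x \<in> S \<Longrightarrow> v \<in> span_of S \<Longrightarrow> P v \<Longrightarrow> P (bas x + v)"
  shows "P v"
proof -
  have "finite X \<Longrightarrow> X \<subseteq> S \<Longrightarrow> P (\<Sum>x\<in>X. bas x) \<and> (\<Sum>x\<in>X. bas x) \<in> span_of S" for X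
    by (induction X rule: finite_induct) (auto intro: assms)
  from this[of "keys v"] show ?thesis
    using assms(1) by (simp add: vec_sum_bas span_of_def)
qed

lemma vec_induct [case_names zero bas_add]:
  assumes "P 0" "\<And>x v. P v \<Longrightarrow> P (bas x + v)"
  shows "P (v :: 'x vec)"
  by (rule span_of_induct[of v UNIV]) (auto simp: span_of_def assms)

lemma lin_zero [simp]: "lin f 0 = 0"
  by (simp add: lin_def)

lemma lin_bas [simp]: "lin f (bas x) = f x"
  by (simp add: lin_def)

text \<open>The common part of \<open>A\<close> and \<open>B\<close> is counted twice and cancels.
  Since supports add by symmetric difference, this is the additivity of \<open>lin\<close>.\<close>

lemma sum_sym_diff:
  fixes f :: "'i \<Rightarrow> 'x vec"
  assumes "finite A" "finite B"
  shows "(\<Sum>x\<in>(A - B) \<union> (B - A). f x) = (\<Sum>x\<in>A. f x) + (\<Sum>x\<in>B. f x)"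
proof -
  have "(\<Sum>x\<in>A. f x) = (\<Sum>x\<in>A - B. f x) + (\<Sum>x\<in>A \<inter> B. f x)"
    using assms by (metis Int_Diff_Un Int_Diff_disjoint add.commute finite_Diff finite_Int sum.union_disjoint)
  moreover have "(\<Sum>x\<in>B. f x) = (\<Sum>x\<in>B - A. f x) + (\<Sum>x\<in>A \<inter> B. f x)"
    using assms by (metis Int_Diff_Un Int_Diff_disjoint Int_commute add.commute finite_Diff finite_Int sum.union_disjoint)
  moreover have "(\<Sum>x\<in>(A - B) \<union> (B - A). f x) = (\<Sum>x\<in>A - B. f x) + (\<Sum>x\<in>B - A. f x)"
    using assms by (intro sum.union_disjoint) auto
  ultimately show ?thesis
    by (simp add: ac_simps)
qed

lemma lin_add: "lin f (v + w) = lin f v + lin f w"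
  by (simp add: lin_def keys_add_bit sum_sym_diff)

lemma lin_sum: "lin f (\<Sum>i\<in>I. g i) = (\<Sum>i\<in>I. lin f (g i))"
  by (induction I rule: infinite_finite_induct) (auto simp: lin_add)

lemma lin_fun_add: "lin (\<lambda>x. f x + g x) v = lin f v + lin g v"
  by (simp add: lin_def sum.distrib)

lemma lin_fun_zero [simp]: "lin (\<lambda>x. 0) v = 0"
  by (simp add: lin_def)

lemma lin_fun_sum: "lin (\<lambda>x. \<Sum>i\<in>I. f i x) v = (\<Sum>i\<in>I. lin (f i) v)"
  unfolding lin_def by (rule sum.swap)

lemma lin_if: "lin f (if c then v else w) = (if c then lin f v else lin f w)"
  by simp

lemma lin_lin: "lin f (lin g v) = lin (\<lambda>x. lin f (g x)) v"
  by (simp add: lin_def[of g] lin_def[of "\<lambda>x. lin f (g x)"] lin_sum)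

lemma lin_lin_swap: "lin (\<lambda>x. lin (\<lambda>y. f x y) w) v = lin (\<lambda>y. lin (\<lambda>x. f x y) v) w"
  unfolding lin_def by (rule sum.swap)

lemma lin_id [simp]: "lin bas v = v"
  by (simp add: lin_def vec_sum_bas)

lemma lin_cong: "(\<And>x. x \<in> keys v \<Longrightarrow> f x = g x) \<Longrightarrow> lin f v = lin g v"
  by (simp add: lin_def)

lemma lin_cong_span: "v \<in> span_of S \<Longrightarrow> (\<And>x. x \<in> S \<Longrightarrow> f x = g x) \<Longrightarrow> lin f v = lin g v"
  by (rule lin_cong) (auto simp: span_of_def)

lemma lin_in_span: "v \<in> span_of S \<Longrightarrow> (\<And>x. x \<in> S \<Longrightarrow> f x \<in> span_of T) \<Longrightarrow> lin f v \<in> span_of T"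
  unfolding lin_def by (rule span_of_sum) (auto simp: span_of_def)

text \<open>The only scalars are 0 and 1, so additivity is linearity and the values on basis vectors
  determine the map.\<close>

lemma additive_eq_lin:
  fixes f :: "'x vec \<Rightarrow> 'y vec"
  assumes "\<And>v w. f (v + w) = f v + f w"
  shows "f v = lin (\<lambda>x. f (bas x)) v"
proof (induction v rule: vec_induct)
  case zero
  show ?case using assms[of 0 0] by simp
qed (simp_all add: lin_add assms)

section \<open>The ring of premorphisms\<close>

text \<open>
  With composition as product these families form a ring of characteristic two. Bimodule structures are
  its Maurer--Cartan elements \<open>m * m + D m = 0\<close>, where \<open>D\<close> inserts the operations of the algebra, and
  morphisms and homotopies obey equally short identities.
\<close>
typedef ('a, 'x) pre =
  "{f :: 'a list \<Rightarrow> 'x vec \<Rightarrow> 'a list \<Rightarrow> 'x vec. \<forall>as bs x y. f as (x + y) bs = f as x bs + f as y bs}"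
  morphisms app Pre
  by (rule exI[of _ "\<lambda>as x bs. 0"]) simp

setup_lifting type_definition_pre

lemma app_add: "app f as (x + y) bs = app f as x bs + app f as y bs"
  using app[of f] by simp

lemma app_zero [simp]: "app f as 0 bs = 0"
  using app_add[of f as 0 0 bs] by simp

lemma app_sum: "app f as (\<Sum>i\<in>I. g i) bs = (\<Sum>i\<in>I. app f as (g i) bs)"
  by (induction I rule: infinite_finite_induct) (auto simp: app_add)

lemma pre_eqI: "(\<And>as x bs. app f as x bs = app g as x bs) \<Longrightarrow> f = g"
  by (metis app_inject ext)

definition splits :: "'a list \<Rightarrow> 'a list \<Rightarrow> (nat \<times> nat) set" where
  "splits as bs = {..length as} \<times> {..length bs}"

lemma splits_Nil [simp]: "splits [] [] = {(0, 0)}"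
  by (auto simp: splits_def)

lemma finite_splits [simp]: "finite (splits as bs)"
  by (simp add: splits_def)

text \<open>Both sides run over the ways of cutting \<open>as\<close> into three consecutive pieces,
  indexed once by the first cut and once by the second. Used for the left and for the right inputs,
  it gives associativity of composition.\<close>

lemma sum_splits_assoc_aux:
  fixes F :: "'a list \<Rightarrow> 'a list \<Rightarrow> 'a list \<Rightarrow> 'v::comm_monoid_add"
  shows "(\<Sum>i\<le>length as. \<Sum>k\<le>length as - i. F (take i as) (take k (drop i as)) (drop k (drop i as))) =
         (\<Sum>i\<le>length as. \<Sum>k\<le>i. F (take k (take i as)) (drop k (take i as)) (drop i as))"
proof -
  have "(\<Sum>i\<le>length as. \<Sum>k\<le>length as - i. F (take i as) (take k (drop i as)) (drop k (drop i as))) =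
    (\<Sum>(i, k)\<in>Sigma {..length as} (\<lambda>i. {..length as - i}). F (take i as) (take k (drop i as)) (drop k (drop i as)))"
    by (simp add: sum.Sigma)
  also have "\<dots> = (\<Sum>(i, k)\<in>Sigma {..length as} (\<lambda>i. {..i}). F (take k (take i as)) (drop k (take i as)) (drop i as))"
    \<comment> \<open>The pair of first cut and length of the middle piece is traded for the pair of
      second cut and first cut.\<close>
    by (rule sum.reindex_bij_witness[of _ "\<lambda>(i, k). (k, i - k)" "\<lambda>(i, k). (i + k, i)"])
       (auto simp: min_def take_drop add.commute)
  also have "\<dots> = (\<Sum>i\<le>length as. \<Sum>k\<le>i. F (take k (take i as)) (drop k (take i as)) (drop i as))"
    by (rule sum.Sigma[symmetric]) auto
  finally show ?thesis .
qed

instantiation pre :: (type, type) ring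
begin

lift_definition zero_pre :: "('a, 'x) pre" is "\<lambda>as x bs. 0" by simp
lift_definition plus_pre :: "('a, 'x) pre \<Rightarrow> ('a, 'x) pre \<Rightarrow> ('a, 'x) pre"
  is "\<lambda>f g as x bs. f as x bs + g as x bs" by (simp add: ac_simps)
definition uminus_pre :: "('a, 'x) pre \<Rightarrow> ('a, 'x) pre" where "uminus_pre f = f"
definition minus_pre :: "('a, 'x) pre \<Rightarrow> ('a, 'x) pre \<Rightarrow> ('a, 'x) pre" where "minus_pre f g = f + g"
lift_definition times_pre :: "('a, 'x) pre \<Rightarrow> ('a, 'x) pre \<Rightarrow> ('a, 'x) pre"
  is "\<lambda>g f as x bs. \<Sum>(i, j)\<in>splits as bs. g (take i as) (f (drop i as) x (take j bs)) (drop j bs)"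
  by (simp add: sum.distrib split_def)

lemma app_0 [simp]: "app (0 :: ('a, 'x) pre) as x bs = 0"
  by transfer simp
lemma app_plus [simp]: "app (f + g :: ('a, 'x) pre) as x bs = app f as x bs + app g as x bs"
  by transfer simp
lemma app_times:
  "app (g * f :: ('a, 'x) pre) as x bs = (\<Sum>(i, j)\<in>splits as bs. app g (take i as) (app f (drop i as) x (take j bs)) (drop j bs))"
  by transfer simp

lemma app_times_nested:
  "app (g * f :: ('a, 'x) pre) as x bs = (\<Sum>i\<le>length as. \<Sum>j\<le>length bs. app g (take i as) (app f (drop i as) x (take j bs)) (drop j bs))"
  by (simp add: app_times splits_def sum.cartesian_product)

instance
proof
  fix f g h :: "('a, 'x) pre"
  show "f + g + h = f + (g + h)" by (rule pre_eqI) (simp add: ac_simps)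
  show "f + g = g + f" by (rule pre_eqI) (simp add: ac_simps)
  show "0 + f = f" by (rule pre_eqI) simp
  show "- f + f = 0" by (rule pre_eqI) (simp add: uminus_pre_def)
  show "f - g = f + - g" by (rule pre_eqI) (simp add: uminus_pre_def minus_pre_def)
  show "(f + g) * h = f * h + g * h"
    by (rule pre_eqI) (simp add: app_times sum.distrib split_def)
  show "f * (g + h) = f * g + f * h"
    by (rule pre_eqI) (simp add: app_times app_add sum.distrib split_def)
  show "f * g * h = f * (g * h)"
  proof (rule pre_eqI)
    fix as bs :: "'a list" and x :: "'x vec"
    have "app (f * (g * h)) as x bs =
      (\<Sum>i\<le>length as. \<Sum>j\<le>length bs. \<Sum>k\<le>length as - i. \<Sum>l\<le>j.
         app f (take i as) (app g (take k (drop i as)) (app h (drop k (drop i as)) x (take l (take j bs)))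
            (drop l (take j bs))) (drop j bs))"
      by (simp add: app_times_nested app_sum min_absorb2 cong: sum.cong_simp)
    also have "\<dots> = (\<Sum>i\<le>length as. \<Sum>k\<le>length as - i. \<Sum>j\<le>length bs. \<Sum>l\<le>j.
         app f (take i as) (app g (take k (drop i as)) (app h (drop k (drop i as)) x (take l (take j bs)))
            (drop l (take j bs))) (drop j bs))"
      by (subst (2) sum.swap) simp
    also have "\<dots> = (\<Sum>i\<le>length as. \<Sum>k\<le>i. \<Sum>j\<le>length bs. \<Sum>l\<le>j.
         app f (take k (take i as)) (app g (drop k (take i as)) (app h (drop i as) x (take l (take j bs)))
            (drop l (take j bs))) (drop j bs))"
      by (rule sum_splits_assoc_aux[of "\<lambda>p q r. \<Sum>j\<le>length bs. \<Sum>l\<le>j.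
         app f p (app g q (app h r x (take l (take j bs))) (drop l (take j bs))) (drop j bs)" as])
    also have "\<dots> = (\<Sum>i\<le>length as. \<Sum>k\<le>i. \<Sum>j\<le>length bs. \<Sum>l\<le>length bs - j.
         app f (take k (take i as)) (app g (drop k (take i as)) (app h (drop i as) x (take j bs))
            (take l (drop j bs))) (drop l (drop j bs)))"
      by (rule sum.cong[OF HOL.refl], rule sum.cong[OF HOL.refl],
          rule sum_splits_assoc_aux[symmetric, of "\<lambda>p q r. app f _ (app g _ (app h _ x p) q) r" bs])
    also have "\<dots> = (\<Sum>i\<le>length as. \<Sum>j\<le>length bs. \<Sum>k\<le>i. \<Sum>l\<le>length bs - j.
         app f (take k (take i as)) (app g (drop k (take i as)) (app h (drop i as) x (take j bs))
            (take l (drop j bs))) (drop l (drop j bs)))"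
      by (rule sum.cong[OF HOL.refl], rule sum.swap)
    also have "\<dots> = app (f * g * h) as x bs"
      by (simp add: app_times_nested min_absorb2 cong: sum.cong_simp)
    finally show "app (f * g * h) as x bs = app (f * (g * h)) as x bs" ..
  qed
qed

end

instantiation pre :: (type, type) ring_1
begin

lift_definition one_pre :: "('a, 'x) pre" is "\<lambda>as x bs. if as = [] \<and> bs = [] then x else 0" by simp

lemma app_1: "app (1 :: ('a, 'x) pre) as x bs = (if as = [] \<and> bs = [] then x else 0)"
  by transfer simp

instance
proof
  fix f :: "('a, 'x) pre"
  show "1 * f = f"
  proof (rule pre_eqI)
    fix as bs :: "'a list" and x :: "'x vec"
    have "app (1 * f) as x bs = (\<Sum>ij\<in>splits as bs. if ij = (0, length bs) then app f as x bs else 0)"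
      unfolding app_times by (rule sum.cong) (auto simp: app_1 splits_def split: if_splits)
    then show "app (1 * f) as x bs = app f as x bs"
      by (simp add: splits_def)
  qed
  show "f * 1 = f"
  proof (rule pre_eqI)
    fix as bs :: "'a list" and x :: "'x vec"
    have "app (f * 1) as x bs = (\<Sum>ij\<in>splits as bs. if ij = (length as, 0) then app f as x bs else 0)"
      unfolding app_times by (rule sum.cong) (auto simp: app_1 splits_def split: if_splits)
    then show "app (f * 1) as x bs = app f as x bs"
      by (simp add: splits_def)
  qed
  \<comment> \<open>The value on any basis vector separates 0 from 1; \<open>undefined\<close>
    merely names some generator.\<close>
  have "app (0 :: ('a, 'x) pre) [] (bas undefined) [] \<noteq> app (1 :: ('a, 'x) pre) [] (bas undefined) []"
    by (simp add: app_1)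
  then show "(0 :: ('a, 'x) pre) \<noteq> 1" by metis
qed

end

lemma pre_add_self [simp]: "f + f = (0 :: ('a, 'x) pre)"
  by (rule pre_eqI) simp

lemma pre_add_self_left [simp]: "f + (f + g) = (g :: ('a, 'x) pre)"
  by (simp flip: add.assoc)

lemma pre_uminus [simp]: "- f = (f :: ('a, 'x) pre)"
  by (rule minus_unique) simp

lemma pre_diff_eq_add [simp]: "f - g = f + (g :: ('a, 'x) pre)"
  using pre_uminus[of g] by (simp only: diff_conv_add_uminus)

lemma pre_add_eq_0_iff: "f + g = 0 \<longleftrightarrow> f = (g :: ('a, 'x) pre)"
  by (metis pre_add_self pre_add_self_left add.right_neutral)

section \<open>Geometric series in elements that consume algebra inputs\<close>

definition positive :: "('a, 'x) pre \<Rightarrow> bool" where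
  "positive f \<longleftrightarrow> (\<forall>x. app f [] x [] = 0)"

text \<open>The inputs are shared out among the factors, so with more factors than inputs some
  factor receives none, and there \<open>N\<close> vanishes.\<close>

lemma positive_power:
  assumes "positive N" "length as + length bs < n"
  shows "app (N ^ n) as x bs = 0"
  using assms(2)
proof (induction n arbitrary: as x bs)
  case (Suc n)
  have "app N (take i as) (app (N ^ n) (drop i as) x (take j bs)) (drop j bs) = 0"
    if "i \<le> length as" "j \<le> length bs" for i j
  proof (cases "take i as = [] \<and> drop j bs = []")
    case True
    then have "take i as = []" "drop j bs = []" by auto
    then show ?thesis using assms(1) by (simp only: positive_def)
  next
    case False
    then have "length (drop i as) + length (take j bs) < n"
      using Suc.prems that by (cases "i = 0") auto
    then show ?thesis by (simp add: Suc.IH)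
  qed
  then show ?case
    by (auto simp: app_times splits_def intro!: sum.neutral)
qed simp

text \<open>The geometric series 1 + N + N^2 + ..., cut off at the number of inputs. For positive
  \<open>N\<close> the terms cut off vanish, and as signs do not matter it is the inverse of 1 +
  N.\<close>

lift_definition star :: "('a, 'x) pre \<Rightarrow> ('a, 'x) pre" is
  "\<lambda>N as x bs. \<Sum>n\<le>length as + length bs. app (N ^ n) as x bs"
  by (simp add: app_add sum.distrib)

text \<open>The cutoff may be raised to a common bound \<open>L\<close>. This is what allows the
  sums belonging to different splittings of one input to be interchanged with the sum over
  powers.\<close>

lemma app_star:
  assumes "positive N" "length as + length bs \<le> L"
  shows "app (star N) as x bs = (\<Sum>n\<le>L. app (N ^ n) as x bs)"
  unfolding star.rep_eq
  by (rule sum.mono_neutral_left) (use assms in \<open>auto intro!: positive_power\<close>)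

lemma star_unfold_aux:
  assumes "positive N"
  shows "(\<Sum>n\<le>length as + length bs. app (N ^ n) as x bs) =
    app 1 as x bs + (\<Sum>n\<le>length as + length bs. app (N ^ Suc n) as x bs)"
proof -
  let ?L = "length as + length bs"
  have "(\<Sum>n\<le>Suc ?L. app (N ^ n) as x bs) = app 1 as x bs + (\<Sum>n\<le>?L. app (N ^ Suc n) as x bs)"
    by (subst sum.atMost_Suc_shift) simp
  \<comment> \<open>Shifting the index produces one power too many; it has more factors than there
    are inputs.\<close>
  moreover have "app (N ^ Suc ?L) as x bs = 0"
    by (rule positive_power[OF assms]) simp
  ultimately show ?thesis by simp
qed

lemma star_left:
  assumes "positive N"
  shows "star N = 1 + N * star N"
proof (rule pre_eqI)
  fix as bs :: "'a list" and x :: "'b vec"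
  have "app (N * star N) as x bs = (\<Sum>(i, j)\<in>splits as bs. \<Sum>n\<le>length as + length bs.
      app N (take i as) (app (N ^ n) (drop i as) x (take j bs)) (drop j bs))"
    unfolding app_times by (rule sum.cong)
      (auto simp: splits_def app_star[OF assms, of _ _ "length as + length bs"] app_sum)
  also have "\<dots> = (\<Sum>n\<le>length as + length bs. app (N ^ Suc n) as x bs)"
    by (simp add: app_times split_def) (rule sum.swap)
  finally show "app (star N) as x bs = app (1 + N * star N) as x bs"
    by (simp only: app_plus) (simp only: star.rep_eq star_unfold_aux[OF assms])
qed

lemma star_right:
  assumes "positive N"
  shows "star N = 1 + star N * N"
proof (rule pre_eqI)
  fix as bs :: "'a list" and x :: "'b vec"
  have "app (star N * N) as x bs = (\<Sum>(i, j)\<in>splits as bs. \<Sum>n\<le>length as + length bs.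
      app (N ^ n) (take i as) (app N (drop i as) x (take j bs)) (drop j bs))"
    unfolding app_times by (rule sum.cong)
      (auto simp: splits_def app_star[OF assms, of _ _ "length as + length bs"])
  also have "\<dots> = (\<Sum>n\<le>length as + length bs. app (N ^ Suc n) as x bs)"
    by (simp only: power_Suc2 app_times split_def) (rule sum.swap)
  finally show "app (star N) as x bs = app (1 + star N * N) as x bs"
    by (simp only: app_plus) (simp only: star.rep_eq star_unfold_aux[OF assms])
qed

section \<open>The derivation inserting operations of the algebra\<close>

definition ctr :: "('a list \<Rightarrow> 'a) \<Rightarrow> 'a list \<Rightarrow> nat \<Rightarrow> nat \<Rightarrow> 'a list" where
  "ctr op as i j = take i as @ op (drop i (take j as)) # drop j as"

lemma finite_segments [simp]: "finite (segments as)"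
  by (rule finite_subset[of _ "{..length as} \<times> {..length as}"]) (auto simp: segments_def)

text \<open>The part of the differential of premorphisms that involves only the algebra. Separated
  from the composition terms it is a derivation of the ring for every \<open>op\<close>; the
  relations of the algebra enter later, through Maurer--Cartan equations.\<close>

lift_definition alg_deriv :: "('a list \<Rightarrow> 'a) \<Rightarrow> ('a, 'x) pre \<Rightarrow> ('a, 'x) pre" is
  "\<lambda>op f as x bs. (\<Sum>(i, j)\<in>segments as. f (ctr op as i j) x bs) + (\<Sum>(i, j)\<in>segments bs. f as x (ctr op bs i j))"
  by (simp add: sum.distrib split_def ac_simps)

lemma alg_deriv_add: "alg_deriv op (f + g) = alg_deriv op f + alg_deriv op g"
  by (rule pre_eqI) (simp add: alg_deriv.rep_eq sum.distrib split_def ac_simps)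

text \<open>A cut of the contracted list lies either behind the new entry, and then it is a cut of
  \<open>as\<close> at or after \<open>q\<close>, or in front of it, at or before \<open>p\<close>.
  Accordingly the contraction happens in the left or in the right piece.\<close>

lemma sum_splits_ctr:
  fixes F :: "'a list \<Rightarrow> 'a list \<Rightarrow> 'v::comm_monoid_add"
  shows "(\<Sum>(p, q)\<in>segments as. \<Sum>i\<le>length (ctr op as p q). F (take i (ctr op as p q)) (drop i (ctr op as p q))) =
    (\<Sum>i\<le>length as. \<Sum>(p, q)\<in>segments (take i as). F (ctr op (take i as) p q) (drop i as)) +
    (\<Sum>i\<le>length as. \<Sum>(p, q)\<in>segments (drop i as). F (take i as) (ctr op (drop i as) p q))"
proof -
  let ?n = "length as"
  have "(\<Sum>(p, q)\<in>segments as. \<Sum>i\<le>length (ctr op as p q). F (take i (ctr op as p q)) (drop i (ctr op as p q))) =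
    (\<Sum>(p, q)\<in>segments as. (\<Sum>i\<in>{q..?n}. F (ctr op (take i as) p q) (drop i as)) +
       (\<Sum>i\<le>p. F (take i as) (ctr op (drop i as) (p - i) (q - i))))"
  proof (rule sum.cong[OF HOL.refl], clarify)
    fix p q assume "(p, q) \<in> segments as"
    then have pq: "p < q" "q \<le> ?n" by (auto simp: segments_def)
    have len: "length (ctr op as p q) = ?n - (q - p) + 1" using pq by (auto simp: ctr_def)
    have "{..length (ctr op as p q)} = {p + 1..?n - (q - p) + 1} \<union> {..p}" "{p + 1..?n - (q - p) + 1} \<inter> {..p} = {}"
      using pq len by auto
    then have "(\<Sum>i\<le>length (ctr op as p q). F (take i (ctr op as p q)) (drop i (ctr op as p q))) =
      (\<Sum>i\<in>{p + 1..?n - (q - p) + 1}. F (take i (ctr op as p q)) (drop i (ctr op as p q))) +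
      (\<Sum>i\<le>p. F (take i (ctr op as p q)) (drop i (ctr op as p q)))"
      by (simp add: sum.union_disjoint)
    moreover have "(\<Sum>i\<in>{p + 1..?n - (q - p) + 1}. F (take i (ctr op as p q)) (drop i (ctr op as p q))) =
      (\<Sum>i\<in>{q..?n}. F (ctr op (take i as) p q) (drop i as))"
    \<comment> \<open>A cut behind the contracted entry moves by the number of entries lost, q - p -
      1.\<close>
    proof (rule sum.reindex_bij_witness[of _ "\<lambda>i. i - (q - p) + 1" "\<lambda>i. i + (q - p) - 1"])
      fix i assume i: "i \<in> {p + 1..?n - (q - p) + 1}"
      then obtain i' where i': "i = p + 1 + i'" using that[of "i - (p + 1)"] by auto
      have "take i (ctr op as p q) = ctr op (take (i + (q - p) - 1) as) p q"
        using pq i by (auto simp: ctr_def i' min_def take_drop ac_simps)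
      moreover have "drop i (ctr op as p q) = drop (i + (q - p) - 1) as"
        using pq i by (auto simp: ctr_def i' min_def ac_simps)
      ultimately show "F (ctr op (take (i + (q - p) - 1) as) p q) (drop (i + (q - p) - 1) as) =
        F (take i (ctr op as p q)) (drop i (ctr op as p q))" by simp
    qed (use pq in auto)
    moreover have "(\<Sum>i\<le>p. F (take i (ctr op as p q)) (drop i (ctr op as p q))) =
        (\<Sum>i\<le>p. F (take i as) (ctr op (drop i as) (p - i) (q - i)))"
    proof (rule sum.cong[OF HOL.refl])
      fix i assume "i \<in> {..p}"
      then have "take i (ctr op as p q) = take i as" "drop i (ctr op as p q) = ctr op (drop i as) (p - i) (q - i)"
        using pq by (auto simp: ctr_def min_def take_drop)
      then show "F (take i (ctr op as p q)) (drop i (ctr op as p q)) = F (take i as) (ctr op (drop i as) (p - i) (q - i))"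
        by simp
    qed
    ultimately show "(\<Sum>i\<le>length (ctr op as p q). F (take i (ctr op as p q)) (drop i (ctr op as p q))) =
      (\<Sum>i\<in>{q..?n}. F (ctr op (take i as) p q) (drop i as)) +
       (\<Sum>i\<le>p. F (take i as) (ctr op (drop i as) (p - i) (q - i)))" by simp
  qed
  also have "\<dots> = (\<Sum>(p, q)\<in>segments as. \<Sum>i\<in>{q..?n}. F (ctr op (take i as) p q) (drop i as)) +
       (\<Sum>(p, q)\<in>segments as. \<Sum>i\<le>p. F (take i as) (ctr op (drop i as) (p - i) (q - i)))"
    by (simp add: split_def sum.distrib)
  also have "(\<Sum>(p, q)\<in>segments as. \<Sum>i\<in>{q..?n}. F (ctr op (take i as) p q) (drop i as)) =
    (\<Sum>i\<le>?n. \<Sum>(p, q)\<in>segments (take i as). F (ctr op (take i as) p q) (drop i as))"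
    by (simp add: split_def sum.Sigma)
      (rule sum.reindex_bij_witness[of _ "\<lambda>(i, pq). (pq, i)" "\<lambda>(pq, i). (i, pq)"]; auto simp: segments_def)
  also have "(\<Sum>(p, q)\<in>segments as. \<Sum>i\<le>p. F (take i as) (ctr op (drop i as) (p - i) (q - i))) =
    (\<Sum>i\<le>?n. \<Sum>(p, q)\<in>segments (drop i as). F (take i as) (ctr op (drop i as) p q))"
    by (simp add: split_def sum.Sigma)
      (rule sum.reindex_bij_witness[of _ "\<lambda>(i, p, q). ((p + i, q + i), i)" "\<lambda>((p, q), i). (i, p - i, q - i)"];
       auto simp: segments_def)
  finally show ?thesis .
qed

text \<open>By \<open>sum_splits_ctr\<close>, applied to the left and the right inputs in turn, each
  contraction falls into exactly one of the two factors. The product rule has no signs.\<close>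

lemma alg_deriv_times: "alg_deriv op (g * f) = alg_deriv op g * f + g * alg_deriv op f"
proof (rule pre_eqI)
  fix as bs :: "'a list" and x :: "'b vec"
  have "(\<Sum>(p, q)\<in>segments as. app (g * f) (ctr op as p q) x bs) =
    (\<Sum>(p, q)\<in>segments as. \<Sum>i\<le>length (ctr op as p q). \<Sum>j\<le>length bs.
       app g (take i (ctr op as p q)) (app f (drop i (ctr op as p q)) x (take j bs)) (drop j bs))"
    by (simp add: app_times_nested)
  also have "\<dots> = (\<Sum>i\<le>length as. \<Sum>(p, q)\<in>segments (take i as). \<Sum>j\<le>length bs.
        app g (ctr op (take i as) p q) (app f (drop i as) x (take j bs)) (drop j bs)) +
      (\<Sum>i\<le>length as. \<Sum>(p, q)\<in>segments (drop i as). \<Sum>j\<le>length bs.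
        app g (take i as) (app f (ctr op (drop i as) p q) x (take j bs)) (drop j bs))"
    by (rule sum_splits_ctr)
  finally have 1: "(\<Sum>(p, q)\<in>segments as. app (g * f) (ctr op as p q) x bs) =
      (\<Sum>i\<le>length as. \<Sum>j\<le>length bs. \<Sum>(p, q)\<in>segments (take i as).
        app g (ctr op (take i as) p q) (app f (drop i as) x (take j bs)) (drop j bs)) +
      (\<Sum>i\<le>length as. \<Sum>j\<le>length bs. \<Sum>(p, q)\<in>segments (drop i as).
        app g (take i as) (app f (ctr op (drop i as) p q) x (take j bs)) (drop j bs))"
    by (simp add: split_def sum.swap[of _ "{..length bs}" "segments _"])
  have "(\<Sum>(p, q)\<in>segments bs. app (g * f) as x (ctr op bs p q)) =
    (\<Sum>(p, q)\<in>segments bs. \<Sum>j\<le>length (ctr op bs p q). \<Sum>i\<le>length as.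
       app g (take i as) (app f (drop i as) x (take j (ctr op bs p q))) (drop j (ctr op bs p q)))"
    by (simp add: app_times_nested) (simp only: sum.swap[of _ "{..length as}"])
  also have "\<dots> = (\<Sum>j\<le>length bs. \<Sum>(p, q)\<in>segments (take j bs). \<Sum>i\<le>length as.
        app g (take i as) (app f (drop i as) x (ctr op (take j bs) p q)) (drop j bs)) +
      (\<Sum>j\<le>length bs. \<Sum>(p, q)\<in>segments (drop j bs). \<Sum>i\<le>length as.
        app g (take i as) (app f (drop i as) x (take j bs)) (ctr op (drop j bs) p q))"
    by (rule sum_splits_ctr)
  finally have 2: "(\<Sum>(p, q)\<in>segments bs. app (g * f) as x (ctr op bs p q)) =
      (\<Sum>i\<le>length as. \<Sum>j\<le>length bs. \<Sum>(p, q)\<in>segments (take j bs).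
        app g (take i as) (app f (drop i as) x (ctr op (take j bs) p q)) (drop j bs)) +
      (\<Sum>i\<le>length as. \<Sum>j\<le>length bs. \<Sum>(p, q)\<in>segments (drop j bs).
        app g (take i as) (app f (drop i as) x (take j bs)) (ctr op (drop j bs) p q))"
    by (simp add: split_def sum.swap[of _ "{..length as}"])
  show "app (alg_deriv op (g * f)) as x bs = app (alg_deriv op g * f + g * alg_deriv op f) as x bs"
    unfolding alg_deriv.rep_eq[of op "g * f"] 1 2
    by (simp add: app_times_nested alg_deriv.rep_eq app_add app_sum sum.distrib split_def ac_simps)
qed

lemma alg_deriv_1 [simp]: "alg_deriv op 1 = 0"
  by (rule pre_eqI) (auto simp: alg_deriv.rep_eq app_1 ctr_def intro!: sum.neutral)

section \<open>Homological perturbation\<close>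

text \<open>
  \<open>b\<close> is the differential, \<open>d\<close> the operations with algebra inputs, \<open>e\<close> the projection onto the chosen
  representatives of homology, \<open>h\<close> the homotopy and \<open>p\<close> the projection onto the underlying space. As \<open>d\<close>
  uses up an algebra input, the geometric series in \<open>h * d\<close> is finite on every input.
\<close>
locale perturbation_data =
  fixes op :: "'a list \<Rightarrow> 'a" and p b h e d :: "('a, 'x) pre"
  assumes pp: "p * p = p" and ep: "e * p = e" and pe: "p * e = e" and ee: "e * e = e"
    and hp: "h * p = h" and ph: "p * h = h" and bp: "b * p = b" and pb: "p * b = b"
    and dp: "d * p = d" and pd: "p * d = d"
    and eb: "e * b = 0" and be: "b * e = 0"
    and homotopy: "e + p = b * h + h * b"
    and positive: "positive d"
    and deriv_b: "alg_deriv op b = 0" and deriv_h: "alg_deriv op h = 0"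
    and deriv_e: "alg_deriv op e = 0" and deriv_p: "alg_deriv op p = 0"
    and mc: "b * d + d * b + d * d + alg_deriv op d = 0"
begin

abbreviation D where "D \<equiv> alg_deriv op"

lemma e_eq: "e = p + b * h + h * b"
  using homotopy by (metis add.commute add.assoc pre_add_self_left)

lemma positive_hd: "positive (h * d)" and positive_dh: "positive (d * h)"
  using positive by (simp_all add: positive_def app_times)

text \<open>The sum of d, d h d, d h d h d, ...: the operator of the perturbation lemma, out of
  which transferred structure, inclusion, projection and homotopy are built.\<close>

definition A where "A = d * star (h * d)"

lemma A_left: "A = d + d * h * A"
  unfolding A_def by (subst star_left[OF positive_hd]) (simp add: algebra_simps)

lemma A_right: "A = d + A * h * d"
  unfolding A_def by (subst star_right[OF positive_hd]) (simp add: algebra_simps)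

lemma pA: "p * A = A" and Ap: "A * p = A"
proof -
  have "p * A = p * d * star (h * d)" by (simp add: A_def mult.assoc)
  then show "p * A = A" by (simp add: pd A_def)
  have "A * p = d * p + A * h * (d * p)" by (subst A_right) (simp add: algebra_simps)
  then show "A * p = A" by (simp add: dp flip: A_right)
qed

text \<open>Multiplication by the invertible elements 1 + d h on the left and 1 + h d on the right
  turns \<open>A\<close> into \<open>d\<close>, and the asserted identity into the Maurer--Cartan
  equation for b + d. The term A e A is there because e differs from p by b h + h b.\<close>

lemma A_deriv: "D A = A * e * A + A * b + b * A"
proof -
  define S where "S = D A + A * e * A + A * b + b * A"
  let ?X = "1 + d * h" and ?Y = "1 + h * d"
  have XA: "?X * A = d"
  proof -
    have "A + d * h * A = d" by (metis A_left add.commute pre_add_self_left)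
    then show ?thesis by (simp add: algebra_simps)
  qed
  have AY: "A * ?Y = d"
  proof -
    have "A + A * h * d = d" by (metis A_right add.commute pre_add_self_left)
    then show ?thesis by (simp add: algebra_simps)
  qed
  \<comment> \<open>Differentiate X A = d. Since D h = 0, only the \<open>d\<close> inside X and the
    factor \<open>A\<close> contribute.\<close>
  have "D (?X * A) = D d * h * A + ?X * D A"
    by (simp add: alg_deriv_times alg_deriv_add deriv_h algebra_simps)
  then have "?X * D A = D d * (1 + h * A)"
    unfolding XA by (metis (no_types) add.commute distrib_left mult.assoc mult_1_right pre_add_self_left)
  then have "?X * D A * ?Y = D d * ((1 + h * A) * ?Y)"
    by (simp add: mult.assoc)
  also have "(1 + h * A) * ?Y = ?Y + h * (A * ?Y)"
    by (simp add: algebra_simps)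
  also have "\<dots> = 1"
    unfolding AY by (simp add: algebra_simps)
  finally have XDY: "?X * D A * ?Y = D d" by simp
  \<comment> \<open>Replacing e by p + b h + h b between two copies of d produces d d and two terms
    that cancel against parts of d b Y and X b d below.\<close>
  have dd: "d * e * d = d * d + d * b * h * d + d * h * b * d"
    unfolding e_eq by (simp add: distrib_left distrib_right dp flip: mult.assoc)
  have "?X * S * ?Y = ?X * D A * ?Y + (?X * A) * e * (A * ?Y) + (?X * A) * b * ?Y + ?X * b * (A * ?Y)"
    by (simp add: S_def distrib_left distrib_right mult.assoc)
  also have "\<dots> = D d + d * e * d + d * b * ?Y + ?X * b * d"
    unfolding XDY XA AY ..
  also have "\<dots> = D d + d * d + d * b + b * d"
    unfolding dd by (simp add: algebra_simps)
  also have "\<dots> = 0"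
    using mc by (simp add: algebra_simps)
  \<comment> \<open>Now both outer factors are undone by their geometric series.\<close>
  finally have "star (d * h) * (?X * S * ?Y) * star (h * d) = 0"
    by simp
  then have "star (d * h) * ?X * S * (?Y * star (h * d)) = 0"
    by (simp only: mult.assoc)
  moreover have "star (d * h) * ?X = 1"
    using star_right[OF positive_dh] by (simp add: distrib_left) (metis add.commute pre_add_self_left)
  moreover have "?Y * star (h * d) = 1"
    using star_left[OF positive_hd] by (simp add: distrib_right) (metis add.commute pre_add_self_left)
  ultimately have "S = 0" by simp
  then show ?thesis
    unfolding S_def by (simp add: add.assoc pre_add_eq_0_iff)
qed

text \<open>The usual output of the perturbation lemma: \<open>\<mu>\<close> is the structure on the
  image of \<open>e\<close>, \<open>I\<close> and \<open>P\<close> are the perturbed inclusion and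
  projection, \<open>H\<close> the perturbed homotopy, and \<open>m\<close> the full structure
  upstairs.\<close>

definition \<mu> where "\<mu> = e * A * e"
definition I where "I = e + h * A * e"
definition P where "P = e + e * A * h"
definition H where "H = h + h * A * h"
definition m where "m = b + d"

lemma mult_assoc_cong: "x * y = z \<Longrightarrow> w * x * y = w * (z :: ('a, 'x) pre)"
  by (simp add: mult.assoc)

text \<open>Each relation is repeated with a further factor on its left, because products are
  normalised to nest to the left and the relation then is not a subterm.\<close>

lemmas corner_simps = ee ep pe hp ph bp pb dp pd eb be pA Ap pp
  mult_assoc_cong[OF ee] mult_assoc_cong[OF ep] mult_assoc_cong[OF pe] mult_assoc_cong[OF hp]
  mult_assoc_cong[OF ph] mult_assoc_cong[OF bp] mult_assoc_cong[OF pb] mult_assoc_cong[OF dp]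
  mult_assoc_cong[OF pd] mult_assoc_cong[OF eb] mult_assoc_cong[OF be] mult_assoc_cong[OF pA]
  mult_assoc_cong[OF Ap] mult_assoc_cong[OF pp]

lemmas deriv_simps = alg_deriv_times alg_deriv_add deriv_b deriv_h deriv_e deriv_p A_deriv

lemmas ring_norm = distrib_left distrib_right mult.assoc[symmetric]

lemma \<mu>_mc: "\<mu> * \<mu> + D \<mu> = 0"
  by (simp add: \<mu>_def deriv_simps ring_norm corner_simps)

lemma dhA: "d * h * A = A + d" and Ahd: "A * h * d = A + d"
  by (metis A_left add.commute pre_add_self_left) (metis A_right add.commute pre_add_self_left)

lemma hb_eq: "h * b = e + p + b * h"
  using homotopy by (metis add.commute add.assoc pre_add_self_left)

text \<open>After D A is expanded, the word h b A e is the one that obstructs cancellation; the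
  homotopy relation trades it for e A e + A e + b h A e, which is the rest of the sum.
  \<open>P_cycle\<close> is the mirror image.\<close>

lemma I_cycle: "m * I + I * \<mu> + D I = 0"
proof -
  have "m * I + I * \<mu> + D I = b * h * A * e + (A * e + d * e) + d * e + e * A * e + h * A * e * A * e + h * (A * e * A + A * b + b * A) * e"
    by (simp add: m_def I_def \<mu>_def deriv_simps ring_norm corner_simps dhA add_ac)
  also have "\<dots> = b * h * A * e + A * e + e * A * e + h * b * A * e"
    by (simp add: ring_norm corner_simps add_ac)
  also have "\<dots> = 0"
    unfolding hb_eq by (simp add: ring_norm corner_simps add_ac)
  finally show ?thesis .
qed

lemma P_cycle: "\<mu> * P + P * m + D P = 0"
proof -
  have "\<mu> * P + P * m + D P = e * d + e * (A + d) + e * A * e + e * A * h * b + e * A * e * A * h + e * (A * e * A + A * b + b * A) * h"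
    by (simp add: m_def P_def \<mu>_def deriv_simps ring_norm corner_simps mult_assoc_cong[OF Ahd[unfolded mult.assoc], unfolded mult.assoc[symmetric]] add_ac)
  also have "\<dots> = e * A + e * A * e + e * A * (h * b) + e * A * b * h"
    by (simp add: ring_norm corner_simps add_ac)
  also have "\<dots> = 0"
    unfolding hb_eq by (simp add: ring_norm corner_simps add_ac)
  finally show ?thesis .
qed

text \<open>Again everything cancels once h b is moved past: it occurs alone, in front of A h and
  behind h A, and each time it is replaced by e + p + b h.\<close>

lemma IP_homotopy: "I * P + p = m * H + H * m + D H"
proof -
  have "I * P + p + (m * H + H * m + D H) =
     e + e * A * h + h * A * e + h * A * e * A * h + p + (b * h + b * h * A * h + d * h + (A + d) * h
     + h * b + h * d + h * A * h * b + h * (A + d)) + h * (A * e * A + A * b + b * A) * h"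
    by (simp add: I_def P_def m_def H_def deriv_simps ring_norm corner_simps dhA
        mult_assoc_cong[OF Ahd[unfolded mult.assoc], unfolded mult.assoc[symmetric]] add_ac)
  also have "\<dots> = e + p + b * h + h * b + (e * A * h + b * h * A * h + A * h + (h * b) * A * h) +
      (h * A * e + h * A * (h * b) + h * A + h * A * b * h)"
    by (simp add: ring_norm corner_simps add_ac)
  also have "\<dots> = 0"
    unfolding hb_eq by (simp add: ring_norm corner_simps add_ac)
  finally show ?thesis by (simp add: pre_add_eq_0_iff)
qed

text \<open>As h h, h e and e h may be nonzero, \<open>U\<close> = P I differs from \<open>e\<close>
  by terms with algebra inputs. \<open>W\<close> is its inverse in the corner of \<open>e\<close>,
  and \<open>K\<close> will be the homotopy between \<open>U\<close> and \<open>e\<close>.\<close>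

definition U where "U = P * I"
definition W where "W = e * star (U + e)"
definition K where "K = W * P * H * I"

lemma eI_Pe: "I * e = I" "e * P = P" "p * I = I" "P * p = P" "H * p = H" "p * H = H"
  by (simp_all add: I_def P_def H_def ring_norm corner_simps)

lemma e_mu: "e * \<mu> = \<mu>" "\<mu> * e = \<mu>"
  by (simp_all add: \<mu>_def ring_norm corner_simps)

lemma U_corner: "e * U = U" "U * e = U"
  by (simp_all add: U_def mult.assoc eI_Pe) (simp add: eI_Pe flip: mult.assoc)

text \<open>Without algebra inputs \<open>A\<close> vanishes, so \<open>I\<close> and
  \<open>P\<close> reduce to \<open>e\<close>, and hence so does their product.\<close>

lemma positive_U: "positive (U + e)"
proof -
  have 1: "app (e * e) [] x [] = app e [] x []" for x by (simp add: ee)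
  have 2: "app A [] x [] = 0" for x
    using positive by (simp add: A_def app_times positive_def)
  have 3: "app (I + e) [] x [] = 0" "app (P + e) [] x [] = 0" for x
    using 2 by (simp_all add: I_def P_def app_times)
  have "app I [] x [] = app e [] x []" "app P [] x [] = app e [] x []" for x
    using 3[of x] by (simp_all add: vec_add_eq_0_iff)
  then show ?thesis
    using 1 by (simp add: positive_def U_def app_times)
qed

text \<open>In the corner of \<open>e\<close> one has U = e + (U + e), so the geometric series in
  the positive element U + e inverts \<open>U\<close>.\<close>

lemma W_U: "W * U = e"
proof -
  have "star (U + e) = 1 + star (U + e) * (U + e)" by (rule star_right[OF positive_U])
  then have "star (U + e) * e = e + star (U + e) * (U + e)"
    by (metis (no_types) U_corner(2) distrib_right ee mult.assoc mult_1)
  then have "star (U + e) * U = e"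
    by (metis add.commute distrib_left pre_add_self_left)
  then show ?thesis by (simp add: W_def mult.assoc ee)
qed

lemma W_corner: "e * W = W" "W * e = W"
proof -
  show "e * W = W" by (simp add: W_def ee flip: mult.assoc)
  let ?N = "U + e"
  have Ne: "e * ?N = ?N" "?N * e = ?N" by (simp_all add: distrib_left distrib_right U_corner ee)
  have N: "e * star ?N = e + ?N * star ?N"
  proof -
    have "e * star ?N = e * (1 + ?N * star ?N)"
      using star_left[OF positive_U] by simp
    also have "\<dots> = e * 1 + e * (?N * star ?N)"
      by (rule distrib_left)
    also have "\<dots> = e + (e * ?N) * star ?N"
      by (simp only: mult_1_right mult.assoc)
    finally show ?thesis by (simp only: Ne)
  qed
  have "star ?N * e = e + star ?N * ?N"
  proof -
    have "star ?N * e = (1 + star ?N * ?N) * e"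
      using star_right[OF positive_U] by simp
    also have "\<dots> = 1 * e + star ?N * ?N * e"
      by (rule distrib_right)
    also have "\<dots> = e + star ?N * (?N * e)"
      by (simp only: mult_1_left mult.assoc)
    finally show ?thesis by (simp only: Ne)
  qed
  moreover have "star ?N * ?N = ?N * star ?N"
    by (metis star_left[OF positive_U] star_right[OF positive_U] add_left_cancel)
  ultimately have "star ?N * e = e * star ?N" using N by simp
  then show "W * e = W" by (simp add: W_def mult.assoc) (simp add: ee flip: mult.assoc)
qed

lemma U_cycle: "\<mu> * U + U * \<mu> + D U = 0"
proof -
  have "\<mu> * U + U * \<mu> + D U = (\<mu> * P + P * m + D P) * I + P * (m * I + I * \<mu> + D I)"
    by (simp add: U_def alg_deriv_times ring_norm add_ac)
  then show ?thesis by (simp add: I_cycle P_cycle)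
qed

text \<open>Differentiating W U = e gives the identity multiplied by \<open>U\<close> on the right.
  That factor can be removed because U W = e holds as well.\<close>

lemma W_cycle: "\<mu> * W + W * \<mu> + D W = 0"
proof -
  let ?Z = "\<mu> * W + W * \<mu> + D W"
  have "D (W * U) = 0" by (simp add: W_U deriv_e)
  then have DW: "D W * U = W * D U" by (simp add: alg_deriv_times pre_add_eq_0_iff)
  have "?Z * U = \<mu> * (W * U) + W * (\<mu> * U + D U)"
    by (simp add: ring_norm DW[symmetric])
  also have "\<mu> * U + D U = U * \<mu>"
    using U_cycle by (metis add.assoc add.commute pre_add_eq_0_iff)
  finally have "?Z * U = 0" by (simp add: W_U e_mu flip: mult.assoc)
  moreover have "?Z * e = ?Z"
  proof -
    have "D W = D (W * e)" by (simp add: W_corner)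
    also have "\<dots> = D W * e" by (simp add: alg_deriv_times deriv_e)
    finally show ?thesis by (simp add: distrib_right mult.assoc W_corner e_mu)
  qed
  \<comment> \<open>The series can also be unfolded from the left, so \<open>W\<close> is a
    two-sided inverse in the corner.\<close>
  moreover have "U * W = e"
  proof -
    let ?N = "U + e"
    have "star ?N = 1 + ?N * star ?N" by (rule star_left[OF positive_U])
    then have "e * star ?N = e + ?N * star ?N"
      by (metis (no_types) U_corner(1) distrib_left ee mult.assoc mult_1_right distrib_right)
    then have "U * star ?N = e"
      by (metis add.assoc add.commute distrib_right pre_add_self_left)
    then show ?thesis by (simp add: W_def U_corner flip: mult.assoc)
  qed
  ultimately show ?thesis
    by (metis mult.assoc mult_zero_left)
qed

text \<open>Sandwiching the homotopy between I P and p by \<open>P\<close> and \<open>I\<close>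
  shows that U U + U is a boundary. Multiplying by the cycle \<open>W\<close> turns it into U + e,
  the boundary of W P H I.\<close>

lemma PI_homotopy: "P * I + e = \<mu> * K + K * \<mu> + D K"
proof -
  have "P * (I * P + p) * I = P * (m * H + H * m + D H) * I"
    by (simp only: IP_homotopy)
  moreover have "P * (I * P + p) * I = U * U + U"
    by (simp add: U_def ring_norm eI_Pe)
  ultimately have 1: "U * U + U = P * m * H * I + P * H * m * I + P * D H * I"
    by (simp add: ring_norm)
  have Pm: "P * m = \<mu> * P + D P" and mI: "m * I = I * \<mu> + D I" and mW: "\<mu> * W = W * \<mu> + D W"
    using P_cycle I_cycle W_cycle by (metis add.commute add.assoc pre_add_eq_0_iff)+
  have "U + e = W * (U * U + U)"
    by (simp add: distrib_left W_U U_corner flip: mult.assoc)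
  also have "\<dots> = W * ((P * m) * H * I + P * H * (m * I) + P * D H * I)"
    unfolding 1 by (simp add: mult.assoc)
  also have "\<dots> = W * \<mu> * P * H * I + W * D P * H * I + W * P * H * I * \<mu> + W * P * H * D I + W * P * D H * I"
    unfolding Pm mI by (simp add: ring_norm add_ac)
  also have "\<dots> = (\<mu> * W) * P * H * I + K * \<mu> + D K"
    unfolding mW by (simp add: K_def alg_deriv_times ring_norm add_ac)
  finally show ?thesis by (simp add: K_def U_def mult.assoc)
qed

end

section \<open>Bimodules as Maurer--Cartan elements\<close>

text \<open>Only the values of \<open>\<phi>\<close> on basis vectors are used, so the result is
  additive for any function; for additive \<open>\<phi>\<close> it is \<open>\<phi>\<close> itself,
  with no algebra inputs.\<close>

lift_definition strict :: "('x vec \<Rightarrow> 'x vec) \<Rightarrow> ('a, 'x) pre" is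
  "\<lambda>\<phi> as x bs. if as = [] \<and> bs = [] then lin (\<lambda>y. \<phi> (bas y)) x else 0"
  by (simp add: lin_add)

lemma app_strict:
  assumes "\<And>v w. \<phi> (v + w) = \<phi> v + \<phi> w"
  shows "app (strict \<phi>) as x bs = (if as = [] \<and> bs = [] then \<phi> x else 0)"
  by (simp add: strict.rep_eq additive_eq_lin[of \<phi> x, OF assms, symmetric])

definition is_strict :: "('a, 'x) pre \<Rightarrow> bool" where
  "is_strict f \<longleftrightarrow> (\<forall>as x bs. as \<noteq> [] \<or> bs \<noteq> [] \<longrightarrow> app f as x bs = 0)"

lemma is_strictD: "is_strict f \<Longrightarrow> as \<noteq> [] \<or> bs \<noteq> [] \<Longrightarrow> app f as x bs = 0"
  by (auto simp: is_strict_def)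

lemma is_strict_strict [simp]: "is_strict (strict \<phi>)"
  by (simp add: is_strict_def strict.rep_eq)

text \<open>Every splitting except the one that gives all inputs to \<open>g\<close> leaves the
  strict factor with an input, where it vanishes.\<close>

lemma app_strict_times:
  assumes "is_strict f"
  shows "app (f * g) as x bs = app f [] (app g as x bs) []"
proof -
  have "app (f * g) as x bs = (\<Sum>ij\<in>splits as bs. if ij = (0, length bs) then app f [] (app g as x bs) [] else 0)"
    unfolding app_times split_def
  proof (rule sum.cong[OF HOL.refl])
    fix ik assume ik: "ik \<in> splits as bs"
    show "app f (take (fst ik) as) (app g (drop (fst ik) as) x (take (snd ik) bs)) (drop (snd ik) bs) =
      (if ik = (0, length bs) then app f [] (app g as x bs) [] else 0)"
    proof (cases "ik = (0, length bs)")
      case False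
      then have "take (fst ik) as \<noteq> [] \<or> drop (snd ik) bs \<noteq> []"
        using ik by (cases ik) (auto simp: splits_def)
      then show ?thesis using False by (simp add: is_strictD[OF assms])
    qed simp
  qed
  then show ?thesis by (simp add: splits_def)
qed

lemma app_times_strict:
  assumes "is_strict f"
  shows "app (g * f) as x bs = app g as (app f [] x []) bs"
proof -
  have "app (g * f) as x bs = (\<Sum>ij\<in>splits as bs. if ij = (length as, 0) then app g as (app f [] x []) bs else 0)"
    unfolding app_times split_def
  proof (rule sum.cong[OF HOL.refl])
    fix ik assume ik: "ik \<in> splits as bs"
    show "app g (take (fst ik) as) (app f (drop (fst ik) as) x (take (snd ik) bs)) (drop (snd ik) bs) =
      (if ik = (length as, 0) then app g as (app f [] x []) bs else 0)"
    proof (cases "ik = (length as, 0)")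
      case False
      then have "drop (fst ik) as \<noteq> [] \<or> take (snd ik) bs \<noteq> []"
        using ik by (cases ik) (auto simp: splits_def)
      then show ?thesis using False by (simp add: is_strictD[OF assms])
    qed simp
  qed
  then show ?thesis by (simp add: splits_def)
qed

lemma is_strict_times: "is_strict f \<Longrightarrow> is_strict g \<Longrightarrow> is_strict (f * g)"
  by (simp add: is_strict_def[of "f * g"] app_strict_times is_strictD)

lemma is_strict_add: "is_strict f \<Longrightarrow> is_strict g \<Longrightarrow> is_strict (f + g)"
  by (simp add: is_strict_def)

lemma strict_eqI:
  assumes "is_strict f" "is_strict g" "\<And>x. app f [] x [] = app g [] x []"
  shows "f = g"
proof (rule pre_eqI)
  fix as x bs
  show "app f as x bs = app g as x bs"
    using assms by (cases "as = [] \<and> bs = []") (auto simp: is_strict_def)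
qed

text \<open>A contracted list is never empty, so a map that vanishes on nonempty inputs has no terms
  here.\<close>

lemma alg_deriv_strict: "is_strict f \<Longrightarrow> alg_deriv op f = 0"
  by (rule pre_eqI) (auto simp: alg_deriv.rep_eq ctr_def is_strict_def intro!: sum.neutral)

lemma app_times_Nil: "app (f * g) [] x [] = app f [] (app g [] x []) []"
  by (simp add: app_times)

text \<open>Additivity in each algebra input. It is kept outside the type \<open>pre\<close> because
  it refers to the carrier of an algebra; it is what makes a ring element a premorphism of record
  structures.\<close>

definition multi :: "'a ainf_alg \<Rightarrow> ('a, 'x) pre \<Rightarrow> bool" where
  "multi A f \<longleftrightarrow> (\<forall>as\<in>lists (carrier A). \<forall>as'\<in>lists (carrier A). \<forall>bs\<in>lists (carrier A).
     \<forall>a\<in>carrier A. \<forall>a'\<in>carrier A. \<forall>x.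
       app f (as @ (a \<otimes>\<^bsub>A\<^esub> a') # as') x bs = app f (as @ a # as') x bs + app f (as @ a' # as') x bs \<and>
       app f bs x (as @ (a \<otimes>\<^bsub>A\<^esub> a') # as') = app f bs x (as @ a # as') + app f bs x (as @ a' # as'))"

lemma multiD:
  assumes "multi A f" "as \<in> lists (carrier A)" "as' \<in> lists (carrier A)" "bs \<in> lists (carrier A)"
    "a \<in> carrier A" "a' \<in> carrier A"
  shows "app f (as @ (a \<otimes>\<^bsub>A\<^esub> a') # as') x bs = app f (as @ a # as') x bs + app f (as @ a' # as') x bs"
    and "app f bs x (as @ (a \<otimes>\<^bsub>A\<^esub> a') # as') = app f bs x (as @ a # as') + app f bs x (as @ a' # as')"
  using assms unfolding multi_def by blast+

lemma multi_0 [simp]: "multi A 0"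
  by (simp add: multi_def)

lemma multi_strict: "is_strict f \<Longrightarrow> multi A f"
  by (simp add: multi_def is_strictD)

lemma multi_1 [simp]: "multi A 1"
  by (simp add: multi_def app_1)

lemma multi_add: "multi A f \<Longrightarrow> multi A g \<Longrightarrow> multi A (f + g)"
  unfolding multi_def[of A "f + g"] by (simp add: multiD add_ac)

text \<open>Cuts are sorted by whether the marked entry \<open>a\<close> lies behind or in front of
  them, so that each term shows the single place where \<open>a\<close> occurs.\<close>

lemma sum_split_at:
  fixes F :: "'a list \<Rightarrow> 'a list \<Rightarrow> 'v::comm_monoid_add"
  shows "(\<Sum>i\<le>length (as @ a # as'). F (take i (as @ a # as')) (drop i (as @ a # as'))) =
    (\<Sum>i\<le>length as. F (take i as) (drop i as @ a # as')) +
    (\<Sum>i\<le>length as'. F (as @ a # take i as') (drop i as'))"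
proof (induction as arbitrary: F)
  case Nil
  show ?case by (simp add: sum.atMost_Suc_shift del: sum.atMost_Suc)
next
  case (Cons c as)
  show ?case
    using Cons.IH[of "\<lambda>p q. F (c # p) q"]
    by (simp add: sum.atMost_Suc_shift add.assoc del: sum.atMost_Suc)
qed

lemma lists_take: "as \<in> lists S \<Longrightarrow> take i as \<in> lists S"
  and lists_drop: "as \<in> lists S \<Longrightarrow> drop i as \<in> lists S"
  by (auto simp: in_lists_conv_set dest: in_set_takeD in_set_dropD)

lemma multi_times:
  assumes f: "multi A f" and g: "multi A g"
  shows "multi A (g * f)"
  unfolding multi_def
proof (intro ballI allI conjI)
  fix as as' bs a a' x
  assume *: "as \<in> lists (carrier A)" "as' \<in> lists (carrier A)" "bs \<in> lists (carrier A)"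
    "a \<in> carrier A" "a' \<in> carrier A"
  note [simp] = lists_take lists_drop
  note ** = multiD[OF f _ _ _ *(4,5)] multiD[OF g _ _ _ *(4,5)]
  have ***: "app g (as @ (a \<otimes>\<^bsub>A\<^esub> a') # as') (app f ps x qs) bs' =
      app g (as @ a # as') (app f ps x qs) bs' + app g (as @ a' # as') (app f ps x qs) bs'"
    if "as' \<in> lists (carrier A)" "bs' \<in> lists (carrier A)" for as' bs' ps qs
    using that * by (intro **) auto
  have "app (g * f) (as @ c # as') x bs =
      (\<Sum>i\<le>length as. \<Sum>j\<le>length bs. app g (take i as) (app f (drop i as @ c # as') x (take j bs)) (drop j bs)) +
      (\<Sum>i\<le>length as'. \<Sum>j\<le>length bs. app g (as @ c # take i as') (app f (drop i as') x (take j bs)) (drop j bs))" for c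
    unfolding app_times_nested by (rule sum_split_at)
  then show "app (g * f) (as @ (a \<otimes>\<^bsub>A\<^esub> a') # as') x bs = app (g * f) (as @ a # as') x bs + app (g * f) (as @ a' # as') x bs"
    using * by (simp add: ** app_add sum.distrib add_ac)
  have "app (g * f) bs x (as @ c # as') =
      (\<Sum>j\<le>length as. \<Sum>i\<le>length bs. app g (take i bs) (app f (drop i bs) x (take j as)) (drop j as @ c # as')) +
      (\<Sum>j\<le>length as'. \<Sum>i\<le>length bs. app g (take i bs) (app f (drop i bs) x (as @ c # take j as')) (drop j as'))" for c
    unfolding app_times_nested sum.swap[of _ "{..length (as @ c # as')}"] by (rule sum_split_at)
  then show "app (g * f) bs x (as @ (a \<otimes>\<^bsub>A\<^esub> a') # as') = app (g * f) bs x (as @ a # as') + app (g * f) bs x (as @ a' # as')"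
    using * by (simp add: ** app_add sum.distrib add_ac)
qed

lemma multi_power: "multi A f \<Longrightarrow> multi A (f ^ n)"
  by (induction n) (auto intro: multi_times)

lemma multi_star:
  assumes "multi A f"
  shows "multi A (star f)"
  unfolding multi_def
proof (intro ballI allI conjI)
  fix as as' bs a a' x
  assume *: "as \<in> lists (carrier A)" "as' \<in> lists (carrier A)" "bs \<in> lists (carrier A)"
    "a \<in> carrier A" "a' \<in> carrier A"
  note ** = multiD[OF multi_power[OF assms] *]
  show "app (star f) (as @ (a \<otimes>\<^bsub>A\<^esub> a') # as') x bs = app (star f) (as @ a # as') x bs + app (star f) (as @ a' # as') x bs"
    by (simp only: star.rep_eq ** sum.distrib length_append length_Cons)
  show "app (star f) bs x (as @ (a \<otimes>\<^bsub>A\<^esub> a') # as') = app (star f) bs x (as @ a # as') + app (star f) bs x (as @ a' # as')"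
    by (simp only: star.rep_eq ** sum.distrib length_append length_Cons)
qed

context perturbation_data
begin

lemma multi_data:
  assumes "multi C d" "is_strict b" "is_strict e" "is_strict h"
  shows "multi C \<mu>" "multi C I" "multi C P" "multi C H" "multi C K"
proof -
  note [intro] = multi_times multi_add multi_star
  have [intro]: "multi C b" "multi C e" "multi C h" "multi C d"
    using assms multi_strict by auto
  have [intro]: "multi C A" unfolding A_def by auto
  have [intro]: "multi C I" "multi C P" "multi C H" unfolding I_def P_def H_def by auto
  have [intro]: "multi C U" unfolding U_def by auto
  have [intro]: "multi C W" unfolding W_def by auto
  show "multi C \<mu>" unfolding \<mu>_def by auto
  show "multi C I" "multi C P" "multi C H" by auto
  show "multi C K" unfolding K_def by auto
qed

end

section \<open>Bimodules over a fixed algebra, presented inside the ring\<close>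

locale alg_base =
  fixes A :: "'a ainf_alg"
  assumes ainf: "ainf_algebra A"
begin

text \<open>The operations of \<open>A\<close> are meaningful on its carrier only, whereas
  identities in the ring range over all input lists. Replacing foreign inputs by the zero vector
  makes the operations total and changes nothing on the carrier.\<close>

definition cr :: "'a \<Rightarrow> 'a" where "cr a = (if a \<in> carrier A then a else \<one>\<^bsub>A\<^esub>)"

definition aop_total :: "'a list \<Rightarrow> 'a" where "aop_total as = cr (aop A (map cr as))"

abbreviation D where "D \<equiv> alg_deriv aop_total"

lemma one_closed: "\<one>\<^bsub>A\<^esub> \<in> carrier A"
  using ainf by (auto simp: ainf_algebra_def f2_space_def comm_group_def group_def monoid.one_closed)

lemma cr_closed [simp]: "cr a \<in> carrier A"
  by (simp add: cr_def one_closed)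

lemma map_cr [simp]: "as \<in> lists (carrier A) \<Longrightarrow> map cr as = as"
  by (induction as) (auto simp: cr_def)

lemma map_cr_closed [simp]: "map cr as \<in> lists (carrier A)"
  by (induction as) auto

lemma cr_cr [simp]: "cr (cr a) = cr a"
  by (simp add: cr_def one_closed)

lemma aop_closed: "as \<in> lists (carrier A) \<Longrightarrow> as \<noteq> [] \<Longrightarrow> aop A as \<in> carrier A"
proof -
  assume *: "as \<in> lists (carrier A)" "as \<noteq> []"
  then obtain a as' where as: "as = a # as'" by (cases as) auto
  have "\<forall>as\<in>lists (carrier A). \<forall>bs\<in>lists (carrier A). (\<lambda>a. aop A (as @ a # bs)) \<in> hom A A"
    using ainf by (simp add: ainf_algebra_def)
  from this[rule_format, of "[]" as'] have "(\<lambda>c. aop A (c # as')) \<in> hom A A"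
    using * by (simp add: as)
  then have "aop A (a # as') \<in> carrier A"
    by (rule hom_in_carrier) (use * as in simp)
  then show ?thesis by (simp add: as)
qed

lemma aop_total_eq: "as \<in> lists (carrier A) \<Longrightarrow> as \<noteq> [] \<Longrightarrow> aop_total as = aop A as"
  using aop_closed[of as] by (simp add: aop_total_def) (simp add: cr_def)

lemma contract_eq: "as \<in> lists (carrier A) \<Longrightarrow> (i, j) \<in> segments as \<Longrightarrow> contract A as i j = ctr aop_total as i j"
  by (auto simp: contract_def ctr_def segments_def aop_total_eq lists_take lists_drop)

lemma contract_closed: "as \<in> lists (carrier A) \<Longrightarrow> (i, j) \<in> segments as \<Longrightarrow> contract A as i j \<in> lists (carrier A)"
proof -
  assume *: "as \<in> lists (carrier A)" "(i, j) \<in> segments as"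
  then have "aop A (drop i (take j as)) \<in> carrier A"
    by (intro aop_closed) (auto simp: segments_def lists_take lists_drop)
  then show ?thesis
    using * lists_take[of as _ i] lists_drop[of as _ j] by (simp add: contract_def)
qed

text \<open>A presentation of the abstract bimodule \<open>N\<close> in the ring: \<open>j\<close>
  embeds it into a free space, \<open>q\<close> retracts onto it, the strict idempotent
  \<open>e\<close> is \<open>j\<close> after \<open>q\<close>, and the Maurer--Cartan element
  \<open>\<mu>\<close> of the corner of \<open>e\<close> carries the operations. As only the image
  of \<open>e\<close> counts, a bimodule and its homology can share one free space.\<close>

definition realizes ::
  "('a, 'm) ainf_bimod \<Rightarrow> ('m \<Rightarrow> 'x vec) \<Rightarrow> ('x vec \<Rightarrow> 'm) \<Rightarrow> ('a, 'x) pre \<Rightarrow> ('a, 'x) pre \<Rightarrow> bool" where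
  "realizes N j q e \<mu> \<longleftrightarrow> f2_space N \<and>
    (\<forall>x\<in>carrier N. \<forall>y\<in>carrier N. j (x \<otimes>\<^bsub>N\<^esub> y) = j x + j y) \<and>
    (\<forall>v. q v \<in> carrier N) \<and> (\<forall>v w. q (v + w) = q v \<otimes>\<^bsub>N\<^esub> q w) \<and>
    (\<forall>x\<in>carrier N. q (j x) = x) \<and> is_strict e \<and> (\<forall>v. j (q v) = app e [] v []) \<and>
    e * \<mu> = \<mu> \<and> \<mu> * e = \<mu> \<and> multi A \<mu> \<and> \<mu> * \<mu> + D \<mu> = 0 \<and>
    (\<forall>as\<in>lists (carrier A). \<forall>bs\<in>lists (carrier A). \<forall>x\<in>carrier N. bop N as x bs = q (app \<mu> as (j x) bs))"

lemma realizesD: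
  assumes "realizes N j q e \<mu>"
  shows "f2_space N" "comm_group N" "comm_monoid N" "x \<in> carrier N \<Longrightarrow> y \<in> carrier N \<Longrightarrow> j (x \<otimes>\<^bsub>N\<^esub> y) = j x + j y"
    "q v \<in> carrier N" "q (v + w) = q v \<otimes>\<^bsub>N\<^esub> q w" "x \<in> carrier N \<Longrightarrow> q (j x) = x" "is_strict e"
    "j (q v) = app e [] v []" "e * \<mu> = \<mu>" "\<mu> * e = \<mu>" "multi A \<mu>" "\<mu> * \<mu> + D \<mu> = 0"
    "as \<in> lists (carrier A) \<Longrightarrow> bs \<in> lists (carrier A) \<Longrightarrow> x \<in> carrier N \<Longrightarrow> bop N as x bs = q (app \<mu> as (j x) bs)"
  using assms by (simp_all add: realizes_def f2_space_def comm_group_def)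

lemma realizes_zero:
  assumes "realizes N j q e \<mu>"
  shows "q 0 = \<one>\<^bsub>N\<^esub>" "j \<one>\<^bsub>N\<^esub> = 0"
proof -
  interpret N: comm_group N by (rule realizesD(2)[OF assms])
  have "q 0 \<otimes>\<^bsub>N\<^esub> q 0 = q 0" using realizesD(6)[OF assms, of 0 0] by simp
  then show "q 0 = \<one>\<^bsub>N\<^esub>" using realizesD(5)[OF assms] by (metis N.r_cancel_one)
  then have "j \<one>\<^bsub>N\<^esub> = app e [] 0 []" using realizesD(9)[OF assms] by metis
  then show "j \<one>\<^bsub>N\<^esub> = 0" by simp
qed

lemma realizes_e_app:
  assumes "realizes N j q e \<mu>" "x \<in> carrier N"
  shows "app e [] (j x) [] = j x"
  using assms(2) realizesD(7,9)[OF assms(1)] by metis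

lemma realizes_eq_iff:
  assumes "realizes N j q e \<mu>" "x \<in> carrier N" "y \<in> carrier N"
  shows "x = y \<longleftrightarrow> j x = j y"
  using realizesD(7)[OF assms(1)] assms(2,3) by metis

lemma realizes_q_cong:
  assumes "realizes N j q e \<mu>" "app e [] v [] = app e [] w []"
  shows "q v = q w"
  using realizesD(7)[OF assms(1) realizesD(5)[OF assms(1)]] realizesD(9)[OF assms(1)] assms(2) by metis

lemma realizes_vsum:
  assumes "realizes N j q e \<mu>" "finite I"
  shows "vsum N (\<lambda>i. q (f i)) I = q (\<Sum>i\<in>I. f i)"
proof -
  interpret N: comm_group N by (rule realizesD(2)[OF assms(1)])
  show ?thesis using assms(2)
    by (induction I rule: finite_induct)
      (simp_all add: realizes_zero[OF assms(1)] realizesD(5,6)[OF assms(1)])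
qed

lemma realizes_vsum':
  assumes "realizes N j q e \<mu>" "finite I" "\<And>i. i \<in> I \<Longrightarrow> g i = q (f i)"
  shows "vsum N g I = q (\<Sum>i\<in>I. f i)"
proof -
  interpret N: comm_group N by (rule realizesD(2)[OF assms(1)])
  have "vsum N g I = vsum N (\<lambda>i. q (f i)) I"
    by (rule N.finprod_cong') (use assms realizesD(5)[OF assms(1)] in auto)
  then show ?thesis using realizes_vsum[OF assms(1,2)] by simp
qed

definition premor :: "('m \<Rightarrow> 'x vec) \<Rightarrow> ('x vec \<Rightarrow> 'n) \<Rightarrow> ('a, 'x) pre \<Rightarrow> 'a list \<Rightarrow> 'm \<Rightarrow> 'a list \<Rightarrow> 'n" where
  "premor j q F as x bs = q (app F as (j x) bs)"

lemma premorphism_premor: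
  assumes M: "realizes M j1 q1 e1 \<mu>1" and N: "realizes N j2 q2 e2 \<mu>2" and F: "multi A F"
  shows "premorphism A M N (premor j1 q2 F)"
  unfolding premorphism_def
proof (intro conjI ballI)
  fix as bs assume "as \<in> lists (carrier A)" "bs \<in> lists (carrier A)"
  show "(\<lambda>x. premor j1 q2 F as x bs) \<in> hom M N"
    by (rule homI) (simp_all add: premor_def realizesD[OF N] realizesD(4)[OF M] app_add)
next
  fix as as' bs x
  assume *: "as \<in> lists (carrier A)" "as' \<in> lists (carrier A)" "bs \<in> lists (carrier A)" "x \<in> carrier M"
  show "(\<lambda>a. premor j1 q2 F (as @ a # as') x bs) \<in> hom A N" "(\<lambda>a. premor j1 q2 F bs x (as @ a # as')) \<in> hom A N"
    by (rule homI; simp add: premor_def realizesD[OF N] multiD[OF F *(1-3)])+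
qed

text \<open>Between the two maps a value passes through \<open>N\<close>, hence through
  \<open>j2\<close> after \<open>q2\<close>, which is \<open>e2\<close>. The hypothesis on
  \<open>e2 * F\<close> makes this passage invisible, and composition becomes the product of the
  ring.\<close>

lemma compose_premor:
  assumes M: "realizes M j1 q1 e1 \<mu>1" and N: "realizes N j2 q2 e2 \<mu>2" and L: "realizes L j3 q3 e3 \<mu>3"
    and eF: "e2 * F = F"
    and f: "\<And>as bs. as \<in> lists (carrier A) \<Longrightarrow> bs \<in> lists (carrier A) \<Longrightarrow> f as x bs = premor j1 q2 F as x bs"
    and g: "\<And>as y bs. as \<in> lists (carrier A) \<Longrightarrow> y \<in> carrier N \<Longrightarrow> bs \<in> lists (carrier A) \<Longrightarrow> g as y bs = premor j2 q3 G as y bs"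
    and x: "x \<in> carrier M" and as: "as \<in> lists (carrier A)" and bs: "bs \<in> lists (carrier A)"
  shows "compose_terms L g f as x bs = premor j1 q3 (G * F) as x bs"
proof -
  have "compose_terms L g f as x bs =
    q3 (\<Sum>(i, k)\<in>splits as bs. app G (take i as) (app F (drop i as) (j1 x) (take k bs)) (drop k bs))"
    unfolding compose_terms_def splits_def[symmetric] split_def
  proof (rule realizes_vsum'[OF L])
    fix ik assume "ik \<in> splits as bs"
    have "app e2 [] (app F as' y bs') [] = app F as' y bs'" for as' y bs'
      by (metis eF app_strict_times[OF realizesD(8)[OF N]])
    then show "g (take (fst ik) as) (f (drop (fst ik) as) x (take (snd ik) bs)) (drop (snd ik) bs) =
      q3 (app G (take (fst ik) as) (app F (drop (fst ik) as) (j1 x) (take (snd ik) bs)) (drop (snd ik) bs))"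
      using as bs by (simp add: f g lists_take lists_drop premor_def realizesD(5,9)[OF N])
  qed simp
  then show ?thesis by (simp add: premor_def app_times)
qed

lemma algebra_terms_premor:
  assumes N: "realizes N j2 q2 e2 \<mu>2"
    and f: "\<And>as bs. as \<in> lists (carrier A) \<Longrightarrow> bs \<in> lists (carrier A) \<Longrightarrow> f as x bs = premor j1 q2 F as x bs"
    and as: "as \<in> lists (carrier A)" and bs: "bs \<in> lists (carrier A)"
  shows "algebra_terms A N f as x bs = premor j1 q2 (D F) as x bs"
proof -
  have "vsum N (\<lambda>(i, k). f (contract A as i k) x bs) (segments as) =
      q2 (\<Sum>(i, k)\<in>segments as. app F (ctr aop_total as i k) (j1 x) bs)"
    unfolding split_def
    by (rule realizes_vsum'[OF N], simp, clarsimp simp: f[OF contract_closed[OF as] bs] premor_def,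
        simp add: contract_eq[OF as])
  moreover have "vsum N (\<lambda>(i, k). f as x (contract A bs i k)) (segments bs) =
      q2 (\<Sum>(i, k)\<in>segments bs. app F as (j1 x) (ctr aop_total bs i k))"
    unfolding split_def
    by (rule realizes_vsum'[OF N], simp, clarsimp simp: f[OF as contract_closed[OF bs]] premor_def,
        simp add: contract_eq[OF bs])
  ultimately show ?thesis
    by (simp add: algebra_terms_def premor_def alg_deriv.rep_eq realizesD(6)[OF N])
qed

lemma bop_premor:
  assumes "realizes N j q e \<mu>" "as \<in> lists (carrier A)" "x \<in> carrier N" "bs \<in> lists (carrier A)"
  shows "bop N as x bs = premor j q \<mu> as x bs"
  using assms by (simp add: premor_def realizesD)

text \<open>With this the search for morphisms and homotopies moves into the ring: being closed and
  being a boundary are short equations between products there.\<close>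

lemma premorphism_diff_premor:
  assumes M: "realizes M j1 q1 e1 \<mu>1" and N: "realizes N j2 q2 e2 \<mu>2"
    and eF: "e2 * F = F"
    and x: "x \<in> carrier M" and as: "as \<in> lists (carrier A)" and bs: "bs \<in> lists (carrier A)"
  shows "premorphism_diff A M N (premor j1 q2 F) as x bs = premor j1 q2 (\<mu>2 * F + F * \<mu>1 + D F) as x bs"
proof -
  have "compose_terms N (bop N) (premor j1 q2 F) as x bs = premor j1 q2 (\<mu>2 * F) as x bs"
    by (rule compose_premor[OF M N N eF]) (use assms bop_premor[OF N] in auto)
  moreover have "compose_terms N (premor j1 q2 F) (bop M) as x bs = premor j1 q2 (F * \<mu>1) as x bs"
    by (rule compose_premor[OF M M N realizesD(10)[OF M]]) (use assms bop_premor[OF M] in auto)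
  moreover have "algebra_terms A N (premor j1 q2 F) as x bs = premor j1 q2 (D F) as x bs"
    by (rule algebra_terms_premor[OF N]) (use as bs in auto)
  ultimately show ?thesis
    by (simp add: premorphism_diff_def premor_def realizesD(6)[OF N])
qed

lemma realizes_premor_zero: "realizes N j2 q2 e2 \<mu>2 \<Longrightarrow> premor j1 q2 0 as x bs = \<one>\<^bsub>N\<^esub>"
  by (simp add: premor_def realizes_zero)

lemma hom_cong_carrier:
  assumes "f \<in> hom G H" "\<And>x. x \<in> carrier G \<Longrightarrow> g x = f x"
    "\<And>x y. x \<in> carrier G \<Longrightarrow> y \<in> carrier G \<Longrightarrow> x \<otimes>\<^bsub>G\<^esub> y \<in> carrier G"
  shows "g \<in> hom G H"
  using assms by (auto simp: hom_def)

lemma ainf_bimodule_realizes: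
  assumes N: "realizes N j q e \<mu>"
  shows "ainf_bimodule A N"
  unfolding ainf_bimodule_def
proof (intro conjI ballI)
  show "ainf_algebra A" by (rule ainf)
  show "f2_space N" by (rule realizesD(1)[OF N])
  interpret N: comm_group N by (rule realizesD(2)[OF N])
  have P: "premorphism A N N (premor j q \<mu>)"
    by (rule premorphism_premor[OF N N realizesD(12)[OF N]])
  have Acl: "a \<in> carrier A \<Longrightarrow> b \<in> carrier A \<Longrightarrow> a \<otimes>\<^bsub>A\<^esub> b \<in> carrier A" for a b
    using ainf by (simp add: ainf_algebra_def f2_space_def comm_group_def group_def monoid.m_closed)
  show "premorphism A N N (bop N)"
    unfolding premorphism_def
  proof (intro conjI ballI)
    fix as bs assume "as \<in> lists (carrier A)" "bs \<in> lists (carrier A)"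
    then show "(\<lambda>x. bop N as x bs) \<in> hom N N"
      by (intro hom_cong_carrier[OF P[unfolded premorphism_def, THEN conjunct1, rule_format]])
        (simp_all add: bop_premor[OF N])
  next
    fix as as' bs x
    assume *: "as \<in> lists (carrier A)" "as' \<in> lists (carrier A)" "bs \<in> lists (carrier A)" "x \<in> carrier N"
    have 1: "(\<lambda>a. premor j q \<mu> (as @ a # as') x bs) \<in> hom A N" "(\<lambda>a. premor j q \<mu> bs x (as @ a # as')) \<in> hom A N"
      using P[unfolded premorphism_def, THEN conjunct2, rule_format, OF *] by simp_all
    show "(\<lambda>a. bop N (as @ a # as') x bs) \<in> hom A N"
      by (rule hom_cong_carrier[OF 1(1)]) (use * in \<open>simp_all add: bop_premor[OF N] Acl\<close>)
    show "(\<lambda>a. bop N bs x (as @ a # as')) \<in> hom A N"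
      by (rule hom_cong_carrier[OF 1(2)]) (use * in \<open>simp_all add: bop_premor[OF N] Acl\<close>)
  qed
  fix as x bs assume *: "as \<in> lists (carrier A)" "x \<in> carrier N" "bs \<in> lists (carrier A)"
  have "compose_terms N (bop N) (bop N) as x bs = premor j q (\<mu> * \<mu>) as x bs"
    by (rule compose_premor[OF N N N realizesD(10)[OF N]]) (use * bop_premor[OF N] in auto)
  moreover have "algebra_terms A N (bop N) as x bs = premor j q (D \<mu>) as x bs"
    by (rule algebra_terms_premor[OF N]) (use * bop_premor[OF N] in auto)
  ultimately have "compose_terms N (bop N) (bop N) as x bs \<otimes>\<^bsub>N\<^esub> algebra_terms A N (bop N) as x bs =
      premor j q (\<mu> * \<mu> + D \<mu>) as x bs"
    by (simp add: premor_def realizesD(6)[OF N])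
  then show "compose_terms N (bop N) (bop N) as x bs \<otimes>\<^bsub>N\<^esub> algebra_terms A N (bop N) as x bs = \<one>\<^bsub>N\<^esub>"
    by (simp add: realizesD(13)[OF N] realizes_premor_zero[OF N])
qed

lemma ainf_morphism_premor:
  assumes M: "realizes M j1 q1 e1 \<mu>1" and N: "realizes N j2 q2 e2 \<mu>2"
    and "e2 * F = F" "multi A F" "\<mu>2 * F + F * \<mu>1 + D F = 0"
  shows "ainf_morphism A M N (premor j1 q2 F)"
  unfolding ainf_morphism_def
  using premorphism_premor[OF M N assms(4)]
  by (simp add: premorphism_diff_premor[OF M N assms(3)] assms(5) realizes_premor_zero[OF N])

lemma ainf_id_premor:
  assumes N: "realizes N j q e \<mu>" and x: "x \<in> carrier N"
  shows "ainf_id N as x bs = premor j q e as x bs"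
  using realizesD(7,8)[OF N] realizes_e_app[OF N x] realizes_zero[OF N] x
  by (auto simp: ainf_id_def premor_def is_strict_def)

lemma ainf_homotopic_premor:
  assumes M: "realizes M j1 q1 e1 \<mu>1" and N: "realizes N j2 q2 e2 \<mu>2"
    and K: "e2 * K = K" "multi A K" "F + G = \<mu>2 * K + K * \<mu>1 + D K"
    and f: "\<And>as x bs. as \<in> lists (carrier A) \<Longrightarrow> x \<in> carrier M \<Longrightarrow> bs \<in> lists (carrier A) \<Longrightarrow> f as x bs = premor j1 q2 F as x bs"
    and g: "\<And>as x bs. as \<in> lists (carrier A) \<Longrightarrow> x \<in> carrier M \<Longrightarrow> bs \<in> lists (carrier A) \<Longrightarrow> g as x bs = premor j1 q2 G as x bs"
  shows "ainf_homotopic A M N f g"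
  unfolding ainf_homotopic_def
proof (intro exI conjI ballI)
  show "premorphism A M N (premor j1 q2 K)" by (rule premorphism_premor[OF M N K(2)])
  fix as x bs assume *: "as \<in> lists (carrier A)" "x \<in> carrier M" "bs \<in> lists (carrier A)"
  have "f as x bs \<otimes>\<^bsub>N\<^esub> g as x bs = premor j1 q2 (F + G) as x bs"
    using * by (simp add: f g premor_def realizesD(6)[OF N])
  then show "f as x bs \<otimes>\<^bsub>N\<^esub> g as x bs = premorphism_diff A M N (premor j1 q2 K) as x bs"
    using * by (simp add: premorphism_diff_premor[OF M N K(1)] K(3))
qed

text \<open>Collects what has to be found in the ring: closed elements \<open>F\<close> and
  \<open>G\<close> in opposite directions, and homotopies \<open>K\<close> and \<open>L\<close> for
  both composites, each in the right corner and additive in its algebra inputs.\<close>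

lemma D_inf_isomorphic_realizes:
  assumes M: "realizes M j1 q1 e1 \<mu>1" and N: "realizes N j2 q2 e2 \<mu>2"
    and F: "e2 * F = F" "multi A F" "\<mu>2 * F + F * \<mu>1 + D F = 0"
    and G: "e1 * G = G" "multi A G" "\<mu>1 * G + G * \<mu>2 + D G = 0"
    and K: "e1 * K = K" "multi A K" "G * F + e1 = \<mu>1 * K + K * \<mu>1 + D K"
    and L: "e2 * L = L" "multi A L" "F * G + e2 = \<mu>2 * L + L * \<mu>2 + D L"
    and "homologically_unital A M" "homologically_unital A N"
  shows "D_inf_isomorphic A M N"
  unfolding D_inf_isomorphic_def D_inf_object_def
proof (intro conjI exI)
  show "ainf_bimodule A M" "ainf_bimodule A N" using M N by (auto intro: ainf_bimodule_realizes)
  show "homologically_unital A M" "homologically_unital A N" by fact+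
  show "ainf_morphism A M N (premor j1 q2 F)" by (rule ainf_morphism_premor[OF M N F])
  show "ainf_morphism A N M (premor j2 q1 G)" by (rule ainf_morphism_premor[OF N M G])
  show "ainf_homotopic A M M (compose_terms M (premor j2 q1 G) (premor j1 q2 F)) (ainf_id M)"
  proof (rule ainf_homotopic_premor[OF M M K])
    fix as x bs assume *: "as \<in> lists (carrier A)" "x \<in> carrier M" "bs \<in> lists (carrier A)"
    show "compose_terms M (premor j2 q1 G) (premor j1 q2 F) as x bs = premor j1 q1 (G * F) as x bs"
      by (rule compose_premor[OF M N M F(1)]) (use * in simp_all)
    show "ainf_id M as x bs = premor j1 q1 e1 as x bs"
      by (rule ainf_id_premor[OF M *(2)])
  qed
  show "ainf_homotopic A N N (compose_terms N (premor j1 q2 F) (premor j2 q1 G)) (ainf_id N)"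
  proof (rule ainf_homotopic_premor[OF N N L])
    fix as x bs assume *: "as \<in> lists (carrier A)" "x \<in> carrier N" "bs \<in> lists (carrier A)"
    show "compose_terms N (premor j1 q2 F) (premor j2 q1 G) as x bs = premor j2 q2 (F * G) as x bs"
      by (rule compose_premor[OF N M N G(1)]) (use * in simp_all)
    show "ainf_id N as x bs = premor j2 q2 e2 as x bs"
      by (rule ainf_id_premor[OF N *(2)])
  qed
qed

end

section \<open>Homology of a bimodule with a strict unit\<close>

lemma comm_group_cong:
  assumes "comm_group G" "carrier H = carrier G" "monoid.mult H = monoid.mult G" "\<one>\<^bsub>H\<^esub> = \<one>\<^bsub>G\<^esub>"
  shows "comm_group H"
proof -
  interpret comm_group G by fact
  show ?thesis
    by (rule comm_groupI) (auto simp: assms m_ac intro: l_inv_ex)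
qed

lemma f2_space_cong:
  assumes "f2_space G" "carrier H = carrier G" "monoid.mult H = monoid.mult G" "\<one>\<^bsub>H\<^esub> = \<one>\<^bsub>G\<^esub>"
  shows "f2_space H"
  using assms comm_group_cong[of G H] by (auto simp: f2_space_def)

lemma comm_group_subgroup:
  assumes "comm_group G" "subgroup H G"
  shows "comm_group (G\<lparr>carrier := H\<rparr>)"
proof -
  interpret comm_group G by fact
  show ?thesis
    by (rule group.group_comm_groupI[OF subgroup.subgroup_is_group[OF assms(2)]])
      (use subgroup.mem_carrier[OF assms(2)] in \<open>auto simp: is_group m_comm\<close>)
qed

lemma segments_Nil [simp]: "segments [] = {}"
  by (auto simp: segments_def)

context alg_base begin

lemma realizes_bdiff:
  assumes "realizes N j q e \<mu>" "x \<in> carrier N"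
  shows "bdiff N x = q (app \<mu> [] (j x) [])" "j (bdiff N x) = app \<mu> [] (j x) []" "bdiff N x \<in> carrier N"
proof -
  show 1: "bdiff N x = q (app \<mu> [] (j x) [])"
    using assms by (simp add: bdiff_def realizesD(14)[OF assms(1)])
  have "j (bdiff N x) = app (e * \<mu>) [] (j x) []"
    by (simp add: 1 realizesD(9)[OF assms(1)] app_times_Nil)
  then show "j (bdiff N x) = app \<mu> [] (j x) []"
    by (simp add: realizesD(10)[OF assms(1)])
  show "bdiff N x \<in> carrier N" by (simp add: 1 realizesD(5)[OF assms(1)])
qed

lemma app_alg_deriv_Nil [simp]: "app (D f) [] x [] = 0"
  by (simp add: alg_deriv.rep_eq)

lemma realizes_diff_diff:
  assumes "realizes N j q e \<mu>"
  shows "app \<mu> [] (app \<mu> [] v []) [] = 0"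
proof -
  have "app (\<mu> * \<mu> + D \<mu>) [] v [] = app 0 [] v []" by (simp add: realizesD(13)[OF assms])
  then show ?thesis by (simp add: app_times_Nil)
qed

lemma realizes_j_one_iff:
  assumes "realizes N j q e \<mu>" "x \<in> carrier N"
  shows "x = \<one>\<^bsub>N\<^esub> \<longleftrightarrow> j x = 0"
  using realizes_eq_iff[OF assms(1,2), of "\<one>\<^bsub>N\<^esub>"] realizes_zero[OF assms(1)] realizesD(5)[OF assms(1)] by metis

end

text \<open>A presented bimodule with an element \<open>u\<close> that acts from either side as the
  identity. The ring elements \<open>p\<close> and \<open>m\<close> are parameters, so that two
  bimodules having the same structure can be expressed as being models of the same \<open>p\<close>,
  \<open>m\<close> and \<open>u\<close>.\<close>

locale bimod_model = alg_base A
  for A :: "'a ainf_alg" +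
  fixes M :: "('a, 'm) ainf_bimod" and j :: "'m \<Rightarrow> 'x vec" and q p m u
  assumes M: "realizes M j q p m"
    and unit: "homology_unit A u"
    and unit_left: "app m [u] v [] = app p [] v []"
    and unit_right: "app m [] v [u] = app p [] v []"
begin

sublocale M: comm_group M by (rule realizesD(2)[OF M])

lemmas MD = realizesD[OF M]

lemma u_closed: "u \<in> carrier A"
  using unit by (simp add: homology_unit_def)

text \<open>Differential \<open>b\<close> and perturbation \<open>d\<close>: the strict part of the
  structure and the part with algebra inputs.\<close>

definition b :: "('a, 'x) pre" where "b = strict (\<lambda>v. app m [] v [])"
definition d :: "('a, 'x) pre" where "d = m + b"

lemma app_b: "app b as x bs = (if as = [] \<and> bs = [] then app m [] x [] else 0)"
  unfolding b_def by (rule app_strict) (rule app_add)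

lemma app_d: "app d as x bs = (if as = [] \<and> bs = [] then 0 else app m as x bs)"
  by (simp add: d_def app_b)

lemma m_eq: "m = b + d"
  by (simp add: d_def add.commute)

lemma strict_b [simp]: "is_strict b" and strict_p [simp]: "is_strict p"
  by (simp_all add: b_def MD(8))

lemma pp: "p * p = p"
proof (rule strict_eqI)
  fix x
  have "app (p * p) [] x [] = j (q (j (q x)))" by (simp add: app_times_Nil MD(9))
  then show "app (p * p) [] x [] = app p [] x []" by (simp add: MD(5,7)) (simp add: MD(9))
qed (simp_all add: is_strict_times)

lemma pb: "p * b = b"
proof (rule strict_eqI)
  fix x
  have "app (p * m) [] x [] = app m [] x []" by (simp only: MD(10))
  then show "app (p * b) [] x [] = app b [] x []" by (simp add: app_times_Nil app_b)
qed (simp_all add: is_strict_times)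

lemma bp: "b * p = b"
proof (rule strict_eqI)
  fix x
  have "app (m * p) [] x [] = app m [] x []" by (simp only: MD(11))
  then show "app (b * p) [] x [] = app b [] x []" by (simp add: app_times_Nil app_b)
qed (simp_all add: is_strict_times)

lemma pd: "p * d = d" and dp: "d * p = d"
  by (simp_all add: d_def distrib_left distrib_right MD(10,11) pb bp)

lemma positive_d: "positive d"
  by (simp add: positive_def app_d)

lemma bb: "b * b = 0"
  by (rule strict_eqI)
    (simp_all add: is_strict_times app_times_Nil app_b realizes_diff_diff[OF M] is_strict_def[of 0])

lemma mc_split: "b * d + d * b + d * d + D d = 0"
proof -
  have "D (b + d) = D d" by (simp add: alg_deriv_add alg_deriv_strict)
  then have "D m = D d" by (simp only: m_eq[symmetric])
  then have "(b + d) * (b + d) + D d = 0" using MD(13) by (simp only: m_eq[symmetric])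
  then show ?thesis by (simp add: distrib_left distrib_right bb add_ac)
qed

lemma j_bdiff: "x \<in> carrier M \<Longrightarrow> j (bdiff M x) = app b [] (j x) []"
  by (simp add: app_b realizes_bdiff(2)[OF M])

lemma bdiff_hom: "bdiff M \<in> hom M M"
  by (rule homI, simp add: realizes_bdiff(3)[OF M], simp add: realizes_bdiff(1)[OF M] MD(4) app_add MD(6))

lemma bdiff_bdiff: "x \<in> carrier M \<Longrightarrow> bdiff M (bdiff M x) = \<one>\<^bsub>M\<^esub>"
  by (subst realizes_bdiff(1)[OF M])
    (simp_all add: realizes_bdiff(2,3)[OF M] realizes_diff_diff[OF M] realizes_zero[OF M])

lemma mem_cycles: "x \<in> cycles M \<longleftrightarrow> x \<in> carrier M \<and> app b [] (j x) [] = 0"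
  using realizes_j_one_iff[OF M realizes_bdiff(3)[OF M]]
  by (auto simp: cycles_def kernel_def j_bdiff)

lemma subgroup_cycles: "subgroup (cycles M) M"
  unfolding cycles_def
  by (rule group_hom.subgroup_kernel) (simp add: group_hom_def group_hom_axioms_def bdiff_hom M.is_group)

lemma boundaries_subset: "boundaries M \<subseteq> cycles M"
  by (auto simp: boundaries_def cycles_def kernel_def realizes_bdiff(3)[OF M] bdiff_bdiff)

lemma subgroup_boundaries: "subgroup (boundaries M) M"
  unfolding boundaries_def
  by (rule group_hom.img_is_subgroup) (simp add: group_hom_def group_hom_axioms_def bdiff_hom M.is_group)

lemma comm_group_cycles: "comm_group (M\<lparr>carrier := cycles M\<rparr>)"
  by (rule comm_group_subgroup[OF M.comm_group_axioms subgroup_cycles])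

lemma subgroup_boundaries': "subgroup (boundaries M) (M\<lparr>carrier := cycles M\<rparr>)"
  by (rule M.subgroup_incl[OF subgroup_boundaries subgroup_cycles boundaries_subset])

lemma comm_group_homology: "comm_group (homology M)"
  unfolding homology_def by (rule comm_group.abelian_FactGroup[OF comm_group_cycles subgroup_boundaries'])

definition cls :: "'m \<Rightarrow> 'm set" where "cls z = boundaries M #>\<^bsub>M\<^esub> z"

lemma carrier_homology: "carrier (homology M) = cls ` cycles M"
  by (simp add: homology_def carrier_FactGroup cls_def image_def)

lemma mult_homology: "C \<otimes>\<^bsub>homology M\<^esub> C' = C <#>\<^bsub>M\<^esub> C'"
  by (simp add: homology_def)

lemma one_homology: "\<one>\<^bsub>homology M\<^esub> = boundaries M"
  by (simp add: homology_def)

lemma cls_mult: "z \<in> carrier M \<Longrightarrow> z' \<in> carrier M \<Longrightarrow> cls (z \<otimes>\<^bsub>M\<^esub> z') = cls z <#>\<^bsub>M\<^esub> cls z'"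
  unfolding cls_def by (rule normal.rcos_sum[symmetric]) (auto simp: M.normal_iff_subgroup subgroup_boundaries)

lemma cls_self: "z \<in> carrier M \<Longrightarrow> z \<in> cls z"
  unfolding cls_def by (rule M.rcos_self[OF _ subgroup_boundaries])

lemma cls_subset: "z \<in> cycles M \<Longrightarrow> cls z \<subseteq> cycles M"
  unfolding cls_def r_coset_def
  using boundaries_subset subgroup.m_closed[OF subgroup_cycles] by auto

lemma cls_eq: "x \<in> cls z \<Longrightarrow> z \<in> carrier M \<Longrightarrow> cls x = cls z"
  unfolding cls_def by (rule M.repr_independence[symmetric, OF _ _ subgroup_boundaries])

lemma f2_M: "x \<in> carrier M \<Longrightarrow> x \<otimes>\<^bsub>M\<^esub> x = \<one>\<^bsub>M\<^esub>"
  using MD(1) by (simp add: f2_space_def)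

lemma f2_homology: "f2_space (homology M)"
  unfolding f2_space_def
proof (intro conjI ballI)
  show "comm_group (homology M)" by (rule comm_group_homology)
  fix C assume "C \<in> carrier (homology M)"
  then obtain z where z: "z \<in> cycles M" "C = cls z" by (auto simp: carrier_homology)
  then have "z \<in> carrier M" by (simp add: mem_cycles)
  then have "cls z <#>\<^bsub>M\<^esub> cls z = cls \<one>\<^bsub>M\<^esub>" by (simp add: f2_M flip: cls_mult)
  then show "C \<otimes>\<^bsub>homology M\<^esub> C = \<one>\<^bsub>homology M\<^esub>"
    using subgroup.subset[OF subgroup_boundaries] by (simp add: z mult_homology one_homology cls_def)
qed

text \<open>The unit acts strictly, so the difference between x and its product with
  \<open>u\<close> is not merely a boundary but zero.\<close>

lemma homologically_unital_M: "homologically_unital A M"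
  unfolding homologically_unital_def
proof (intro exI conjI ballI)
  show "homology_unit A u" by (rule unit)
  fix x assume "x \<in> cycles M"
  then have x: "x \<in> carrier M" by (simp add: mem_cycles)
  have "q (app p [] (j x) []) = x"
    using MD(7,9) x by metis
  then have "bop M [u] x [] = x" "bop M [] x [u] = x"
    using x by (simp_all add: MD(14) u_closed unit_left unit_right)
  then show "bop M [u] x [] \<otimes>\<^bsub>M\<^esub> x \<in> boundaries M" "bop M [] x [u] \<otimes>\<^bsub>M\<^esub> x \<in> boundaries M"
    using x subgroup.one_closed[OF subgroup_boundaries] by (simp_all add: f2_M)
qed

end

section \<open>The transferred bimodule as a corner of the ring\<close>

locale bimod_contraction = bimod_model A M j q p m u
  for A :: "'a ainf_alg" and M :: "('a, 'm) ainf_bimod" and j :: "'m \<Rightarrow> 'x vec" and q p m u +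
  fixes \<iota> \<pi> h
  assumes contraction: "homology_contraction M \<iota> \<pi> h"
begin

text \<open>The homotopy and the projection onto representatives, extended from \<open>M\<close> to
  the whole free space through \<open>q\<close> and \<open>j\<close>.\<close>

definition h0 :: "('a, 'x) pre" where "h0 = strict (\<lambda>v. j (h (q v)))"
definition e0 :: "('a, 'x) pre" where "e0 = strict (\<lambda>v. j (\<iota> (\<pi> (q v))))"

lemma \<iota>_hom: "\<iota> \<in> hom (homology M) M" and \<pi>_hom: "\<pi> \<in> hom M (homology M)" and h_hom: "h \<in> hom M M"
  and \<iota>_in: "C \<in> carrier (homology M) \<Longrightarrow> \<iota> C \<in> C" and \<pi>_\<iota>: "C \<in> carrier (homology M) \<Longrightarrow> \<pi> (\<iota> C) = C"
  and \<pi>_bdiff: "x \<in> carrier M \<Longrightarrow> \<pi> (bdiff M x) = \<one>\<^bsub>homology M\<^esub>"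
  and \<iota>_\<pi>: "x \<in> carrier M \<Longrightarrow> \<iota> (\<pi> x) \<otimes>\<^bsub>M\<^esub> x = bdiff M (h x) \<otimes>\<^bsub>M\<^esub> h (bdiff M x)"
  using contraction by (simp_all add: homology_contraction_def)

lemma \<iota>_closed: "C \<in> carrier (homology M) \<Longrightarrow> \<iota> C \<in> carrier M"
  using hom_in_carrier[OF \<iota>_hom] by simp

lemma \<pi>_closed: "x \<in> carrier M \<Longrightarrow> \<pi> x \<in> carrier (homology M)"
  using hom_in_carrier[OF \<pi>_hom] by simp

lemma h_closed: "x \<in> carrier M \<Longrightarrow> h x \<in> carrier M"
  using hom_in_carrier[OF h_hom] by simp

lemma app_h0: "app h0 as x bs = (if as = [] \<and> bs = [] then j (h (q x)) else 0)"
  unfolding h0_def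
  by (rule app_strict) (simp add: MD hom_mult[OF h_hom] h_closed)

lemma app_e0: "app e0 as x bs = (if as = [] \<and> bs = [] then j (\<iota> (\<pi> (q x))) else 0)"
  unfolding e0_def
  by (rule app_strict) (simp add: MD hom_mult[OF \<pi>_hom] hom_mult[OF \<iota>_hom] \<pi>_closed \<iota>_closed)

lemma strict_h0 [simp]: "is_strict h0" and strict_e0 [simp]: "is_strict e0"
  by (simp_all add: h0_def e0_def)

lemma q_p: "q (app p [] v []) = q v"
  by (rule realizes_q_cong[OF M]) (simp add: pp flip: app_times_Nil)

lemma p_j: "x \<in> carrier M \<Longrightarrow> app p [] (j x) [] = j x"
  by (rule realizes_e_app[OF M])

lemma q_b: "q (app b [] v []) = bdiff M (q v)"
proof -
  have "app b [] v [] = app b [] (j (q v)) []"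
    by (simp add: MD(9) bp flip: app_times_Nil)
  also have "\<dots> = j (bdiff M (q v))" by (simp add: j_bdiff MD(5))
  finally show ?thesis by (simp add: MD(7) realizes_bdiff(3)[OF M] MD(5))
qed

lemma one_\<iota>: "\<iota> \<one>\<^bsub>homology M\<^esub> = \<one>\<^bsub>M\<^esub>"
  by (rule hom_one[OF \<iota>_hom]) (use comm_group_homology in \<open>auto simp: comm_group_def\<close>)

lemma \<iota>_cycle: "C \<in> carrier (homology M) \<Longrightarrow> \<iota> C \<in> cycles M"
  using \<iota>_in cls_subset unfolding carrier_homology by blast

lemma b_\<iota>: "C \<in> carrier (homology M) \<Longrightarrow> app b [] (j (\<iota> C)) [] = 0"
  using \<iota>_cycle by (simp add: mem_cycles)

sublocale hpl: perturbation_data aop_total p b h0 e0 d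
proof
  show "p * p = p" "b * p = b" "p * b = b" "d * p = d" "p * d = d" "positive d"
    "b * d + d * b + d * d + alg_deriv aop_total d = 0"
    by (rule pp bp pb dp pd positive_d mc_split)+
  show "alg_deriv aop_total b = 0" "alg_deriv aop_total h0 = 0" "alg_deriv aop_total e0 = 0" "alg_deriv aop_total p = 0"
    by (simp_all add: alg_deriv_strict)
  show "e0 * p = e0" "h0 * p = h0"
    by (rule strict_eqI; simp add: is_strict_times app_times_Nil app_e0 app_h0 q_p)+
  show "p * e0 = e0" "p * h0 = h0"
    by (rule strict_eqI; simp add: is_strict_times app_times_Nil app_e0 app_h0 p_j \<iota>_closed \<pi>_closed h_closed MD(5))+
  show "e0 * e0 = e0"
    by (rule strict_eqI) (simp_all add: is_strict_times app_times_Nil app_e0 MD(7) \<pi>_\<iota> \<iota>_closed \<pi>_closed MD(5))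
  show "e0 * b = 0"
    by (rule strict_eqI)
      (simp_all add: is_strict_times app_times_Nil app_e0 q_b \<pi>_bdiff MD(5) one_\<iota> realizes_zero[OF M], simp add: is_strict_def[of 0])
  show "b * e0 = 0"
    by (rule strict_eqI)
      (simp_all add: is_strict_times app_times_Nil app_e0 b_\<iota> \<pi>_closed MD(5), simp add: is_strict_def[of 0])
  show "e0 + p = b * h0 + h0 * b"
  proof (rule strict_eqI)
    fix v
    have "j (\<iota> (\<pi> (q v)) \<otimes>\<^bsub>M\<^esub> q v) = j (bdiff M (h (q v)) \<otimes>\<^bsub>M\<^esub> h (bdiff M (q v)))"
      by (simp add: \<iota>_\<pi> MD(5))
    then have "j (\<iota> (\<pi> (q v))) + app p [] v [] = app b [] (j (h (q v))) [] + j (h (q (app b [] v [])))"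
      by (simp add: MD(4,5) MD(9)[symmetric] \<iota>_closed \<pi>_closed h_closed realizes_bdiff(3)[OF M] j_bdiff q_b)
    then show "app (e0 + p) [] v [] = app (b * h0 + h0 * b) [] v []"
      by (simp add: app_e0 app_h0 app_times_Nil)
  qed (simp_all add: is_strict_times is_strict_add)
qed

abbreviation E where "E \<equiv> transferred_bimod M \<iota> \<pi> h"

lemma carrier_E: "carrier E = carrier (homology M)" and mult_E: "monoid.mult E = monoid.mult (homology M)"
  and one_E: "\<one>\<^bsub>E\<^esub> = \<one>\<^bsub>homology M\<^esub>"
  by (simp_all add: transferred_bimod_def)

text \<open>The recursion defining the iterates is left multiplication by \<open>h0 * d\<close>. The
  index pair left out in \<open>perturbation\<close> is the one in which the operation would receive
  no algebra input, and there \<open>d\<close> is zero.\<close>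

lemma pert_iterate_closed_eq:
  assumes "C \<in> carrier (homology M)" "as \<in> lists (carrier A)" "bs \<in> lists (carrier A)"
  shows "pert_iterate M \<iota> h n as C bs = q (app ((h0 * d) ^ n) as (j (\<iota> C)) bs)"
    and "perturbation M (pert_iterate M \<iota> h n) as C bs = q (app (d * (h0 * d) ^ n) as (j (\<iota> C)) bs)"
proof -
  have pert: "perturbation M f as C bs = q (app (d * F) as (j (\<iota> C)) bs)"
    if f: "\<And>as bs. as \<in> lists (carrier A) \<Longrightarrow> bs \<in> lists (carrier A) \<Longrightarrow> f as C bs = q (app F as (j (\<iota> C)) bs)"
      and "as \<in> lists (carrier A)" "bs \<in> lists (carrier A)" for f F as bs
  proof -
    have "perturbation M f as C bs = q (\<Sum>(i, k)\<in>splits as bs - {(0, length bs)}.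
        app d (take i as) (app F (drop i as) (j (\<iota> C)) (take k bs)) (drop k bs))"
      unfolding perturbation_def splits_def[symmetric] split_def
    proof (rule realizes_vsum'[OF M])
      fix ik assume ik: "ik \<in> splits as bs - {(0, length bs)}"
      then have "\<not> (take (fst ik) as = [] \<and> drop (snd ik) bs = [])"
        by (cases ik) (auto simp: splits_def)
      then have "app d (take (fst ik) as) v (drop (snd ik) bs) = app m (take (fst ik) as) v (drop (snd ik) bs)" for v
        unfolding app_d by (rule if_not_P)
      \<comment> \<open>Values pass through \<open>M\<close> between two steps, which inserts a
        \<open>p\<close>; the operations absorb it.\<close>
      moreover have "app m as' (app p [] v []) bs' = app m as' v bs'" for as' v bs'
        by (simp add: MD(11) flip: app_times_strict)
      ultimately show "bop M (take (fst ik) as) (f (drop (fst ik) as) C (take (snd ik) bs)) (drop (snd ik) bs) =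
        q (app d (take (fst ik) as) (app F (drop (fst ik) as) (j (\<iota> C)) (take (snd ik) bs)) (drop (snd ik) bs))"
        using that by (simp add: f lists_take lists_drop MD(5,9,14))
    qed simp
    also have "(\<Sum>(i, k)\<in>splits as bs - {(0, length bs)}.
        app d (take i as) (app F (drop i as) (j (\<iota> C)) (take k bs)) (drop k bs)) = app (d * F) as (j (\<iota> C)) bs"
      unfolding app_times
      by (rule sum.mono_neutral_left) (auto simp: app_d)
    finally show ?thesis .
  qed
  have 1: "pert_iterate M \<iota> h n as C bs = q (app ((h0 * d) ^ n) as (j (\<iota> C)) bs)"
    if "as \<in> lists (carrier A)" "bs \<in> lists (carrier A)" for as bs
    using that
  proof (induction n arbitrary: as bs)
    case 0
    then show ?case using assms(1) by (simp add: app_1 MD(7) \<iota>_closed realizes_zero[OF M])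
  next
    case (Suc n)
    have "pert_iterate M \<iota> h (Suc n) as C bs = h (q (app (d * (h0 * d) ^ n) as (j (\<iota> C)) bs))"
      using pert[of "pert_iterate M \<iota> h n" "(h0 * d) ^ n", OF Suc.IH Suc.prems] by simp
    also have "\<dots> = q (app (h0 * (d * (h0 * d) ^ n)) as (j (\<iota> C)) bs)"
      by (simp add: app_strict_times app_h0 MD(5,7) h_closed)
    finally show ?case by (simp add: mult.assoc)
  qed
  show "pert_iterate M \<iota> h n as C bs = q (app ((h0 * d) ^ n) as (j (\<iota> C)) bs)"
    by (rule 1[OF assms(2,3)])
  show "perturbation M (pert_iterate M \<iota> h n) as C bs = q (app (d * (h0 * d) ^ n) as (j (\<iota> C)) bs)"
    by (rule pert[of "pert_iterate M \<iota> h n" "(h0 * d) ^ n", OF 1 assms(2,3)])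
qed

lemma app_A: "app hpl.A as v bs = (\<Sum>n\<le>length as + length bs. app (d * (h0 * d) ^ n) as v bs)"
proof -
  have "app hpl.A as v bs = (\<Sum>(i, k)\<in>splits as bs. \<Sum>n\<le>length as + length bs.
      app d (take i as) (app ((h0 * d) ^ n) (drop i as) v (take k bs)) (drop k bs))"
    unfolding hpl.A_def app_times by (rule sum.cong)
      (auto simp: splits_def app_star[OF hpl.positive_hd, of _ _ "length as + length bs"] app_sum)
  then show ?thesis
    by (simp add: app_times split_def) (rule sum.swap)
qed

lemma \<pi>_e0: "\<pi> (q (app e0 [] v [])) = \<pi> (q v)"
  by (simp add: app_e0 MD(5,7) \<iota>_closed \<pi>_closed \<pi>_\<iota>)

text \<open>Homology is presented over the free space of \<open>M\<close>, as the image of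
  \<open>e0\<close>: a class goes to its representative under \<open>\<iota>\<close>. The operations
  of the definition then become e A e.\<close>

lemma realizes_E: "realizes E (j \<circ> \<iota>) (\<pi> \<circ> q) e0 hpl.\<mu>"
  unfolding realizes_def
proof (intro conjI allI ballI)
  show "f2_space E"
    by (rule f2_space_cong[OF f2_homology carrier_E mult_E one_E])
  fix v w
  show "(\<pi> \<circ> q) v \<in> carrier E" by (simp add: carrier_E \<pi>_closed MD(5))
  show "(\<pi> \<circ> q) (v + w) = (\<pi> \<circ> q) v \<otimes>\<^bsub>E\<^esub> (\<pi> \<circ> q) w"
    by (simp add: mult_E MD(5,6) hom_mult[OF \<pi>_hom])
  show "(j \<circ> \<iota>) ((\<pi> \<circ> q) v) = app e0 [] v []" by (simp add: app_e0)
  show "is_strict e0" by simp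
  show "e0 * hpl.\<mu> = hpl.\<mu>" "hpl.\<mu> * e0 = hpl.\<mu>" by (rule hpl.e_mu)+
  have "multi A b" by (rule multi_strict) simp
  then have "multi A d" unfolding d_def using MD(12) by (intro multi_add)
  then show "multi A hpl.\<mu>" by (rule hpl.multi_data) simp_all
  show "hpl.\<mu> * hpl.\<mu> + D hpl.\<mu> = 0" by (rule hpl.\<mu>_mc)
next
  fix x y assume "x \<in> carrier E" "y \<in> carrier E"
  then show "(j \<circ> \<iota>) (x \<otimes>\<^bsub>E\<^esub> y) = (j \<circ> \<iota>) x + (j \<circ> \<iota>) y"
    by (simp add: mult_E carrier_E hom_mult[OF \<iota>_hom] MD(4) \<iota>_closed)
next
  fix x assume "x \<in> carrier E"
  then show "(\<pi> \<circ> q) ((j \<circ> \<iota>) x) = x" by (simp add: carrier_E MD(7) \<iota>_closed \<pi>_\<iota>)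
next
  fix as bs C assume *: "as \<in> lists (carrier A)" "bs \<in> lists (carrier A)" "C \<in> carrier E"
  have "vsum M (\<lambda>n. perturbation M (pert_iterate M \<iota> h n) as C bs) {..length as + length bs} =
    q (\<Sum>n\<le>length as + length bs. app (d * (h0 * d) ^ n) as (j (\<iota> C)) bs)"
    by (rule realizes_vsum'[OF M]) (use * in \<open>simp_all add: pert_iterate_closed_eq carrier_E\<close>)
  also have "\<dots> = q (app hpl.A as (j (\<iota> C)) bs)" by (simp add: app_A)
  finally have "bop E as C bs = \<pi> (q (app hpl.A as (j (\<iota> C)) bs))"
    by (simp add: transferred_bimod_def)
  \<comment> \<open>Both copies of \<open>e0\<close> can be inserted: \<open>\<pi>\<close> does not
    notice one behind it, and representatives are fixed by the other.\<close>
  also have "\<dots> = \<pi> (q (app e0 [] (app hpl.A as (app e0 [] (j (\<iota> C)) []) bs) []))"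
    using * by (subst \<pi>_e0) (simp add: app_e0 MD(7) carrier_E \<iota>_closed \<pi>_\<iota>)
  also have "\<dots> = (\<pi> \<circ> q) (app hpl.\<mu> as ((j \<circ> \<iota>) C) bs)"
    by (simp add: hpl.\<mu>_def app_strict_times app_times_strict)
  finally show "bop E as C bs = (\<pi> \<circ> q) (app hpl.\<mu> as ((j \<circ> \<iota>) C) bs)" .
qed

end

section \<open>Minimal models and quasi-isomorphisms\<close>

text \<open>Existence of complements is available for vector spaces with a scalar action. Over
  \<open>bit\<close> this is the only possible action, and its linear maps are the additive
  ones.\<close>

definition bit_scale :: "bit \<Rightarrow> 'x vec \<Rightarrow> 'x vec" where
  "bit_scale c v = (if c = 0 then 0 else v)"

lemma vector_space_bit_scale: "vector_space bit_scale"
  by unfold_locales (auto simp: bit_scale_def)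

lemma linear_bit_scale_iff:
  fixes f :: "'a vec \<Rightarrow> 'b vec"
  shows
  "Vector_Spaces.linear bit_scale bit_scale f \<longleftrightarrow> (\<forall>v w. f (v + w) = f v + f w)"
proof
  assume "Vector_Spaces.linear bit_scale bit_scale f"
  then show "\<forall>v w. f (v + w) = f v + f w"
    by (simp add: linear_iff_module_hom module_hom.add)
next
  assume *: "\<forall>v w. f (v + w) = f v + f w"
  then have "f 0 = 0" by (metis add.right_neutral add_left_cancel)
  interpret v1: vector_space "bit_scale :: bit \<Rightarrow> 'a vec \<Rightarrow> _" by (rule vector_space_bit_scale)
  interpret v2: vector_space "bit_scale :: bit \<Rightarrow> 'b vec \<Rightarrow> _" by (rule vector_space_bit_scale)
  show "Vector_Spaces.linear bit_scale bit_scale f"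
    by unfold_locales (use * \<open>f 0 = 0\<close> in \<open>auto simp: bit_scale_def\<close>)
qed

lemma additive_right_inverse:
  fixes f :: "'x vec \<Rightarrow> 'y vec"
  assumes "\<And>v w. f (v + w) = f v + f w"
  obtains g where "\<And>v w. g (v + w) = g v + g w" "\<And>v. f (g (f v)) = f v"
proof -
  interpret vector_space_pair "bit_scale :: bit \<Rightarrow> 'x vec \<Rightarrow> _" "bit_scale :: bit \<Rightarrow> 'y vec \<Rightarrow> _"
    unfolding vector_space_pair_def by (simp add: vector_space_bit_scale)
  show ?thesis
    using linear_exists_right_inverse_on[of f UNIV] assms that
    by (auto simp: linear_bit_scale_iff)
qed

lemma additive_projection:
  fixes S :: "'x vec set"
  assumes "0 \<in> S" "\<And>v w. v \<in> S \<Longrightarrow> w \<in> S \<Longrightarrow> v + w \<in> S"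
  obtains r where "\<And>v w. r (v + w) = r v + r w" "\<And>v. r v \<in> S" "\<And>v. v \<in> S \<Longrightarrow> r v = v"
proof -
  interpret vector_space_pair "bit_scale :: bit \<Rightarrow> 'x vec \<Rightarrow> _" "bit_scale :: bit \<Rightarrow> 'x vec \<Rightarrow> _"
    unfolding vector_space_pair_def by (simp add: vector_space_bit_scale)
  have "vs1.subspace S"
    using assms by (auto simp: vs1.subspace_def bit_scale_def)
  from linear_exists_left_inverse_on[OF _ this, of id]
  obtain g where "range g \<subseteq> S" "\<forall>v w. g (v + w) = g v + g w" "\<forall>v\<in>S. g v = v"
    by (auto simp: linear_bit_scale_iff)
  then show ?thesis by (intro that[of g]) auto
qed

section \<open>The minimal model and the bimodule it comes from\<close>

context bimod_contraction begin

lemma m_eq_hpl: "hpl.m = m"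
  unfolding hpl.m_def by (rule m_eq[symmetric])

text \<open>With a single algebra input the series for \<open>A\<close> stops at \<open>d\<close>,
  since a second factor \<open>d\<close> would be left without input. The unit therefore acts on the
  transferred bimodule through e p e, which is \<open>e0\<close>.\<close>

lemma app_\<mu>_unit: "app hpl.\<mu> [u] v [] = app e0 [] v []" "app hpl.\<mu> [] v [u] = app e0 [] v []"
proof -
  have A0: "app hpl.A [] w [] = 0" for w
    by (simp add: hpl.A_def app_times app_d)
  have s: "splits [u] [] = {(0, 0), (1, 0)}" "splits [] [u] = {(0, 0), (0, 1)}"
    by (auto simp: splits_def atMost_Suc)
  have "app (d * (h0 * hpl.A)) [u] w [] = 0" "app (d * (h0 * hpl.A)) [] w [u] = 0" for w
    unfolding app_times[of d] by (simp_all add: s app_d app_strict_times A0)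
  then have "app hpl.A [u] w [] = app d [u] w []" "app hpl.A [] w [u] = app d [] w [u]" for w
    by (subst hpl.A_left, simp add: mult.assoc)+
  then have "app hpl.\<mu> [u] v [] = app (e0 * p * e0) [] v []" "app hpl.\<mu> [] v [u] = app (e0 * p * e0) [] v []"
    by (simp_all add: hpl.\<mu>_def app_strict_times app_times_strict app_d unit_left unit_right mult.assoc)
  then show "app hpl.\<mu> [u] v [] = app e0 [] v []" "app hpl.\<mu> [] v [u] = app e0 [] v []"
    by (simp_all add: hpl.corner_simps)
qed

lemma homologically_unital_E: "homologically_unital A E"
proof -
  have "bimod_model A E (j \<circ> \<iota>) (\<pi> \<circ> q) e0 hpl.\<mu> u"
    by unfold_locales (simp_all add: realizes_E unit app_\<mu>_unit)
  then show ?thesis by (rule bimod_model.homologically_unital_M)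
qed

lemma multi_d: "multi A d"
proof -
  have "multi A b" by (rule multi_strict) simp
  then show ?thesis unfolding d_def using MD(12) by (intro multi_add)
qed

text \<open>The target \<open>L\<close> may be any bimodule presented by the same ring elements as
  the source of the transfer. This compares a minimal model of the associated graded with
  \<open>M_Kh\<close> directly.\<close>

lemma D_inf_isomorphic_E:
  assumes L: "bimod_model A L j' q' p m u"
  shows "D_inf_isomorphic A E L"
proof -
  interpret L: bimod_model A L j' q' p m u by (rule L)
  note multi = hpl.multi_data[OF multi_d strict_b strict_e0 strict_h0]
  show ?thesis
  proof (rule D_inf_isomorphic_realizes[OF realizes_E L.M])
    show "p * hpl.I = hpl.I" "e0 * hpl.P = hpl.P" "p * hpl.H = hpl.H" by (rule hpl.eI_Pe)+
    show "multi A hpl.I" "multi A hpl.P" "multi A hpl.H" "multi A hpl.K" by (rule multi)+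
    show "m * hpl.I + hpl.I * hpl.\<mu> + D hpl.I = 0" using hpl.I_cycle by (simp only: m_eq_hpl)
    show "hpl.\<mu> * hpl.P + hpl.P * m + D hpl.P = 0" using hpl.P_cycle by (simp only: m_eq_hpl)
    show "hpl.P * hpl.I + e0 = hpl.\<mu> * hpl.K + hpl.K * hpl.\<mu> + D hpl.K" by (rule hpl.PI_homotopy)
    show "hpl.I * hpl.P + p = m * hpl.H + hpl.H * m + D hpl.H" using hpl.IP_homotopy by (simp only: m_eq_hpl)
    show "e0 * hpl.K = hpl.K" unfolding hpl.K_def by (simp add: hpl.W_corner flip: mult.assoc)
    show "homologically_unital A E" by (rule homologically_unital_E)
    show "homologically_unital A L" by (rule L.homologically_unital_M)
  qed
qed

end

section \<open>Existence of contractions and comparison of models\<close>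

context bimod_model begin

lemma D_inf_isomorphic_minimal_model:
  assumes "bimod_model A L j' q' p m u" "E \<in> minimal_models M"
  shows "D_inf_isomorphic A E L"
proof -
  from assms(2) obtain \<iota> \<pi> h where *: "E = transferred_bimod M \<iota> \<pi> h" "homology_contraction M \<iota> \<pi> h"
    by (auto simp: minimal_models_def)
  interpret bimod_contraction A M j q p m u \<iota> \<pi> h
    by unfold_locales (rule *(2))
  show ?thesis using D_inf_isomorphic_E[OF assms(1)] by (simp add: *(1))
qed

text \<open>Linear algebra on the free space: a linear section \<open>s\<close> of the differential
  and a linear projection \<open>r\<close> onto the boundaries determine the projection onto
  representatives and the homotopy by explicit formulas.\<close>

lemma homology_contraction_exists: "\<exists>\<iota> \<pi> h. homology_contraction M \<iota> \<pi> h"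
proof -
  let ?b = "\<lambda>v. app b [] v []" and ?p = "\<lambda>v. app p [] v []"
  have bpv: "?b (?p v) = ?b v" and pbv: "?p (?b v) = ?b v" and bbv: "?b (?b v) = 0" for v
    by (simp_all add: bp pb bb flip: app_times_Nil)
  \<comment> \<open>A right inverse of the differential on its image; composing with
    \<open>p\<close> will make it take values in the image of \<open>M\<close>.\<close>
  obtain s0 where s0: "\<And>v w. s0 (v + w) = s0 v + s0 w" "\<And>v. ?b (s0 (?b v)) = ?b v"
    using additive_right_inverse[of ?b] app_add by metis
  define s where "s v = ?p (s0 v)" for v
  have s: "s (v + w) = s v + s w" "?b (s (?b v)) = ?b v" "?p (s v) = s v" for v w
    by (simp_all add: s_def app_add bpv s0) (simp add: pp flip: app_times_Nil)
  have range_zero: "0 \<in> range ?b" by (rule range_eqI[of _ _ 0]) simp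
  have range_add: "v + w \<in> range ?b" if "v \<in> range ?b" "w \<in> range ?b" for v w
  proof -
    obtain v' w' where "v = ?b v'" "w = ?b w'" using \<open>v \<in> range ?b\<close> \<open>w \<in> range ?b\<close> by blast
    then show ?thesis by (intro range_eqI[of _ _ "v' + w'"]) (simp add: app_add)
  qed
  obtain r where r: "\<And>v w. r (v + w) = r v + r w" "\<And>v. r v \<in> range ?b" "\<And>v. v \<in> range ?b \<Longrightarrow> r v = v"
    by (rule additive_projection[OF range_zero range_add]; (assumption | (rule that; assumption)))
  \<comment> \<open>\<open>z\<close> projects onto the cycles, \<open>e\<close> onto a complement of
    the boundaries among them, and \<open>\<eta>\<close> lifts the boundary part of
    \<open>z\<close>.\<close>
  define z where "z v = ?p v + s (?b v)" for v
  define e where "e v = z v + r (z v)" for v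
  define \<eta> where "\<eta> v = s (r (z v))" for v
  have add: "z (v + w) = z v + z w" "e (v + w) = e v + e w" "\<eta> (v + w) = \<eta> v + \<eta> w" for v w
    by (simp_all add: z_def e_def \<eta>_def app_add s r add_ac)
  have rb: "r (?b v) = ?b v" for v by (rule r(3)) simp
  have br: "?b (r v) = 0" and pr: "?p (r v) = r v" and bsr: "?b (s (r v)) = r v" for v
    using r(2)[of v] by (auto simp: bbv pbv s(2))
  have pe: "?p (e v) = e v" and p\<eta>: "?p (\<eta> v) = \<eta> v" for v
    by (simp_all add: e_def z_def \<eta>_def app_add s(3) pr) (simp add: pp flip: app_times_Nil)
  have s00: "s 0 = 0" using s(1)[of 0 0] by simp
  have r00: "r 0 = 0" using r(1)[of 0 0] by simp
  have bz: "?b (z v) = 0" and zb: "z (?b v) = ?b v" for v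
    by (simp_all add: z_def app_add bpv s(2) pbv bbv s00)
  have be: "?b (e v) = 0" and eb: "e (?b v) = 0" for v
    by (simp_all add: e_def app_add bz br zb rb)
  have homot: "e v + ?p v = ?b (\<eta> v) + \<eta> (?b v)" for v
    by (simp add: e_def \<eta>_def bsr zb rb) (simp add: z_def add_ac)
  have e_cycle: "e v = v + r v" if "?p v = v" "?b v = 0" for v
    using that by (simp add: e_def z_def s00)
  \<comment> \<open>A class is a set, so a member has to be chosen; by \<open>jcls\<close> the
    result does not depend on it, because \<open>e\<close> kills boundaries.\<close>
  define \<iota> where "\<iota> C = q (e (j (SOME x. x \<in> C)))" for C
  define \<pi> where "\<pi> x = cls (q (e (j x)))" for x
  define h where "h x = q (\<eta> (j x))" for x
  have pj: "?p (j x) = j x" if "x \<in> carrier M" for x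
    by (rule realizes_e_app[OF M that])
  have cyc: "q (e v) \<in> cycles M" for v
    by (simp add: mem_cycles MD(5,9) pe be)
  have jcls: "e (j x) = e (j y)" if xy: "x \<in> cls y" "y \<in> carrier M" for x y
  proof -
    obtain w where w: "w \<in> carrier M" "x = bdiff M w \<otimes>\<^bsub>M\<^esub> y"
      using xy by (auto simp: cls_def r_coset_def boundaries_def)
    then show ?thesis
      using xy by (simp add: MD(4) realizes_bdiff(3)[OF M] j_bdiff add eb)
  qed
  have \<iota>_cls: "\<iota> (cls z) = q (e (j z))" if "z \<in> cycles M" for z
  proof -
    have z: "z \<in> carrier M" using that by (simp add: mem_cycles)
    have "e (j (SOME x. x \<in> cls z)) = e (j z)"
      by (rule jcls[OF someI[of "\<lambda>x. x \<in> cls z", OF cls_self[OF z]] z])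
    then show ?thesis by (simp add: \<iota>_def)
  qed
  have cls_e: "cls (q (e (j z))) = cls z" if "z \<in> cycles M" for z
  proof (rule cls_eq)
    show z: "z \<in> carrier M" using that by (simp add: mem_cycles)
    obtain w where w: "r (j z) = ?b w" using r(2)[of "j z"] by auto
    have "e (j z) = ?b (j (q w)) + j z"
      using that by (simp add: mem_cycles e_cycle pj w MD(9) bpv add.commute)
    then have "q (e (j z)) = bdiff M (q w) \<otimes>\<^bsub>M\<^esub> z"
      using z by (simp add: MD(5,6,7) realizes_bdiff(3)[OF M] flip: j_bdiff)
    then show "q (e (j z)) \<in> cls z"
      using MD(5) by (auto simp: cls_def r_coset_def boundaries_def)
  qed
  have cyc_mult: "x \<otimes>\<^bsub>M\<^esub> y \<in> cycles M" if "x \<in> cycles M" "y \<in> cycles M" for x y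
    by (rule subgroup.m_closed[OF subgroup_cycles that])
  have cyc_carrier: "x \<in> carrier M" if "x \<in> cycles M" for x
    using that by (simp add: mem_cycles)
  have "homology_contraction M \<iota> \<pi> h"
    unfolding homology_contraction_def
  proof (intro conjI ballI)
    show "\<iota> \<in> hom (homology M) M"
    proof (rule homI)
      fix C C' assume "C \<in> carrier (homology M)" "C' \<in> carrier (homology M)"
      then obtain z z' where zz: "z \<in> cycles M" "z' \<in> cycles M" "C = cls z" "C' = cls z'"
        by (auto simp: carrier_homology)
      show "\<iota> C \<in> carrier M" by (simp add: \<iota>_def MD(5))
      show "\<iota> (C \<otimes>\<^bsub>homology M\<^esub> C') = \<iota> C \<otimes>\<^bsub>M\<^esub> \<iota> C'"
        using zz cyc_carrier[OF zz(1)] cyc_carrier[OF zz(2)]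
        by (simp add: mult_homology \<iota>_cls cyc_mult MD(4,6) add flip: cls_mult)
    qed
    show "\<pi> \<in> hom M (homology M)"
    proof (rule homI)
      fix x y assume xy: "x \<in> carrier M" "y \<in> carrier M"
      show "\<pi> x \<in> carrier (homology M)" by (simp add: \<pi>_def carrier_homology cyc)
      show "\<pi> (x \<otimes>\<^bsub>M\<^esub> y) = \<pi> x \<otimes>\<^bsub>homology M\<^esub> \<pi> y"
        using xy by (simp add: \<pi>_def MD(4,6) add mult_homology cls_mult MD(5))
    qed
    show "h \<in> hom M M"
      by (rule homI) (simp_all add: h_def MD(4,5,6) add)
    fix C assume "C \<in> carrier (homology M)"
    then obtain z where zz: "z \<in> cycles M" "C = cls z" by (auto simp: carrier_homology)
    have "\<iota> C = q (e (j z))" by (simp add: zz \<iota>_cls)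
    then show "\<iota> C \<in> C"
      using cls_e[OF zz(1)] cls_self[of "q (e (j z))"] by (simp add: zz MD(5))
    show "\<pi> (\<iota> C) = C"
      using cls_e[OF cyc, of "j z"] cls_e[OF zz(1)] by (simp add: zz \<iota>_cls \<pi>_def)
  next
    fix x assume x: "x \<in> carrier M"
    show "\<pi> (bdiff M x) = \<one>\<^bsub>homology M\<^esub>"
      using subgroup.subset[OF subgroup_boundaries]
      by (simp add: \<pi>_def j_bdiff x eb realizes_zero[OF M] cls_def one_homology)
    have "\<iota> (\<pi> x) = q (e (j (q (e (j x)))))"
      by (simp add: \<pi>_def \<iota>_cls cyc)
    also have "j (q (e (j x))) = e (j x)" by (simp add: MD(9) pe)
    also have "e (e (j x)) = e (j x) + r (e (j x))" by (rule e_cycle[OF pe be])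
    also have "r (e (j x)) = 0"
    proof -
      have "r (r v) = r v" for v by (rule r(3)[OF r(2)])
      then show ?thesis by (simp add: e_def r(1))
    qed
    finally have \<iota>\<pi>: "\<iota> (\<pi> x) = q (e (j x))" by simp
    have "j (\<iota> (\<pi> x) \<otimes>\<^bsub>M\<^esub> x) = ?b (\<eta> (j x)) + \<eta> (?b (j x))"
      using homot[of "j x"] x by (simp add: \<iota>\<pi> MD(4,5,9) pe pj)
    also have "\<dots> = j (bdiff M (h x) \<otimes>\<^bsub>M\<^esub> h (bdiff M x))"
      using x by (simp add: MD(4,5,9) h_def realizes_bdiff(3)[OF M] j_bdiff p\<eta>)
    finally show "\<iota> (\<pi> x) \<otimes>\<^bsub>M\<^esub> x = bdiff M (h x) \<otimes>\<^bsub>M\<^esub> h (bdiff M x)"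
      by (subst realizes_eq_iff[OF M]) (use x in \<open>simp_all add: \<iota>_def h_def MD(5) realizes_bdiff(3)[OF M]\<close>)
  qed
  then show ?thesis by blast
qed

lemma minimal_models_nonempty: "\<exists>E. E \<in> minimal_models M"
  using homology_contraction_exists unfolding minimal_models_def by blast

text \<open>Two models of the same ring elements are strictly isomorphic: \<open>p\<close>, read as
  a map from \<open>M\<close> to \<open>L\<close>, is a morphism without higher terms since p
  commutes with m, and \<open>\<psi>\<close> inverts it.\<close>

lemma quasi_isomorphic_model:
  assumes "bimod_model A L j' q' p m u"
  shows "quasi_isomorphic A M L"
proof -
  interpret L: bimod_model A L j' q' p m u by (rule assms)
  define \<phi> where "\<phi> x = q' (j x)" for x
  define \<psi> where "\<psi> y = q (j' y)" for y
  have mor: "ainf_morphism A M L (premor j q' p)"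
    by (rule ainf_morphism_premor[OF M L.M])
      (simp_all add: pp multi_strict alg_deriv_strict MD(10,11))
  have f: "premor j q' p [] x [] = \<phi> x" if "x \<in> carrier M" for x
    using realizes_e_app[OF M that] by (simp add: premor_def \<phi>_def)
  have \<phi>: "\<phi> x \<in> carrier L" "\<phi> (x \<otimes>\<^bsub>M\<^esub> y) = \<phi> x \<otimes>\<^bsub>L\<^esub> \<phi> y" "\<psi> (\<phi> x) = x" "\<phi> (bdiff M x) = bdiff L (\<phi> x)"
    if "x \<in> carrier M" "y \<in> carrier M" for x y
    using that realizes_e_app[OF M] realizes_bdiff(1)[OF L.M L.MD(5)]
    by (simp_all add: \<phi>_def \<psi>_def MD(4,7) L.MD(5,6,9) realizes_bdiff(2)[OF M])
  have \<psi>: "\<psi> x \<in> carrier M" "\<phi> (\<psi> x) = x" "\<psi> (bdiff L x) = bdiff M (\<psi> x)"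
    if "x \<in> carrier L" for x
    using that realizes_e_app[OF L.M] realizes_bdiff(1)[OF M MD(5)]
    by (simp_all add: \<phi>_def \<psi>_def MD(5,9) L.MD(7) realizes_bdiff(2)[OF L.M])
  have \<phi>_cyc: "\<phi> x \<in> cycles L" if "x \<in> cycles M" for x
    using that \<phi>[of x x] \<phi>[of "\<one>\<^bsub>M\<^esub>" "\<one>\<^bsub>M\<^esub>"] realizes_zero[OF M] realizes_zero[OF L.M]
    by (auto simp: cycles_def kernel_def \<phi>_def)
  have \<psi>_cyc: "\<psi> x \<in> cycles M" if "x \<in> cycles L" for x
    using that \<psi>[of x] realizes_zero[OF M] realizes_zero[OF L.M]
    by (auto simp: cycles_def kernel_def \<psi>_def)
  have bd: "\<phi> ` boundaries M = boundaries L"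
  proof (intro equalityI subsetI)
    fix y assume "y \<in> \<phi> ` boundaries M"
    then show "y \<in> boundaries L" using \<phi> by (auto simp: boundaries_def)
  next
    fix y assume "y \<in> boundaries L"
    then obtain x where x: "x \<in> carrier L" "y = bdiff L x" by (auto simp: boundaries_def)
    then have "y = \<phi> (bdiff M (\<psi> x))" using \<phi>[OF \<psi>(1) \<psi>(1)] \<psi> by simp
    then show "y \<in> \<phi> ` boundaries M" using \<psi>(1) x(1) by (auto simp: boundaries_def)
  qed
  let ?H = "homology_map L (\<lambda>x. premor j q' p [] x [])"
  have H: "?H (cls z) = L.cls (\<phi> z)" if "z \<in> cycles M" for z
  proof -
    have z: "z \<in> carrier M" using that by (simp add: mem_cycles)
    have sub: "boundaries M \<subseteq> carrier M" by (rule subgroup.subset[OF subgroup_boundaries])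
    have "(\<lambda>x. premor j q' p [] x []) ` cls z = (\<lambda>x. \<phi> x \<otimes>\<^bsub>L\<^esub> \<phi> z) ` boundaries M"
      using z sub by (auto simp: cls_def r_coset_def f image_iff \<phi>(2) subset_iff)
    also have "\<dots> = L.cls (\<phi> z)"
      by (auto simp: L.cls_def r_coset_def simp flip: bd)
    finally have 1: "(\<lambda>x. premor j q' p [] x []) ` cls z = L.cls (\<phi> z)" .
    have "boundaries L = L.cls \<one>\<^bsub>L\<^esub>"
      using subgroup.subset[OF L.subgroup_boundaries] by (simp add: L.cls_def)
    then show ?thesis
      using \<phi>(1)[OF z z] by (simp add: homology_map_def 1 flip: L.cls_mult)
  qed
  have "?H \<in> iso (homology M) (homology L)"
    unfolding iso_def
  proof (intro CollectI conjI)
    show "?H \<in> hom (homology M) (homology L)"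
    proof (rule homI)
      fix C C' assume "C \<in> carrier (homology M)" "C' \<in> carrier (homology M)"
      then obtain z z' where zz: "z \<in> cycles M" "z' \<in> cycles M" "C = cls z" "C' = cls z'"
        by (auto simp: carrier_homology)
      then have car: "z \<in> carrier M" "z' \<in> carrier M" by (auto simp: mem_cycles)
      show "?H C \<in> carrier (homology L)" by (simp add: zz H L.carrier_homology \<phi>_cyc)
      have "z \<otimes>\<^bsub>M\<^esub> z' \<in> cycles M" by (rule subgroup.m_closed[OF subgroup_cycles zz(1,2)])
      then show "?H (C \<otimes>\<^bsub>homology M\<^esub> C') = ?H C \<otimes>\<^bsub>homology L\<^esub> ?H C'"
        using car zz(1,2) \<phi>[OF car] \<phi>[OF car(2) car(2)]
        by (simp add: zz mult_homology L.mult_homology H flip: cls_mult L.cls_mult)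
    qed
    show "bij_betw ?H (carrier (homology M)) (carrier (homology L))"
    \<comment> \<open>The inverse takes a class to the class of the image of any of its members
      under \<open>\<psi>\<close>.\<close>
    proof (rule bij_betw_byWitness[where f' = "\<lambda>C. cls (\<psi> (SOME y. y \<in> C))"])
      have pick: "cls (\<psi> (SOME y. y \<in> L.cls x)) = cls (\<psi> x)" if "x \<in> cycles L" for x
      proof (rule cls_eq)
        have x: "x \<in> carrier L" using that by (simp add: L.mem_cycles)
        have "(SOME y. y \<in> L.cls x) \<in> L.cls x" by (rule someI[of "\<lambda>y. y \<in> L.cls x"], rule L.cls_self[OF x])
        then obtain w where w: "w \<in> boundaries M" "(SOME y. y \<in> L.cls x) = \<phi> w \<otimes>\<^bsub>L\<^esub> x"
          by (auto simp: L.cls_def r_coset_def simp flip: bd)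
        then have wc: "w \<in> carrier M" using subgroup.subset[OF subgroup_boundaries] by auto
        have "\<phi> w \<otimes>\<^bsub>L\<^esub> x = \<phi> (w \<otimes>\<^bsub>M\<^esub> \<psi> x)" using \<phi>(2)[OF wc \<psi>(1)[OF x]] \<psi>(2)[OF x] by simp
        then have "\<psi> (SOME y. y \<in> L.cls x) = w \<otimes>\<^bsub>M\<^esub> \<psi> x"
          using w wc \<psi>(1)[OF x] \<phi>(3)[of "w \<otimes>\<^bsub>M\<^esub> \<psi> x" "w \<otimes>\<^bsub>M\<^esub> \<psi> x"] by simp
        then show "\<psi> (SOME y. y \<in> L.cls x) \<in> cls (\<psi> x)"
          using w(1) by (auto simp: cls_def r_coset_def)
        show "\<psi> x \<in> carrier M" by (rule \<psi>(1)[OF x])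
      qed
      show "\<forall>C\<in>carrier (homology M). cls (\<psi> (SOME y. y \<in> ?H C)) = C"
        using \<phi>(3) by (auto simp: carrier_homology H pick \<phi>_cyc mem_cycles)
      show "\<forall>C\<in>carrier (homology L). ?H (cls (\<psi> (SOME y. y \<in> C))) = C"
        using \<psi>(2) by (auto simp: L.carrier_homology H pick \<psi>_cyc L.mem_cycles)
      show "?H ` carrier (homology M) \<subseteq> carrier (homology L)"
        by (auto simp: carrier_homology H L.carrier_homology \<phi>_cyc)
      show "(\<lambda>C. cls (\<psi> (SOME y. y \<in> C))) ` carrier (homology L) \<subseteq> carrier (homology M)"
        by (auto simp: carrier_homology pick L.carrier_homology \<psi>_cyc)
    qed
  qed
  then have "quasi_isomorphism A M L (premor j q' p)"
    using mor by (simp add: quasi_isomorphism_def)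
  then show ?thesis
    unfolding quasi_isomorphic_def using ainf_bimodule_realizes[OF M] ainf_bimodule_realizes[OF L.M] by blast
qed

end

section \<open>Differential bimodules over an algebra with basis\<close>

lemma sum_set_Cons:
  "(\<Sum>xs\<in>set_Cons S T. f xs) = (\<Sum>x\<in>S. \<Sum>xs\<in>T. f (x # xs))"
proof -
  have "set_Cons S T = (\<lambda>(x, xs). x # xs) ` (S \<times> T)"
    by (auto simp: set_Cons_def)
  moreover have "inj_on (\<lambda>(x, xs). x # xs) (S \<times> T)"
    by (auto simp: inj_on_def)
  ultimately have "(\<Sum>xs\<in>set_Cons S T. f xs) = (\<Sum>(x, xs)\<in>S \<times> T. f (x # xs))"
    by (simp add: sum.reindex split_def)
  then show ?thesis by (simp add: sum.cartesian_product)
qed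

lemma listset_length: "xs \<in> listset Ss \<Longrightarrow> length xs = length Ss"
  by (induction Ss arbitrary: xs) (auto simp: set_Cons_def)

definition amul :: "'g based_alg \<Rightarrow> 'g vec \<Rightarrow> 'g vec \<Rightarrow> 'g vec" where
  "amul B v w = lin (\<lambda>a. lin (\<lambda>b. acoef B [a, b]) w) v"

lemma amul_add_left: "amul B (v + v') w = amul B v w + amul B v' w"
  by (simp add: amul_def lin_add)

lemma amul_add_right: "amul B v (w + w') = amul B v w + amul B v w'"
  by (simp add: amul_def lin_add lin_fun_add)

lemma amul_zero [simp]: "amul B 0 w = 0" "amul B v 0 = 0"
  by (simp_all add: amul_def)

definition Dop :: "('g, 'x) based_bimod \<Rightarrow> 'x vec \<Rightarrow> 'x vec" where
  "Dop K v = lin (\<lambda>x. coef K [] x []) v"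

definition Lop :: "('g, 'x) based_bimod \<Rightarrow> 'g vec \<Rightarrow> 'x vec \<Rightarrow> 'x vec" where
  "Lop K a v = lin (\<lambda>g. lin (\<lambda>x. coef K [g] x []) v) a"

definition Rop :: "('g, 'x) based_bimod \<Rightarrow> 'x vec \<Rightarrow> 'g vec \<Rightarrow> 'x vec" where
  "Rop K v a = lin (\<lambda>x. lin (\<lambda>g. coef K [] x [g]) a) v"

lemma Dop_add: "Dop K (v + w) = Dop K v + Dop K w"
  by (simp add: Dop_def lin_add)

lemma Lop_add: "Lop K (a + b) v = Lop K a v + Lop K b v" "Lop K a (v + w) = Lop K a v + Lop K a w"
  by (simp_all add: Lop_def lin_add lin_fun_add)

lemma Rop_add: "Rop K v (a + b) = Rop K v a + Rop K v b" "Rop K (v + w) a = Rop K v a + Rop K w a"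
  by (simp_all add: Rop_def lin_add lin_fun_add)

lemma op_zero [simp]: "Dop K 0 = 0" "Lop K 0 v = 0" "Lop K a 0 = 0" "Rop K 0 a = 0" "Rop K v 0 = 0"
  by (simp_all add: Dop_def Lop_def Rop_def)

lemma op_bas: "Dop K (bas x) = coef K [] x []" "Lop K (bas a) (bas x) = coef K [a] x []"
  "Rop K (bas x) (bas a) = coef K [] x [a]" "amul B (bas a) (bas b) = acoef B [a, b]"
  by (simp_all add: Dop_def Lop_def Rop_def amul_def)

text \<open>An associative algebra given by structure constants. The unit \<open>u\<close> is a
  vector and not a generator, because in the algebras below it is the sum of all
  idempotents.\<close>

locale based_algebra =
  fixes B :: "'g based_alg" and u :: "'g vec"
  assumes binary: "length gs \<noteq> 2 \<Longrightarrow> acoef B gs = 0"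
    and acoef_closed: "a \<in> agens B \<Longrightarrow> b \<in> agens B \<Longrightarrow> acoef B [a, b] \<in> span_of (agens B)"
    and assoc: "a \<in> agens B \<Longrightarrow> b \<in> agens B \<Longrightarrow> c \<in> agens B \<Longrightarrow>
      amul B (acoef B [a, b]) (bas c) = amul B (bas a) (acoef B [b, c])"
    and u_in: "u \<in> span_of (agens B)"
    and u_left: "a \<in> agens B \<Longrightarrow> amul B u (bas a) = bas a"
    and u_right: "a \<in> agens B \<Longrightarrow> amul B (bas a) u = bas a"
begin

abbreviation "Sp \<equiv> span_of (agens B)"

lemma carrier_lin_alg: "carrier (lin_alg B) = Sp" and mult_lin_alg: "monoid.mult (lin_alg B) = (+)"
  and one_lin_alg: "\<one>\<^bsub>lin_alg B\<^esub> = 0"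
  by (simp_all add: lin_alg_def span_of_def)

lemma amul_closed: "v \<in> Sp \<Longrightarrow> w \<in> Sp \<Longrightarrow> amul B v w \<in> Sp"
  unfolding amul_def by (intro lin_in_span[where S = "agens B"] acoef_closed)

lemma amul_assoc: "v \<in> Sp \<Longrightarrow> w \<in> Sp \<Longrightarrow> z \<in> Sp \<Longrightarrow> amul B (amul B v w) z = amul B v (amul B w z)"
proof (induction v rule: span_of_induct)
  case (bas_add a v)
  have "amul B (amul B (bas a) w) z = amul B (bas a) (amul B w z)"
    using \<open>w \<in> Sp\<close>
  proof (induction w rule: span_of_induct)
    case (bas_add b w)
    have "amul B (amul B (bas a) (bas b)) z = amul B (bas a) (amul B (bas b) z)"
      using \<open>z \<in> Sp\<close>
      by (induction z rule: span_of_induct)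
        (use \<open>a \<in> agens B\<close> \<open>b \<in> agens B\<close> in \<open>simp_all add: amul_add_left amul_add_right op_bas assoc\<close>)
    then show ?case using bas_add by (simp add: amul_add_left amul_add_right)
  qed simp
  then show ?case using bas_add by (simp add: amul_add_left amul_add_right)
qed simp

lemma u_left': "v \<in> Sp \<Longrightarrow> amul B u v = v"
  by (induction v rule: span_of_induct) (simp_all add: amul_add_right u_left)

lemma u_right': "v \<in> Sp \<Longrightarrow> amul B v u = v"
  by (induction v rule: span_of_induct) (simp_all add: amul_add_left u_right)

lemma aop_lin_alg2: "aop (lin_alg B) [v, w] = amul B v w"
  by (simp add: lin_alg_def sum_set_Cons amul_def lin_def sum.reindex inj_on_def)

lemma aop_lin_alg_other: "length vs \<noteq> 2 \<Longrightarrow> aop (lin_alg B) vs = 0"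
  by (auto simp: lin_alg_def dest!: listset_length intro!: sum.neutral binary)

lemma aop_lin_alg_closed: "vs \<in> lists Sp \<Longrightarrow> aop (lin_alg B) vs \<in> Sp"
proof (cases "length vs = 2")
  case True
  assume "vs \<in> lists Sp"
  moreover from True obtain v w where "vs = [v, w]"
    by (auto simp: length_Suc_conv eval_nat_numeral)
  ultimately show ?thesis by (simp add: aop_lin_alg2 amul_closed)
qed (simp add: aop_lin_alg_other)

lemma aop_lin_alg_zero: "0 \<in> set vs \<Longrightarrow> aop (lin_alg B) vs = 0"
proof (cases "length vs = 2")
  case True
  assume "0 \<in> set vs"
  moreover from True obtain v w where "vs = [v, w]"
    by (auto simp: length_Suc_conv eval_nat_numeral)
  ultimately show ?thesis by (auto simp: aop_lin_alg2)
qed (simp add: aop_lin_alg_other)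

end

lemma comm_group_vec:
  fixes V :: "('x vec, 'e) monoid_scheme"
  assumes "carrier V = span_of S" "monoid.mult V = (+)" "\<one>\<^bsub>V\<^esub> = 0"
  shows "comm_group V"
  by (rule comm_groupI) (auto simp: assms add_ac intro!: bexI)

lemma f2_space_vec:
  fixes V :: "('x vec, 'e) monoid_scheme"
  assumes "carrier V = span_of S" "monoid.mult V = (+)" "\<one>\<^bsub>V\<^esub> = 0"
  shows "f2_space V"
  using comm_group_vec[OF assms] by (simp add: f2_space_def assms)

lemma vsum_vec:
  fixes V :: "('x vec, 'e) monoid_scheme"
  assumes V: "carrier V = span_of S" "monoid.mult V = (+)" "\<one>\<^bsub>V\<^esub> = 0"
    and f: "\<And>i. i \<in> I \<Longrightarrow> f i \<in> span_of S"
  shows "vsum V f I = (\<Sum>i\<in>I. f i)"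
proof (cases "finite I")
  case True
  interpret comm_group V by (rule comm_group_vec[OF V])
  show ?thesis using True f
    by (induction I rule: finite_induct) (auto simp: V Pi_def)
next
  case False
  interpret comm_group V by (rule comm_group_vec[OF V])
  show ?thesis using False by (simp add: V)
qed

context based_algebra begin

lemmas lin_alg_simps = carrier_lin_alg mult_lin_alg one_lin_alg

text \<open>Only products of two entries are nonzero, so contracting a segment of any other length
  inserts a zero. What remains is the relation for three inputs, which is associativity.\<close>

lemma ainf_algebra_lin_alg: "ainf_algebra (lin_alg B)"
  unfolding ainf_algebra_def
proof (intro conjI ballI impI)
  show "f2_space (lin_alg B)" by (rule f2_space_vec[OF lin_alg_simps])
next
  fix as bs assume "as \<in> lists (carrier (lin_alg B))" "bs \<in> lists (carrier (lin_alg B))"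
  then have *: "as \<in> lists Sp" "bs \<in> lists Sp" by (simp_all add: carrier_lin_alg)
  have "aop (lin_alg B) (as @ (v + w) # bs) = aop (lin_alg B) (as @ v # bs) + aop (lin_alg B) (as @ w # bs)" for v w
  proof (cases "length as + length bs = 1")
    case True
    then consider a where "as = [a]" "bs = []" | b where "as = []" "bs = [b]"
      by (cases as; cases bs) auto
    then show ?thesis by cases (simp_all add: aop_lin_alg2 amul_add_left amul_add_right)
  qed (simp add: aop_lin_alg_other)
  then show "(\<lambda>a. aop (lin_alg B) (as @ a # bs)) \<in> hom (lin_alg B) (lin_alg B)"
    using * by (intro homI) (simp_all add: lin_alg_simps aop_lin_alg_closed)
next
  fix as assume "as \<in> lists (carrier (lin_alg B))" "as \<noteq> []"
  then have as: "as \<in> lists Sp" by (simp add: carrier_lin_alg)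
  have closed: "contract (lin_alg B) as i k \<in> lists Sp" for i k
    using aop_lin_alg_closed[OF lists_drop[OF lists_take[OF as, of k], of i]]
      lists_take[OF as, of i] lists_drop[OF as, of k]
    by (simp add: contract_def)
  have "vsum (lin_alg B) (\<lambda>(i, j). aop (lin_alg B) (contract (lin_alg B) as i j)) (segments as) =
    (\<Sum>(i, j)\<in>segments as. aop (lin_alg B) (contract (lin_alg B) as i j))"
    by (rule vsum_vec[OF lin_alg_simps], clarify, rule aop_lin_alg_closed, rule closed)
  also have "\<dots> = 0"
  proof (cases "length as = 3")
    case False
    show ?thesis
    proof (rule sum.neutral, clarify)
      fix i k assume ik: "(i, k) \<in> segments as"
      show "aop (lin_alg B) (contract (lin_alg B) as i k) = 0"
      proof (cases "k = i + 2")
        case True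
        then have "length (contract (lin_alg B) as i k) \<noteq> 2"
          using ik False by (auto simp: contract_def segments_def)
        then show ?thesis by (rule aop_lin_alg_other)
      next
        case False
        then have "length (drop i (take k as)) \<noteq> 2" using ik by (auto simp: segments_def)
        then show ?thesis
          by (intro aop_lin_alg_zero) (simp add: contract_def aop_lin_alg_other)
      qed
    qed
  next
    case True
    then obtain a b c where abc: "as = [a, b, c]"
      by (auto simp: length_Suc_conv eval_nat_numeral)
    have "segments as = {(0,1), (0,2), (0,3), (1,2), (1,3), (2,3)}"
      by (auto simp: segments_def abc)
    then show ?thesis
      using as by (simp add: abc contract_def aop_lin_alg2 aop_lin_alg_other numeral_2_eq_2 numeral_3_eq_3 amul_assoc)
  qed
  finally show "vsum (lin_alg B) (\<lambda>(i, j). aop (lin_alg B) (contract (lin_alg B) as i j)) (segments as) = \<one>\<^bsub>lin_alg B\<^esub>"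
    by (simp add: one_lin_alg)
qed

text \<open>The differential of the algebra is zero, so being a unit up to boundaries is being a
  unit.\<close>

lemma homology_unit_u: "homology_unit (lin_alg B) u"
proof -
  have "0 \<in> (\<lambda>b. aop (lin_alg B) [b]) ` Sp"
    by (rule image_eqI[of _ _ 0]) (simp_all add: aop_lin_alg_other)
  then show ?thesis
    unfolding homology_unit_def
    by (auto simp: lin_alg_simps aop_lin_alg2 aop_lin_alg_other u_in u_left' u_right')
qed

sublocale lin: alg_base "lin_alg B"
  by unfold_locales (rule ainf_algebra_lin_alg)

end

section \<open>Bimodules whose operations take at most one algebra input\<close>

definition short :: "('g, 'x) based_bimod \<Rightarrow> bool" where
  "short K \<longleftrightarrow> (\<forall>as x bs. length as + length bs > 1 \<longrightarrow> coef K as x bs = 0)"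

text \<open>For such bimodules over an associative algebra the A-infinity relations are the six with
  at most two algebra inputs: \<open>DD\<close>, \<open>DL\<close>, \<open>DR\<close>,
  \<open>LL\<close>, \<open>RR\<close> and \<open>LR\<close>. They are stated on generators, where
  they can be checked by cases.\<close>

locale dg_bimod = based_algebra B u for B :: "'g based_alg" and u +
  fixes K :: "('g, 'x) based_bimod"
  assumes short: "short K"
    and D_closed: "x \<in> gens K \<Longrightarrow> coef K [] x [] \<in> span_of (gens K)"
    and L_closed: "a \<in> agens B \<Longrightarrow> x \<in> gens K \<Longrightarrow> coef K [a] x [] \<in> span_of (gens K)"
    and R_closed: "a \<in> agens B \<Longrightarrow> x \<in> gens K \<Longrightarrow> coef K [] x [a] \<in> span_of (gens K)"
    and DD: "x \<in> gens K \<Longrightarrow> Dop K (coef K [] x []) = 0"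
    and DL: "a \<in> agens B \<Longrightarrow> x \<in> gens K \<Longrightarrow> Dop K (coef K [a] x []) = Lop K (bas a) (coef K [] x [])"
    and DR: "a \<in> agens B \<Longrightarrow> x \<in> gens K \<Longrightarrow> Dop K (coef K [] x [a]) = Rop K (coef K [] x []) (bas a)"
    and LL: "a \<in> agens B \<Longrightarrow> b \<in> agens B \<Longrightarrow> x \<in> gens K \<Longrightarrow>
      Lop K (acoef B [a, b]) (bas x) = Lop K (bas a) (coef K [b] x [])"
    and RR: "a \<in> agens B \<Longrightarrow> b \<in> agens B \<Longrightarrow> x \<in> gens K \<Longrightarrow>
      Rop K (bas x) (acoef B [a, b]) = Rop K (coef K [] x [a]) (bas b)"
    and LR: "a \<in> agens B \<Longrightarrow> b \<in> agens B \<Longrightarrow> x \<in> gens K \<Longrightarrow>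
      Lop K (bas a) (coef K [] x [b]) = Rop K (coef K [a] x []) (bas b)"
    and uL: "x \<in> gens K \<Longrightarrow> Lop K u (bas x) = bas x"
    and uR: "x \<in> gens K \<Longrightarrow> Rop K (bas x) u = bas x"
begin

abbreviation "Sm \<equiv> span_of (gens K)"

lemma carrier_lin_bimod: "carrier (lin_bimod K) = Sm" and mult_lin_bimod: "monoid.mult (lin_bimod K) = (+)"
  and one_lin_bimod: "\<one>\<^bsub>lin_bimod K\<^esub> = 0"
  by (simp_all add: lin_bimod_def span_of_def)

lemma Dop_closed: "v \<in> Sm \<Longrightarrow> Dop K v \<in> Sm"
  unfolding Dop_def by (rule lin_in_span) (auto intro: D_closed)

lemma Lop_closed: "a \<in> Sp \<Longrightarrow> v \<in> Sm \<Longrightarrow> Lop K a v \<in> Sm"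
  unfolding Lop_def by (intro lin_in_span[where S = "agens B"] lin_in_span[where S = "gens K"] L_closed)

lemma Rop_closed: "a \<in> Sp \<Longrightarrow> v \<in> Sm \<Longrightarrow> Rop K v a \<in> Sm"
  unfolding Rop_def by (intro lin_in_span[where S = "agens B"] lin_in_span[where S = "gens K"] R_closed)

lemma DD': "v \<in> Sm \<Longrightarrow> Dop K (Dop K v) = 0"
  by (induction v rule: span_of_induct) (simp_all add: Dop_add op_bas DD)

lemma DL': "a \<in> Sp \<Longrightarrow> v \<in> Sm \<Longrightarrow> Dop K (Lop K a v) = Lop K a (Dop K v)"
proof (induction a rule: span_of_induct)
  case (bas_add a w)
  from \<open>v \<in> Sm\<close> have "Dop K (Lop K (bas a) v) = Lop K (bas a) (Dop K v)"
    by (induction v rule: span_of_induct) (simp_all add: Dop_add Lop_add op_bas DL bas_add)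
  then show ?case using bas_add by (simp add: Lop_add Dop_add)
qed simp

lemma DR': "a \<in> Sp \<Longrightarrow> v \<in> Sm \<Longrightarrow> Dop K (Rop K v a) = Rop K (Dop K v) a"
proof (induction a rule: span_of_induct)
  case (bas_add a w)
  from \<open>v \<in> Sm\<close> have "Dop K (Rop K v (bas a)) = Rop K (Dop K v) (bas a)"
    by (induction v rule: span_of_induct) (simp_all add: Dop_add Rop_add op_bas DR bas_add)
  then show ?case using bas_add by (simp add: Rop_add Dop_add)
qed simp

lemma LL': "a \<in> Sp \<Longrightarrow> b \<in> Sp \<Longrightarrow> v \<in> Sm \<Longrightarrow> Lop K (amul B a b) v = Lop K a (Lop K b v)"
proof (induction a rule: span_of_induct)
  case (bas_add a w)
  from \<open>b \<in> Sp\<close> have "Lop K (amul B (bas a) b) v = Lop K (bas a) (Lop K b v)"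
  proof (induction b rule: span_of_induct)
    case (bas_add b w)
    from \<open>v \<in> Sm\<close> have "Lop K (amul B (bas a) (bas b)) v = Lop K (bas a) (Lop K (bas b) v)"
      by (induction v rule: span_of_induct) (simp_all add: Lop_add op_bas LL bas_add \<open>a \<in> agens B\<close>)
    then show ?case using bas_add by (simp add: Lop_add amul_add_right)
  qed simp
  then show ?case using bas_add by (simp add: Lop_add amul_add_left)
qed simp

lemma RR': "a \<in> Sp \<Longrightarrow> b \<in> Sp \<Longrightarrow> v \<in> Sm \<Longrightarrow> Rop K v (amul B a b) = Rop K (Rop K v a) b"
proof (induction a rule: span_of_induct)
  case (bas_add a w)
  from \<open>b \<in> Sp\<close> have "Rop K v (amul B (bas a) b) = Rop K (Rop K v (bas a)) b"
  proof (induction b rule: span_of_induct)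
    case (bas_add b w)
    from \<open>v \<in> Sm\<close> have "Rop K v (amul B (bas a) (bas b)) = Rop K (Rop K v (bas a)) (bas b)"
      by (induction v rule: span_of_induct) (simp_all add: Rop_add op_bas RR bas_add \<open>a \<in> agens B\<close>)
    then show ?case using bas_add by (simp add: Rop_add amul_add_right)
  qed simp
  then show ?case using bas_add by (simp add: Rop_add amul_add_left)
qed simp

lemma LR': "a \<in> Sp \<Longrightarrow> b \<in> Sp \<Longrightarrow> v \<in> Sm \<Longrightarrow> Lop K a (Rop K v b) = Rop K (Lop K a v) b"
proof (induction a rule: span_of_induct)
  case (bas_add a w)
  from \<open>b \<in> Sp\<close> have "Lop K (bas a) (Rop K v b) = Rop K (Lop K (bas a) v) b"
  proof (induction b rule: span_of_induct)
    case (bas_add b w)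
    from \<open>v \<in> Sm\<close> have "Lop K (bas a) (Rop K v (bas b)) = Rop K (Lop K (bas a) v) (bas b)"
      by (induction v rule: span_of_induct) (simp_all add: Lop_add Rop_add op_bas LR bas_add \<open>a \<in> agens B\<close>)
    then show ?case using bas_add by (simp add: Lop_add Rop_add)
  qed simp
  then show ?case using bas_add by (simp add: Lop_add Rop_add)
qed simp

lemma uL': "v \<in> Sm \<Longrightarrow> Lop K u v = v"
  by (induction v rule: span_of_induct) (simp_all add: Lop_add uL)

lemma uR': "v \<in> Sm \<Longrightarrow> Rop K v u = v"
  by (induction v rule: span_of_induct) (simp_all add: Rop_add uR)

definition pr :: "'x vec \<Rightarrow> 'x vec" where
  "pr v = lin (\<lambda>x. if x \<in> gens K then bas x else 0) v"

lemma pr_add: "pr (v + w) = pr v + pr w"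
  by (simp add: pr_def lin_add)

lemma pr_closed [simp]: "pr v \<in> Sm"
  unfolding pr_def by (rule lin_in_span[where S = UNIV]) (auto simp: span_of_def)

lemma pr_id: "v \<in> Sm \<Longrightarrow> pr v = v"
  unfolding pr_def by (subst lin_cong_span[where g = bas]) simp_all

lemma bop_lin_bimod:
  "bop (lin_bimod K) [] v [] = Dop K v" "bop (lin_bimod K) [a] v [] = Lop K a v"
  "bop (lin_bimod K) [] v [b] = Rop K v b"
  by (simp_all add: lin_bimod_def sum_set_Cons Dop_def Lop_def Rop_def lin_def sum.reindex inj_on_def flip: sum.cartesian_product)

lemma bop_lin_bimod_long: "length as + length bs > 1 \<Longrightarrow> bop (lin_bimod K) as v bs = 0"
  using short by (auto simp: lin_bimod_def short_def dest!: listset_length intro!: sum.neutral)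

text \<open>Inputs outside the carriers are projected first, which makes the operations an element
  of the ring on the full free space.\<close>

lift_definition total_op :: "('g vec, 'x) pre" is
  "\<lambda>as v bs. bop (lin_bimod K) (map lin.cr as) (pr v) (map lin.cr bs)"
proof -
  fix as bs :: "'g vec list" and v w :: "'x vec"
  show "bop (lin_bimod K) (map lin.cr as) (pr (v + w)) (map lin.cr bs) =
    bop (lin_bimod K) (map lin.cr as) (pr v) (map lin.cr bs) + bop (lin_bimod K) (map lin.cr as) (pr w) (map lin.cr bs)"
  proof (cases "length as + length bs > 1")
    case False
    then consider "as = []" "bs = []" | a where "as = [a]" "bs = []" | b where "as = []" "bs = [b]"
      by (cases as; cases bs) auto
    then show ?thesis
      by cases (simp_all add: bop_lin_bimod pr_add Dop_add Lop_add Rop_add)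
  qed (simp add: bop_lin_bimod_long)
qed

lemma app_total_op:
  "app total_op [] v [] = Dop K (pr v)" "app total_op [a] v [] = Lop K (lin.cr a) (pr v)"
  "app total_op [] v [b] = Rop K (pr v) (lin.cr b)"
  by (simp_all add: total_op.rep_eq bop_lin_bimod)

lemma app_total_op_long: "length as + length bs > 1 \<Longrightarrow> app total_op as v bs = 0"
  by (simp add: total_op.rep_eq bop_lin_bimod_long)

lemma cr_Sp [simp]: "lin.cr a \<in> Sp"
  using lin.cr_closed[of a] by (simp only: carrier_lin_alg)

lemma cr_zero [simp]: "lin.cr 0 = 0"
  by (simp add: lin.cr_def one_lin_alg)

lemma cr_id: "a \<in> Sp \<Longrightarrow> lin.cr a = a"
  by (simp add: lin.cr_def carrier_lin_alg)

lemma short_cases: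
  fixes as bs :: "'c list"
  obtains "as = []" "bs = []" | a where "as = [a]" "bs = []" | b where "as = []" "bs = [b]" |
    "length as + length bs > 1"
  by (cases as; cases bs) auto

lemma total_op_closed: "app total_op as v bs \<in> Sm"
  by (cases as bs rule: short_cases)
    (simp_all add: app_total_op app_total_op_long Dop_closed Lop_closed Rop_closed)

lemma aop_total_other: "length as \<noteq> 2 \<Longrightarrow> lin.aop_total as = 0"
  by (simp add: lin.aop_total_def aop_lin_alg_other)

lemma aop_total2: "lin.aop_total [a, b] = amul B (lin.cr a) (lin.cr b)"
  by (simp add: lin.aop_total_def aop_lin_alg2 cr_id amul_closed)

lemma app_total_op_zero: "0 \<in> set as \<or> 0 \<in> set bs \<Longrightarrow> app total_op as v bs = 0"
  by (cases as bs rule: short_cases) (auto simp: app_total_op app_total_op_long)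

text \<open>With more than two algebra inputs every term contains an operation with too many inputs
  or an inserted zero. The remaining six patterns of inputs correspond to the six relations of the
  locale.\<close>

lemma total_op_mc: "total_op * total_op + lin.D total_op = 0"
proof (rule pre_eqI)
  fix as bs v
  let ?m = "app total_op"
  have seg1: "segments [a] = {(0, 1)}" for a :: "'g vec" by (auto simp: segments_def)
  have seg2: "segments [a, b] = {(0, 1), (0, 2), (1, 2)}" for a b :: "'g vec" by (auto simp: segments_def)
  have "(\<Sum>(i, k)\<in>splits as bs. ?m (take i as) (?m (drop i as) v (take k bs)) (drop k bs)) +
    ((\<Sum>(i, k)\<in>segments as. ?m (ctr lin.aop_total as i k) v bs) +
     (\<Sum>(i, k)\<in>segments bs. ?m as v (ctr lin.aop_total bs i k))) = 0"
  proof (cases "length as + length bs > 2")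
    case True
    have 1: "?m (take i as) (?m (drop i as) v (take k bs)) (drop k bs) = 0" if "(i, k) \<in> splits as bs" for i k
    proof (cases "length (drop i as) + length (take k bs) > 1")
      case False
      then have "length (take i as) + length (drop k bs) > 1"
        using that True by (auto simp: splits_def)
      then show ?thesis by (rule app_total_op_long)
    qed (simp add: app_total_op_long)
    have 2: "?m (ctr lin.aop_total as i k) v bs = 0" if "(i, k) \<in> segments as" for i k
    proof (cases "k = i + 2")
      case False
      then have "length (drop i (take k as)) \<noteq> 2" using that by (auto simp: segments_def)
      then show ?thesis by (intro app_total_op_zero) (simp add: ctr_def aop_total_other)
    next
      case True' : True
      then have "length (ctr lin.aop_total as i k) + length bs > 1"
        using that True by (auto simp: ctr_def segments_def)
      then show ?thesis by (rule app_total_op_long)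
    qed
    have 3: "?m as v (ctr lin.aop_total bs i k) = 0" if "(i, k) \<in> segments bs" for i k
    proof (cases "k = i + 2")
      case False
      then have "length (drop i (take k bs)) \<noteq> 2" using that by (auto simp: segments_def)
      then show ?thesis by (intro app_total_op_zero) (simp add: ctr_def aop_total_other)
    next
      case True' : True
      then have "length as + length (ctr lin.aop_total bs i k) > 1"
        using that True by (auto simp: ctr_def segments_def)
      then show ?thesis by (rule app_total_op_long)
    qed
    have "(\<Sum>(i, k)\<in>splits as bs. ?m (take i as) (?m (drop i as) v (take k bs)) (drop k bs)) = 0"
      "(\<Sum>(i, k)\<in>segments as. ?m (ctr lin.aop_total as i k) v bs) = 0"
      "(\<Sum>(i, k)\<in>segments bs. ?m as v (ctr lin.aop_total bs i k)) = 0"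
      using 1 2 3 by (auto intro!: sum.neutral)
    then show ?thesis by simp
  next
    case False
    note simps = splits_def atMost_Suc ctr_def aop_total_other aop_total2 app_total_op app_total_op_long
      pr_id DD' DL' DR' LL' RR' LR' Dop_closed Lop_closed Rop_closed seg1 seg2 numeral_2_eq_2
    from False consider "as = []" "bs = []" | a where "as = [a]" "bs = []" | b where "as = []" "bs = [b]"
      | a b where "as = [a, b]" "bs = []" | a b where "as = []" "bs = [a, b]" | a b where "as = [a]" "bs = [b]"
      by (cases as; cases "tl as"; cases bs; cases "tl bs") auto
    then show ?thesis
    proof cases
      case 1 then show ?thesis by (simp add: simps)
    next
      case 2 then show ?thesis by (simp add: simps)
    next
      case 3 then show ?thesis by (simp add: simps)
    next
      case 4 then show ?thesis by (simp add: simps cr_id amul_closed)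
    next
      case 5 then show ?thesis by (simp add: simps cr_id amul_closed)
    next
      case 6 then show ?thesis by (simp add: simps)
    qed
  qed
  then show "app (total_op * total_op + lin.D total_op) as v bs = app 0 as v bs"
    by (simp add: app_times alg_deriv.rep_eq)
qed

lemma multi_total_op: "multi (lin_alg B) total_op"
proof -
  have cr_add: "lin.cr (a + a') = lin.cr a + lin.cr a'" if "a \<in> Sp" "a' \<in> Sp" for a a'
    using that by (simp add: cr_id span_of_add)
  have "app total_op (as @ (a + a') # as') x bs = app total_op (as @ a # as') x bs + app total_op (as @ a' # as') x bs"
    "app total_op bs x (as @ (a + a') # as') = app total_op bs x (as @ a # as') + app total_op bs x (as @ a' # as')"
    if "a \<in> Sp" "a' \<in> Sp" for as as' bs :: "'g vec list" and a a' x
  proof -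
    show "app total_op (as @ (a + a') # as') x bs = app total_op (as @ a # as') x bs + app total_op (as @ a' # as') x bs"
      using that by (cases "as = [] \<and> as' = [] \<and> bs = []")
        (auto simp: app_total_op app_total_op_long cr_add Lop_add)
    show "app total_op bs x (as @ (a + a') # as') = app total_op bs x (as @ a # as') + app total_op bs x (as @ a' # as')"
      using that by (cases "as = [] \<and> as' = [] \<and> bs = []")
        (auto simp: app_total_op app_total_op_long cr_add Rop_add)
  qed
  then show ?thesis by (simp add: multi_def lin_alg_simps)
qed

lemma app_strict_pr: "app (strict pr) as v bs = (if as = [] \<and> bs = [] then pr v else 0)"
  by (rule app_strict) (rule pr_add)

lemma pr_total_op: "strict pr * total_op = total_op"
  by (rule pre_eqI) (simp add: app_strict_times app_strict_pr pr_id total_op_closed)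

lemma total_op_pr: "total_op * strict pr = total_op"
  by (rule pre_eqI) (simp add: app_times_strict app_strict_pr, simp add: total_op.rep_eq pr_id)

text \<open>A bimodule strictly isomorphic to \<open>lin_bimod K\<close> is presented by the same
  \<open>total_op\<close>. In this way the associated graded, made of families of cosets, receives
  the ring element of the Khovanov bimodule.\<close>

lemma bimod_model_strict_iso:
  assumes \<Phi>: "\<Phi> \<in> hom (lin_bimod K) M" and \<Psi>: "\<And>v. v \<in> Sm \<Longrightarrow> \<Psi> (\<Phi> v) = v"
    and \<Phi>\<Psi>: "\<And>x. x \<in> carrier M \<Longrightarrow> \<Psi> x \<in> Sm \<and> \<Phi> (\<Psi> x) = x"
    and M: "comm_group M"
    and bop: "\<And>as v bs. as \<in> lists (carrier (lin_alg B)) \<Longrightarrow> v \<in> Sm \<Longrightarrow> bs \<in> lists (carrier (lin_alg B)) \<Longrightarrow>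
      bop M as (\<Phi> v) bs = \<Phi> (bop (lin_bimod K) as v bs)"
  shows "bimod_model (lin_alg B) M \<Psi> (\<Phi> \<circ> pr) (strict pr) total_op u"
proof unfold_locales
  interpret M: comm_group M by (rule M)
  have \<Phi>_add: "\<Phi> (v + w) = \<Phi> v \<otimes>\<^bsub>M\<^esub> \<Phi> w" if "v \<in> Sm" "w \<in> Sm" for v w
    using hom_mult[OF \<Phi>, of v w] that by (simp add: carrier_lin_bimod mult_lin_bimod)
  have \<Phi>_closed: "\<Phi> v \<in> carrier M" if "v \<in> Sm" for v
    using hom_in_carrier[OF \<Phi>, of v] that by (simp add: carrier_lin_bimod)
  have \<Phi>_zero: "\<Phi> 0 = \<one>\<^bsub>M\<^esub>"
    using \<Phi>_add[of 0 0] \<Phi>_closed[of 0] by (metis M.r_cancel_one add_0 span_of_zero)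
  have \<Psi>_add: "\<Psi> (x \<otimes>\<^bsub>M\<^esub> y) = \<Psi> x + \<Psi> y" if "x \<in> carrier M" "y \<in> carrier M" for x y
    using that \<Phi>\<Psi> \<Phi>_add[of "\<Psi> x" "\<Psi> y"] \<Psi>[of "\<Psi> x + \<Psi> y"] by (metis span_of_add)
  show "lin.realizes M \<Psi> (\<Phi> \<circ> pr) (strict pr) total_op"
    unfolding lin.realizes_def
  proof (intro conjI allI ballI)
    show "f2_space M"
      unfolding f2_space_def
    proof (intro conjI ballI M)
      fix x assume x: "x \<in> carrier M"
      then have "x \<otimes>\<^bsub>M\<^esub> x = \<Phi> (\<Psi> x + \<Psi> x)" using \<Phi>_add[of "\<Psi> x" "\<Psi> x"] \<Phi>\<Psi>[OF x] by simp
      then show "x \<otimes>\<^bsub>M\<^esub> x = \<one>\<^bsub>M\<^esub>" by (simp add: \<Phi>_zero)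
    qed
    fix as bs x assume *: "as \<in> lists (carrier (lin_alg B))" "bs \<in> lists (carrier (lin_alg B))" "x \<in> carrier M"
    have "bop M as x bs = \<Phi> (bop (lin_bimod K) as (\<Psi> x) bs)"
      using bop[of as "\<Psi> x" bs] * \<Phi>\<Psi>[of x] by simp
    also have "bop (lin_bimod K) as (\<Psi> x) bs = app total_op as (\<Psi> x) bs"
      using * \<Phi>\<Psi>[of x] by (simp add: total_op.rep_eq pr_id)
    finally show "bop M as x bs = (\<Phi> \<circ> pr) (app total_op as (\<Psi> x) bs)"
      by (simp add: pr_id total_op_closed)
  qed (simp_all add: \<Psi>_add \<Phi>_closed pr_add \<Phi>_add pr_id \<Phi>\<Psi> app_strict_pr \<Psi> pr_total_op total_op_pr multi_total_op total_op_mc)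
  show "homology_unit (lin_alg B) u" by (rule homology_unit_u)
  fix v
  show "app total_op [u] v [] = app (strict pr) [] v []" "app total_op [] v [u] = app (strict pr) [] v []"
    by (simp_all add: app_total_op app_strict_pr cr_id u_in uL' uR')
qed

lemma bimod_model_lin_bimod: "bimod_model (lin_alg B) (lin_bimod K) id (id \<circ> pr) (strict pr) total_op u"
proof (rule bimod_model_strict_iso)
  show "comm_group (lin_bimod K)"
    by (rule comm_group_vec[OF carrier_lin_bimod mult_lin_bimod one_lin_bimod])
qed (simp_all add: carrier_lin_bimod hom_def)

end

section \<open>Bar words and tensor products\<close>

text \<open>
  The tensor product is spanned by words with letters in the left factor, the algebra and the right factor.
  Its differential multiplies adjacent letters and differentiates single ones, so its properties follow
  from those of letters.
\<close>
datatype ('g, 'x) letter = LM 'x | LA 'g | LN 'x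

definition consw :: "'s vec \<Rightarrow> 's list vec \<Rightarrow> 's list vec" where
  "consw v w = lin (\<lambda>s. lin (\<lambda>l. bas (s # l)) w) v"

lemma consw_add: "consw (v + v') w = consw v w + consw v' w" "consw v (w + w') = consw v w + consw v w'"
  by (simp_all add: consw_def lin_add lin_fun_add)

lemma consw_zero [simp]: "consw 0 w = 0" "consw v 0 = 0"
  by (simp_all add: consw_def)

lemma consw_bas: "consw (bas s) (bas l) = bas (s # l)"
  by (simp add: consw_def)

text \<open>Associativity, the Leibniz rule and the vanishing of the squared differential are
  required for letters only. Left factor, algebra and right factor can then be treated alike, with
  product zero for letters that do not fit together.\<close>

locale bar_words =
  fixes mul :: "'s \<Rightarrow> 's \<Rightarrow> 's vec" and dif :: "'s \<Rightarrow> 's vec" and S :: "'s set"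
  assumes mul_assoc: "s \<in> S \<Longrightarrow> t \<in> S \<Longrightarrow> r \<in> S \<Longrightarrow> lin (\<lambda>p. mul p r) (mul s t) = lin (mul s) (mul t r)"
    and leibniz: "s \<in> S \<Longrightarrow> t \<in> S \<Longrightarrow> lin dif (mul s t) = lin (\<lambda>p. mul p t) (dif s) + lin (mul s) (dif t)"
    and dif_dif: "s \<in> S \<Longrightarrow> lin dif (dif s) = 0"
begin

definition mulv :: "'s vec \<Rightarrow> 's vec \<Rightarrow> 's vec" where
  "mulv v w = lin (\<lambda>s. lin (mul s) w) v"

lemma mulv_add: "mulv (v + v') w = mulv v w + mulv v' w" "mulv v (w + w') = mulv v w + mulv v w'"
  by (simp_all add: mulv_def lin_add lin_fun_add)

lemma mulv_zero [simp]: "mulv 0 w = 0" "mulv v 0 = 0"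
  by (simp_all add: mulv_def)

lemma mulv_bas: "mulv (bas s) (bas t) = mul s t" "mulv (bas s) v = lin (mul s) v" "mulv v (bas t) = lin (\<lambda>p. mul p t) v"
  by (simp_all add: mulv_def)

lemma mulv_assoc: "v \<in> span_of S \<Longrightarrow> t \<in> S \<Longrightarrow> r \<in> S \<Longrightarrow>
    mulv (mulv v (bas t)) (bas r) = mulv v (mul t r)"
proof (induction v rule: span_of_induct)
  case (bas_add s v)
  then have "mulv (mul s t) (bas r) = lin (mul s) (mul t r)"
    by (simp add: mulv_bas(3) mul_assoc)
  then show ?case using bas_add by (simp add: mulv_add mulv_bas(1,2))
qed simp

lemma leibniz': "v \<in> span_of S \<Longrightarrow> t \<in> S \<Longrightarrow>
    lin dif (mulv v (bas t)) = mulv (lin dif v) (bas t) + mulv v (dif t)"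
  by (induction v rule: span_of_induct) (simp_all add: mulv_add lin_add mulv_bas leibniz add_ac)

text \<open>The term of the bar differential at the seam: \<open>v\<close> is multiplied into the
  first letter of the word it is put in front of.\<close>

primrec push :: "'s vec \<Rightarrow> 's list \<Rightarrow> 's list vec" where
  "push v [] = 0"
| "push v (t # l) = consw (mulv v (bas t)) (bas l)"

primrec bar :: "'s list \<Rightarrow> 's list vec" where
  "bar [] = 0"
| "bar (s # l) = consw (dif s) (bas l) + push (bas s) l + consw (bas s) (bar l)"

lemma push_add: "push (v + v') l = push v l + push v' l"
  by (cases l) (simp_all add: mulv_add consw_add)

lemma push_zero [simp]: "push 0 l = 0"
  by (cases l) simp_all

lemma bar_consw: "lin bar (consw v w) = consw (lin dif v) w + lin (push v) w + consw v (lin bar w)"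
proof (induction v rule: vec_induct)
  case (bas_add s v)
  have "lin bar (consw (bas s) w) = consw (dif s) w + lin (push (bas s)) w + consw (bas s) (lin bar w)"
    by (induction w rule: vec_induct) (simp_all add: consw_add lin_add consw_bas add_ac)
  then show ?case
    using bas_add by (simp add: consw_add lin_add push_add lin_fun_add add_ac)
qed simp

lemma push_consw: "lin (push v) (consw t w) = consw (mulv v t) w"
proof (induction t rule: vec_induct)
  case (bas_add s t)
  have "lin (push v) (consw (bas s) w) = consw (mulv v (bas s)) w"
    by (induction w rule: vec_induct) (simp_all add: consw_add lin_add consw_bas)
  then show ?case using bas_add by (simp add: consw_add lin_add mulv_add)
qed simp

lemma push_push: "v \<in> span_of S \<Longrightarrow> t \<in> S \<Longrightarrow> l \<in> lists S \<Longrightarrow>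
    lin (push v) (push (bas t) l) = push (mulv v (bas t)) l"
  by (cases l) (simp_all add: push_consw mulv_assoc mulv_bas(1))

text \<open>The Leibniz rule accounts for differentiating the merged letter, associativity for
  merging it with the next one.\<close>

lemma bar_push:
  assumes "v \<in> span_of S" "l \<in> lists S"
  shows "lin bar (push v l) = lin (push v) (bar l) + push (lin dif v) l"
proof (cases l)
  case (Cons t l')
  then have t: "t \<in> S" "l' \<in> lists S" using assms(2) by auto
  have "lin bar (push v l) = consw (mulv (lin dif v) (bas t) + mulv v (dif t)) (bas l') +
      push (mulv v (bas t)) l' + consw (mulv v (bas t)) (bar l')"
    by (simp add: Cons bar_consw leibniz' assms t)
  moreover have "lin (push v) (bar l) = consw (mulv v (dif t)) (bas l') + push (mulv v (bas t)) l' + consw (mulv v (bas t)) (bar l')"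
    using push_push[OF assms(1) t] by (simp add: Cons lin_add push_consw)
  ultimately show ?thesis
    by (simp add: Cons consw_add add_ac)
qed simp

text \<open>Peeling off the first letter, every mixed term occurs twice by \<open>bar_consw\<close>
  and \<open>bar_push\<close>, leaving the square of \<open>dif\<close> on the letter and the
  induction hypothesis.\<close>

lemma bar_bar: "l \<in> lists S \<Longrightarrow> lin bar (bar l) = 0"
proof (induction l)
  case (Cons s l)
  then show ?case
    by (simp add: lin_add bar_consw bar_push dif_dif add_ac)
qed simp

text \<open>The two actions on a tensor product change only the first or only the last letter. As
  derivations of words, with letter maps vanishing on the other kinds of letters, they need no
  reference to positions.\<close>

primrec leibniz_ext :: "('s \<Rightarrow> 's vec) \<Rightarrow> 's list \<Rightarrow> 's list vec" where
  "leibniz_ext \<theta> [] = 0"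
| "leibniz_ext \<theta> (s # l) = consw (\<theta> s) (bas l) + consw (bas s) (leibniz_ext \<theta> l)"

lemma leibniz_ext_consw: "lin (leibniz_ext \<theta>) (consw v w) = consw (lin \<theta> v) w + consw v (lin (leibniz_ext \<theta>) w)"
proof (induction v rule: vec_induct)
  case (bas_add s v)
  have "lin (leibniz_ext \<theta>) (consw (bas s) w) = consw (\<theta> s) w + consw (bas s) (lin (leibniz_ext \<theta>) w)"
    by (induction w rule: vec_induct) (simp_all add: consw_add lin_add consw_bas add_ac)
  then show ?case
    using bas_add by (simp add: consw_add lin_add add_ac)
qed simp

text \<open>The terms in which a merged pair meets \<open>\<theta>\<close> match because
  \<open>\<theta>\<close> is a derivation of the product of letters; all others match because it
  commutes with \<open>dif\<close>.\<close>

lemma bar_leibniz_ext: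
  assumes \<theta>: "\<And>s. s \<in> S \<Longrightarrow> lin \<theta> (dif s) = lin dif (\<theta> s)"
    "\<And>s t. s \<in> S \<Longrightarrow> t \<in> S \<Longrightarrow> lin \<theta> (mul s t) = lin (\<lambda>p. mul p t) (\<theta> s) + lin (mul s) (\<theta> t)"
  shows "l \<in> lists S \<Longrightarrow> lin bar (leibniz_ext \<theta> l) = lin (leibniz_ext \<theta>) (bar l)"
proof (induction l)
  case (Cons s l)
  have "push (\<theta> s) l + lin (push (bas s)) (leibniz_ext \<theta> l) = lin (leibniz_ext \<theta>) (push (bas s) l)"
  proof (cases l)
    case l: (Cons t l')
    then have "t \<in> S" using Cons by auto
    then show ?thesis
      using Cons(2) by (simp add: l lin_add push_consw leibniz_ext_consw mulv_bas \<theta>(2) consw_add add_ac)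
  qed simp
  then show ?case
    using Cons by (simp add: lin_add bar_consw leibniz_ext_consw \<theta>(1) add_ac)
qed simp

end

section \<open>Letters and words of a tensor product\<close>

locale tensor_pair =
  M: dg_bimod B u M + N: dg_bimod B u N
  for B :: "'g based_alg" and u and M N :: "('g, 'g mgen) based_bimod"
begin

text \<open>Right action on \<open>M\<close>, product of \<open>B\<close>, left action on
  \<open>N\<close>. A letter of \<open>M\<close> next to one of \<open>N\<close> has product zero:
  with no algebra factor left there is nothing to absorb.\<close>

fun lmul :: "('g, 'g mgen) letter \<Rightarrow> ('g, 'g mgen) letter \<Rightarrow> ('g, 'g mgen) letter vec" where
  "lmul (LM x) (LA a) = lin (\<lambda>x'. bas (LM x')) (coef M [] x [a])"
| "lmul (LA a) (LA b) = lin (\<lambda>c. bas (LA c)) (acoef B [a, b])"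
| "lmul (LA a) (LN y) = lin (\<lambda>y'. bas (LN y')) (coef N [a] y [])"
| "lmul _ _ = 0"

fun ldif :: "('g, 'g mgen) letter \<Rightarrow> ('g, 'g mgen) letter vec" where
  "ldif (LM x) = lin (\<lambda>x'. bas (LM x')) (coef M [] x [])"
| "ldif (LA a) = 0"
| "ldif (LN y) = lin (\<lambda>y'. bas (LN y')) (coef N [] y [])"

definition letters :: "('g, 'g mgen) letter set" where
  "letters = LM ` gens M \<union> LA ` agens B \<union> LN ` gens N"

lemma lin_pull: "lin f (lin (\<lambda>x. bas (C x)) v) = lin (\<lambda>x. f (C x)) v"
  by (simp add: lin_lin)

lemma lin_push: "lin (\<lambda>x. lin (\<lambda>x'. bas (C x')) (f x)) v = lin (\<lambda>x'. bas (C x')) (lin f v)"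
  by (simp add: lin_lin)

text \<open>On letters the axioms are module relations: \<open>DR\<close> and \<open>DL\<close> give
  the Leibniz rule, while \<open>RR\<close>, \<open>LL\<close> and associativity of \<open>B\<close>
  give associativity. In all other combinations both sides vanish.\<close>

sublocale bar_words lmul ldif letters
proof
  fix s t r assume st: "s \<in> letters" "t \<in> letters"
  show "lin ldif (lmul s t) = lin (\<lambda>p. lmul p t) (ldif s) + lin (lmul s) (ldif t)"
    using st M.DR N.DL
    by (cases s; cases t) (auto simp: letters_def lin_pull lin_push Dop_def Rop_def Lop_def)
  show "lin ldif (ldif s) = 0"
    using st M.DD N.DD by (cases s) (auto simp: letters_def lin_pull lin_push Dop_def)
  assume r: "r \<in> letters"
  show "lin (\<lambda>p. lmul p r) (lmul s t) = lin (lmul s) (lmul t r)"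
    using st r M.RR N.LL M.assoc
    by (cases s; cases t; cases r) (auto simp: letters_def lin_pull lin_push amul_def Rop_def Lop_def)
qed

definition word :: "'g mgen \<Rightarrow> ('g, 'g mgen) letter list" where
  "word z = (case z of Tens x as y \<Rightarrow> LM x # map LA as @ [LN y] | _ \<Rightarrow> [])"

text \<open>Inverse of \<open>word\<close> on the words that come from generators; its values on
  words of another shape do not matter.\<close>

definition unword :: "('g, 'g mgen) letter list \<Rightarrow> 'g mgen" where
  "unword l = (case l of LM x # r \<Rightarrow>
     Tens x (map (\<lambda>c. case c of LA a \<Rightarrow> a) (butlast r)) (case last r of LN y \<Rightarrow> y))"

lemma unword_word: "unword (word (Tens x as y)) = Tens x as y"
  by (simp add: word_def unword_def comp_def)

abbreviation "K \<equiv> ainf_tensor B M N"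

lemma gens_K: "z \<in> gens K \<longleftrightarrow> (\<exists>x as y. z = Tens x as y \<and> x \<in> gens M \<and> as \<in> lists (agens B) \<and> y \<in> gens N)"
  by (auto simp: ainf_tensor_def)

lemma coef_K: "coef K = tensor_coef B M N"
  by (simp add: ainf_tensor_def)

definition \<tau> :: "'g mgen vec \<Rightarrow> ('g, 'g mgen) letter list vec" where
  "\<tau> v = lin (\<lambda>z. bas (word z)) v"

text \<open>Allows relations in the tensor product to be checked on words, where the differential is
  recursive.\<close>

lemma \<tau>_inj:
  assumes "v \<in> span_of (gens K)" "w \<in> span_of (gens K)" "\<tau> v = \<tau> w"
  shows "v = w"
proof -
  have "lin (\<lambda>l. bas (unword l)) (\<tau> v) = v" if "v \<in> span_of (gens K)" for v
  proof -
    have "lin (\<lambda>l. bas (unword l)) (\<tau> v) = lin bas v"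
      unfolding \<tau>_def lin_lin
      by (rule lin_cong_span[OF that]) (auto simp: gens_K unword_word)
    then show ?thesis by simp
  qed
  then show ?thesis using assms by metis
qed

lemma word_letters: "z \<in> gens K \<Longrightarrow> word z \<in> lists letters"
  by (auto simp: gens_K word_def letters_def)

lemma coef_M_short: "length bs > 1 \<Longrightarrow> coef M [] x bs = 0" "bs \<noteq> [] \<Longrightarrow> coef M [a] x bs = 0"
  using M.short by (auto simp: short_def)

lemma coef_N_short: "length as > 1 \<Longrightarrow> coef N as y [] = 0" "as \<noteq> [] \<Longrightarrow> coef N as y [a] = 0"
  using N.short by (auto simp: short_def)

lemma sum_left_action:
  "(\<Sum>i\<le>length as. F i (coef M [] x (take i as))) =
     F 0 (coef M [] x []) + (if as = [] then 0 else F 1 (coef M [] x [hd as]))"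
  if F0: "\<And>i. F i 0 = (0 :: 'y vec)"
proof (cases as)
  case (Cons a as')
  have "(\<Sum>i\<le>length as. F i (coef M [] x (take i as))) = (\<Sum>i\<in>{0, 1}. F i (coef M [] x (take i as)))"
    by (rule sum.mono_neutral_right) (auto simp: Cons F0 coef_M_short)
  then show ?thesis by (simp add: Cons)
qed simp

lemma segments_Cons: "segments (a # as) = (\<lambda>j. (0, Suc j)) ` {..length as} \<union> (\<lambda>(i, j). (Suc i, Suc j)) ` segments as"
proof -
  have "(i, j) \<in> segments (a # as) \<longleftrightarrow> (i, j) \<in> (\<lambda>j. (0, Suc j)) ` {..length as} \<union> (\<lambda>(i, j). (Suc i, Suc j)) ` segments as" for i j
    by (cases i; cases j) (auto simp: segments_def image_iff)
  then show ?thesis by auto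
qed

lemma sum_segments_Cons:
  "(\<Sum>(i, j)\<in>segments (a # as). F i j) = (\<Sum>j\<le>length as. F 0 (Suc j)) + (\<Sum>(i, j)\<in>segments as. F (Suc i) (Suc j))"
  for F :: "nat \<Rightarrow> nat \<Rightarrow> 'y vec"
proof -
  have "(\<Sum>(i, j)\<in>segments (a # as). F i j) =
      (\<Sum>(i, j)\<in>(\<lambda>j. (0, Suc j)) ` {..length as}. F i j) + (\<Sum>(i, j)\<in>(\<lambda>(i, j). (Suc i, Suc j)) ` segments as. F i j)"
    unfolding segments_Cons by (rule sum.union_disjoint) auto
  moreover have "(\<Sum>(i, j)\<in>(\<lambda>(i, j). (Suc i, Suc j)) ` segments as. F i j) = (\<Sum>(i, j)\<in>segments as. F (Suc i) (Suc j))"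
    by (subst sum.reindex) (auto simp: inj_on_def split_def)
  ultimately show ?thesis
    by (simp add: sum.reindex inj_on_def)
qed

text \<open>Matches the recursive differential with the sums over positions in
  \<open>tensor_coef\<close>, for the part of a word behind its first letter. Taking off one algebra
  letter separates the segments that begin there from the others.\<close>

lemma bar_suffix:
  "bar (map LA as @ [LN y]) =
     (\<Sum>(i, j)\<in>segments as. lin (\<lambda>a. bas (map LA (take i as @ a # drop j as) @ [LN y])) (acoef B (drop i (take j as)))) +
     (\<Sum>i\<le>length as. lin (\<lambda>y'. bas (map LA (take i as) @ [LN y'])) (coef N (drop i as) y []))"
proof (induction as)
  case Nil
  show ?case by (simp add: consw_def lin_pull)
next
  case (Cons a as)
  let ?l = "map LA as @ [LN y]"
  have c: "consw (bas (LA a)) (\<Sum>i\<in>I. f i) = (\<Sum>i\<in>I. consw (bas (LA a)) (f i))" for f and I :: "'i set"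
    by (induction I rule: infinite_finite_induct) (simp_all add: consw_add)
  have cl: "consw (bas (LA a)) (lin f v) = lin (\<lambda>x. consw (bas (LA a)) (f x)) v" for f and v :: "'y vec"
    by (simp add: consw_def lin_lin)
  have 1: "consw (bas (LA a)) (bar ?l) =
     (\<Sum>(i, j)\<in>segments as. lin (\<lambda>c. bas (map LA (take (Suc i) (a # as) @ c # drop (Suc j) (a # as)) @ [LN y])) (acoef B (drop (Suc i) (take (Suc j) (a # as))))) +
     (\<Sum>i\<le>length as. lin (\<lambda>y'. bas (map LA (take (Suc i) (a # as)) @ [LN y'])) (coef N (drop (Suc i) (a # as)) y []))"
    by (simp add: Cons.IH consw_add c split_def cl consw_bas)
  have 2: "push (bas (LA a)) ?l =
     (\<Sum>j\<le>length as. lin (\<lambda>c. bas (map LA (take 0 (a # as) @ c # drop (Suc j) (a # as)) @ [LN y])) (acoef B (drop 0 (take (Suc j) (a # as))))) +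
     lin (\<lambda>y'. bas (map LA (take 0 (a # as)) @ [LN y'])) (coef N (drop 0 (a # as)) y [])"
  proof (cases as)
    case Nil
    then show ?thesis by (simp add: mulv_bas consw_def lin_pull M.binary)
  next
    case as: (Cons b as')
    \<comment> \<open>Of the segments that begin at the front only the one with two entries has a
      nonzero product.\<close>
    have "(\<Sum>j\<le>length as. lin (\<lambda>c. bas (map LA (take 0 (a # as) @ c # drop (Suc j) (a # as)) @ [LN y])) (acoef B (drop 0 (take (Suc j) (a # as))))) =
      (\<Sum>j\<in>{1}. lin (\<lambda>c. bas (map LA (take 0 (a # as) @ c # drop (Suc j) (a # as)) @ [LN y])) (acoef B (drop 0 (take (Suc j) (a # as)))))"
      by (rule sum.mono_neutral_right) (auto simp: as M.binary)
    then show ?thesis by (simp add: as mulv_bas consw_def lin_pull coef_N_short)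
  qed
  show ?case
    unfolding sum_segments_Cons length_Cons sum.atMost_Suc_shift
    by (simp only: list.map append_Cons bar.simps 1 2 ldif.simps consw_zero add_0_left add_ac)
qed

lemma \<tau>_add: "\<tau> (v + w) = \<tau> v + \<tau> w" and \<tau>_zero [simp]: "\<tau> 0 = 0" and \<tau>_bas: "\<tau> (bas z) = bas (word z)"
  by (simp_all add: \<tau>_def lin_add)

lemma \<tau>_sum: "\<tau> (\<Sum>i\<in>I. f i) = (\<Sum>i\<in>I. \<tau> (f i))"
  by (simp add: \<tau>_def lin_sum)

lemma \<tau>_lin: "\<tau> (lin f v) = lin (\<lambda>x. \<tau> (f x)) v"
  by (simp add: \<tau>_def lin_lin)

lemma coef_K_D:
  "coef K [] (Tens x as y) [] =
     (\<Sum>i\<le>length as. lin (\<lambda>x'. bas (Tens x' (drop i as) y)) (coef M [] x (take i as))) +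
     (\<Sum>(i, j)\<in>segments as. lin (\<lambda>a. bas (Tens x (take i as @ a # drop j as) y)) (acoef B (drop i (take j as)))) +
     (\<Sum>i\<le>length as. lin (\<lambda>y'. bas (Tens x (take i as) y')) (coef N (drop i as) y []))"
  by (simp add: coef_K tensor_coef_def)

lemma coef_K_L: "coef K [a] (Tens x as y) [] = lin (\<lambda>x'. bas (Tens x' as y)) (coef M [a] x [])"
proof -
  have "coef K [a] (Tens x as y) [] = (\<Sum>i\<le>length as. lin (\<lambda>x'. bas (Tens x' (drop i as) y)) (coef M [a] x (take i as)))"
    by (simp add: coef_K tensor_coef_def)
  also have "\<dots> = (\<Sum>i\<in>{0}. lin (\<lambda>x'. bas (Tens x' (drop i as) y)) (coef M [a] x (take i as)))"
  proof (rule sum.mono_neutral_right)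
    show "\<forall>i\<in>{..length as} - {0}. lin (\<lambda>x'. bas (Tens x' (drop i as) y)) (coef M [a] x (take i as)) = 0"
    proof
      fix i assume "i \<in> {..length as} - {0}"
      then have "take i as \<noteq> []" by auto
      then show "lin (\<lambda>x'. bas (Tens x' (drop i as) y)) (coef M [a] x (take i as)) = 0"
        by (simp add: coef_M_short)
    qed
  qed auto
  finally show ?thesis by simp
qed

lemma coef_K_R: "coef K [] (Tens x as y) [b] = lin (\<lambda>y'. bas (Tens x as y')) (coef N [] y [b])"
proof -
  have "coef K [] (Tens x as y) [b] = (\<Sum>i\<le>length as. lin (\<lambda>y'. bas (Tens x (take i as) y')) (coef N (drop i as) y [b]))"
    by (simp add: coef_K tensor_coef_def)
  also have "\<dots> = (\<Sum>i\<in>{length as}. lin (\<lambda>y'. bas (Tens x (take i as) y')) (coef N (drop i as) y [b]))"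
    by (rule sum.mono_neutral_right) (auto simp: coef_N_short)
  finally show ?thesis by simp
qed

lemma \<tau>_D: "\<tau> (coef K [] (Tens x as y) []) = bar (word (Tens x as y))"
proof -
  let ?l = "map LA as @ [LN y]"
  have c: "consw (bas (LM x)) (\<Sum>i\<in>I. f i) = (\<Sum>i\<in>I. consw (bas (LM x)) (f i))" for f and I :: "'i set"
    by (induction I rule: infinite_finite_induct) (simp_all add: consw_add)
  have cl: "consw (bas (LM x)) (lin f v) = lin (\<lambda>z. consw (bas (LM x)) (f z)) v" for f and v :: "'y vec"
    by (simp add: consw_def lin_lin)
  have 1: "(\<Sum>i\<le>length as. lin (\<lambda>x'. bas (word (Tens x' (drop i as) y))) (coef M [] x (take i as))) =
      consw (ldif (LM x)) (bas ?l) + push (bas (LM x)) ?l"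
    by (subst sum_left_action[of "\<lambda>i. lin (\<lambda>x'. bas (word (Tens x' (drop i as) y)))"])
       (cases as; simp add: word_def consw_def lin_pull mulv_bas)+
  have 2: "(\<Sum>(i, j)\<in>segments as. lin (\<lambda>a. bas (word (Tens x (take i as @ a # drop j as) y))) (acoef B (drop i (take j as)))) +
      (\<Sum>i\<le>length as. lin (\<lambda>y'. bas (word (Tens x (take i as) y'))) (coef N (drop i as) y [])) =
      consw (bas (LM x)) (bar ?l)"
    unfolding bar_suffix
    by (simp add: consw_add c split_def cl consw_bas word_def)
  have "\<tau> (coef K [] (Tens x as y) []) = (consw (ldif (LM x)) (bas ?l) + push (bas (LM x)) ?l) + consw (bas (LM x)) (bar ?l)"
    unfolding coef_K_D
    by (simp add: \<tau>_add \<tau>_sum split_def \<tau>_lin \<tau>_bas 1 add.assoc 2[unfolded split_def])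
  then show ?thesis by (simp add: word_def)
qed

text \<open>Pure tensors, extended bilinearly in the outer factors. Both actions affect these
  factors alone, so relations between the actions can be verified here without words.\<close>

definition E where "E v as w = lin (\<lambda>x. lin (\<lambda>y. bas (Tens x as y)) w) v"

lemma E_bas: "E (bas x) as (bas y) = bas (Tens x as y)"
  by (simp add: E_def)

lemma L_E: "Lop K a (E v as w) = E (Lop M a v) as w"
proof -
  have "Lop K a (E v as w) = lin (\<lambda>g. lin (\<lambda>x. lin (\<lambda>y. lin (\<lambda>x'. bas (Tens x' as y)) (coef M [g] x [])) w) v) a"
    by (simp add: Lop_def E_def lin_lin coef_K_L)
  also have "\<dots> = lin (\<lambda>g. lin (\<lambda>x. lin (\<lambda>x'. lin (\<lambda>y. bas (Tens x' as y)) w) (coef M [g] x [])) v) a"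
    by (subst lin_lin_swap) simp
  finally show ?thesis by (simp add: E_def Lop_def lin_lin)
qed

lemma R_E: "Rop K (E v as w) b = E v as (Rop N w b)"
proof -
  have "Rop K (E v as w) b = lin (\<lambda>x. lin (\<lambda>y. lin (\<lambda>g. lin (\<lambda>y'. bas (Tens x as y')) (coef N [] y [g])) b) w) v"
    by (simp add: Rop_def E_def lin_lin coef_K_R)
  then show ?thesis by (simp add: E_def Rop_def lin_lin)
qed

section \<open>The two actions as derivations on words\<close>

fun left_letter :: "'g \<Rightarrow> ('g, 'g mgen) letter \<Rightarrow> ('g, 'g mgen) letter vec" where
  "left_letter a (LM x) = lin (\<lambda>x'. bas (LM x')) (coef M [a] x [])"
| "left_letter a _ = 0"

fun right_letter :: "'g \<Rightarrow> ('g, 'g mgen) letter \<Rightarrow> ('g, 'g mgen) letter vec" where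
  "right_letter b (LN y) = lin (\<lambda>y'. bas (LN y')) (coef N [] y [b])"
| "right_letter b _ = 0"

lemma leibniz_ext_suffix_left: "leibniz_ext (left_letter a) (map LA as @ [LN y]) = 0"
  by (induction as) simp_all

lemma leibniz_ext_suffix_right:
  "leibniz_ext (right_letter b) (map LA as @ [LN y]) = lin (\<lambda>y'. bas (map LA as @ [LN y'])) (coef N [] y [b])"
  by (induction as) (simp_all add: consw_def lin_pull lin_lin)

lemma \<tau>_L: "v \<in> span_of (gens K) \<Longrightarrow> \<tau> (Lop K (bas a) v) = lin (leibniz_ext (left_letter a)) (\<tau> v)"
proof (induction v rule: span_of_induct)
  case (bas_add z v)
  then obtain x as y where z: "z = Tens x as y" by (auto simp: gens_K)
  have "\<tau> (coef K [a] z []) = leibniz_ext (left_letter a) (word z)"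
    by (simp add: z coef_K_L \<tau>_lin \<tau>_bas) (simp add: word_def leibniz_ext_suffix_left consw_def lin_pull)
  then show ?case using bas_add by (simp add: Lop_add \<tau>_add lin_add op_bas \<tau>_bas)
qed simp

lemma \<tau>_R: "v \<in> span_of (gens K) \<Longrightarrow> \<tau> (Rop K v (bas b)) = lin (leibniz_ext (right_letter b)) (\<tau> v)"
proof (induction v rule: span_of_induct)
  case (bas_add z v)
  then obtain x as y where z: "z = Tens x as y" by (auto simp: gens_K)
  have "\<tau> (coef K [] z [b]) = leibniz_ext (right_letter b) (word z)"
    by (simp add: z coef_K_R \<tau>_lin \<tau>_bas) (simp add: word_def leibniz_ext_suffix_right consw_def lin_lin)
  then show ?case using bas_add by (simp add: Rop_add \<tau>_add lin_add op_bas \<tau>_bas)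
qed simp

lemma \<tau>_Dop: "v \<in> span_of (gens K) \<Longrightarrow> \<tau> (Dop K v) = lin bar (\<tau> v)"
proof (induction v rule: span_of_induct)
  case (bas_add z v)
  then obtain x as y where z: "z = Tens x as y" by (auto simp: gens_K)
  show ?case using bas_add by (simp add: Dop_add \<tau>_add lin_add op_bas \<tau>_bas \<tau>_D z)
qed simp

lemma E_closed: "v \<in> span_of (gens M) \<Longrightarrow> as \<in> lists (agens B) \<Longrightarrow> w \<in> span_of (gens N) \<Longrightarrow> E v as w \<in> span_of (gens K)"
  unfolding E_def by (intro lin_in_span[where S = "gens M"] lin_in_span[where S = "gens N"]) (auto simp: gens_K)

lemma coef_K_eq_E: "coef K [a] (Tens x as y) [] = E (coef M [a] x []) as (bas y)"
  "coef K [] (Tens x as y) [b] = E (bas x) as (coef N [] y [b])"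
  by (simp_all add: coef_K_L coef_K_R E_def)

text \<open>Relations with the differential are carried to words, where they are
  \<open>bar_bar\<close> and \<open>bar_leibniz_ext\<close>. Relations between the actions come from
  the outer factors by \<open>L_E\<close> and \<open>R_E\<close>.\<close>

lemma dg_bimod_tensor: "dg_bimod B u K"
proof (rule dg_bimod.intro)
  show "based_algebra B u" by (rule M.based_algebra_axioms)
  have D_closed: "coef K [] z [] \<in> span_of (gens K)" if gz: "z \<in> gens K" for z
  proof -
    obtain x as y where z: "z = Tens x as y" "x \<in> gens M" "as \<in> lists (agens B)" "y \<in> gens N"
      using gz unfolding gens_K by blast
    have 1: "coef M [] x (take i as) \<in> span_of (gens M)" for i
      by (cases "[] :: 'g list" "take i as" rule: M.short_cases)
        (use lists_take[OF z(3), of i] in \<open>auto simp: z M.D_closed M.R_closed coef_M_short\<close>)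
    have 2: "coef N (drop i as) y [] \<in> span_of (gens N)" for i
      by (cases "drop i as" "[] :: 'g list" rule: M.short_cases)
        (use lists_drop[OF z(3), of i] in \<open>auto simp: z N.D_closed N.L_closed coef_N_short\<close>)
    have 3: "acoef B (drop i (take j as)) \<in> span_of (agens B)" for i j
    proof (cases "length (drop i (take j as)) = 2")
      case True
      then obtain a b where "drop i (take j as) = [a, b]"
        by (auto simp: length_Suc_conv eval_nat_numeral simp del: length_drop)
      then show ?thesis
        using lists_drop[OF lists_take[OF z(3)], of i j] by (auto intro: M.acoef_closed)
    qed (simp add: M.binary)
    show ?thesis
      unfolding z(1) coef_K_D
    proof (intro span_of_add span_of_sum)
      fix i
      show "lin (\<lambda>x'. bas (Tens x' (drop i as) y)) (coef M [] x (take i as)) \<in> span_of (gens K)"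
        by (rule lin_in_span[OF 1]) (simp add: gens_K z lists_drop[OF z(3)] del: in_lists_conv_set)
    next
      fix i
      show "lin (\<lambda>y'. bas (Tens x (take i as) y')) (coef N (drop i as) y []) \<in> span_of (gens K)"
        by (rule lin_in_span[OF 2]) (simp add: gens_K z lists_take[OF z(3)] del: in_lists_conv_set)
    next
      fix p
      show "(case p of (i, j) \<Rightarrow> lin (\<lambda>a. bas (Tens x (take i as @ a # drop j as) y)) (acoef B (drop i (take j as))))
          \<in> span_of (gens K)"
        unfolding split_def
        by (rule lin_in_span[OF 3]) (simp add: gens_K z lists_take[OF z(3)] lists_drop[OF z(3)] del: in_lists_conv_set)
    qed
  qed
  have L_closed: "coef K [a] z [] \<in> span_of (gens K)" and R_closed: "coef K [] z [a] \<in> span_of (gens K)"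
    if "z \<in> gens K" "a \<in> agens B" for z a
    using that by (auto simp: gens_K coef_K_eq_E simp del: in_lists_conv_set intro!: E_closed M.L_closed N.R_closed)
  have Dop_closed: "Dop K v \<in> span_of (gens K)" if "v \<in> span_of (gens K)" for v
    unfolding Dop_def by (rule lin_in_span[OF that]) (rule D_closed)
  have LopK_closed: "Lop K (bas a) v \<in> span_of (gens K)" if "a \<in> agens B" "v \<in> span_of (gens K)" for a v
    unfolding Lop_def by (simp, rule lin_in_span[OF that(2)]) (rule L_closed[OF _ that(1)])
  have RopK_closed: "Rop K v (bas a) \<in> span_of (gens K)" if "a \<in> agens B" "v \<in> span_of (gens K)" for a v
    unfolding Rop_def by (rule lin_in_span[OF that(2)], simp) (rule R_closed[OF _ that(1)])
  show "dg_bimod_axioms B u K"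
  proof
    show "short K"
      unfolding short_def
    proof (intro allI impI)
      fix cs ds :: "'g list" and z :: "'g mgen" assume len: "1 < length cs + length ds"
      show "coef K cs z ds = 0"
      proof (cases z)
        case (Tens x as y)
        have "length cs > 1 \<Longrightarrow> coef M cs x bs = 0" "length ds > 1 \<Longrightarrow> coef N bs y ds = 0" for bs
          using M.short N.short by (auto simp: short_def trans_less_add1 trans_less_add2)
        then show ?thesis
          using len by (auto simp: Tens coef_K tensor_coef_def intro!: sum.neutral)
      qed (simp_all add: coef_K tensor_coef_def)
    qed
    fix z assume z: "z \<in> gens K"
    then obtain x as y where z': "z = Tens x as y" "x \<in> gens M" "as \<in> lists (agens B)" "y \<in> gens N"
      unfolding gens_K by blast
    have zv: "bas z \<in> span_of (gens K)" using z by simp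
    note word = word_letters[OF z]
    have tD: "\<tau> (coef K [] z []) = bar (word z)" by (simp add: z'(1) \<tau>_D)
    show "coef K [] z [] \<in> span_of (gens K)" by (rule D_closed[OF z])
    show "Dop K (coef K [] z []) = 0"
    proof (rule \<tau>_inj)
      show "\<tau> (Dop K (coef K [] z [])) = \<tau> 0"
        by (simp only: \<tau>_Dop[OF D_closed[OF z]] tD bar_bar[OF word] \<tau>_zero)
    qed (auto intro: Dop_closed D_closed z)
    show "Lop K u (bas z) = bas z" "Rop K (bas z) u = bas z"
      using L_E[of u "bas x" as "bas y"] R_E[of "bas x" as "bas y" u] by (simp_all add: z' E_bas M.uL N.uR)
    fix a assume a: "a \<in> agens B"
    show "coef K [a] z [] \<in> span_of (gens K)" "coef K [] z [a] \<in> span_of (gens K)"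
      by (rule L_closed[OF z a] R_closed[OF z a])+
    have \<theta>L: "lin bar (leibniz_ext (left_letter a) (word z)) = lin (leibniz_ext (left_letter a)) (bar (word z))"
    proof (rule bar_leibniz_ext[OF _ _ word])
      fix s assume s: "s \<in> letters"
      show "lin (left_letter a) (ldif s) = lin ldif (left_letter a s)"
        using s M.DL[OF a] by (cases s) (auto simp: letters_def lin_pull lin_push Dop_def Lop_def)
      fix t assume t: "t \<in> letters"
      show "lin (left_letter a) (lmul s t) = lin (\<lambda>p. lmul p t) (left_letter a s) + lin (lmul s) (left_letter a t)"
        using s t M.LR[OF a] by (cases s; cases t) (auto simp: letters_def lin_pull lin_push Lop_def Rop_def)
    qed
    have \<theta>R: "lin bar (leibniz_ext (right_letter a) (word z)) = lin (leibniz_ext (right_letter a)) (bar (word z))"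
    proof (rule bar_leibniz_ext[OF _ _ word])
      fix s assume s: "s \<in> letters"
      show "lin (right_letter a) (ldif s) = lin ldif (right_letter a s)"
        using s N.DR[OF a] by (cases s) (auto simp: letters_def lin_pull lin_push Dop_def Rop_def)
      fix t assume t: "t \<in> letters"
      show "lin (right_letter a) (lmul s t) = lin (\<lambda>p. lmul p t) (right_letter a s) + lin (lmul s) (right_letter a t)"
        using s t N.LR[OF _ a] by (cases s; cases t) (auto simp: letters_def lin_pull lin_push Lop_def Rop_def)
    qed
    show "Dop K (coef K [a] z []) = Lop K (bas a) (coef K [] z [])"
    proof (rule \<tau>_inj)
      have "\<tau> (coef K [a] z []) = leibniz_ext (left_letter a) (word z)"
        using \<tau>_L[OF zv, of a] by (simp add: op_bas \<tau>_bas)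
      then show "\<tau> (Dop K (coef K [a] z [])) = \<tau> (Lop K (bas a) (coef K [] z []))"
        by (simp only: \<tau>_Dop[OF L_closed[OF z a]] \<tau>_L[OF D_closed[OF z]] tD \<theta>L)
    qed (auto intro: Dop_closed D_closed L_closed LopK_closed z a)
    show "Dop K (coef K [] z [a]) = Rop K (coef K [] z []) (bas a)"
    proof (rule \<tau>_inj)
      have "\<tau> (coef K [] z [a]) = leibniz_ext (right_letter a) (word z)"
        using \<tau>_R[OF zv, of a] by (simp add: op_bas \<tau>_bas)
      then show "\<tau> (Dop K (coef K [] z [a])) = \<tau> (Rop K (coef K [] z []) (bas a))"
        by (simp only: \<tau>_Dop[OF R_closed[OF z a]] \<tau>_R[OF D_closed[OF z]] tD \<theta>R)
    qed (auto intro: Dop_closed D_closed R_closed RopK_closed z a)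
    fix b assume b: "b \<in> agens B"
    show "Lop K (acoef B [a, b]) (bas z) = Lop K (bas a) (coef K [b] z [])"
      using L_E[of _ "bas x" as "bas y"] by (simp add: z' E_bas coef_K_eq_E L_E M.LL a b)
    show "Rop K (bas z) (acoef B [a, b]) = Rop K (coef K [] z [a]) (bas b)"
      using R_E[of "bas x" as "bas y"] by (simp add: z' E_bas coef_K_eq_E R_E N.RR a b)
    show "Lop K (bas a) (coef K [] z [b]) = Rop K (coef K [a] z []) (bas b)"
      by (simp add: z' coef_K_eq_E L_E R_E op_bas)
  qed
qed

end

section \<open>The elementary bimodules\<close>

lemma amul_sum_left: "amul B (\<Sum>i\<in>I. f i) w = (\<Sum>i\<in>I. amul B (f i) w)"
  by (simp add: amul_def lin_sum)

lemma amul_sum_right: "amul B w (\<Sum>i\<in>I. f i) = (\<Sum>i\<in>I. amul B w (f i))"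
  by (induction I rule: infinite_finite_induct) (simp_all add: amul_add_right)

lemma Lop_sum: "Lop K (\<Sum>i\<in>I. f i) w = (\<Sum>i\<in>I. Lop K (f i) w)"
  by (induction I rule: infinite_finite_induct) (simp_all add: Lop_add)

lemma Rop_sum: "Rop K w (\<Sum>i\<in>I. f i) = (\<Sum>i\<in>I. Rop K w (f i))"
  by (induction I rule: infinite_finite_induct) (simp_all add: Rop_add)

section \<open>The two algebras and their units\<close>

definition kh_unit :: "nat \<Rightarrow> kh_gen vec" where
  "kh_unit m = (\<Sum>i\<le>m. bas (One i i))"

definition hf_unit :: "nat \<Rightarrow> hf_gen vec" where
  "hf_unit m = (\<Sum>i\<le>m. bas (HOne i))"

lemma agens_kh_alg [simp]:
  "One i j \<in> agens (kh_alg m) \<longleftrightarrow> j \<le> i \<and> i \<le> m" "X i j \<in> agens (kh_alg m) \<longleftrightarrow> j < i \<and> i \<le> m"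
  by (auto simp: kh_alg_def)

lemma acoef_kh_alg: "acoef (kh_alg m) [] = 0" "acoef (kh_alg m) [a] = 0" "acoef (kh_alg m) [a, b] = kh_mul a b"
  "acoef (kh_alg m) (a # b # c # gs) = 0"
  by (simp_all add: kh_alg_def)

lemma agens_hf_alg [simp]:
  "HOne i \<in> agens (hf_alg m) \<longleftrightarrow> i \<le> m" "Rho i j \<in> agens (hf_alg m) \<longleftrightarrow> j < i \<and> i \<le> m"
  "Sig i j \<in> agens (hf_alg m) \<longleftrightarrow> j < i \<and> i \<le> m"
  by (auto simp: hf_alg_def)

lemma acoef_hf_alg: "acoef (hf_alg m) [] = 0" "acoef (hf_alg m) [a] = 0" "acoef (hf_alg m) [a, b] = hf_mul a b"
  "acoef (hf_alg m) (a # b # c # gs) = 0"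
  by (simp_all add: hf_alg_def)

lemma based_algebra_kh: "based_algebra (kh_alg m) (kh_unit m)"
proof
  fix gs :: "kh_gen list" assume "length gs \<noteq> 2"
  then show "acoef (kh_alg m) gs = 0"
    by (cases gs; cases "tl gs"; cases "tl (tl gs)") (auto simp: acoef_kh_alg)
next
  fix a b assume ab: "a \<in> agens (kh_alg m)" "b \<in> agens (kh_alg m)"
  show "acoef (kh_alg m) [a, b] \<in> span_of (agens (kh_alg m))"
    using ab by (cases a; cases b) (auto simp: acoef_kh_alg)
  fix c assume "c \<in> agens (kh_alg m)"
  then show "amul (kh_alg m) (acoef (kh_alg m) [a, b]) (bas c) = amul (kh_alg m) (bas a) (acoef (kh_alg m) [b, c])"
    by (cases a; cases b; cases c) (auto simp: acoef_kh_alg amul_def)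
next
  show "kh_unit m \<in> span_of (agens (kh_alg m))"
    unfolding kh_unit_def by (rule span_of_sum) simp
next
  fix a assume a: "a \<in> agens (kh_alg m)"
  have s: "(\<Sum>i\<le>m. if i = j then v else 0) = (if j \<le> m then v else 0)" "(\<Sum>i\<le>m. if j = i then v else 0) = (if j \<le> m then v else 0)"
    for j and v :: "kh_gen vec" by simp_all
  show "amul (kh_alg m) (kh_unit m) (bas a) = bas a" "amul (kh_alg m) (bas a) (kh_unit m) = bas a"
    using a by (cases a; simp add: kh_unit_def amul_sum_left amul_sum_right op_bas acoef_kh_alg s cong: if_cong)+
qed

lemma based_algebra_hf: "based_algebra (hf_alg m) (hf_unit m)"
proof
  fix gs :: "hf_gen list" assume "length gs \<noteq> 2"
  then show "acoef (hf_alg m) gs = 0"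
    by (cases gs; cases "tl gs"; cases "tl (tl gs)") (auto simp: acoef_hf_alg)
next
  fix a b assume ab: "a \<in> agens (hf_alg m)" "b \<in> agens (hf_alg m)"
  show "acoef (hf_alg m) [a, b] \<in> span_of (agens (hf_alg m))"
    using ab by (cases a; cases b) (auto simp: acoef_hf_alg)
  fix c assume "c \<in> agens (hf_alg m)"
  then show "amul (hf_alg m) (acoef (hf_alg m) [a, b]) (bas c) = amul (hf_alg m) (bas a) (acoef (hf_alg m) [b, c])"
    by (cases a; cases b; cases c) (auto simp: acoef_hf_alg amul_def)
next
  show "hf_unit m \<in> span_of (agens (hf_alg m))"
    unfolding hf_unit_def by (rule span_of_sum) simp
next
  fix a assume a: "a \<in> agens (hf_alg m)"
  show "amul (hf_alg m) (hf_unit m) (bas a) = bas a" "amul (hf_alg m) (bas a) (hf_unit m) = bas a"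
    using a by (cases a; simp add: hf_unit_def amul_sum_left amul_sum_right op_bas acoef_hf_alg cong: if_cong)+
qed

section \<open>Cones on generators\<close>

lemma gens_cone [simp]: "gens (mapping_cone M N f) = gens M \<union> gens N"
  by (simp add: mapping_cone_def)

lemma gens_diagonal [simp]: "Alg b \<in> gens (diagonal B) \<longleftrightarrow> b \<in> agens B" "PP p q \<notin> gens (diagonal B)"
  "Tens x as y \<notin> gens (diagonal B)"
  by (auto simp: diagonal_def)

lemma gens_outer [simp]: "Alg b \<notin> gens (outer_bimod l r)" "PP p q \<in> gens (outer_bimod l r)"
  "Tens x as y \<notin> gens (outer_bimod l r)"
  by (auto simp: outer_bimod_def)

lemma coef_cone: "coef (mapping_cone M N f) as x bs = (if x \<in> gens M then coef M as x bs + f as x bs else coef N as x bs)"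
  by (simp add: mapping_cone_def)

lemma coef_diagonal: "coef (diagonal B) as (Alg b) bs = lin (\<lambda>c. bas (Alg c)) (acoef B (as @ b # bs))"
  by (simp add: diagonal_def)

lemma coef_outer: "coef (outer_bimod l r) [a] (PP p q) [] = lin (\<lambda>p'. bas (PP p' q)) (l a p)"
  "coef (outer_bimod l r) [] (PP p q) [b] = lin (\<lambda>q'. bas (PP p q')) (r q b)"
  "coef (outer_bimod l r) [] (PP p q) [] = 0"
  by (simp_all add: outer_bimod_def)

lemma short_outer: "length as + length bs > 1 \<Longrightarrow> coef (outer_bimod l r) as x bs = 0"
  by (cases as; cases bs; cases "tl as"; cases "tl bs"; cases x) (auto simp: outer_bimod_def)

lemma (in based_algebra) short_diagonal: "length as + length bs > 1 \<Longrightarrow> coef (diagonal B) as x bs = 0"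
  by (cases x) (auto simp: diagonal_def binary)

lemma short_gamma: "length as + length bs > 1 \<Longrightarrow> gamma l as x bs = 0"
  by (cases as; cases bs; cases x) (auto simp: gamma_def)

lemma short_beta: "length as + length bs > 1 \<Longrightarrow> beta bl br as x bs = 0"
  by (cases as; cases bs; cases "tl as"; cases "tl bs"; cases x) (auto simp: beta_def)

lemma gamma_simps: "gamma l [] (Alg b) [] = lin (\<lambda>p. bas (PP p U)) (l b Ustar) + lin (\<lambda>p. bas (PP p V)) (l b Vstar)"
  "gamma l [a] x [] = 0" "gamma l [] x [a] = 0"
  by (cases x; simp add: gamma_def)+

lemma beta_simps: "beta bl br [a] (PP p q) [] = lin (\<lambda>c. bas (Alg c)) (bl a p q)"
  "beta bl br [] (PP p q) [b] = lin (\<lambda>c. bas (Alg c)) (br p q b)"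
  "beta bl br [] x [] = 0"
  by (cases x; simp add: beta_def)+

lemma short_cone:
  assumes "short M" "short N" "\<And>as x bs. length as + length bs > 1 \<Longrightarrow> f as x bs = 0"
  shows "short (mapping_cone M N f)"
  using assms by (auto simp: short_def coef_cone)

lemmas elementary_simps = coef_cone coef_diagonal coef_outer gamma_simps beta_simps lin_if

lemmas kh_simps = elementary_simps acoef_kh_alg

lemmas hf_simps = elementary_simps acoef_hf_alg

lemma bas_eq_iff [simp]: "bas x = bas y \<longleftrightarrow> x = y"
  by (metis lookup_single_eq lookup_single_not_eq zero_neq_one)

lemma cone_cases:
  assumes "x \<in> gens (diagonal B) \<union> gens (outer_bimod l r)"
  obtains b where "x = Alg b" "b \<in> agens B" | "x = PP Ustar U" | "x = PP Ustar V" | "x = PP Vstar U" | "x = PP Vstar V"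
proof (cases x)
  case (PP p q)
  then show ?thesis using that by (cases p; cases q) auto
qed (use assms that in auto)

lemma kh_agens_cases:
  assumes "b \<in> agens (kh_alg m)"
  obtains i j where "b = One i j" "j \<le> i" "i \<le> m" | i j where "b = X i j" "j < i" "i \<le> m"
  using assms by (cases b) auto

lemma hf_agens_cases:
  assumes "b \<in> agens (hf_alg m)"
  obtains i where "b = HOne i" "i \<le> m" | i j where "b = Rho i j" "j < i" "i \<le> m"
    | i j where "b = Sig i j" "j < i" "i \<le> m"
  using assms by (cases b) auto

lemma kh_cone_cases:
  assumes "x \<in> gens (diagonal (kh_alg m)) \<union> gens (outer_bimod l r)"
  obtains i j where "x = Alg (One i j)" "j \<le> i" "i \<le> m" | i j where "x = Alg (X i j)" "j < i" "i \<le> m" | "x = PP Ustar U" | "x = PP Ustar V" | "x = PP Vstar U" | "x = PP Vstar V"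
  by (rule cone_cases[OF assms]) (auto elim!: kh_agens_cases that)

lemma hf_cone_cases:
  assumes "x \<in> gens (diagonal (hf_alg m)) \<union> gens (outer_bimod l r)"
  obtains i where "x = Alg (HOne i)" "i \<le> m" | i j where "x = Alg (Rho i j)" "j < i" "i \<le> m" | i j where "x = Alg (Sig i j)" "j < i" "i \<le> m" | "x = PP Ustar U" | "x = PP Ustar V" | "x = PP Vstar U" | "x = PP Vstar V"
  by (rule cone_cases[OF assms]) (auto elim!: hf_agens_cases that)

text \<open>A case check on generators. The cone is of a strict map, which appears in the
  differential; \<open>DL\<close> and \<open>DR\<close> therefore say that it is a bimodule map, and
  the remaining action relations concern the two summands separately.\<close>

lemma dg_bimod_kh_neg:
  assumes "1 \<le> k" "k \<le> m"
  shows "dg_bimod (kh_alg m) (kh_unit m) (kh_elementary m (SgInv k))"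
proof -
  \<comment> \<open>Writing k as a successor replaces the truncated difference k - 1 by a variable,
    so that index comparisons can be decided.\<close>
  obtain k' where k': "k = Suc k'" using assms by (cases k) auto
  note assms = assms[unfolded k']
  interpret based_algebra "kh_alg m" "kh_unit m" by (rule based_algebra_kh)
  let ?K = "kh_elementary m (SgInv k)"
  note ops = k' Dop_def Lop_def Rop_def kh_simps
  show ?thesis
  proof
    show "short ?K"
      unfolding kh_elementary.simps using short_diagonal short_outer short_gamma
      by (intro short_cone) (auto simp: short_def)
    fix x assume "x \<in> gens ?K"
    then have x: "x \<in> gens (diagonal (kh_alg m)) \<union> gens (outer_bimod (kh_left k) (kh_right k))"
      by auto
    show "coef ?K [] x [] \<in> span_of (gens ?K)"
      by (rule kh_cone_cases[OF x]; insert assms; simp add: ops span_of_add)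
    show "Dop ?K (coef ?K [] x []) = 0"
      by (rule kh_cone_cases[OF x]; insert assms; simp add: ops lin_add cong: if_cong)
    \<comment> \<open>\<open>?s\<close> and \<open>?t\<close> are the left and right idempotents of
      the generator \<open>x\<close>. Of the summands of the unit exactly these act nontrivially,
      and they act as the identity.\<close>
    let ?s = "case x of Alg b \<Rightarrow> (case b of One i j \<Rightarrow> i | X i j \<Rightarrow> i) | PP p q \<Rightarrow> (case p of Ustar \<Rightarrow> k | Vstar \<Rightarrow> k - 1)"
    let ?t = "case x of Alg b \<Rightarrow> (case b of One i j \<Rightarrow> j | X i j \<Rightarrow> j) | PP p q \<Rightarrow> (case q of U \<Rightarrow> k | V \<Rightarrow> k - 1)"
    have "coef ?K [One i i] x [] = (if i = ?s then bas x else 0)" for i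
      by (rule kh_cone_cases[OF x]; insert assms; simp add: ops cong: if_cong)
    moreover have "coef ?K [] x [One i i] = (if i = ?t then bas x else 0)" for i
      by (rule kh_cone_cases[OF x]; insert assms; simp add: ops cong: if_cong)
    moreover have "?s \<le> m" "?t \<le> m"
      by (rule kh_cone_cases[OF x]; insert assms; simp add: k')+
    ultimately show "Lop ?K (kh_unit m) (bas x) = bas x" "Rop ?K (bas x) (kh_unit m) = bas x"
      by (simp_all add: kh_unit_def Lop_sum Rop_sum op_bas)
    fix a assume a: "a \<in> agens (kh_alg m)"
    show "coef ?K [a] x [] \<in> span_of (gens ?K)"
      by (rule kh_cone_cases[OF x]; rule kh_agens_cases[OF a]; insert assms; simp add: ops span_of_add)
    show "coef ?K [] x [a] \<in> span_of (gens ?K)"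
      by (rule kh_cone_cases[OF x]; rule kh_agens_cases[OF a]; insert assms; simp add: ops span_of_add)
    show "Dop ?K (coef ?K [a] x []) = Lop ?K (bas a) (coef ?K [] x [])"
      by (rule kh_cone_cases[OF x]; rule kh_agens_cases[OF a]; insert assms; simp add: ops lin_add lin_fun_add cong: if_cong)
    show "Dop ?K (coef ?K [] x [a]) = Rop ?K (coef ?K [] x []) (bas a)"
      by (rule kh_cone_cases[OF x]; rule kh_agens_cases[OF a]; insert assms; simp add: ops lin_add lin_fun_add cong: if_cong)
    fix b assume b: "b \<in> agens (kh_alg m)"
    show "Lop ?K (acoef (kh_alg m) [a, b]) (bas x) = Lop ?K (bas a) (coef ?K [b] x [])"
      by (rule kh_cone_cases[OF x]; rule kh_agens_cases[OF a]; rule kh_agens_cases[OF b]; insert assms; simp add: ops lin_add lin_fun_add cong: if_cong)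
    show "Rop ?K (bas x) (acoef (kh_alg m) [a, b]) = Rop ?K (coef ?K [] x [a]) (bas b)"
      by (rule kh_cone_cases[OF x]; rule kh_agens_cases[OF a]; rule kh_agens_cases[OF b]; insert assms; simp add: ops lin_add lin_fun_add cong: if_cong)
    show "Lop ?K (bas a) (coef ?K [] x [b]) = Rop ?K (coef ?K [a] x []) (bas b)"
      by (rule kh_cone_cases[OF x]; rule kh_agens_cases[OF a]; rule kh_agens_cases[OF b]; insert assms; simp add: ops lin_add lin_fun_add cong: if_cong)
  qed
qed

text \<open>Every term of \<open>beta\<close> has one algebra input, so the differential of this
  cone is zero and the morphism equations of \<open>beta\<close> are contained in \<open>LL\<close>,
  \<open>RR\<close> and \<open>LR\<close>.\<close>

lemma dg_bimod_kh_pos: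
  assumes "1 \<le> k" "k \<le> m"
  shows "dg_bimod (kh_alg m) (kh_unit m) (kh_elementary m (Sg k))"
proof -
  obtain k' where k': "k = Suc k'" using assms by (cases k) auto
  note assms = assms[unfolded k']
  interpret based_algebra "kh_alg m" "kh_unit m" by (rule based_algebra_kh)
  let ?K = "kh_elementary m (Sg k)"
  note ops = k' Dop_def Lop_def Rop_def kh_simps
  show ?thesis
  proof
    show "short ?K"
      unfolding kh_elementary.simps using short_diagonal short_outer short_beta
      by (intro short_cone) (auto simp: short_def)
    fix x assume "x \<in> gens ?K"
    then have x: "x \<in> gens (diagonal (kh_alg m)) \<union> gens (outer_bimod (kh_left k) (kh_right k))"
      by auto
    show "coef ?K [] x [] \<in> span_of (gens ?K)"
      by (rule kh_cone_cases[OF x]; insert assms; simp add: ops span_of_add)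
    show "Dop ?K (coef ?K [] x []) = 0"
      by (rule kh_cone_cases[OF x]; insert assms; simp add: ops lin_add cong: if_cong)
    let ?s = "case x of Alg b \<Rightarrow> (case b of One i j \<Rightarrow> i | X i j \<Rightarrow> i) | PP p q \<Rightarrow> (case p of Ustar \<Rightarrow> k | Vstar \<Rightarrow> k - 1)"
    let ?t = "case x of Alg b \<Rightarrow> (case b of One i j \<Rightarrow> j | X i j \<Rightarrow> j) | PP p q \<Rightarrow> (case q of U \<Rightarrow> k | V \<Rightarrow> k - 1)"
    have "coef ?K [One i i] x [] = (if i = ?s then bas x else 0)" for i
      by (rule kh_cone_cases[OF x]; insert assms; simp add: ops cong: if_cong)
    moreover have "coef ?K [] x [One i i] = (if i = ?t then bas x else 0)" for i
      by (rule kh_cone_cases[OF x]; insert assms; simp add: ops cong: if_cong)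
    moreover have "?s \<le> m" "?t \<le> m"
      by (rule kh_cone_cases[OF x]; insert assms; simp add: k')+
    ultimately show "Lop ?K (kh_unit m) (bas x) = bas x" "Rop ?K (bas x) (kh_unit m) = bas x"
      by (simp_all add: kh_unit_def Lop_sum Rop_sum op_bas)
    fix a assume a: "a \<in> agens (kh_alg m)"
    show "coef ?K [a] x [] \<in> span_of (gens ?K)"
      by (rule kh_cone_cases[OF x]; rule kh_agens_cases[OF a]; insert assms; simp add: ops span_of_add)
    show "coef ?K [] x [a] \<in> span_of (gens ?K)"
      by (rule kh_cone_cases[OF x]; rule kh_agens_cases[OF a]; insert assms; simp add: ops span_of_add)
    show "Dop ?K (coef ?K [a] x []) = Lop ?K (bas a) (coef ?K [] x [])"
      by (rule kh_cone_cases[OF x]; rule kh_agens_cases[OF a]; insert assms; simp add: ops lin_add lin_fun_add cong: if_cong)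
    show "Dop ?K (coef ?K [] x [a]) = Rop ?K (coef ?K [] x []) (bas a)"
      by (rule kh_cone_cases[OF x]; rule kh_agens_cases[OF a]; insert assms; simp add: ops lin_add lin_fun_add cong: if_cong)
    fix b assume b: "b \<in> agens (kh_alg m)"
    show "Lop ?K (acoef (kh_alg m) [a, b]) (bas x) = Lop ?K (bas a) (coef ?K [b] x [])"
      by (rule kh_cone_cases[OF x]; rule kh_agens_cases[OF a]; rule kh_agens_cases[OF b]; insert assms; simp add: ops lin_add lin_fun_add cong: if_cong)
    show "Rop ?K (bas x) (acoef (kh_alg m) [a, b]) = Rop ?K (coef ?K [] x [a]) (bas b)"
      by (rule kh_cone_cases[OF x]; rule kh_agens_cases[OF a]; rule kh_agens_cases[OF b]; insert assms; simp add: ops lin_add lin_fun_add cong: if_cong)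
    show "Lop ?K (bas a) (coef ?K [] x [b]) = Rop ?K (coef ?K [a] x []) (bas b)"
      by (rule kh_cone_cases[OF x]; rule kh_agens_cases[OF a]; rule kh_agens_cases[OF b]; insert assms; simp add: ops lin_add lin_fun_add cong: if_cong)
  qed
qed

lemma dg_bimod_hf_neg:
  assumes "1 \<le> k" "k \<le> m"
  shows "dg_bimod (hf_alg m) (hf_unit m) (hf_elementary m (SgInv k))"
proof -
  obtain k' where k': "k = Suc k'" using assms by (cases k) auto
  note assms = assms[unfolded k']
  interpret based_algebra "hf_alg m" "hf_unit m" by (rule based_algebra_hf)
  let ?K = "hf_elementary m (SgInv k)"
  note ops = k' Dop_def Lop_def Rop_def hf_simps
  show ?thesis
  proof
    show "short ?K"
      unfolding hf_elementary.simps using short_diagonal short_outer short_gamma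
      by (intro short_cone) (auto simp: short_def)
    fix x assume "x \<in> gens ?K"
    then have x: "x \<in> gens (diagonal (hf_alg m)) \<union> gens (outer_bimod (hf_left k) (hf_right k))"
      by auto
    show "coef ?K [] x [] \<in> span_of (gens ?K)"
      by (rule hf_cone_cases[OF x]; insert assms; simp add: ops span_of_add)
    show "Dop ?K (coef ?K [] x []) = 0"
      by (rule hf_cone_cases[OF x]; insert assms; simp add: ops lin_add cong: if_cong)
    let ?s = "case x of Alg b \<Rightarrow> (case b of HOne i \<Rightarrow> i | Rho i j \<Rightarrow> i | Sig i j \<Rightarrow> i) | PP p q \<Rightarrow> (case p of Ustar \<Rightarrow> k | Vstar \<Rightarrow> k - 1)"
    let ?t = "case x of Alg b \<Rightarrow> (case b of HOne i \<Rightarrow> i | Rho i j \<Rightarrow> j | Sig i j \<Rightarrow> j) | PP p q \<Rightarrow> (case q of U \<Rightarrow> k | V \<Rightarrow> k - 1)"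
    have "coef ?K [HOne i] x [] = (if i = ?s then bas x else 0)" for i
      by (rule hf_cone_cases[OF x]; insert assms; simp add: ops cong: if_cong)
    moreover have "coef ?K [] x [HOne i] = (if i = ?t then bas x else 0)" for i
      by (rule hf_cone_cases[OF x]; insert assms; simp add: ops cong: if_cong)
    moreover have "?s \<le> m" "?t \<le> m"
      by (rule hf_cone_cases[OF x]; insert assms; simp add: k')+
    ultimately show "Lop ?K (hf_unit m) (bas x) = bas x" "Rop ?K (bas x) (hf_unit m) = bas x"
      by (simp_all add: hf_unit_def Lop_sum Rop_sum op_bas)
    fix a assume a: "a \<in> agens (hf_alg m)"
    show "coef ?K [a] x [] \<in> span_of (gens ?K)"
      by (rule hf_cone_cases[OF x]; rule hf_agens_cases[OF a]; insert assms; simp add: ops span_of_add)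
    show "coef ?K [] x [a] \<in> span_of (gens ?K)"
      by (rule hf_cone_cases[OF x]; rule hf_agens_cases[OF a]; insert assms; simp add: ops span_of_add)
    show "Dop ?K (coef ?K [a] x []) = Lop ?K (bas a) (coef ?K [] x [])"
      by (rule hf_cone_cases[OF x]; rule hf_agens_cases[OF a]; insert assms; simp add: ops lin_add lin_fun_add cong: if_cong)
    show "Dop ?K (coef ?K [] x [a]) = Rop ?K (coef ?K [] x []) (bas a)"
      by (rule hf_cone_cases[OF x]; rule hf_agens_cases[OF a]; insert assms; simp add: ops lin_add lin_fun_add cong: if_cong)
    fix b assume b: "b \<in> agens (hf_alg m)"
    show "Lop ?K (acoef (hf_alg m) [a, b]) (bas x) = Lop ?K (bas a) (coef ?K [b] x [])"
      by (rule hf_cone_cases[OF x]; rule hf_agens_cases[OF a]; rule hf_agens_cases[OF b]; insert assms; simp add: ops lin_add lin_fun_add cong: if_cong)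
    show "Rop ?K (bas x) (acoef (hf_alg m) [a, b]) = Rop ?K (coef ?K [] x [a]) (bas b)"
      by (rule hf_cone_cases[OF x]; rule hf_agens_cases[OF a]; rule hf_agens_cases[OF b]; insert assms; simp add: ops lin_add lin_fun_add cong: if_cong)
    show "Lop ?K (bas a) (coef ?K [] x [b]) = Rop ?K (coef ?K [a] x []) (bas b)"
      by (rule hf_cone_cases[OF x]; rule hf_agens_cases[OF a]; rule hf_agens_cases[OF b]; insert assms; simp add: ops lin_add lin_fun_add cong: if_cong)
  qed
qed

lemma dg_bimod_hf_pos:
  assumes "1 \<le> k" "k \<le> m"
  shows "dg_bimod (hf_alg m) (hf_unit m) (hf_elementary m (Sg k))"
proof -
  obtain k' where k': "k = Suc k'" using assms by (cases k) auto
  note assms = assms[unfolded k']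
  interpret based_algebra "hf_alg m" "hf_unit m" by (rule based_algebra_hf)
  let ?K = "hf_elementary m (Sg k)"
  note ops = k' Dop_def Lop_def Rop_def hf_simps
  show ?thesis
  proof
    show "short ?K"
      unfolding hf_elementary.simps using short_diagonal short_outer short_beta
      by (intro short_cone) (auto simp: short_def)
    fix x assume "x \<in> gens ?K"
    then have x: "x \<in> gens (diagonal (hf_alg m)) \<union> gens (outer_bimod (hf_left k) (hf_right k))"
      by auto
    show "coef ?K [] x [] \<in> span_of (gens ?K)"
      by (rule hf_cone_cases[OF x]; insert assms; simp add: ops span_of_add)
    show "Dop ?K (coef ?K [] x []) = 0"
      by (rule hf_cone_cases[OF x]; insert assms; simp add: ops lin_add cong: if_cong)
    let ?s = "case x of Alg b \<Rightarrow> (case b of HOne i \<Rightarrow> i | Rho i j \<Rightarrow> i | Sig i j \<Rightarrow> i) | PP p q \<Rightarrow> (case p of Ustar \<Rightarrow> k | Vstar \<Rightarrow> k - 1)"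
    let ?t = "case x of Alg b \<Rightarrow> (case b of HOne i \<Rightarrow> i | Rho i j \<Rightarrow> j | Sig i j \<Rightarrow> j) | PP p q \<Rightarrow> (case q of U \<Rightarrow> k | V \<Rightarrow> k - 1)"
    have "coef ?K [HOne i] x [] = (if i = ?s then bas x else 0)" for i
      by (rule hf_cone_cases[OF x]; insert assms; simp add: ops cong: if_cong)
    moreover have "coef ?K [] x [HOne i] = (if i = ?t then bas x else 0)" for i
      by (rule hf_cone_cases[OF x]; insert assms; simp add: ops cong: if_cong)
    moreover have "?s \<le> m" "?t \<le> m"
      by (rule hf_cone_cases[OF x]; insert assms; simp add: k')+
    ultimately show "Lop ?K (hf_unit m) (bas x) = bas x" "Rop ?K (bas x) (hf_unit m) = bas x"
      by (simp_all add: hf_unit_def Lop_sum Rop_sum op_bas)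
    fix a assume a: "a \<in> agens (hf_alg m)"
    show "coef ?K [a] x [] \<in> span_of (gens ?K)"
      by (rule hf_cone_cases[OF x]; rule hf_agens_cases[OF a]; insert assms; simp add: ops span_of_add)
    show "coef ?K [] x [a] \<in> span_of (gens ?K)"
      by (rule hf_cone_cases[OF x]; rule hf_agens_cases[OF a]; insert assms; simp add: ops span_of_add)
    show "Dop ?K (coef ?K [a] x []) = Lop ?K (bas a) (coef ?K [] x [])"
      by (rule hf_cone_cases[OF x]; rule hf_agens_cases[OF a]; insert assms; simp add: ops lin_add lin_fun_add cong: if_cong)
    show "Dop ?K (coef ?K [] x [a]) = Rop ?K (coef ?K [] x []) (bas a)"
      by (rule hf_cone_cases[OF x]; rule hf_agens_cases[OF a]; insert assms; simp add: ops lin_add lin_fun_add cong: if_cong)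
    fix b assume b: "b \<in> agens (hf_alg m)"
    show "Lop ?K (acoef (hf_alg m) [a, b]) (bas x) = Lop ?K (bas a) (coef ?K [b] x [])"
      by (rule hf_cone_cases[OF x]; rule hf_agens_cases[OF a]; rule hf_agens_cases[OF b]; insert assms; simp add: ops lin_add lin_fun_add cong: if_cong)
    show "Rop ?K (bas x) (acoef (hf_alg m) [a, b]) = Rop ?K (coef ?K [] x [a]) (bas b)"
      by (rule hf_cone_cases[OF x]; rule hf_agens_cases[OF a]; rule hf_agens_cases[OF b]; insert assms; simp add: ops lin_add lin_fun_add cong: if_cong)
    show "Lop ?K (bas a) (coef ?K [] x [b]) = Rop ?K (coef ?K [a] x []) (bas b)"
      by (rule hf_cone_cases[OF x]; rule hf_agens_cases[OF a]; rule hf_agens_cases[OF b]; insert assms; simp add: ops lin_add lin_fun_add cong: if_cong)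
  qed
qed

lemma (in based_algebra) dg_bimod_diagonal: "dg_bimod B u (diagonal B)"
proof
  have R: "Rop (diagonal B) (lin (\<lambda>c. bas (Alg c)) v) w = lin (\<lambda>c. bas (Alg c)) (amul B v w)" for v w
    by (simp add: Rop_def amul_def lin_lin coef_diagonal)
  have L: "Lop (diagonal B) w (lin (\<lambda>c. bas (Alg c)) v) = lin (\<lambda>c. bas (Alg c)) (amul B w v)" for v w
    by (simp add: Lop_def amul_def lin_lin coef_diagonal)
  have D: "coef (diagonal B) [] x [] = 0" for x
    by (cases x) (simp_all add: diagonal_def binary)
  have cl: "lin (\<lambda>c. bas (Alg c)) v \<in> span_of (gens (diagonal B))" if "v \<in> Sp" for v
    by (rule lin_in_span[OF that]) simp
  show "short (diagonal B)" using short_diagonal by (simp add: short_def)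
  fix x assume "x \<in> gens (diagonal B)"
  then obtain b where b: "x = Alg b" "b \<in> agens B" by (auto simp: diagonal_def)
  have x: "bas x = lin (\<lambda>c. bas (Alg c)) (bas b)" by (simp add: b)
  show "coef (diagonal B) [] x [] \<in> span_of (gens (diagonal B))" "Dop (diagonal B) (coef (diagonal B) [] x []) = 0"
    by (simp_all add: D)
  show "Lop (diagonal B) u (bas x) = bas x" "Rop (diagonal B) (bas x) u = bas x"
    unfolding x L R using b by (simp_all add: u_left u_right)
  fix a assume a: "a \<in> agens B"
  show "coef (diagonal B) [a] x [] \<in> span_of (gens (diagonal B))" "coef (diagonal B) [] x [a] \<in> span_of (gens (diagonal B))"
    using a b by (simp_all add: coef_diagonal cl acoef_closed)
  show "Dop (diagonal B) (coef (diagonal B) [a] x []) = Lop (diagonal B) (bas a) (coef (diagonal B) [] x [])"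
    "Dop (diagonal B) (coef (diagonal B) [] x [a]) = Rop (diagonal B) (coef (diagonal B) [] x []) (bas a)"
    by (simp_all add: D Dop_def)
  fix c assume c: "c \<in> agens B"
  show "Lop (diagonal B) (acoef B [a, c]) (bas x) = Lop (diagonal B) (bas a) (coef (diagonal B) [c] x [])"
    unfolding x L using a b c by (simp add: coef_diagonal L assoc)
  show "Rop (diagonal B) (bas x) (acoef B [a, c]) = Rop (diagonal B) (coef (diagonal B) [] x [a]) (bas c)"
    unfolding x R using a b c by (simp add: coef_diagonal R assoc)
  show "Lop (diagonal B) (bas a) (coef (diagonal B) [] x [c]) = Rop (diagonal B) (coef (diagonal B) [a] x []) (bas c)"
    using a b c by (simp add: coef_diagonal L R assoc)
qed

section \<open>Bases adapted to a filtration\<close>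

lemma keys_sum_bas: "finite Y \<Longrightarrow> keys (\<Sum>x\<in>Y. bas x) = Y"
  by (induction Y rule: finite_induct) (auto simp: keys_add_bit)

definition homog :: "('x \<Rightarrow> int) \<Rightarrow> int \<Rightarrow> 'x vec \<Rightarrow> 'x vec" where
  "homog deg d v = lin (\<lambda>x. if deg x = d then bas x else 0) v"

lemma homog_add: "homog deg d (v + w) = homog deg d v + homog deg d w"
  by (simp add: homog_def lin_add)

lemma homog_zero [simp]: "homog deg d 0 = 0"
  by (simp add: homog_def)

lemma homog_sum: "homog deg d (\<Sum>i\<in>I. f i) = (\<Sum>i\<in>I. homog deg d (f i))"
  by (simp add: homog_def lin_sum)

lemma keys_homog: "keys (homog deg d v) = {x \<in> keys v. deg x = d}"
proof -
  have "homog deg d v = (\<Sum>x\<in>keys v. if deg x = d then bas x else 0)"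
    by (simp add: homog_def lin_def)
  also have "\<dots> = (\<Sum>x\<in>{x \<in> keys v. deg x = d}. bas x)"
    by (simp add: sum.inter_filter)
  finally show ?thesis by (simp add: keys_sum_bas)
qed

lemma homog_bas: "homog deg d (bas x) = (if deg x = d then bas x else 0)"
  by (simp add: homog_def)

lemma sum_homog:
  assumes "finite I" "deg ` keys v \<subseteq> I"
  shows "(\<Sum>d\<in>I. homog deg d v) = v"
proof -
  have "(\<Sum>d\<in>I. homog deg d v) = lin (\<lambda>x. \<Sum>d\<in>I. if deg x = d then bas x else 0) v"
    by (simp add: homog_def lin_fun_sum)
  also have "\<dots> = lin bas v"
    by (rule lin_cong) (use assms in auto)
  finally show ?thesis by simp
qed

lemma homog_eq_0_iff: "homog deg d v = 0 \<longleftrightarrow> d \<notin> deg ` keys v"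
proof -
  have "homog deg d v = 0 \<longleftrightarrow> keys (homog deg d v) = {}" by simp
  then show ?thesis by (auto simp: keys_homog simp del: Poly_Mapping.keys_eq_empty)
qed

lemma homog_of_homog: "v \<in> span_of {x \<in> S. deg x = e} \<Longrightarrow> homog deg d v = (if d = e then v else 0)"
  by (induction v rule: span_of_induct) (auto simp: homog_add homog_bas)

text \<open>\<open>V\<close> is the filtered space and \<open>span_of S\<close> the graded one,
  identified by the bijection \<open>\<Psi>\<close>; the filtration is the image of the one by
  degree. Keeping \<open>S\<close> apart from \<open>T\<close> lets \<open>S\<close> be the
  generators of the Khovanov object and \<open>T\<close> those of the Floer object.\<close>

locale adapted_basis =
  fixes V :: "('y vec, 'e) monoid_scheme" and S :: "'x set" and T :: "'y set" and deg :: "'x \<Rightarrow> int"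
    and \<Psi> :: "'x vec \<Rightarrow> 'y vec"
  assumes V: "carrier V = span_of T" "monoid.mult V = (+)" "\<one>\<^bsub>V\<^esub> = 0"
    and \<Psi>_add: "\<Psi> (v + w) = \<Psi> v + \<Psi> w"
    and \<Psi>_bij: "bij_betw \<Psi> (span_of S) (span_of T)"
begin

definition low :: "int \<Rightarrow> 'x vec set" where "low i = span_of {x \<in> S. deg x \<le> i}"

definition fil :: "int \<Rightarrow> 'y vec set" where "fil i = \<Psi> ` low i"

text \<open>The identification of the graded space with the associated graded of \<open>V\<close>:
  in degree d, the class of the component of degree d. Where that component is zero this is the
  trivial coset.\<close>

definition \<Theta> :: "'x vec \<Rightarrow> int \<Rightarrow> 'y vec set" where
  "\<Theta> v = (\<lambda>d. fil (d - 1) #>\<^bsub>V\<^esub> \<Psi> (homog deg d v))"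

lemma \<Psi>_zero [simp]: "\<Psi> 0 = 0"
  using \<Psi>_add[of 0 0] by simp

lemma \<Psi>_sum: "\<Psi> (\<Sum>i\<in>I. f i) = (\<Sum>i\<in>I. \<Psi> (f i))"
  by (induction I rule: infinite_finite_induct) (simp_all add: \<Psi>_add)

lemma \<Psi>_closed: "v \<in> span_of S \<Longrightarrow> \<Psi> v \<in> span_of T"
  using \<Psi>_bij by (auto simp: bij_betw_def)

lemma \<Psi>_inj: "v \<in> span_of S \<Longrightarrow> w \<in> span_of S \<Longrightarrow> \<Psi> v = \<Psi> w \<longleftrightarrow> v = w"
  using \<Psi>_bij by (auto simp: bij_betw_def inj_on_def)

lemma low_subset: "v \<in> low i \<Longrightarrow> v \<in> span_of S"
  unfolding low_def by (rule span_of_mono[rotated]) auto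

lemma low_mono: "i \<le> j \<Longrightarrow> v \<in> low i \<Longrightarrow> v \<in> low j"
  unfolding low_def by (rule span_of_mono[rotated]) auto

lemma low_zero [simp]: "0 \<in> low i" and low_add: "v \<in> low i \<Longrightarrow> w \<in> low i \<Longrightarrow> v + w \<in> low i"
  by (auto simp: low_def)

lemma fil_zero [simp]: "0 \<in> fil i"
  unfolding fil_def by (rule image_eqI[of _ _ 0]) simp_all

lemma fil_add: "a \<in> fil i \<Longrightarrow> b \<in> fil i \<Longrightarrow> a + b \<in> fil i"
  by (auto simp: fil_def simp flip: \<Psi>_add intro: low_add)

lemma fil_mono: "i \<le> j \<Longrightarrow> a \<in> fil i \<Longrightarrow> a \<in> fil j"
  by (auto simp: fil_def intro: low_mono)

lemma fil_subset: "a \<in> fil i \<Longrightarrow> a \<in> span_of T"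
  by (auto simp: fil_def intro: \<Psi>_closed low_subset)

lemma \<Psi>_fil_iff: "v \<in> span_of S \<Longrightarrow> \<Psi> v \<in> fil i \<longleftrightarrow> v \<in> low i"
  unfolding fil_def using \<Psi>_inj low_subset by blast

lemma comm_group_V: "comm_group V"
  by (rule comm_group_vec[OF V])

lemma inv_V: "a \<in> span_of T \<Longrightarrow> inv\<^bsub>V\<^esub> a = a"
proof -
  interpret comm_group V by (rule comm_group_V)
  show "a \<in> span_of T \<Longrightarrow> inv\<^bsub>V\<^esub> a = a"
    by (rule inv_equality) (simp_all add: V)
qed

lemma subgroup_fil: "subgroup (fil i) V"
  by (rule subgroup.intro) (auto simp: V inv_V fil_subset fil_add)

lemma fil_step: "fil i \<subseteq> fil (i + 1)"
  using fil_mono[of i "i + 1"] by auto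

lemma coset_eq: "F #>\<^bsub>V\<^esub> a = (\<lambda>f. f + a) ` F"
  by (auto simp: r_coset_def V)

text \<open>Subtraction is addition, so congruence modulo a step of the filtration is a condition on
  a sum. All computations with cosets go through this form.\<close>

lemma cst_mem: "b \<in> fil (d - 1) #>\<^bsub>V\<^esub> a \<longleftrightarrow> b + a \<in> fil (d - 1)"
proof
  assume "b \<in> fil (d - 1) #>\<^bsub>V\<^esub> a"
  then show "b + a \<in> fil (d - 1)" by (auto simp: coset_eq add.assoc)
next
  assume "b + a \<in> fil (d - 1)"
  moreover have "b = (b + a) + a" by (simp add: add.assoc)
  ultimately show "b \<in> fil (d - 1) #>\<^bsub>V\<^esub> a" unfolding coset_eq by blast
qed

lemma cst_eq_iff: "fil (d - 1) #>\<^bsub>V\<^esub> a = fil (d - 1) #>\<^bsub>V\<^esub> b \<longleftrightarrow> a + b \<in> fil (d - 1)"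
proof
  assume *: "fil (d - 1) #>\<^bsub>V\<^esub> a = fil (d - 1) #>\<^bsub>V\<^esub> b"
  have "a \<in> fil (d - 1) #>\<^bsub>V\<^esub> a" by (simp add: cst_mem)
  then show "a + b \<in> fil (d - 1)" unfolding * cst_mem .
next
  assume *: "a + b \<in> fil (d - 1)"
  have "c + a \<in> fil (d - 1) \<longleftrightarrow> c + b \<in> fil (d - 1)" for c
    using fil_add[OF _ *, of "c + a"] fil_add[OF _ *, of "c + b"] by (auto simp: ac_simps)
  then show "fil (d - 1) #>\<^bsub>V\<^esub> a = fil (d - 1) #>\<^bsub>V\<^esub> b"
    by (auto simp: cst_mem)
qed

lemma cst_zero: "fil (d - 1) #>\<^bsub>V\<^esub> 0 = fil (d - 1)"
  by (simp add: coset_eq)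

lemma cst_mult: "(fil (d - 1) #>\<^bsub>V\<^esub> a) <#>\<^bsub>V\<^esub> (fil (d - 1) #>\<^bsub>V\<^esub> b) = fil (d - 1) #>\<^bsub>V\<^esub> (a + b)"
proof (intro equalityI subsetI)
  fix c assume "c \<in> (fil (d - 1) #>\<^bsub>V\<^esub> a) <#>\<^bsub>V\<^esub> (fil (d - 1) #>\<^bsub>V\<^esub> b)"
  then obtain p q where "c = p + q" "p + a \<in> fil (d - 1)" "q + b \<in> fil (d - 1)"
    by (auto simp: set_mult_def V cst_mem)
  then show "c \<in> fil (d - 1) #>\<^bsub>V\<^esub> (a + b)"
    using fil_add[of "p + a" "d - 1" "q + b"] by (simp add: cst_mem ac_simps)
next
  fix c assume "c \<in> fil (d - 1) #>\<^bsub>V\<^esub> (a + b)"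
  then have "c + b \<in> fil (d - 1) #>\<^bsub>V\<^esub> a" "b \<in> fil (d - 1) #>\<^bsub>V\<^esub> b"
    by (simp_all add: cst_mem ac_simps)
  moreover have "c = (c + b) \<otimes>\<^bsub>V\<^esub> b" by (simp add: V add.assoc)
  ultimately show "c \<in> (fil (d - 1) #>\<^bsub>V\<^esub> a) <#>\<^bsub>V\<^esub> (fil (d - 1) #>\<^bsub>V\<^esub> b)"
    unfolding set_mult_def by blast
qed

lemma comm_group_gr_piece: "comm_group (gr_piece V fil d)"
proof -
  interpret comm_group V by (rule comm_group_V)
  have "subgroup (fil (d - 1)) (V\<lparr>carrier := fil d\<rparr>)"
    by (rule subgroup_incl[OF subgroup_fil subgroup_fil]) (use fil_mono[of "d - 1" d] in auto)
  then show ?thesis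
    unfolding gr_piece_def
    by (rule comm_group.abelian_FactGroup[OF comm_group_subgroup[OF comm_group_V subgroup_fil]])
qed

lemma carrier_gr_piece: "carrier (gr_piece V fil d) = (\<lambda>a. fil (d - 1) #>\<^bsub>V\<^esub> a) ` fil d"
  by (auto simp: gr_piece_def carrier_FactGroup)

lemma mult_gr_piece: "C \<otimes>\<^bsub>gr_piece V fil d\<^esub> C' = C <#>\<^bsub>V\<^esub> C'" and one_gr_piece: "\<one>\<^bsub>gr_piece V fil d\<^esub> = fil (d - 1)"
  by (simp_all add: gr_piece_def)

lemma vsum_gr_piece:
  assumes "finite I" "\<And>i. i \<in> I \<Longrightarrow> g i = fil (d - 1) #>\<^bsub>V\<^esub> a i" "\<And>i. i \<in> I \<Longrightarrow> a i \<in> fil d"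
  shows "vsum (gr_piece V fil d) g I = fil (d - 1) #>\<^bsub>V\<^esub> (\<Sum>i\<in>I. a i)"
proof -
  interpret comm_group "gr_piece V fil d" by (rule comm_group_gr_piece)
  show ?thesis using assms
  proof (induction I rule: finite_induct)
    case (insert i I)
    have "g \<in> I \<rightarrow> carrier (gr_piece V fil d)" "g i \<in> carrier (gr_piece V fil d)"
      using insert by (auto simp: carrier_gr_piece)
    then show ?case using insert by (simp add: mult_gr_piece cst_mult)
  qed (simp add: one_gr_piece cst_zero)
qed

lemma comm_group_gr_space: "comm_group (gr_space V fil)"
proof -
  have g: "group (gr_piece V fil d)" for d using comm_group_gr_piece by (simp add: comm_group_def)
  have "group (gr_space V fil)" unfolding gr_space_def by (rule sum_group) (rule g)
  then show ?thesis
  proof (rule group.group_comm_groupI)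
    fix \<alpha> \<beta> assume "\<alpha> \<in> carrier (gr_space V fil)" "\<beta> \<in> carrier (gr_space V fil)"
    then have "\<alpha> d \<in> carrier (gr_piece V fil d)" "\<beta> d \<in> carrier (gr_piece V fil d)" for d
      using g by (auto simp: gr_space_def carrier_sum_group)
    then show "\<alpha> \<otimes>\<^bsub>gr_space V fil\<^esub> \<beta> = \<beta> \<otimes>\<^bsub>gr_space V fil\<^esub> \<alpha>"
      using comm_group_gr_piece
      by (auto simp: gr_space_def comm_group_def comm_monoid.m_comm intro!: ext)
  qed
qed

lemma carrier_gr_space: "\<alpha> \<in> carrier (gr_space V fil) \<longleftrightarrow>
    (\<forall>d. \<alpha> d \<in> carrier (gr_piece V fil d)) \<and> finite {d. \<alpha> d \<noteq> fil (d - 1)}"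
proof -
  have "group (gr_piece V fil d)" for d using comm_group_gr_piece by (simp add: comm_group_def)
  then show ?thesis by (auto simp: gr_space_def carrier_sum_group one_gr_piece)
qed

lemma mult_gr_space: "\<alpha> \<otimes>\<^bsub>gr_space V fil\<^esub> \<beta> = (\<lambda>d. \<alpha> d <#>\<^bsub>V\<^esub> \<beta> d)"
  by (simp add: gr_space_def mult_gr_piece restrict_def)

lemma homog_closed: "v \<in> span_of S \<Longrightarrow> homog deg d v \<in> span_of {x \<in> S. deg x = d}"
  by (auto simp: span_of_def keys_homog)

lemma homog_low: "v \<in> span_of S \<Longrightarrow> homog deg d v \<in> low d"
  unfolding low_def by (rule span_of_mono[OF _ homog_closed]) auto

lemma homog_low_iff: "v \<in> span_of S \<Longrightarrow> homog deg d v \<in> low (d - 1) \<longleftrightarrow> homog deg d v = 0"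
proof
  assume "v \<in> span_of S" "homog deg d v \<in> low (d - 1)"
  then have "keys (homog deg d v) = {}" by (auto simp: low_def span_of_def keys_homog)
  then show "homog deg d v = 0" by simp
qed simp

lemma low_homog: "v \<in> low d \<Longrightarrow> v + homog deg d v \<in> low (d - 1)"
  by (auto simp: low_def span_of_def keys_add_bit keys_homog)

lemma \<Theta>_trivial_iff: "v \<in> span_of S \<Longrightarrow> \<Theta> v d = fil (d - 1) \<longleftrightarrow> homog deg d v = 0"
  using cst_eq_iff[of d "\<Psi> (homog deg d v)" 0] low_subset[OF homog_low]
  by (simp add: \<Theta>_def cst_zero \<Psi>_fil_iff homog_low_iff)

lemma \<Theta>_support: "v \<in> span_of S \<Longrightarrow> {d. \<Theta> v d \<noteq> fil (d - 1)} = deg ` keys v"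
  by (auto simp: \<Theta>_trivial_iff homog_eq_0_iff)

lemma \<Theta>_closed: "v \<in> span_of S \<Longrightarrow> \<Theta> v \<in> carrier (gr_space V fil)"
  unfolding carrier_gr_space \<Theta>_support
  by (auto simp: \<Theta>_def carrier_gr_piece fil_def intro!: imageI homog_low)

lemma \<Theta>_add: "\<Theta> (v + w) = \<Theta> v \<otimes>\<^bsub>gr_space V fil\<^esub> \<Theta> w"
  unfolding mult_gr_space by (rule ext) (simp add: \<Theta>_def homog_add \<Psi>_add cst_mult)

lemma \<Theta>_inj:
  assumes "v \<in> span_of S" "w \<in> span_of S" "\<Theta> v = \<Theta> w"
  shows "v = w"
proof -
  have vw: "v + w \<in> span_of S" using assms by auto
  have "homog deg d (v + w) = 0" for d
  proof -
    have "\<Psi> (homog deg d v) + \<Psi> (homog deg d w) \<in> fil (d - 1)"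
      using fun_cong[OF assms(3), of d] by (simp add: \<Theta>_def cst_eq_iff)
    then have "\<Psi> (homog deg d (v + w)) \<in> fil (d - 1)" by (simp add: homog_add \<Psi>_add)
    then show ?thesis using vw low_subset[OF homog_low[OF vw]] by (simp add: \<Psi>_fil_iff homog_low_iff)
  qed
  then have "v + w = 0"
    using sum_homog[of "deg ` keys (v + w)" deg "v + w"] by simp
  then show ?thesis by (simp add: vec_add_eq_0_iff)
qed

text \<open>Lift each of the finitely many nontrivial classes, keep the component of the lift in the
  degree of its class, and add up. What is discarded has lower degree and does not affect the
  class.\<close>

lemma \<Theta>_surj:
  assumes "\<alpha> \<in> carrier (gr_space V fil)"
  obtains v where "v \<in> span_of S" "\<Theta> v = \<alpha>"
proof -
  have "\<exists>w. w \<in> low d \<and> \<alpha> d = fil (d - 1) #>\<^bsub>V\<^esub> \<Psi> w" for d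
    using assms by (auto simp: carrier_gr_space carrier_gr_piece fil_def)
  then obtain w where w: "\<And>d. w d \<in> low d" "\<And>d. \<alpha> d = fil (d - 1) #>\<^bsub>V\<^esub> \<Psi> (w d)" by metis
  define I where "I = {d. \<alpha> d \<noteq> fil (d - 1)}"
  have I: "finite I" using assms by (simp add: carrier_gr_space I_def)
  define v where "v = (\<Sum>d\<in>I. homog deg d (w d))"
  have v: "v \<in> span_of S"
    unfolding v_def by (rule span_of_sum) (rule low_subset[OF homog_low[OF low_subset[OF w(1)]]])
  have hv: "homog deg d v = (if d \<in> I then homog deg d (w d) else 0)" for d
  proof -
    have "homog deg d v = (\<Sum>e\<in>I. if d = e then homog deg e (w e) else 0)"
      unfolding v_def homog_sum
      by (rule sum.cong) (simp_all add: homog_of_homog[OF homog_closed[OF low_subset[OF w(1)]]])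
    then show ?thesis using I by simp
  qed
  have "\<Theta> v = \<alpha>"
  proof (rule ext)
    fix d
    show "\<Theta> v d = \<alpha> d"
    proof (cases "d \<in> I")
      case True
      have "\<Psi> (homog deg d (w d)) + \<Psi> (w d) \<in> fil (d - 1)"
        using low_homog[OF w(1), of d] by (auto simp: fil_def add.commute simp flip: \<Psi>_add)
      then show ?thesis by (simp add: \<Theta>_def hv True w(2) cst_eq_iff)
    next
      case False
      then show ?thesis by (simp add: \<Theta>_def hv cst_zero I_def)
    qed
  qed
  with v show ?thesis by (rule that)
qed

text \<open>A representative consists of the prescribed leading component and some remainder of
  lower degree; operations on cosets are evaluated through this description.\<close>

lemma \<Theta>_mem: "v \<in> span_of S \<Longrightarrow> a \<in> \<Theta> v d \<Longrightarrow>
    \<exists>w. w \<in> low d \<and> a = \<Psi> w \<and> w + homog deg d v \<in> low (d - 1)"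
proof -
  assume v: "v \<in> span_of S" and "a \<in> \<Theta> v d"
  then have "a + \<Psi> (homog deg d v) \<in> fil (d - 1)" by (simp add: \<Theta>_def cst_mem)
  then obtain g where g: "g \<in> low (d - 1)" "a + \<Psi> (homog deg d v) = \<Psi> g" by (auto simp: fil_def)
  have "a = \<Psi> (g + homog deg d v)"
    using g(2) by (simp add: \<Psi>_add vec_eq_add_iff[symmetric] flip: vec_eq_add_iff)
  moreover have "g + homog deg d v \<in> low d"
    using g(1) homog_low[OF v] low_mono[of "d - 1" d] by (intro low_add) auto
  ultimately show ?thesis using g(1) by (intro exI[of _ "g + homog deg d v"]) (simp add: add.assoc)
qed

lemma \<Theta>_nonempty: "\<Psi> (homog deg d v) \<in> \<Theta> v d"
  by (simp add: \<Theta>_def cst_mem)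

lemma fil_bot: "(\<And>x. x \<in> S \<Longrightarrow> i < deg x) \<Longrightarrow> fil i = {0}"
proof -
  assume "\<And>x. x \<in> S \<Longrightarrow> i < deg x"
  then have e: "{x \<in> S. deg x \<le> i} = {}" by force
  have "low i = {0}" unfolding low_def e by (auto simp: span_of_def)
  then show "fil i = {0}" by (simp add: fil_def)
qed

lemma fil_exhaustive: "exhaustive V fil"
proof -
  have "\<exists>i. a \<in> fil i" if a: "a \<in> span_of T" for a
  proof -
    obtain v where v: "v \<in> span_of S" "a = \<Psi> v" using a \<Psi>_bij by (auto simp: bij_betw_def)
    obtain i where "\<forall>x\<in>keys v. deg x \<le> i"
      using finite_keys[of v] by (metis (no_types, lifting) Max_ge finite_imageI imageI)
    then have "v \<in> low i" using v(1) by (auto simp: low_def span_of_def)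
    then show ?thesis by (auto simp: v(2) fil_def)
  qed
  then show ?thesis using fil_subset by (auto simp: exhaustive_def V)
qed

end

text \<open>
  \<open>f0\<close> is homogeneous in the adapted bases and \<open>f\<close> agrees with it up to terms of lower filtration
  degree, so the map induced by \<open>f\<close> on the associated graded spaces is \<open>f0\<close>.
\<close>
locale linear_gr = M: adapted_basis V S T deg \<Psi>
  for V :: "('y vec, 'e) monoid_scheme" and S :: "'x set" and T deg \<Psi> +
  fixes f :: "'y vec \<Rightarrow> 'y vec" and f0 :: "'x vec \<Rightarrow> 'x vec"
  assumes f_add: "f (a + b) = f a + f b" and f0_add: "f0 (v + w) = f0 v + f0 w"
    and f0_homog: "x \<in> S \<Longrightarrow> f0 (bas x) \<in> span_of {y \<in> S. deg y = deg x}"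
    and f_lower: "x \<in> S \<Longrightarrow> f (\<Psi> (bas x)) + \<Psi> (f0 (bas x)) \<in> M.fil (deg x - 1)"
begin

lemma f_zero [simp]: "f 0 = 0" and f0_zero [simp]: "f0 0 = 0"
  using f_add[of 0 0] f0_add[of 0 0] by simp_all

lemma f0_low: "v \<in> M.low d \<Longrightarrow> f0 v \<in> M.low d"
  unfolding M.low_def
  by (induction v rule: span_of_induct) (auto simp: f0_add intro!: span_of_add span_of_mono[OF _ f0_homog])

lemma f_low: "v \<in> M.low d \<Longrightarrow> f (\<Psi> v) + \<Psi> (f0 v) \<in> M.fil (d - 1)"
  unfolding M.low_def
proof (induction v rule: span_of_induct)
  case (bas_add x v)
  have "f (\<Psi> (bas x)) + \<Psi> (f0 (bas x)) \<in> M.fil (d - 1)"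
    using bas_add by (intro M.fil_mono[OF _ f_lower]) auto
  then have "(f (\<Psi> (bas x)) + \<Psi> (f0 (bas x))) + (f (\<Psi> v) + \<Psi> (f0 v)) \<in> M.fil (d - 1)"
    by (rule M.fil_add[OF _ bas_add.IH])
  then show ?case by (simp add: M.\<Psi>_add f_add f0_add ac_simps)
qed simp

lemma f_fil: "a \<in> M.fil d \<Longrightarrow> f a \<in> M.fil d"
proof -
  assume "a \<in> M.fil d"
  then obtain v where v: "v \<in> M.low d" "a = \<Psi> v" by (auto simp: M.fil_def)
  have "(f (\<Psi> v) + \<Psi> (f0 v)) + \<Psi> (f0 v) \<in> M.fil d"
    by (rule M.fil_add[OF M.fil_mono[OF _ f_low[OF v(1)]]]) (use f0_low[OF v(1)] in \<open>auto simp: M.fil_def\<close>)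
  then show ?thesis by (simp add: v(2) add.assoc)
qed

lemma f0_homog_comm: "v \<in> span_of S \<Longrightarrow> homog deg d (f0 v) = f0 (homog deg d v)"
  by (induction v rule: span_of_induct)
    (auto simp: homog_add f0_add homog_bas homog_of_homog[OF f0_homog])

lemma f_coset:
  assumes v: "v \<in> span_of S"
  shows "M.fil (d - 1) <#>\<^bsub>V\<^esub> (f ` M.\<Theta> v d) = M.\<Theta> (f0 v) d"
proof -
  have 1: "f a + \<Psi> (f0 (homog deg d v)) \<in> M.fil (d - 1)" if a: "a \<in> M.\<Theta> v d" for a
  proof -
    obtain w where w: "w \<in> M.low d" "a = \<Psi> w" "w + homog deg d v \<in> M.low (d - 1)"
      using M.\<Theta>_mem[OF v a] by auto
    have "\<Psi> (f0 (w + homog deg d v)) \<in> M.fil (d - 1)"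
      using f0_low[OF w(3)] by (auto simp: M.fil_def)
    then have "(f (\<Psi> w) + \<Psi> (f0 w)) + \<Psi> (f0 (w + homog deg d v)) \<in> M.fil (d - 1)"
      by (rule M.fil_add[OF f_low[OF w(1)]])
    then show ?thesis by (simp add: w(2) M.\<Psi>_add f0_add ac_simps)
  qed
  show ?thesis
  proof (intro equalityI subsetI)
    fix c assume "c \<in> M.fil (d - 1) <#>\<^bsub>V\<^esub> (f ` M.\<Theta> v d)"
    then obtain g a where "c = g + f a" "g \<in> M.fil (d - 1)" "a \<in> M.\<Theta> v d"
      by (auto simp: set_mult_def M.V)
    then show "c \<in> M.\<Theta> (f0 v) d"
      using M.fil_add[OF _ 1, of g a] by (simp add: M.\<Theta>_def M.cst_mem f0_homog_comm v add.assoc)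
  next
    fix c assume c: "c \<in> M.\<Theta> (f0 v) d"
    let ?a = "\<Psi> (homog deg d v)"
    have "(c + \<Psi> (f0 (homog deg d v))) + (f ?a + \<Psi> (f0 (homog deg d v))) \<in> M.fil (d - 1)"
      by (rule M.fil_add; use c 1[OF M.\<Theta>_nonempty] in \<open>simp add: M.\<Theta>_def M.cst_mem f0_homog_comm v\<close>)
    then have "c + f ?a \<in> M.fil (d - 1)" by (simp add: ac_simps)
    moreover have "c = (c + f ?a) \<otimes>\<^bsub>V\<^esub> f ?a" by (simp add: M.V add.assoc)
    ultimately show "c \<in> M.fil (d - 1) <#>\<^bsub>V\<^esub> (f ` M.\<Theta> v d)"
      unfolding set_mult_def using M.\<Theta>_nonempty by blast
  qed
qed

end

text \<open>The analogue of \<open>linear_gr\<close> in two variables, for the product of the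
  algebra and the two actions on a bimodule.\<close>

locale bilinear_gr =
  A: adapted_basis V1 S1 T1 deg1 \<Psi>1 + B: adapted_basis V2 S2 T2 deg2 \<Psi>2 + C: adapted_basis V3 S3 T3 deg3 \<Psi>3
  for V1 :: "('y1 vec, 'e1) monoid_scheme" and S1 :: "'x1 set" and T1 deg1 \<Psi>1
  and V2 :: "('y2 vec, 'e2) monoid_scheme" and S2 :: "'x2 set" and T2 deg2 \<Psi>2
  and V3 :: "('y3 vec, 'e3) monoid_scheme" and S3 :: "'x3 set" and T3 deg3 \<Psi>3 +
  fixes f :: "'y1 vec \<Rightarrow> 'y2 vec \<Rightarrow> 'y3 vec" and f0 :: "'x1 vec \<Rightarrow> 'x2 vec \<Rightarrow> 'x3 vec"
  assumes f_add: "f (a + a') b = f a b + f a' b" "f a (b + b') = f a b + f a b'"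
    and f0_add: "f0 (v + v') w = f0 v w + f0 v' w" "f0 v (w + w') = f0 v w + f0 v w'"
    and f0_homog: "x \<in> S1 \<Longrightarrow> y \<in> S2 \<Longrightarrow> f0 (bas x) (bas y) \<in> span_of {z \<in> S3. deg3 z = deg1 x + deg2 y}"
    and f_lower: "x \<in> S1 \<Longrightarrow> y \<in> S2 \<Longrightarrow>
      f (\<Psi>1 (bas x)) (\<Psi>2 (bas y)) + \<Psi>3 (f0 (bas x) (bas y)) \<in> C.fil (deg1 x + deg2 y - 1)"
begin

lemma f_zero [simp]: "f 0 b = 0" "f a 0 = 0" and f0_zero [simp]: "f0 0 w = 0" "f0 v 0 = 0"
  using f_add(1)[of 0 0 b] f_add(2)[of a 0 0] f0_add(1)[of 0 0 w] f0_add(2)[of v 0 0] by simp_all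

lemma f0_sum: "f0 (\<Sum>i\<in>I. g i) w = (\<Sum>i\<in>I. f0 (g i) w)" "f0 v (\<Sum>i\<in>J. h i) = (\<Sum>i\<in>J. f0 v (h i))"
  by (induction I rule: infinite_finite_induct; simp add: f0_add)
     (induction J rule: infinite_finite_induct; simp add: f0_add)

lemma f0_homog': "v \<in> span_of {x \<in> S1. deg1 x = i} \<Longrightarrow> w \<in> span_of {x \<in> S2. deg2 x = j} \<Longrightarrow>
    f0 v w \<in> span_of {z \<in> S3. deg3 z = i + j}"
proof (induction v rule: span_of_induct)
  case (bas_add x v)
  from \<open>w \<in> span_of {x \<in> S2. deg2 x = j}\<close> have "f0 (bas x) w \<in> span_of {z \<in> S3. deg3 z = i + j}"
    by (induction w rule: span_of_induct) (use bas_add f0_homog in \<open>auto simp: f0_add\<close>)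
  then show ?case using bas_add by (auto simp: f0_add)
qed simp

lemma f0_low: "v \<in> A.low i \<Longrightarrow> w \<in> B.low j \<Longrightarrow> f0 v w \<in> C.low (i + j)"
  unfolding A.low_def B.low_def
proof (induction v rule: span_of_induct)
  case (bas_add x v)
  from \<open>w \<in> span_of {x \<in> S2. deg2 x \<le> j}\<close> have "f0 (bas x) w \<in> C.low (i + j)"
  proof (induction w rule: span_of_induct)
    case (bas_add y w)
    have "f0 (bas x) (bas y) \<in> C.low (i + j)"
      unfolding C.low_def
      by (rule span_of_mono[OF _ f0_homog]) (use bas_add \<open>x \<in> {x \<in> S1. deg1 x \<le> i}\<close> in auto)
    then show ?case using bas_add by (auto simp: f0_add intro: C.low_add)
  qed simp
  then show ?case using bas_add by (auto simp: f0_add intro: C.low_add)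
qed simp

lemma f_low: "v \<in> A.low i \<Longrightarrow> w \<in> B.low j \<Longrightarrow> f (\<Psi>1 v) (\<Psi>2 w) + \<Psi>3 (f0 v w) \<in> C.fil (i + j - 1)"
  unfolding A.low_def B.low_def
proof (induction v rule: span_of_induct)
  case (bas_add x v)
  from \<open>w \<in> span_of {x \<in> S2. deg2 x \<le> j}\<close>
  have "f (\<Psi>1 (bas x)) (\<Psi>2 w) + \<Psi>3 (f0 (bas x) w) \<in> C.fil (i + j - 1)"
  proof (induction w rule: span_of_induct)
    case (bas_add y w)
    have "f (\<Psi>1 (bas x)) (\<Psi>2 (bas y)) + \<Psi>3 (f0 (bas x) (bas y)) \<in> C.fil (i + j - 1)"
      by (rule C.fil_mono[OF _ f_lower]) (use bas_add \<open>x \<in> {x \<in> S1. deg1 x \<le> i}\<close> in auto)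
    from C.fil_add[OF this bas_add.IH] show ?case
      by (simp add: B.\<Psi>_add C.\<Psi>_add f_add f0_add add_ac)
  qed simp
  from C.fil_add[OF this bas_add.IH[OF bas_add.prems]] show ?case
    by (simp add: A.\<Psi>_add C.\<Psi>_add f_add f0_add add_ac)
qed simp

lemma f_fil: "a \<in> A.fil i \<Longrightarrow> b \<in> B.fil j \<Longrightarrow> f a b \<in> C.fil (i + j)"
proof -
  assume "a \<in> A.fil i" "b \<in> B.fil j"
  then obtain v w where vw: "v \<in> A.low i" "a = \<Psi>1 v" "w \<in> B.low j" "b = \<Psi>2 w"
    by (auto simp: A.fil_def B.fil_def)
  have "(f a b + \<Psi>3 (f0 v w)) + \<Psi>3 (f0 v w) \<in> C.fil (i + j)"
    by (rule C.fil_add[OF C.fil_mono[OF _ f_low[OF vw(1,3)], folded vw(2,4)]])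
      (use f0_low[OF vw(1,3)] in \<open>auto simp: C.fil_def\<close>)
  then show ?thesis by (simp add: add.assoc)
qed

text \<open>Changing either representative by something of lower degree changes the value only below
  degree k. Together with the filtration step below k the values therefore fill a single
  coset.\<close>

lemma f_coset:
  assumes v: "v \<in> span_of S1" and w: "w \<in> span_of S2" and k: "k = i + j"
  shows "C.fil (k - 1) <#>\<^bsub>V3\<^esub> {f a b | a b. a \<in> A.\<Theta> v i \<and> b \<in> B.\<Theta> w j} =
    C.fil (k - 1) #>\<^bsub>V3\<^esub> \<Psi>3 (f0 (homog deg1 i v) (homog deg2 j w))"
proof -
  let ?c = "\<Psi>3 (f0 (homog deg1 i v) (homog deg2 j w))"
  have 1: "f a b + ?c \<in> C.fil (k - 1)" if a: "a \<in> A.\<Theta> v i" and b: "b \<in> B.\<Theta> w j" for a b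
  proof -
    obtain v' where v': "v' \<in> A.low i" "a = \<Psi>1 v'" "v' + homog deg1 i v \<in> A.low (i - 1)"
      using A.\<Theta>_mem[OF v a] by auto
    obtain w' where w': "w' \<in> B.low j" "b = \<Psi>2 w'" "w' + homog deg2 j w \<in> B.low (j - 1)"
      using B.\<Theta>_mem[OF w b] by auto
    \<comment> \<open>The factors are replaced by their leading components one at a time, each
      replacement costing an error of lower degree.\<close>
    have "f0 (v' + homog deg1 i v) w' \<in> C.low (k - 1)" "f0 (homog deg1 i v) (w' + homog deg2 j w) \<in> C.low (k - 1)"
      using f0_low[OF v'(3) w'(1)] f0_low[OF A.homog_low[OF v] w'(3)] unfolding k by (simp_all only: diff_add_eq add_diff_eq)
    then have "\<Psi>3 (f0 (v' + homog deg1 i v) w' + f0 (homog deg1 i v) (w' + homog deg2 j w)) \<in> C.fil (k - 1)"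
      unfolding C.fil_def by (intro imageI C.low_add)
    from C.fil_add[OF f_low[OF v'(1) w'(1), folded k] this] show ?thesis
      by (simp add: v'(2) w'(2) C.\<Psi>_add f0_add add_ac)
  qed
  show ?thesis
  proof (intro equalityI subsetI)
    fix c assume "c \<in> C.fil (k - 1) <#>\<^bsub>V3\<^esub> {f a b | a b. a \<in> A.\<Theta> v i \<and> b \<in> B.\<Theta> w j}"
    then obtain g a b where "c = g + f a b" "g \<in> C.fil (k - 1)" "a \<in> A.\<Theta> v i" "b \<in> B.\<Theta> w j"
      by (auto simp: set_mult_def C.V)
    then show "c \<in> C.fil (k - 1) #>\<^bsub>V3\<^esub> ?c"
      using C.fil_add[OF _ 1, of g a b] by (simp add: C.cst_mem add.assoc)
  next
    fix c assume c: "c \<in> C.fil (k - 1) #>\<^bsub>V3\<^esub> ?c"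
    let ?a = "\<Psi>1 (homog deg1 i v)" and ?b = "\<Psi>2 (homog deg2 j w)"
    have "(c + ?c) + (f ?a ?b + ?c) \<in> C.fil (k - 1)"
      by (rule C.fil_add[OF c[unfolded C.cst_mem] 1[OF A.\<Theta>_nonempty B.\<Theta>_nonempty]])
    moreover have "(c + ?c) + (f ?a ?b + ?c) = c + f ?a ?b"
      using vec_add_self_left[of ?c "c + f ?a ?b"] by (simp only: add_ac)
    ultimately have 2: "c + f ?a ?b \<in> C.fil (k - 1)" by (simp only:)
    have 3: "f ?a ?b \<in> {f a b | a b. a \<in> A.\<Theta> v i \<and> b \<in> B.\<Theta> w j}"
      by (rule CollectI, rule exI[of _ ?a], rule exI[of _ ?b]) (simp only: A.\<Theta>_nonempty B.\<Theta>_nonempty simp_thms)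
    have "c = (c + f ?a ?b) \<otimes>\<^bsub>V3\<^esub> f ?a ?b" by (simp only: C.V add.assoc vec_add_self add_0_right)
    then show "c \<in> C.fil (k - 1) <#>\<^bsub>V3\<^esub> {f a b | a b. a \<in> A.\<Theta> v i \<and> b \<in> B.\<Theta> w j}"
      unfolding set_mult_def by (intro UN_I[OF 2] UN_I[OF 3]) (simp only: singleton_iff)
  qed
qed

text \<open>The sum is restricted to degrees in which both components are nonzero, since this is how
  \<open>multidegrees\<close> indexes the operations of the associated graded.\<close>

lemma f0_degree:
  assumes v: "v \<in> span_of S1" and w: "w \<in> span_of S2"
  shows "homog deg3 k (f0 v w) =
    (\<Sum>(i, j)\<in>{(i, j). A.\<Theta> v i \<noteq> A.fil (i - 1) \<and> B.\<Theta> w j \<noteq> B.fil (j - 1) \<and> i + j = k}.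
      f0 (homog deg1 i v) (homog deg2 j w))"
proof -
  let ?I = "deg1 ` keys v" and ?J = "deg2 ` keys w"
  have "f0 v w = (\<Sum>i\<in>?I. \<Sum>j\<in>?J. f0 (homog deg1 i v) (homog deg2 j w))"
    using sum_homog[of ?I deg1 v] sum_homog[of ?J deg2 w] by (simp flip: f0_sum)
  then have "homog deg3 k (f0 v w) = (\<Sum>(i, j)\<in>?I \<times> ?J. homog deg3 k (f0 (homog deg1 i v) (homog deg2 j w)))"
    by (simp add: homog_sum sum.cartesian_product split_def)
  also have "\<dots> = (\<Sum>(i, j)\<in>?I \<times> ?J. if i + j = k then f0 (homog deg1 i v) (homog deg2 j w) else 0)"
    by (rule sum.cong)
      (auto simp: homog_of_homog[OF f0_homog'[OF A.homog_closed[OF v] B.homog_closed[OF w]]])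
  also have "\<dots> = (\<Sum>(i, j)\<in>{p \<in> ?I \<times> ?J. fst p + snd p = k}. f0 (homog deg1 i v) (homog deg2 j w))"
    by (simp add: sum.inter_filter split_def)
  also have "{p \<in> ?I \<times> ?J. fst p + snd p = k} =
      {(i, j). A.\<Theta> v i \<noteq> A.fil (i - 1) \<and> B.\<Theta> w j \<noteq> B.fil (j - 1) \<and> i + j = k}"
    using A.\<Theta>_support[OF v] B.\<Theta>_support[OF w] by (auto simp: set_eq_iff)
  finally show ?thesis .
qed

lemma finite_degrees:
  assumes v: "v \<in> span_of S1" and w: "w \<in> span_of S2"
  shows "finite {(i, j). A.\<Theta> v i \<noteq> A.fil (i - 1) \<and> B.\<Theta> w j \<noteq> B.fil (j - 1) \<and> i + j = k}"
  by (rule finite_subset[of _ "deg1 ` keys v \<times> deg2 ` keys w"])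
    (use A.\<Theta>_support[OF v] B.\<Theta>_support[OF w] in auto)

text \<open>The index set \<open>J\<close> stays open because the algebra sums over lists of degrees
  and bimodules over triples containing two such lists; \<open>\<phi>\<close> translates from pairs
  of degrees.\<close>

lemma f_gr:
  assumes v: "v \<in> span_of S1" and w: "w \<in> span_of S2"
    and J: "bij_betw \<phi> {(i, j). A.\<Theta> v i \<noteq> A.fil (i - 1) \<and> B.\<Theta> w j \<noteq> B.fil (j - 1) \<and> i + j = k} J"
    and g: "\<And>i j. i + j = k \<Longrightarrow> g (\<phi> (i, j)) = C.fil (k - 1) <#>\<^bsub>V3\<^esub> {f a b | a b. a \<in> A.\<Theta> v i \<and> b \<in> B.\<Theta> w j}"
  shows "vsum (gr_piece V3 C.fil k) g J = C.\<Theta> (f0 v w) k"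
proof -
  let ?I = "{(i, j). A.\<Theta> v i \<noteq> A.fil (i - 1) \<and> B.\<Theta> w j \<noteq> B.fil (j - 1) \<and> i + j = k}"
  let ?h = "\<lambda>p. f0 (homog deg1 (fst p) v) (homog deg2 (snd p) w)"
  interpret G: comm_group "gr_piece V3 C.fil k" by (rule C.comm_group_gr_piece)
  have gI: "g (\<phi> p) = C.fil (k - 1) #>\<^bsub>V3\<^esub> \<Psi>3 (?h p)" and hI: "\<Psi>3 (?h p) \<in> C.fil k" if pI: "p \<in> ?I" for p
  proof -
    obtain i j where p: "p = (i, j)" "i + j = k" using pI by auto
    show "g (\<phi> p) = C.fil (k - 1) #>\<^bsub>V3\<^esub> \<Psi>3 (?h p)"
      using f_coset[OF v w p(2)[symmetric]] g[OF p(2)] by (simp add: p(1))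
    show "\<Psi>3 (?h p) \<in> C.fil k"
      using f0_low[OF A.homog_low[OF v] B.homog_low[OF w], of i j] p by (auto simp: C.fil_def)
  qed
  have "vsum (gr_piece V3 C.fil k) g J = vsum (gr_piece V3 C.fil k) g (\<phi> ` ?I)"
    using J by (simp add: bij_betw_def)
  also have "\<dots> = vsum (gr_piece V3 C.fil k) (\<lambda>p. g (\<phi> p)) ?I"
  proof (rule G.finprod_reindex)
    show "g \<in> \<phi> ` ?I \<rightarrow> carrier (gr_piece V3 C.fil k)"
    proof (rule funcsetI, elim imageE)
      fix z p assume "z = \<phi> p" "p \<in> ?I"
      then show "g z \<in> carrier (gr_piece V3 C.fil k)"
        unfolding C.carrier_gr_piece using imageI[OF hI, of p "\<lambda>a. C.fil (k - 1) #>\<^bsub>V3\<^esub> a"] gI[of p] by simp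
    qed
    show "inj_on \<phi> ?I" using J by (simp add: bij_betw_def)
  qed
  also have "\<dots> = C.fil (k - 1) #>\<^bsub>V3\<^esub> (\<Sum>p\<in>?I. \<Psi>3 (?h p))"
    by (rule C.vsum_gr_piece[OF finite_degrees[OF v w] gI hI])
  also have "(\<Sum>p\<in>?I. \<Psi>3 (?h p)) = \<Psi>3 (homog deg3 k (f0 v w))"
    by (simp add: f0_degree[OF v w] C.\<Psi>_sum split_def)
  finally show ?thesis by (simp add: C.\<Theta>_def)
qed

end

section \<open>The associated graded algebra\<close>

lemma listset_nonempty: "(\<And>Y. Y \<in> set Ys \<Longrightarrow> Y \<noteq> {}) \<Longrightarrow> listset Ys \<noteq> {}"
  by (induction Ys) (auto simp: set_Cons_def)

text \<open>The relations of \<open>A'\<close> are images of those of \<open>A\<close>. Applied to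
  the associated graded algebra it replaces a verification with cosets.\<close>

lemma ainf_algebra_iso:
  assumes A: "ainf_algebra A" and \<phi>: "\<phi> \<in> iso A A'" and A': "f2_space A'"
    and aop: "\<And>as. as \<in> lists (carrier A) \<Longrightarrow> as \<noteq> [] \<Longrightarrow> \<phi> (aop A as) = aop A' (map \<phi> as)"
  shows "ainf_algebra A'"
proof -
  interpret A: alg_base A by unfold_locales (rule A)
  interpret G: comm_group A using A by (simp add: ainf_algebra_def f2_space_def)
  interpret G': comm_group A' using A' by (simp add: f2_space_def)
  have hom: "\<phi> \<in> hom A A'" and surj: "\<phi> ` carrier A = carrier A'"
    using \<phi> by (auto simp: iso_def bij_betw_def)
  have lift: "\<exists>as0\<in>lists (carrier A). as = map \<phi> as0" if "as \<in> lists (carrier A')" for as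
    using that
  proof (induction as)
    case (Cons a as)
    obtain as0 where "as0 \<in> lists (carrier A)" "as = map \<phi> as0" using Cons.IH by blast
    moreover obtain a0 where "a0 \<in> carrier A" "a = \<phi> a0" using Cons.hyps(1) surj by blast
    ultimately show ?case by (intro bexI[of _ "a0 # as0"]) auto
  qed simp
  have fin: "\<phi> (vsum A f I) = vsum A' (\<lambda>i. \<phi> (f i)) I" if "\<And>i. i \<in> I \<Longrightarrow> f i \<in> carrier A" for f and I :: "'i set"
  proof (cases "finite I")
    case True
    have one: "\<phi> \<one>\<^bsub>A\<^esub> = \<one>\<^bsub>A'\<^esub>" by (rule hom_one[OF hom]) (rule G.is_group G'.is_group)+
    show ?thesis using True that
    proof (induction I rule: finite_induct)
      case (insert i I)
      have "f \<in> I \<rightarrow> carrier A" "(\<lambda>i. \<phi> (f i)) \<in> I \<rightarrow> carrier A'" "f i \<in> carrier A" "\<phi> (f i) \<in> carrier A'"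
        using insert hom_in_carrier[OF hom] by auto
      then show ?case using insert by (simp add: hom_mult[OF hom])
    qed (simp add: one)
  next
    case False
    have one: "\<phi> \<one>\<^bsub>A\<^esub> = \<one>\<^bsub>A'\<^esub>" by (rule hom_one[OF hom]) (rule G.is_group G'.is_group)+
    show ?thesis using False by (simp add: one)
  qed
  have con: "map \<phi> (contract A as i j) = contract A' (map \<phi> as) i j"
    if "as \<in> lists (carrier A)" "(i, j) \<in> segments as" for as i j
  proof -
    have "\<phi> (aop A (drop i (take j as))) = aop A' (map \<phi> (drop i (take j as)))"
      using that lists_drop[OF lists_take[OF that(1)]] by (intro aop) (auto simp: segments_def)
    then show ?thesis by (simp add: contract_def take_map drop_map)
  qed
  show ?thesis
    unfolding ainf_algebra_def
  proof (intro conjI ballI impI A')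
    fix as bs assume as': "as \<in> lists (carrier A')" "bs \<in> lists (carrier A')"
    obtain as0 where as: "as0 \<in> lists (carrier A)" "as = map \<phi> as0" using lift[OF as'(1)] by blast
    obtain bs0 where bs: "bs0 \<in> lists (carrier A)" "bs = map \<phi> bs0" using lift[OF as'(2)] by blast
    have h: "(\<lambda>a. aop A (as0 @ a # bs0)) \<in> hom A A"
      using A as(1) bs(1) by (simp add: ainf_algebra_def)
    have e: "aop A' (as @ \<phi> a # bs) = \<phi> (aop A (as0 @ a # bs0))" if "a \<in> carrier A" for a
      using that as bs by (subst aop) auto
    show "(\<lambda>a. aop A' (as @ a # bs)) \<in> hom A' A'"
    proof (rule homI)
      fix a b assume ab': "a \<in> carrier A'" "b \<in> carrier A'"
      obtain a0 where a: "a0 \<in> carrier A" "a = \<phi> a0" using ab'(1) surj by blast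
      obtain b0 where b: "b0 \<in> carrier A" "b = \<phi> b0" using ab'(2) surj by blast
      show "aop A' (as @ a # bs) \<in> carrier A'"
        using hom_in_carrier[OF hom hom_in_carrier[OF h a(1)]] by (simp add: a e)
      have "aop A' (as @ (a \<otimes>\<^bsub>A'\<^esub> b) # bs) = \<phi> (aop A (as0 @ (a0 \<otimes>\<^bsub>A\<^esub> b0) # bs0))"
        using e[of "a0 \<otimes>\<^bsub>A\<^esub> b0"] a b by (simp add: hom_mult[OF hom])
      also have "\<dots> = aop A' (as @ a # bs) \<otimes>\<^bsub>A'\<^esub> aop A' (as @ b # bs)"
        using hom_mult[OF h a(1) b(1)] hom_in_carrier[OF h a(1)] hom_in_carrier[OF h b(1)]
        by (simp add: hom_mult[OF hom] a b e)
      finally show "aop A' (as @ (a \<otimes>\<^bsub>A'\<^esub> b) # bs) = aop A' (as @ a # bs) \<otimes>\<^bsub>A'\<^esub> aop A' (as @ b # bs)" .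
    qed
  next
    fix as assume as': "as \<in> lists (carrier A')" "as \<noteq> []"
    obtain as0 where as: "as0 \<in> lists (carrier A)" "as = map \<phi> as0" using lift[OF as'(1)] by blast
    have ne: "as0 \<noteq> []" using as as'(2) by auto
    have seg: "segments as = segments as0" by (simp add: segments_def as)
    have cl: "aop A (contract A as0 i j) \<in> carrier A" if "(i, j) \<in> segments as0" for i j
      by (rule A.aop_closed[OF A.contract_closed[OF as(1) that]]) (simp add: contract_def)
    have pt: "aop A' (contract A' as i j) = \<phi> (aop A (contract A as0 i j))" if "(i, j) \<in> segments as0" for i j
      using aop[OF A.contract_closed[OF as(1) that]] con[OF as(1) that] by (simp add: as contract_def)
    have "vsum A' (\<lambda>(i, j). aop A' (contract A' as i j)) (segments as) =
      vsum A' (\<lambda>p. \<phi> (case p of (i, j) \<Rightarrow> aop A (contract A as0 i j))) (segments as0)"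
      unfolding seg
      by (rule G'.finprod_cong') (use cl hom_in_carrier[OF hom] pt in auto)
    also have "\<dots> = \<phi> (vsum A (\<lambda>(i, j). aop A (contract A as0 i j)) (segments as0))"
      by (rule fin[symmetric]) (use cl in auto)
    also have "vsum A (\<lambda>(i, j). aop A (contract A as0 i j)) (segments as0) = \<one>\<^bsub>A\<^esub>"
      using A as(1) ne by (simp add: ainf_algebra_def)
    also have "\<phi> \<one>\<^bsub>A\<^esub> = \<one>\<^bsub>A'\<^esub>" by (rule hom_one[OF hom]) (rule G.is_group G'.is_group)+
    finally show "vsum A' (\<lambda>(i, j). aop A' (contract A' as i j)) (segments as) = \<one>\<^bsub>A'\<^esub>" .
  qed
qed

text \<open>Once \<open>\<psi>\<close> identifies the spaces, the structure constants of the
  filtered algebra \<open>B'\<close> are those of the graded algebra \<open>B\<close> up to lower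
  degree. This makes \<open>B\<close> the associated graded of \<open>B'\<close>.\<close>

locale filtered_alg =
  A0: based_algebra B u + A1: based_algebra B' u' +
  alg: adapted_basis "lin_alg B'" "agens B" "agens B'" degA \<psi>
  for B :: "'g based_alg" and u and B' :: "'h based_alg" and u' degA \<psi> +
  assumes acoef_homog: "a \<in> agens B \<Longrightarrow> b \<in> agens B \<Longrightarrow> acoef B [a, b] \<in> span_of {c \<in> agens B. degA c = degA a + degA b}"
    and amul_lower: "a \<in> agens B \<Longrightarrow> b \<in> agens B \<Longrightarrow>
      amul B' (\<psi> (bas a)) (\<psi> (bas b)) + \<psi> (acoef B [a, b]) \<in> alg.fil (degA a + degA b - 1)"
begin

sublocale mul: bilinear_gr "lin_alg B'" "agens B" "agens B'" degA \<psi> "lin_alg B'" "agens B" "agens B'" degA \<psi>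
  "lin_alg B'" "agens B" "agens B'" degA \<psi> "amul B'" "amul B"
  by unfold_locales (simp_all add: amul_add_left amul_add_right op_bas acoef_homog amul_lower)

abbreviation "F \<equiv> alg.fil"
abbreviation "gA \<equiv> gr_alg (lin_alg B') F"

lemma multidegrees_1: "multidegrees G [\<alpha>] = {[i] | i. \<alpha> i \<noteq> G (i - 1)}"
  by (auto simp: multidegrees_def list_all2_Cons2)

lemma multidegrees_0: "multidegrees G [] = {[]}"
  by (auto simp: multidegrees_def)

lemma multidegrees_2: "multidegrees G [\<alpha>, \<beta>] = {[i, j] | i j. \<alpha> i \<noteq> G (i - 1) \<and> \<beta> j \<noteq> G (j - 1)}"
  by (auto simp: multidegrees_def list_all2_Cons2)

text \<open>Cosets contain something. This ensures that an operation vanishing identically has {0}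
  as its set of values and not the empty set.\<close>

lemma components_nonempty: "components ds (map alg.\<Theta> vs) \<noteq> {}"
  unfolding components_def
proof (rule listset_nonempty)
  fix Y assume "Y \<in> set (map2 (\<lambda>d \<alpha>. \<alpha> d) ds (map alg.\<Theta> vs))"
  then obtain d v where "Y = alg.\<Theta> v d" by (auto simp: in_set_conv_nth)
  then show "Y \<noteq> {}" using alg.\<Theta>_nonempty by blast
qed

lemma gr_aop2:
  assumes v: "v \<in> A0.Sp" and w: "w \<in> A0.Sp"
  shows "aop gA [alg.\<Theta> v, alg.\<Theta> w] = alg.\<Theta> (amul B v w)"
proof (rule ext)
  fix k
  have "vsum (gr_piece (lin_alg B') F k) (\<lambda>ds. F (k - 1) <#>\<^bsub>lin_alg B'\<^esub> (aop (lin_alg B') ` components ds [alg.\<Theta> v, alg.\<Theta> w]))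
      {ds \<in> multidegrees F [alg.\<Theta> v, alg.\<Theta> w]. sum_list ds = k} = alg.\<Theta> (amul B v w) k"
  proof (rule mul.f_gr[OF v w, where \<phi> = "\<lambda>(i, j). [i, j]"])
    show "bij_betw (\<lambda>(i, j). [i, j]) {(i, j). alg.\<Theta> v i \<noteq> F (i - 1) \<and> alg.\<Theta> w j \<noteq> F (j - 1) \<and> i + j = k}
      {ds \<in> multidegrees F [alg.\<Theta> v, alg.\<Theta> w]. sum_list ds = k}"
      by (auto simp: bij_betw_def inj_on_def multidegrees_2 image_iff)
    fix i j :: int assume "i + j = k"
    have "aop (lin_alg B') ` components [i, j] [alg.\<Theta> v, alg.\<Theta> w] =
        {amul B' a b | a b. a \<in> alg.\<Theta> v i \<and> b \<in> alg.\<Theta> w j}"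
    proof (intro equalityI subsetI)
      fix x assume "x \<in> {amul B' a b | a b. a \<in> alg.\<Theta> v i \<and> b \<in> alg.\<Theta> w j}"
      then obtain a b where "x = aop (lin_alg B') [a, b]" "[a, b] \<in> components [i, j] [alg.\<Theta> v, alg.\<Theta> w]"
        by (auto simp: components_def set_Cons_def A1.aop_lin_alg2)
      then show "x \<in> aop (lin_alg B') ` components [i, j] [alg.\<Theta> v, alg.\<Theta> w]" by blast
    next
      fix x assume "x \<in> aop (lin_alg B') ` components [i, j] [alg.\<Theta> v, alg.\<Theta> w]"
      then obtain a b where "x = amul B' a b" "a \<in> alg.\<Theta> v i" "b \<in> alg.\<Theta> w j"
        by (auto simp: components_def set_Cons_def A1.aop_lin_alg2)
      then show "x \<in> {amul B' a b | a b. a \<in> alg.\<Theta> v i \<and> b \<in> alg.\<Theta> w j}"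
        by (intro CollectI exI[of _ a] exI[of _ b]) simp
    qed
    then show "F (k - 1) <#>\<^bsub>lin_alg B'\<^esub> (aop (lin_alg B') ` components (case (i, j) of (i, j) \<Rightarrow> [i, j]) [alg.\<Theta> v, alg.\<Theta> w]) =
        F (k - 1) <#>\<^bsub>lin_alg B'\<^esub> {amul B' a b | a b. a \<in> alg.\<Theta> v i \<and> b \<in> alg.\<Theta> w j}"
      by simp
  qed
  then show "aop gA [alg.\<Theta> v, alg.\<Theta> w] k = alg.\<Theta> (amul B v w) k"
    by (simp add: gr_alg_def)
qed

lemma gr_aop_other:
  assumes "length vs \<noteq> 2"
  shows "aop gA (map alg.\<Theta> vs) = alg.\<Theta> 0"
proof (rule ext)
  fix k
  interpret G: comm_group "gr_piece (lin_alg B') F k" by (rule alg.comm_group_gr_piece)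
  have "vsum (gr_piece (lin_alg B') F k) (\<lambda>ds. F (k - 1) <#>\<^bsub>lin_alg B'\<^esub> (aop (lin_alg B') ` components ds (map alg.\<Theta> vs)))
      {ds \<in> multidegrees F (map alg.\<Theta> vs). sum_list ds = k} = \<one>\<^bsub>gr_piece (lin_alg B') F k\<^esub>"
  proof (rule G.finprod_one_eqI)
    fix ds assume "ds \<in> {ds \<in> multidegrees F (map alg.\<Theta> vs). sum_list ds = k}"
    then have "length ds = length vs" by (auto simp: multidegrees_def dest: list_all2_lengthD)
    then have "as \<in> components ds (map alg.\<Theta> vs) \<Longrightarrow> aop (lin_alg B') as = 0" for as
      using assms by (intro A1.aop_lin_alg_other) (auto simp: components_def dest!: listset_length)
    then have "aop (lin_alg B') ` components ds (map alg.\<Theta> vs) = {0}"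
      using components_nonempty[of ds vs] by auto
    then show "F (k - 1) <#>\<^bsub>lin_alg B'\<^esub> (aop (lin_alg B') ` components ds (map alg.\<Theta> vs)) = \<one>\<^bsub>gr_piece (lin_alg B') F k\<^esub>"
      by (simp add: alg.one_gr_piece set_mult_def A1.lin_alg_simps)
  qed
  then show "aop gA (map alg.\<Theta> vs) k = alg.\<Theta> 0 k"
    by (simp add: gr_alg_def alg.\<Theta>_def alg.cst_zero alg.one_gr_piece)
qed

lemma carrier_gA: "carrier gA = carrier (gr_space (lin_alg B') F)" "monoid.mult gA = monoid.mult (gr_space (lin_alg B') F)"
  "\<one>\<^bsub>gA\<^esub> = \<one>\<^bsub>gr_space (lin_alg B') F\<^esub>"
  by (simp_all add: gr_alg_def)

lemma \<Theta>_iso: "alg.\<Theta> \<in> iso (lin_alg B) gA"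
proof -
  have "alg.\<Theta> \<in> hom (lin_alg B) gA"
    by (rule homI) (simp_all add: A0.lin_alg_simps carrier_gA alg.\<Theta>_closed alg.\<Theta>_add)
  moreover have "bij_betw alg.\<Theta> (carrier (lin_alg B)) (carrier gA)"
    unfolding bij_betw_def
  proof
    show "inj_on alg.\<Theta> (carrier (lin_alg B))"
      by (rule inj_onI) (simp add: A0.lin_alg_simps alg.\<Theta>_inj)
    have "\<alpha> \<in> alg.\<Theta> ` A0.Sp" if "\<alpha> \<in> carrier (gr_space (lin_alg B') F)" for \<alpha>
      using alg.\<Theta>_surj[OF that] by blast
    then show "alg.\<Theta> ` carrier (lin_alg B) = carrier gA"
      using alg.\<Theta>_closed by (auto simp: A0.lin_alg_simps carrier_gA)
  qed
  ultimately show ?thesis by (simp add: iso_def)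
qed

lemma strict_ainf_iso_gr: "strict_ainf_iso (lin_alg B) gA alg.\<Theta>"
proof -
  have aop: "alg.\<Theta> (aop (lin_alg B) vs) = aop gA (map alg.\<Theta> vs)" if "vs \<in> lists (carrier (lin_alg B))" for vs
  proof (cases "length vs = 2")
    case True
    then obtain v w where "vs = [v, w]" by (auto simp: length_Suc_conv eval_nat_numeral)
    then show ?thesis using that by (simp add: A0.aop_lin_alg2 gr_aop2 A0.lin_alg_simps)
  qed (simp add: A0.aop_lin_alg_other gr_aop_other)
  have cg: "comm_group gA"
    by (rule comm_group_cong[OF alg.comm_group_gr_space carrier_gA])
  have "f2_space gA"
    unfolding f2_space_def
  proof (intro conjI ballI cg)
    fix \<alpha> assume "\<alpha> \<in> carrier gA"
    then obtain v where "v \<in> A0.Sp" "\<alpha> = alg.\<Theta> v" using alg.\<Theta>_surj carrier_gA(1) by metis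
    then have "\<alpha> \<otimes>\<^bsub>gA\<^esub> \<alpha> = alg.\<Theta> 0" by (simp add: carrier_gA flip: alg.\<Theta>_add)
    then show "\<alpha> \<otimes>\<^bsub>gA\<^esub> \<alpha> = \<one>\<^bsub>gA\<^esub>"
      by (auto simp: carrier_gA alg.\<Theta>_def alg.cst_zero gr_space_def alg.one_gr_piece restrict_def)
  qed
  then have "ainf_algebra gA"
    by (rule ainf_algebra_iso[OF A0.ainf_algebra_lin_alg \<Theta>_iso]) (rule aop)
  then show ?thesis
    unfolding strict_ainf_iso_def using \<Theta>_iso aop A0.ainf_algebra_lin_alg by blast
qed

lemma filtered_algebra_fil: "filtered_algebra (lin_alg B') F"
  unfolding filtered_algebra_def
proof (intro conjI allI impI)
  show "ainf_algebra (lin_alg B')" by (rule A1.ainf_algebra_lin_alg)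
  show "subgroup (F i) (lin_alg B')" for i by (rule alg.subgroup_fil)
  show "F i \<subseteq> F (i + 1)" for i by (rule alg.fil_step)
  fix ds as assume "as \<noteq> [] \<and> list_all2 (\<lambda>i a. a \<in> F i) ds as"
  then have l: "list_all2 (\<lambda>i a. a \<in> F i) ds as" by simp
  show "aop (lin_alg B') as \<in> F (sum_list ds)"
  proof (cases "length as = 2")
    case True
    then obtain a b where "as = [a, b]" by (auto simp: length_Suc_conv eval_nat_numeral)
    then show ?thesis using l by (auto simp: list_all2_Cons2 A1.aop_lin_alg2 intro: mul.f_fil)
  qed (simp add: A1.aop_lin_alg_other)
qed

end

section \<open>The associated graded bimodule\<close>

locale filtered_dg = filtered_alg B u B' u' degA \<psi> +
  K0: dg_bimod B u K + K1: dg_bimod B' u' K' +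
  mod: adapted_basis "lin_bimod K'" "gens K" "gens K'" degM \<Psi>
  for B :: "'g based_alg" and u and B' :: "'h based_alg" and u' degA \<psi>
    and K :: "('g, 'x) based_bimod" and K' :: "('h, 'y) based_bimod" and degM \<Psi> +
  assumes D_homog: "x \<in> gens K \<Longrightarrow> coef K [] x [] \<in> span_of {y \<in> gens K. degM y = degM x}"
    and D_lower: "x \<in> gens K \<Longrightarrow> Dop K' (\<Psi> (bas x)) + \<Psi> (coef K [] x []) \<in> mod.fil (degM x - 1)"
    and L_homog: "a \<in> agens B \<Longrightarrow> x \<in> gens K \<Longrightarrow> coef K [a] x [] \<in> span_of {y \<in> gens K. degM y = degA a + degM x}"
    and L_lower: "a \<in> agens B \<Longrightarrow> x \<in> gens K \<Longrightarrow>
      Lop K' (\<psi> (bas a)) (\<Psi> (bas x)) + \<Psi> (coef K [a] x []) \<in> mod.fil (degA a + degM x - 1)"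
    and R_homog: "a \<in> agens B \<Longrightarrow> x \<in> gens K \<Longrightarrow> coef K [] x [a] \<in> span_of {y \<in> gens K. degM y = degM x + degA a}"
    and R_lower: "a \<in> agens B \<Longrightarrow> x \<in> gens K \<Longrightarrow>
      Rop K' (\<Psi> (bas x)) (\<psi> (bas a)) + \<Psi> (coef K [] x [a]) \<in> mod.fil (degM x + degA a - 1)"
begin

sublocale Dg: linear_gr "lin_bimod K'" "gens K" "gens K'" degM \<Psi> "Dop K'" "Dop K"
  by unfold_locales (simp_all add: Dop_add op_bas D_homog D_lower)

sublocale Lg: bilinear_gr "lin_alg B'" "agens B" "agens B'" degA \<psi> "lin_bimod K'" "gens K" "gens K'" degM \<Psi>
  "lin_bimod K'" "gens K" "gens K'" degM \<Psi> "Lop K'" "Lop K"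
  by unfold_locales (simp_all add: Lop_add op_bas L_homog L_lower)

sublocale Rg: bilinear_gr "lin_bimod K'" "gens K" "gens K'" degM \<Psi> "lin_alg B'" "agens B" "agens B'" degA \<psi>
  "lin_bimod K'" "gens K" "gens K'" degM \<Psi> "Rop K'" "Rop K"
  by unfold_locales (simp_all add: Rop_add op_bas R_homog R_lower)

abbreviation "G \<equiv> mod.fil"
abbreviation "gM \<equiv> gr_bimod (lin_alg B') F (lin_bimod K') G"

lemma bop_gM: "bop gM \<alpha>s \<xi> \<beta>s k = vsum (gr_piece (lin_bimod K') G k)
    (\<lambda>(ds, d, es). G (k - 1) <#>\<^bsub>lin_bimod K'\<^esub>
        {bop (lin_bimod K') as x bs | as x bs. as \<in> components ds \<alpha>s \<and> x \<in> \<xi> d \<and> bs \<in> components es \<beta>s})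
    {(ds, d, es). ds \<in> multidegrees F \<alpha>s \<and> \<xi> d \<noteq> G (d - 1) \<and> es \<in> multidegrees F \<beta>s \<and>
            sum_list ds + d + sum_list es = k}"
  by (simp add: gr_bimod_def)

lemma components_simps: "components [] [] = {[]}" "components [i] [\<alpha>] = (\<lambda>x. [x]) ` \<alpha> i"
  by (auto simp: components_def set_Cons_def)

lemma bop_gM_D:
  assumes z: "z \<in> span_of (gens K)"
  shows "bop gM [] (mod.\<Theta> z) [] = mod.\<Theta> (Dop K z)"
proof (rule ext)
  fix k
  interpret C: comm_group "gr_piece (lin_bimod K') G k" by (rule mod.comm_group_gr_piece)
  let ?g = "\<lambda>(ds, d, es). G (k - 1) <#>\<^bsub>lin_bimod K'\<^esub>
        {bop (lin_bimod K') as x bs | as x bs. as \<in> components ds [] \<and> x \<in> mod.\<Theta> z d \<and> bs \<in> components es []}"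
  have "{bop (lin_bimod K') as x bs | as x bs. as \<in> components [] [] \<and> x \<in> mod.\<Theta> z k \<and> bs \<in> components [] []} =
      Dop K' ` mod.\<Theta> z k"
    by (auto simp: components_simps K1.bop_lin_bimod)
  then have g: "?g ([], k, []) = mod.\<Theta> (Dop K z) k"
    using Dg.f_coset[OF z, of k] by simp
  \<comment> \<open>Without algebra inputs the only possible degree is k itself, and it is missing
    from the index set when the component of \<open>z\<close> there is zero.\<close>
  have I: "{(ds, d, es). ds \<in> multidegrees F [] \<and> mod.\<Theta> z d \<noteq> G (d - 1) \<and> es \<in> multidegrees F [] \<and>
            sum_list ds + d + sum_list es = k} = (if mod.\<Theta> z k = G (k - 1) then {} else {([], k, [])})"
    by (auto simp: multidegrees_0)
  show "bop gM [] (mod.\<Theta> z) [] k = mod.\<Theta> (Dop K z) k"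
  proof (cases "mod.\<Theta> z k = G (k - 1)")
    case True
    then have "homog degM k (Dop K z) = 0" by (simp add: Dg.f0_homog_comm z mod.\<Theta>_trivial_iff)
    then show ?thesis
      unfolding bop_gM I by (simp add: True mod.one_gr_piece) (simp add: mod.\<Theta>_def mod.cst_zero)
  next
    case False
    have "mod.\<Theta> (Dop K z) k \<in> carrier (gr_piece (lin_bimod K') G k)"
      using mod.\<Theta>_closed[OF K0.Dop_closed[OF z]] by (simp add: mod.carrier_gr_space)
    then have "vsum (gr_piece (lin_bimod K') G k) ?g {([], k, [])} = ?g ([], k, [])"
      by (simp only: C.finprod_insert[of "{}"] finite.emptyI C.finprod_empty g C.r_one Pi_I empty_iff not_False_eq_True simp_thms)
        (subst C.finprod_insert; simp add: g[simplified])
    then show ?thesis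
      unfolding bop_gM I using False g by simp
  qed
qed

lemma bop_gM_L:
  assumes v: "v \<in> A0.Sp" and z: "z \<in> span_of (gens K)"
  shows "bop gM [alg.\<Theta> v] (mod.\<Theta> z) [] = mod.\<Theta> (Lop K v z)"
proof (rule ext)
  fix k
  show "bop gM [alg.\<Theta> v] (mod.\<Theta> z) [] k = mod.\<Theta> (Lop K v z) k"
    unfolding bop_gM
  proof (rule Lg.f_gr[OF v z, where \<phi> = "\<lambda>(i, j). ([i], j, [])"])
    show "bij_betw (\<lambda>(i, j). ([i], j, [])) {(i, j). alg.\<Theta> v i \<noteq> F (i - 1) \<and> mod.\<Theta> z j \<noteq> G (j - 1) \<and> i + j = k}
      {(ds, d, es). ds \<in> multidegrees F [alg.\<Theta> v] \<and> mod.\<Theta> z d \<noteq> G (d - 1) \<and> es \<in> multidegrees F [] \<and>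
            sum_list ds + d + sum_list es = k}"
      by (auto simp: bij_betw_def inj_on_def multidegrees_1 multidegrees_0 image_iff)
    fix i j :: int assume "i + j = k"
    have "{bop (lin_bimod K') as x bs | as x bs. as \<in> components [i] [alg.\<Theta> v] \<and> x \<in> mod.\<Theta> z j \<and> bs \<in> components [] []} =
        {Lop K' a b | a b. a \<in> alg.\<Theta> v i \<and> b \<in> mod.\<Theta> z j}"
    proof (intro equalityI subsetI)
      fix c assume "c \<in> {Lop K' a b | a b. a \<in> alg.\<Theta> v i \<and> b \<in> mod.\<Theta> z j}"
      then obtain a b where ab': "c = bop (lin_bimod K') [a] b []" "[a] \<in> components [i] [alg.\<Theta> v]" "b \<in> mod.\<Theta> z j"
        "[] \<in> components [] []"
        by (auto simp: components_simps K1.bop_lin_bimod)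
      then show "c \<in> {bop (lin_bimod K') as x bs | as x bs. as \<in> components [i] [alg.\<Theta> v] \<and> x \<in> mod.\<Theta> z j \<and>
          bs \<in> components [] []}"
        by - (rule CollectI, rule exI[of _ "[a]"], rule exI[of _ b], rule exI[of _ "[]"], simp add: components_simps(1))
    next
      fix c assume "c \<in> {bop (lin_bimod K') as x bs | as x bs. as \<in> components [i] [alg.\<Theta> v] \<and> x \<in> mod.\<Theta> z j \<and>
          bs \<in> components [] []}"
      then obtain a b where "c = Lop K' a b" "a \<in> alg.\<Theta> v i" "b \<in> mod.\<Theta> z j"
        by (auto simp: components_simps K1.bop_lin_bimod)
      then show "c \<in> {Lop K' a b | a b. a \<in> alg.\<Theta> v i \<and> b \<in> mod.\<Theta> z j}"
        by (intro CollectI exI[of _ a] exI[of _ b]) simp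
    qed
    then show "(case case (i, j) of (i, j) \<Rightarrow> ([i], j, []) of (ds, d, es) \<Rightarrow> G (k - 1) <#>\<^bsub>lin_bimod K'\<^esub>
        {bop (lin_bimod K') as x bs | as x bs. as \<in> components ds [alg.\<Theta> v] \<and> x \<in> mod.\<Theta> z d \<and> bs \<in> components es []}) =
        G (k - 1) <#>\<^bsub>lin_bimod K'\<^esub> {Lop K' a b | a b. a \<in> alg.\<Theta> v i \<and> b \<in> mod.\<Theta> z j}"
      by simp
  qed
qed

lemma bop_gM_R:
  assumes v: "v \<in> A0.Sp" and z: "z \<in> span_of (gens K)"
  shows "bop gM [] (mod.\<Theta> z) [alg.\<Theta> v] = mod.\<Theta> (Rop K z v)"
proof (rule ext)
  fix k
  show "bop gM [] (mod.\<Theta> z) [alg.\<Theta> v] k = mod.\<Theta> (Rop K z v) k"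
    unfolding bop_gM
  proof (rule Rg.f_gr[OF z v, where \<phi> = "\<lambda>(i, j). ([], i, [j])"])
    show "bij_betw (\<lambda>(i, j). ([], i, [j])) {(i, j). mod.\<Theta> z i \<noteq> G (i - 1) \<and> alg.\<Theta> v j \<noteq> F (j - 1) \<and> i + j = k}
      {(ds, d, es). ds \<in> multidegrees F [] \<and> mod.\<Theta> z d \<noteq> G (d - 1) \<and> es \<in> multidegrees F [alg.\<Theta> v] \<and>
            sum_list ds + d + sum_list es = k}"
      by (auto simp: bij_betw_def inj_on_def multidegrees_1 multidegrees_0 image_iff)
    fix i j :: int assume "i + j = k"
    have "{bop (lin_bimod K') as x bs | as x bs. as \<in> components [] [] \<and> x \<in> mod.\<Theta> z i \<and> bs \<in> components [j] [alg.\<Theta> v]} =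
        {Rop K' a b | a b. a \<in> mod.\<Theta> z i \<and> b \<in> alg.\<Theta> v j}"
    proof (intro equalityI subsetI)
      fix c assume "c \<in> {Rop K' a b | a b. a \<in> mod.\<Theta> z i \<and> b \<in> alg.\<Theta> v j}"
      then obtain a b where ab': "c = bop (lin_bimod K') [] a [b]" "[] \<in> components [] []" "a \<in> mod.\<Theta> z i"
        "[b] \<in> components [j] [alg.\<Theta> v]"
        by (auto simp: components_simps K1.bop_lin_bimod)
      then show "c \<in> {bop (lin_bimod K') as x bs | as x bs. as \<in> components [] [] \<and> x \<in> mod.\<Theta> z i \<and>
          bs \<in> components [j] [alg.\<Theta> v]}"
        by - (rule CollectI, rule exI[of _ "[]"], rule exI[of _ a], rule exI[of _ "[b]"], simp add: components_simps(1))
    next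
      fix c assume "c \<in> {bop (lin_bimod K') as x bs | as x bs. as \<in> components [] [] \<and> x \<in> mod.\<Theta> z i \<and>
          bs \<in> components [j] [alg.\<Theta> v]}"
      then obtain a b where "c = Rop K' a b" "a \<in> mod.\<Theta> z i" "b \<in> alg.\<Theta> v j"
        by (auto simp: components_simps K1.bop_lin_bimod)
      then show "c \<in> {Rop K' a b | a b. a \<in> mod.\<Theta> z i \<and> b \<in> alg.\<Theta> v j}"
        by (intro CollectI exI[of _ a] exI[of _ b]) simp
    qed
    then show "(case case (i, j) of (i, j) \<Rightarrow> ([], i, [j]) of (ds, d, es) \<Rightarrow> G (k - 1) <#>\<^bsub>lin_bimod K'\<^esub>
        {bop (lin_bimod K') as x bs | as x bs. as \<in> components ds [] \<and> x \<in> mod.\<Theta> z d \<and> bs \<in> components es [alg.\<Theta> v]}) =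
        G (k - 1) <#>\<^bsub>lin_bimod K'\<^esub> {Rop K' a b | a b. a \<in> mod.\<Theta> z i \<and> b \<in> alg.\<Theta> v j}"
      by simp
  qed
qed

lemma bop_gM_long:
  assumes "length vs + length ws > 1"
  shows "bop gM (map alg.\<Theta> vs) (mod.\<Theta> z) (map alg.\<Theta> ws) = mod.\<Theta> 0"
proof (rule ext)
  fix k
  interpret C: comm_group "gr_piece (lin_bimod K') G k" by (rule mod.comm_group_gr_piece)
  have "bop gM (map alg.\<Theta> vs) (mod.\<Theta> z) (map alg.\<Theta> ws) k = \<one>\<^bsub>gr_piece (lin_bimod K') G k\<^esub>"
    unfolding bop_gM
  proof (rule C.finprod_one_eqI)
    fix t assume "t \<in> {(ds, d, es). ds \<in> multidegrees F (map alg.\<Theta> vs) \<and> mod.\<Theta> z d \<noteq> G (d - 1) \<and>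
        es \<in> multidegrees F (map alg.\<Theta> ws) \<and> sum_list ds + d + sum_list es = k}"
    then obtain ds d es where t: "t = (ds, d, es)"
      and "ds \<in> multidegrees F (map alg.\<Theta> vs)" "es \<in> multidegrees F (map alg.\<Theta> ws)" by auto
    then have l: "length ds = length vs" "length es = length ws"
      by (auto simp: multidegrees_def dest: list_all2_lengthD)
    have bop0: "bop (lin_bimod K') as x bs = 0"
      if "as \<in> components ds (map alg.\<Theta> vs)" "bs \<in> components es (map alg.\<Theta> ws)" for as x bs
      using that assms l by (intro K1.bop_lin_bimod_long) (auto simp: components_def dest!: listset_length)
    obtain as bs where "as \<in> components ds (map alg.\<Theta> vs)" "bs \<in> components es (map alg.\<Theta> ws)"
      using components_nonempty by blast
    moreover from this have "0 \<in> {bop (lin_bimod K') as x bs | as x bs. as \<in> components ds (map alg.\<Theta> vs) \<and>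
        x \<in> mod.\<Theta> z d \<and> bs \<in> components es (map alg.\<Theta> ws)}"
      using mod.\<Theta>_nonempty[of d z] bop0
      by (intro CollectI exI[of _ as] exI[of _ "\<Psi> (homog degM d z)"] exI[of _ bs]) simp
    ultimately have "{bop (lin_bimod K') as x bs | as x bs. as \<in> components ds (map alg.\<Theta> vs) \<and> x \<in> mod.\<Theta> z d \<and>
        bs \<in> components es (map alg.\<Theta> ws)} = {0}"
      using bop0 by blast
    then show "(case t of (ds, d, es) \<Rightarrow> G (k - 1) <#>\<^bsub>lin_bimod K'\<^esub> {bop (lin_bimod K') as x bs | as x bs.
        as \<in> components ds (map alg.\<Theta> vs) \<and> x \<in> mod.\<Theta> z d \<and> bs \<in> components es (map alg.\<Theta> ws)}) = \<one>\<^bsub>gr_piece (lin_bimod K') G k\<^esub>"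
      by (simp add: t mod.one_gr_piece set_mult_def mod.V)
  qed
  then show "bop gM (map alg.\<Theta> vs) (mod.\<Theta> z) (map alg.\<Theta> ws) k = mod.\<Theta> 0 k"
    by (simp add: mod.\<Theta>_def mod.cst_zero mod.one_gr_piece)
qed

lemma bop_gM_\<Theta>:
  assumes "vs \<in> lists A0.Sp" "ws \<in> lists A0.Sp" "z \<in> span_of (gens K)"
  shows "bop gM (map alg.\<Theta> vs) (mod.\<Theta> z) (map alg.\<Theta> ws) = mod.\<Theta> (bop (lin_bimod K) vs z ws)"
  by (cases vs ws rule: K0.short_cases)
    (use assms in \<open>simp_all add: bop_gM_D bop_gM_L bop_gM_R bop_gM_long K0.bop_lin_bimod K0.bop_lin_bimod_long\<close>)

lemma filtered_bimodule_fil: "filtered_bimodule (lin_alg B') F (lin_bimod K') G"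
  unfolding filtered_bimodule_def
proof (intro conjI allI impI)
  interpret M: bimod_model "lin_alg B'" "lin_bimod K'" id "id \<circ> K1.pr" "strict K1.pr" K1.total_op u'
    by (rule K1.bimod_model_lin_bimod)
  show "filtered_algebra (lin_alg B') F" by (rule filtered_algebra_fil)
  show "ainf_bimodule (lin_alg B') (lin_bimod K')" by (rule A1.lin.ainf_bimodule_realizes[OF M.M])
  show "subgroup (G i) (lin_bimod K')" "G i \<subseteq> G (i + 1)" for i by (rule mod.subgroup_fil mod.fil_step)+
  fix ds as d x es bs
  assume *: "list_all2 (\<lambda>i a. a \<in> F i) ds as \<and> x \<in> G d \<and> list_all2 (\<lambda>i b. b \<in> F i) es bs"
  show "bop (lin_bimod K') as x bs \<in> G (sum_list ds + d + sum_list es)"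
    by (cases as bs rule: K0.short_cases)
      (use * Dg.f_fil Lg.f_fil Rg.f_fil in \<open>auto simp: list_all2_Cons2 K1.bop_lin_bimod K1.bop_lin_bimod_long\<close>)
qed

definition \<Theta>inv where "\<Theta>inv = the_inv_into (span_of (gens K)) mod.\<Theta>"

text \<open>Transport along \<open>mod.\<Theta>\<close> presents the associated graded by the ring
  element of \<open>K\<close>. The map \<open>\<theta>\<close> is compared with
  \<open>alg.\<Theta>\<close> on the span of the generators, where the inputs of the operations
  lie.\<close>

lemma bimod_model_gr:
  assumes \<theta>: "\<And>v. v \<in> A0.Sp \<Longrightarrow> \<theta> v = alg.\<Theta> v"
  shows "bimod_model (lin_alg B) (restrict_scalars \<theta> gM) \<Theta>inv (mod.\<Theta> \<circ> K0.pr) (strict K0.pr) K0.total_op u"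
proof (rule K0.bimod_model_strict_iso)
  have c: "carrier (restrict_scalars \<theta> gM) = carrier (gr_space (lin_bimod K') G)"
    "monoid.mult (restrict_scalars \<theta> gM) = monoid.mult (gr_space (lin_bimod K') G)"
    "\<one>\<^bsub>restrict_scalars \<theta> gM\<^esub> = \<one>\<^bsub>gr_space (lin_bimod K') G\<^esub>"
    by (simp_all add: restrict_scalars_def gr_bimod_def)
  show "mod.\<Theta> \<in> hom (lin_bimod K) (restrict_scalars \<theta> gM)"
    by (rule homI) (simp_all add: c K0.carrier_lin_bimod K0.mult_lin_bimod mod.\<Theta>_closed mod.\<Theta>_add)
  have inj: "inj_on mod.\<Theta> (span_of (gens K))"
    by (rule inj_onI) (rule mod.\<Theta>_inj)
  show "\<Theta>inv (mod.\<Theta> v) = v" if "v \<in> span_of (gens K)" for v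
    unfolding \<Theta>inv_def by (rule the_inv_into_f_f[OF inj that])
  fix x assume "x \<in> carrier (restrict_scalars \<theta> gM)"
  then obtain v where "v \<in> span_of (gens K)" "mod.\<Theta> v = x" unfolding c by (rule mod.\<Theta>_surj)
  then show "\<Theta>inv x \<in> span_of (gens K) \<and> mod.\<Theta> (\<Theta>inv x) = x"
    unfolding \<Theta>inv_def using the_inv_into_f_f[OF inj] by auto
next
  show "comm_group (restrict_scalars \<theta> gM)"
    by (rule comm_group_cong[OF mod.comm_group_gr_space]) (simp_all add: restrict_scalars_def gr_bimod_def)
  fix as v bs
  assume "as \<in> lists (carrier (lin_alg B))" "v \<in> span_of (gens K)" "bs \<in> lists (carrier (lin_alg B))"
  moreover from this have "map \<theta> as = map alg.\<Theta> as" "map \<theta> bs = map alg.\<Theta> bs"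
    by (auto simp: A0.carrier_lin_alg \<theta>)
  ultimately have "bop gM (map \<theta> as) (mod.\<Theta> v) (map \<theta> bs) = mod.\<Theta> (bop (lin_bimod K) as v bs)"
    by (simp only: A0.carrier_lin_alg bop_gM_\<Theta>)
  then show "bop (restrict_scalars \<theta> gM) as (mod.\<Theta> v) bs = mod.\<Theta> (bop (lin_bimod K) as v bs)"
    by (simp add: restrict_scalars_def)
qed

end

section \<open>Filtrations on tensor products\<close>

lemma consw_in:
  assumes "v \<in> span_of A" "w \<in> span_of L" "\<And>s l. s \<in> A \<Longrightarrow> l \<in> L \<Longrightarrow> s # l \<in> L'"
  shows "consw v w \<in> span_of L'"
  unfolding consw_def by (intro lin_in_span[OF assms(1)] lin_in_span[OF assms(2)]) (simp add: assms(3))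

text \<open>Tensor power of \<open>\<omega>\<close>: every letter is substituted and the result is
  multiplied out.\<close>

primrec word_map :: "('s \<Rightarrow> 't vec) \<Rightarrow> 's list \<Rightarrow> 't list vec" where
  "word_map \<omega> [] = bas []"
| "word_map \<omega> (s # l) = consw (\<omega> s) (word_map \<omega> l)"

lemma word_map_consw: "lin (word_map \<omega>) (consw v w) = consw (lin \<omega> v) (lin (word_map \<omega>) w)"
proof (induction v rule: vec_induct)
  case (bas_add s v)
  have "lin (word_map \<omega>) (consw (bas s) w) = consw (\<omega> s) (lin (word_map \<omega>) w)"
    by (induction w rule: vec_induct) (simp_all add: consw_add lin_add consw_bas)
  then show ?case using bas_add by (simp add: consw_add lin_add)
qed simp

lemma word_map_inverse:
  "(\<And>s. s \<in> set l \<Longrightarrow> lin \<omega>' (\<omega> s) = bas s) \<Longrightarrow> lin (word_map \<omega>') (word_map \<omega> l) = bas l"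
  by (induction l) (simp_all add: word_map_consw consw_bas)

definition wdeg :: "('s \<Rightarrow> int) \<Rightarrow> 's list \<Rightarrow> int" where
  "wdeg deg l = sum_list (map deg l)"

lemma wdeg_simps [simp]: "wdeg deg [] = 0" "wdeg deg (s # l) = deg s + wdeg deg l"
  by (simp_all add: wdeg_def)

text \<open>The hypotheses concern single letters and pairs of letters. Remainders are given as
  explicit vectors \<open>r\<close> on the source side, so that the remainder of a word can be
  assembled from those of its letters.\<close>

locale bar_map = S: bar_words mul dif S + S': bar_words mul' dif' S'
  for mul dif and S :: "'s set" and mul' dif' and S' :: "'t set" +
  fixes \<omega> :: "'s \<Rightarrow> 't vec" and deg :: "'s \<Rightarrow> int"
  assumes mul_homog: "s \<in> S \<Longrightarrow> t \<in> S \<Longrightarrow> mul s t \<in> span_of {r \<in> S. deg r = deg s + deg t}"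
    and dif_homog: "s \<in> S \<Longrightarrow> dif s \<in> span_of {r \<in> S. deg r = deg s}"
    and mul_lower: "s \<in> S \<Longrightarrow> t \<in> S \<Longrightarrow> \<exists>r\<in>span_of {r \<in> S. deg r < deg s + deg t}.
      S'.mulv (\<omega> s) (\<omega> t) = lin \<omega> (mul s t) + lin \<omega> r"
    and dif_lower: "s \<in> S \<Longrightarrow> \<exists>r\<in>span_of {r \<in> S. deg r < deg s}. lin dif' (\<omega> s) = lin \<omega> (dif s) + lin \<omega> r"
begin

definition words :: "(int \<Rightarrow> bool) \<Rightarrow> 's list set" where
  "words P = {l \<in> lists S. P (wdeg deg l)}"

lemma bas_words: "l \<in> lists S \<Longrightarrow> P (wdeg deg l) \<Longrightarrow> bas l \<in> span_of (words P)"
  by (simp add: words_def)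

lemma consw_words:
  assumes "v \<in> span_of {s \<in> S. P (deg s)}" "w \<in> span_of (words Q)" "\<And>i j. P i \<Longrightarrow> Q j \<Longrightarrow> R (i + j)"
  shows "consw v w \<in> span_of (words R)"
  by (rule consw_in[OF assms(1,2)]) (simp add: words_def assms(3))

lemma push_homog: "s \<in> S \<Longrightarrow> l \<in> lists S \<Longrightarrow> S.push (bas s) l \<in> span_of (words (\<lambda>d. d = deg s + wdeg deg l))"
proof (cases l)
  case (Cons t l')
  assume "s \<in> S" "l \<in> lists S"
  then show ?thesis
    using consw_words[OF mul_homog bas_words[of l' "\<lambda>d. d = wdeg deg l'"]] by (simp add: Cons S.mulv_bas)
qed simp

lemma bar_homog: "l \<in> lists S \<Longrightarrow> S.bar l \<in> span_of (words (\<lambda>d. d = wdeg deg l))"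
proof (induction l)
  case (Cons s l)
  then have s: "s \<in> S" "l \<in> lists S" by auto
  show ?case
    unfolding S.bar.simps
    by (intro span_of_add consw_words[OF dif_homog bas_words[of l "\<lambda>d. d = wdeg deg l"]] consw_words[where P = "\<lambda>d. d = deg s", OF _ Cons.IH])
      (use s push_homog in auto)
qed simp

lemma push_lower:
  assumes s: "s \<in> S" and l: "l \<in> lists S"
  shows "\<exists>r\<in>span_of (words (\<lambda>d. d < deg s + wdeg deg l)).
    lin (S'.push (\<omega> s)) (word_map \<omega> l) = lin (word_map \<omega>) (S.push (bas s) l) + lin (word_map \<omega>) r"
proof (cases l)
  case Nil
  then show ?thesis by (intro bexI[of _ 0]) simp_all
next
  case (Cons t l')
  then have t: "t \<in> S" "l' \<in> lists S" using l by auto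
  obtain r where r: "r \<in> span_of {r \<in> S. deg r < deg s + deg t}"
    "S'.mulv (\<omega> s) (\<omega> t) = lin \<omega> (mul s t) + lin \<omega> r"
    using mul_lower[OF s t(1)] by blast
  show ?thesis
  proof (rule bexI[of _ "consw r (bas l')"])
    show "consw r (bas l') \<in> span_of (words (\<lambda>d. d < deg s + wdeg deg l))"
      by (rule consw_words[OF r(1) bas_words[of l' "\<lambda>d. d = wdeg deg l'"]]) (simp_all add: t Cons)
  qed (simp add: Cons S'.push_consw S.mulv_bas word_map_consw r(2) consw_add)
qed

text \<open>Degrees of letters add. A remainder of lower degree in one letter, or in the product of
  two neighbours, thus remains of lower degree when the other letters are kept.\<close>

lemma bar_lower:
  "l \<in> lists S \<Longrightarrow> \<exists>r\<in>span_of (words (\<lambda>d. d < wdeg deg l)).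
    lin S'.bar (word_map \<omega> l) = lin (word_map \<omega>) (S.bar l) + lin (word_map \<omega>) r"
proof (induction l)
  case Nil
  show ?case by (intro bexI[of _ 0]) simp_all
next
  case (Cons s l)
  then have s: "s \<in> S" "l \<in> lists S" by auto
  obtain r0 where r0: "r0 \<in> span_of {r \<in> S. deg r < deg s}" "lin dif' (\<omega> s) = lin \<omega> (dif s) + lin \<omega> r0"
    using dif_lower[OF s(1)] by blast
  obtain r1 where r1: "r1 \<in> span_of (words (\<lambda>d. d < deg s + wdeg deg l))"
    "lin (S'.push (\<omega> s)) (word_map \<omega> l) = lin (word_map \<omega>) (S.push (bas s) l) + lin (word_map \<omega>) r1"
    using push_lower[OF s] by blast
  obtain r2 where r2: "r2 \<in> span_of (words (\<lambda>d. d < wdeg deg l))"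
    "lin S'.bar (word_map \<omega> l) = lin (word_map \<omega>) (S.bar l) + lin (word_map \<omega>) r2"
    using Cons.IH[OF s(2)] by blast
  show ?case
  proof (rule bexI[of _ "consw r0 (bas l) + r1 + consw (bas s) r2"])
    have "consw r0 (bas l) \<in> span_of (words (\<lambda>d. d < wdeg deg (s # l)))"
      by (rule consw_words[OF r0(1) bas_words[of l "\<lambda>d. d = wdeg deg l"]]) (simp_all add: s)
    moreover have "consw (bas s) r2 \<in> span_of (words (\<lambda>d. d < wdeg deg (s # l)))"
      by (rule consw_words[where P = "\<lambda>d. d = deg s", OF _ r2(1)]) (simp_all add: s)
    ultimately show "consw r0 (bas l) + r1 + consw (bas s) r2 \<in> span_of (words (\<lambda>d. d < wdeg deg (s # l)))"
      using r1(1) by (simp add: span_of_add)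
    show "lin S'.bar (word_map \<omega> (s # l)) = lin (word_map \<omega>) (S.bar (s # l)) +
        lin (word_map \<omega>) (consw r0 (bas l) + r1 + consw (bas s) r2)"
      by (simp add: S'.bar_consw r0(2) r1(2) r2(2) word_map_consw consw_add lin_add add_ac)
  qed
qed

lemma ext_homog:
  assumes \<theta>: "\<And>s. s \<in> S \<Longrightarrow> \<theta> s \<in> span_of {t \<in> S. deg t = deg s + e}"
  shows "l \<in> lists S \<Longrightarrow> S.leibniz_ext \<theta> l \<in> span_of (words (\<lambda>d. d = wdeg deg l + e))"
proof (induction l)
  case (Cons s l)
  then have s: "s \<in> S" "l \<in> lists S" by auto
  show ?case
    unfolding S.leibniz_ext.simps
    by (intro span_of_add consw_words[OF \<theta> bas_words[of l "\<lambda>d. d = wdeg deg l"]] consw_words[where P = "\<lambda>d. d = deg s", OF _ Cons.IH])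
      (use s in auto)
qed simp

lemma ext_lower:
  assumes \<theta>: "\<And>s. s \<in> S \<Longrightarrow> \<exists>r\<in>span_of {t \<in> S. deg t < deg s + e}. lin \<theta>' (\<omega> s) = lin \<omega> (\<theta> s) + lin \<omega> r"
  shows "l \<in> lists S \<Longrightarrow> \<exists>r\<in>span_of (words (\<lambda>d. d < wdeg deg l + e)).
    lin (S'.leibniz_ext \<theta>') (word_map \<omega> l) = lin (word_map \<omega>) (S.leibniz_ext \<theta> l) + lin (word_map \<omega>) r"
proof (induction l)
  case Nil
  show ?case by (intro bexI[of _ 0]) simp_all
next
  case (Cons s l)
  then have s: "s \<in> S" "l \<in> lists S" by auto
  obtain r0 where r0: "r0 \<in> span_of {t \<in> S. deg t < deg s + e}" "lin \<theta>' (\<omega> s) = lin \<omega> (\<theta> s) + lin \<omega> r0"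
    using \<theta>[OF s(1)] by blast
  obtain r2 where r2: "r2 \<in> span_of (words (\<lambda>d. d < wdeg deg l + e))"
    "lin (S'.leibniz_ext \<theta>') (word_map \<omega> l) = lin (word_map \<omega>) (S.leibniz_ext \<theta> l) + lin (word_map \<omega>) r2"
    using Cons.IH[OF s(2)] by blast
  show ?case
  proof (rule bexI[of _ "consw r0 (bas l) + consw (bas s) r2"])
    have "consw r0 (bas l) \<in> span_of (words (\<lambda>d. d < wdeg deg (s # l) + e))"
      by (rule consw_words[OF r0(1) bas_words[of l "\<lambda>d. d = wdeg deg l"]]) (simp_all add: s)
    moreover have "consw (bas s) r2 \<in> span_of (words (\<lambda>d. d < wdeg deg (s # l) + e))"
      by (rule consw_words[where P = "\<lambda>d. d = deg s", OF _ r2(1)]) (simp_all add: s)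
    ultimately show "consw r0 (bas l) + consw (bas s) r2 \<in> span_of (words (\<lambda>d. d < wdeg deg (s # l) + e))"
      by (simp add: span_of_add)
    show "lin (S'.leibniz_ext \<theta>') (word_map \<omega> (s # l)) = lin (word_map \<omega>) (S.leibniz_ext \<theta> (s # l)) +
        lin (word_map \<omega>) (consw r0 (bas l) + consw (bas s) r2)"
      by (simp add: S'.leibniz_ext_consw r0(2) r2(2) word_map_consw consw_add lin_add add_ac)
  qed
qed

end

section \<open>Changes of basis on letters and words\<close>

fun letter_map :: "('x \<Rightarrow> 'y vec) \<Rightarrow> ('g \<Rightarrow> 'h vec) \<Rightarrow> ('x \<Rightarrow> 'y vec) \<Rightarrow> ('g, 'x) letter \<Rightarrow> ('h, 'y) letter vec"
  where
  "letter_map p \<psi> q (LM x) = lin (\<lambda>x'. bas (LM x')) (p x)"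
| "letter_map p \<psi> q (LA a) = lin (\<lambda>a'. bas (LA a')) (\<psi> a)"
| "letter_map p \<psi> q (LN y) = lin (\<lambda>y'. bas (LN y')) (q y)"

fun letter_deg :: "('x \<Rightarrow> int) \<Rightarrow> ('g \<Rightarrow> int) \<Rightarrow> ('x \<Rightarrow> int) \<Rightarrow> ('g, 'x) letter \<Rightarrow> int" where
  "letter_deg dM dA dN (LM x) = dM x"
| "letter_deg dM dA dN (LA a) = dA a"
| "letter_deg dM dA dN (LN y) = dN y"

text \<open>The words coming from generators of a tensor product. \<open>word_map\<close> has to
  preserve this shape for its result to be read back by \<open>unword\<close>.\<close>

definition bar_shape :: "'x set \<Rightarrow> 'g set \<Rightarrow> 'x set \<Rightarrow> ('g, 'x) letter list set" where
  "bar_shape M A N = {LM x # map LA as @ [LN y] | x as y. x \<in> M \<and> as \<in> lists A \<and> y \<in> N}"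

lemma word_map_shape:
  fixes p q :: "'x \<Rightarrow> 'y vec" and \<psi> :: "'g \<Rightarrow> 'h vec"
  assumes "\<And>x. x \<in> M \<Longrightarrow> p x \<in> span_of M'" "\<And>a. a \<in> A \<Longrightarrow> \<psi> a \<in> span_of A'" "\<And>y. y \<in> N \<Longrightarrow> q y \<in> span_of N'"
    and "l \<in> bar_shape M A N"
  shows "word_map (letter_map p \<psi> q) l \<in> span_of (bar_shape M' A' N')"
proof -
  obtain x as y where l: "l = LM x # map LA as @ [LN y]" "x \<in> M" "as \<in> lists A" "y \<in> N"
    using assms(4) unfolding bar_shape_def by blast
  have "word_map (letter_map p \<psi> q) (map LA as @ [LN y]) \<in>
      span_of {map LA as' @ [LN y'] | as' y'. as' \<in> lists A' \<and> y' \<in> N'}"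
    using l(3)
  proof (induction as)
    case Nil
    have "lin (\<lambda>y'. bas (LN y')) (q y) \<in> span_of (LN ` N')"
      by (rule lin_in_span[OF assms(3)[OF l(4)]]) simp
    moreover have "bas [] \<in> span_of {[]}" by simp
    ultimately have "consw (lin (\<lambda>y'. bas (LN y')) (q y)) (bas []) \<in>
        span_of {map LA as' @ [LN y'] | as' y'. as' \<in> lists A' \<and> y' \<in> N'}"
      by (rule consw_in) (auto intro!: exI[of _ "[]"])
    then show ?case by simp
  next
    case (Cons a as)
    then have "lin (\<lambda>a'. bas (LA a')) (\<psi> a) \<in> span_of (LA ` A')"
      by (intro lin_in_span[OF assms(2)]) auto
    moreover note Cons.IH
    ultimately have "consw (lin (\<lambda>a'. bas (LA a')) (\<psi> a)) (word_map (letter_map p \<psi> q) (map LA as @ [LN y])) \<in>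
        span_of {map LA as' @ [LN y'] | as' y'. as' \<in> lists A' \<and> y' \<in> N'}"
    proof (rule consw_in)
      fix s :: "('h, 'y) letter" and l assume "s \<in> LA ` A'" "l \<in> {map LA as' @ [LN y'] | as' y'. as' \<in> lists A' \<and> y' \<in> N'}"
      then obtain a' as' y' where "s = LA a'" "a' \<in> A'" "l = map LA as' @ [LN y']" "as' \<in> lists A'" "y' \<in> N'"
        by blast
      then show "s # l \<in> {map LA as' @ [LN y'] | as' y'. as' \<in> lists A' \<and> y' \<in> N'}"
        by (intro CollectI exI[of _ "a' # as'"] exI[of _ y']) simp
    qed
    then show ?case by simp
  qed
  moreover have "lin (\<lambda>x'. bas (LM x')) (p x) \<in> span_of (LM ` M')"
    by (rule lin_in_span[OF assms(1)[OF l(2)]]) simp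
  ultimately show ?thesis
    unfolding l(1) word_map.simps letter_map.simps
    by (intro consw_in) (auto simp: bar_shape_def simp del: in_lists_conv_set)
qed

text \<open>Mutually inverse changes of basis, given on generators. The inverse is kept as data
  because the one for a tensor product is composed from it letter by letter.\<close>

definition lin_inverse :: "'x set \<Rightarrow> 'y set \<Rightarrow> ('x \<Rightarrow> 'y vec) \<Rightarrow> ('y \<Rightarrow> 'x vec) \<Rightarrow> bool" where
  "lin_inverse S T p p' \<longleftrightarrow>
     (\<forall>x\<in>S. p x \<in> span_of T \<and> lin p' (p x) = bas x) \<and> (\<forall>y\<in>T. p' y \<in> span_of S \<and> lin p (p' y) = bas y)"

lemma lin_inverse_bij:
  assumes "lin_inverse S T p p'"
  shows "bij_betw (lin p) (span_of S) (span_of T)"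
proof (rule bij_betw_byWitness[where f' = "lin p'"])
  have "lin p' (lin p v) = lin bas v" if "v \<in> span_of S" for v
    unfolding lin_lin by (rule lin_cong_span[OF that]) (use assms in \<open>simp add: lin_inverse_def\<close>)
  then show "\<forall>v\<in>span_of S. lin p' (lin p v) = v" by simp
  have "lin p (lin p' v) = lin bas v" if "v \<in> span_of T" for v
    unfolding lin_lin by (rule lin_cong_span[OF that]) (use assms in \<open>simp add: lin_inverse_def\<close>)
  then show "\<forall>v\<in>span_of T. lin p (lin p' v) = v" by simp
  have "v \<in> span_of S \<Longrightarrow> lin p v \<in> span_of T" "w \<in> span_of T \<Longrightarrow> lin p' w \<in> span_of S" for v w
    using assms by (auto simp: lin_inverse_def intro: lin_in_span)
  then show "lin p ` span_of S \<subseteq> span_of T" "lin p' ` span_of T \<subseteq> span_of S" by auto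
qed

lemma adapted_basis_lin:
  fixes V :: "('y vec, 'e) monoid_scheme"
  assumes "lin_inverse S T p p'" "carrier V = span_of T" "monoid.mult V = (+)" "\<one>\<^bsub>V\<^esub> = 0"
  shows "adapted_basis V S T (lin p)"
  by (rule adapted_basis.intro) (simp_all add: assms(2-) lin_add lin_inverse_bij[OF assms(1)])

text \<open>Degrees are integers, so lying in \<open>fil (d - 1)\<close> means having a preimage of
  degree less than d. The lemma after this one translates in the other direction.\<close>

lemma (in adapted_basis) fil_witness:
  assumes "r \<in> span_of {y \<in> S. deg y < d}" "\<Psi> c + a = \<Psi> r"
  shows "a + \<Psi> c \<in> fil (d - 1)"
proof -
  have "{y \<in> S. deg y < d} = {y \<in> S. deg y \<le> d - 1}" by auto
  then show ?thesis
    using assms by (auto simp: fil_def low_def add.commute)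
qed

lemma (in adapted_basis) fil_witnessE:
  assumes "a + \<Psi> c \<in> fil (d - 1)"
  shows "\<exists>r\<in>span_of {y \<in> S. deg y < d}. a = \<Psi> c + \<Psi> r"
proof -
  have e: "{y \<in> S. deg y < d} = {y \<in> S. deg y \<le> d - 1}" by auto
  obtain r where "r \<in> span_of {y \<in> S. deg y \<le> d - 1}" "a + \<Psi> c = \<Psi> r"
    using assms by (auto simp: fil_def low_def)
  moreover from this(2) have "a = \<Psi> c + \<Psi> r"
    using vec_add_self_left[of "\<Psi> c" a] by (simp add: add.commute)
  ultimately show ?thesis unfolding e by blast
qed

section \<open>Comparison of tensor products\<close>

locale filtered_tensor =
  M: filtered_dg B u B' u' degA "lin \<psi>" M M' degM "lin p" +
  N: filtered_dg B u B' u' degA "lin \<psi>" N N' degN "lin q"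
  for B :: "'g based_alg" and u and B' :: "'h based_alg" and u' degA \<psi>
    and M :: "('g, 'g mgen) based_bimod" and M' :: "('h, 'h mgen) based_bimod" and degM p
    and N :: "('g, 'g mgen) based_bimod" and N' :: "('h, 'h mgen) based_bimod" and degN q +
  fixes \<psi>' p' q'
  assumes inverse_A: "lin_inverse (agens B) (agens B') \<psi> \<psi>'"
    and inverse_M: "lin_inverse (gens M) (gens M') p p'"
    and inverse_N: "lin_inverse (gens N) (gens N') q q'"
begin

sublocale T: tensor_pair B u M N by unfold_locales

sublocale T': tensor_pair B' u' M' N' by unfold_locales

abbreviation "\<omega> \<equiv> letter_map p \<psi> q"
abbreviation "\<omega>' \<equiv> letter_map p' \<psi>' q'"
abbreviation "ldeg \<equiv> letter_deg degM degA degN"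

lemma mulv_letters:
  "T'.mulv (lin (\<lambda>x. bas (LM x)) v) (lin (\<lambda>a. bas (LA a)) b) = lin (\<lambda>x. bas (LM x)) (Rop M' v b)"
  "T'.mulv (lin (\<lambda>a. bas (LA a)) b) (lin (\<lambda>a. bas (LA a)) c) = lin (\<lambda>a. bas (LA a)) (amul B' b c)"
  "T'.mulv (lin (\<lambda>a. bas (LA a)) b) (lin (\<lambda>y. bas (LN y)) w) = lin (\<lambda>y. bas (LN y)) (Lop N' b w)"
  "T'.mulv (lin (\<lambda>x. bas (LM x)) v) (lin (\<lambda>y. bas (LN y)) w) = 0"
  "T'.mulv (lin (\<lambda>x. bas (LM x)) v) (lin (\<lambda>x. bas (LM x)) v') = 0"
  "T'.mulv (lin (\<lambda>a. bas (LA a)) b) (lin (\<lambda>x. bas (LM x)) v) = 0"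
  "T'.mulv (lin (\<lambda>y. bas (LN y)) w) t = 0"
proof -
  have "T'.lmul (LN y) = (\<lambda>s. 0)" for y
  proof (rule ext)
    show "T'.lmul (LN y) s = 0" for s by (cases s) simp_all
  qed
  then show "T'.mulv (lin (\<lambda>y. bas (LN y)) w) t = 0"
    by (simp add: T'.mulv_def lin_lin)
qed (simp_all add: T'.mulv_def lin_lin Rop_def Lop_def amul_def)

lemma mul_lower_letters:
  assumes "s \<in> T.letters" "t \<in> T.letters"
  shows "\<exists>r\<in>span_of {r \<in> T.letters. ldeg r < ldeg s + ldeg t}.
    T'.mulv (\<omega> s) (\<omega> t) = lin \<omega> (T.lmul s t) + lin \<omega> r"
proof -
  have zero: "\<exists>r\<in>span_of {r \<in> T.letters. ldeg r < ldeg s + ldeg t}. T'.mulv (\<omega> s) (\<omega> t) = lin \<omega> (T.lmul s t) + lin \<omega> r"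
    if "T'.mulv (\<omega> s) (\<omega> t) = 0" "T.lmul s t = 0" for s t
    using that by (intro bexI[of _ 0]) simp_all
  show ?thesis
  proof (cases s)
    case s: (LM x)
    show ?thesis
    proof (cases t)
      case t: (LA a)
      have xa: "x \<in> gens M" "a \<in> agens B" using assms by (auto simp: s t T.letters_def)
      have "Rop M' (p x) (\<psi> a) + lin p (coef M [] x [a]) \<in> M.mod.fil (degM x + degA a - 1)"
        using M.R_lower[OF xa(2,1)] by simp
      from M.mod.fil_witnessE[OF this] obtain r where r: "r \<in> span_of {y \<in> gens M. degM y < degM x + degA a}"
        "Rop M' (p x) (\<psi> a) = lin p (coef M [] x [a]) + lin p r" by blast
      have "lin (\<lambda>x. bas (LM x)) r \<in> span_of {r \<in> T.letters. ldeg r < ldeg s + ldeg t}"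
        by (rule lin_in_span[OF r(1)]) (simp add: s t T.letters_def)
      then show ?thesis
        by (intro bexI[of _ "lin (\<lambda>x. bas (LM x)) r"]) (simp_all add: s t mulv_letters r(2) lin_lin lin_add)
    next
      case t: (LM y)
      show ?thesis by (rule zero) (simp_all add: s t mulv_letters)
    next
      case t: (LN y)
      show ?thesis by (rule zero) (simp_all add: s t mulv_letters)
    qed
  next
    case s: (LA b)
    show ?thesis
    proof (cases t)
      case t: (LA a)
      have ba: "b \<in> agens B" "a \<in> agens B" using assms by (auto simp: s t T.letters_def)
      have "amul B' (\<psi> b) (\<psi> a) + lin \<psi> (acoef B [b, a]) \<in> M.alg.fil (degA b + degA a - 1)"
        using M.amul_lower[OF ba] by simp
      from M.alg.fil_witnessE[OF this] obtain r where r: "r \<in> span_of {y \<in> agens B. degA y < degA b + degA a}"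
        "amul B' (\<psi> b) (\<psi> a) = lin \<psi> (acoef B [b, a]) + lin \<psi> r" by blast
      have "lin (\<lambda>x. bas (LA x)) r \<in> span_of {r \<in> T.letters. ldeg r < ldeg s + ldeg t}"
        by (rule lin_in_span[OF r(1)]) (simp add: s t T.letters_def)
      then show ?thesis
        by (intro bexI[of _ "lin (\<lambda>x. bas (LA x)) r"]) (simp_all add: s t mulv_letters r(2) lin_lin lin_add)
    next
      case t: (LN y)
      have by': "b \<in> agens B" "y \<in> gens N" using assms by (auto simp: s t T.letters_def)
      have "Lop N' (\<psi> b) (q y) + lin q (coef N [b] y []) \<in> N.mod.fil (degA b + degN y - 1)"
        using N.L_lower[OF by'] by simp
      from N.mod.fil_witnessE[OF this] obtain r where r: "r \<in> span_of {z \<in> gens N. degN z < degA b + degN y}"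
        "Lop N' (\<psi> b) (q y) = lin q (coef N [b] y []) + lin q r" by blast
      have "lin (\<lambda>x. bas (LN x)) r \<in> span_of {r \<in> T.letters. ldeg r < ldeg s + ldeg t}"
        by (rule lin_in_span[OF r(1)]) (simp add: s t T.letters_def)
      then show ?thesis
        by (intro bexI[of _ "lin (\<lambda>x. bas (LN x)) r"]) (simp_all add: s t mulv_letters r(2) lin_lin lin_add)
    next
      case t: (LM y)
      show ?thesis by (rule zero) (simp_all add: s t mulv_letters)
    qed
  next
    case s: (LN y)
    show ?thesis
      by (rule zero) (cases t; simp add: s mulv_letters)+
  qed
qed

lemma ldif_letters:
  "lin T'.ldif (lin (\<lambda>x. bas (LM x)) v) = lin (\<lambda>x. bas (LM x)) (Dop M' v)"
  "lin T'.ldif (lin (\<lambda>a. bas (LA a)) b) = 0"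
  "lin T'.ldif (lin (\<lambda>y. bas (LN y)) w) = lin (\<lambda>y. bas (LN y)) (Dop N' w)"
  by (simp_all add: lin_lin Dop_def)

lemma dif_lower_letters:
  assumes "s \<in> T.letters"
  shows "\<exists>r\<in>span_of {r \<in> T.letters. ldeg r < ldeg s}. lin T'.ldif (\<omega> s) = lin \<omega> (T.ldif s) + lin \<omega> r"
proof (cases s)
  case s: (LM x)
  have "Dop M' (p x) + lin p (coef M [] x []) \<in> M.mod.fil (degM x - 1)"
    using M.D_lower[of x] assms by (auto simp: s T.letters_def)
  from M.mod.fil_witnessE[OF this] obtain r where r: "r \<in> span_of {y \<in> gens M. degM y < degM x}"
    "Dop M' (p x) = lin p (coef M [] x []) + lin p r" by blast
  have "lin (\<lambda>x. bas (LM x)) r \<in> span_of {r \<in> T.letters. ldeg r < ldeg s}"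
    by (rule lin_in_span[OF r(1)]) (simp add: s T.letters_def)
  then show ?thesis
    by (intro bexI[of _ "lin (\<lambda>x. bas (LM x)) r"])
      (simp only: s letter_map.simps T.ldif.simps ldif_letters r(2), simp add: lin_lin lin_add)
next
  case s: (LA a)
  show ?thesis by (intro bexI[of _ 0]) (simp_all add: s ldif_letters)
next
  case s: (LN x)
  have "Dop N' (q x) + lin q (coef N [] x []) \<in> N.mod.fil (degN x - 1)"
    using N.D_lower[of x] assms by (auto simp: s T.letters_def)
  from N.mod.fil_witnessE[OF this] obtain r where r: "r \<in> span_of {y \<in> gens N. degN y < degN x}"
    "Dop N' (q x) = lin q (coef N [] x []) + lin q r" by blast
  have "lin (\<lambda>x. bas (LN x)) r \<in> span_of {r \<in> T.letters. ldeg r < ldeg s}"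
    by (rule lin_in_span[OF r(1)]) (simp add: s T.letters_def)
  then show ?thesis
    by (intro bexI[of _ "lin (\<lambda>x. bas (LN x)) r"])
      (simp only: s letter_map.simps T.ldif.simps ldif_letters r(2), simp add: lin_lin lin_add)
qed

lemma lin_letters_homog:
  "v \<in> span_of {x \<in> gens M. degM x = d} \<Longrightarrow> lin (\<lambda>x. bas (LM x)) v \<in> span_of {r \<in> T.letters. ldeg r = d}"
  "b \<in> span_of {x \<in> agens B. degA x = d} \<Longrightarrow> lin (\<lambda>x. bas (LA x)) b \<in> span_of {r \<in> T.letters. ldeg r = d}"
  "w \<in> span_of {x \<in> gens N. degN x = d} \<Longrightarrow> lin (\<lambda>x. bas (LN x)) w \<in> span_of {r \<in> T.letters. ldeg r = d}"
  by (rule lin_in_span, assumption, simp add: T.letters_def)+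

lemma letters_mem: "LM x \<in> T.letters \<longleftrightarrow> x \<in> gens M" "LA a \<in> T.letters \<longleftrightarrow> a \<in> agens B" "LN y \<in> T.letters \<longleftrightarrow> y \<in> gens N"
  by (auto simp: T.letters_def)

sublocale W: bar_map T.lmul T.ldif T.letters T'.lmul T'.ldif T'.letters \<omega> ldeg
proof
  fix s assume s: "s \<in> T.letters"
  show "T.ldif s \<in> span_of {r \<in> T.letters. ldeg r = ldeg s}"
    using s by (cases s) (auto simp: letters_mem intro!: lin_letters_homog M.D_homog N.D_homog)
  show "\<exists>r\<in>span_of {r \<in> T.letters. ldeg r < ldeg s}. lin T'.ldif (\<omega> s) = lin \<omega> (T.ldif s) + lin \<omega> r"
    by (rule dif_lower_letters[OF s])
  fix t assume t: "t \<in> T.letters"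
  show "T.lmul s t \<in> span_of {r \<in> T.letters. ldeg r = ldeg s + ldeg t}"
    using s t by (cases s; cases t)
      (auto simp: letters_mem intro!: lin_letters_homog M.acoef_homog M.R_homog N.L_homog)
  show "\<exists>r\<in>span_of {r \<in> T.letters. ldeg r < ldeg s + ldeg t}. T'.mulv (\<omega> s) (\<omega> t) = lin \<omega> (T.lmul s t) + lin \<omega> r"
    by (rule mul_lower_letters[OF s t])
qed

abbreviation "Sh \<equiv> bar_shape (gens M) (agens B) (gens N)"
abbreviation "Sh' \<equiv> bar_shape (gens M') (agens B') (gens N')"

lemma word_shape: "z \<in> gens T.K \<Longrightarrow> T.word z \<in> Sh" "z' \<in> gens T'.K \<Longrightarrow> T'.word z' \<in> Sh'"
  by (auto simp: T.gens_K T'.gens_K T.word_def T'.word_def bar_shape_def simp del: in_lists_conv_set)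

lemma unword_shape:
  "l \<in> Sh \<Longrightarrow> T.unword l \<in> gens T.K \<and> T.word (T.unword l) = l"
  "l' \<in> Sh' \<Longrightarrow> T'.unword l' \<in> gens T'.K \<and> T'.word (T'.unword l') = l'"
  by (auto simp: T.gens_K T'.gens_K T.word_def T'.word_def T.unword_def T'.unword_def bar_shape_def comp_def
      simp del: in_lists_conv_set)

lemma map_shape: "l \<in> Sh \<Longrightarrow> word_map \<omega> l \<in> span_of Sh'" "l' \<in> Sh' \<Longrightarrow> word_map \<omega>' l' \<in> span_of Sh"
  by (rule word_map_shape; use inverse_A inverse_M inverse_N in \<open>auto simp: lin_inverse_def\<close>)+

lemma letter_inverse:
  "s \<in> T.letters \<Longrightarrow> lin \<omega>' (\<omega> s) = bas s" "s' \<in> T'.letters \<Longrightarrow> lin \<omega> (\<omega>' s') = bas s'"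
proof -
  show "s \<in> T.letters \<Longrightarrow> lin \<omega>' (\<omega> s) = bas s"
    using inverse_A inverse_M inverse_N
    by (cases s) (auto simp: T.letters_def lin_inverse_def T.lin_pull simp flip: lin_lin[of "\<lambda>x. bas (LM x)" p'] lin_lin[of "\<lambda>x. bas (LA x)" \<psi>'] lin_lin[of "\<lambda>x. bas (LN x)" q'])
  show "s' \<in> T'.letters \<Longrightarrow> lin \<omega> (\<omega>' s') = bas s'"
    using inverse_A inverse_M inverse_N
    by (cases s') (auto simp: T'.letters_def lin_inverse_def T'.lin_pull simp flip: lin_lin[of "\<lambda>x. bas (LM x)" p] lin_lin[of "\<lambda>x. bas (LA x)" \<psi>] lin_lin[of "\<lambda>x. bas (LN x)" q])
qed

lemma shape_letters: "l \<in> Sh \<Longrightarrow> l \<in> lists T.letters" "l' \<in> Sh' \<Longrightarrow> l' \<in> lists T'.letters"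
  by (auto simp: bar_shape_def T.letters_def T'.letters_def)

lemma map_inverse: "l \<in> Sh \<Longrightarrow> lin (word_map \<omega>') (word_map \<omega> l) = bas l"
  "l' \<in> Sh' \<Longrightarrow> lin (word_map \<omega>) (word_map \<omega>' l') = bas l'"
  by (rule word_map_inverse; use shape_letters in \<open>fastforce intro: letter_inverse\<close>)+

text \<open>A generator is sent to a sum of generators in each tensor factor; passing through words
  multiplies this out.\<close>

definition tens_map :: "'g mgen \<Rightarrow> 'h mgen vec" where
  "tens_map z = lin (\<lambda>l. bas (T'.unword l)) (word_map \<omega> (T.word z))"

definition tens_map' :: "'h mgen \<Rightarrow> 'g mgen vec" where
  "tens_map' z = lin (\<lambda>l. bas (T.unword l)) (word_map \<omega>' (T'.word z))"

definition tens_deg :: "'g mgen \<Rightarrow> int" where "tens_deg z = wdeg ldeg (T.word z)"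

lemma unword_in_span: "v \<in> span_of Sh \<Longrightarrow> lin (\<lambda>l. bas (T.unword l)) v \<in> span_of (gens T.K)"
  "v' \<in> span_of Sh' \<Longrightarrow> lin (\<lambda>l. bas (T'.unword l)) v' \<in> span_of (gens T'.K)"
  by (rule lin_in_span, assumption, simp add: unword_shape)+

lemma \<tau>_unword: "v \<in> span_of Sh \<Longrightarrow> T.\<tau> (lin (\<lambda>l. bas (T.unword l)) v) = v"
  "v' \<in> span_of Sh' \<Longrightarrow> T'.\<tau> (lin (\<lambda>l. bas (T'.unword l)) v') = v'"
proof -
  show "T.\<tau> (lin (\<lambda>l. bas (T.unword l)) v) = v" if "v \<in> span_of Sh"
    using lin_cong_span[OF that, of "\<lambda>l. bas (T.word (T.unword l))" bas] by (simp add: T.\<tau>_def lin_lin unword_shape)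
  show "T'.\<tau> (lin (\<lambda>l. bas (T'.unword l)) v') = v'" if "v' \<in> span_of Sh'"
    using lin_cong_span[OF that, of "\<lambda>l. bas (T'.word (T'.unword l))" bas] by (simp add: T'.\<tau>_def lin_lin unword_shape)
qed

lemma \<tau>_shape: "v \<in> span_of (gens T.K) \<Longrightarrow> T.\<tau> v \<in> span_of Sh"
  "v' \<in> span_of (gens T'.K) \<Longrightarrow> T'.\<tau> v' \<in> span_of Sh'"
  unfolding T.\<tau>_def T'.\<tau>_def by (rule lin_in_span, assumption, simp add: word_shape)+

lemma tens_map_closed: "z \<in> gens T.K \<Longrightarrow> tens_map z \<in> span_of (gens T'.K)"
  "z' \<in> gens T'.K \<Longrightarrow> tens_map' z' \<in> span_of (gens T.K)"
  unfolding tens_map_def tens_map'_def by (intro unword_in_span map_shape word_shape; assumption)+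

lemma \<tau>_tens_map: "v \<in> span_of (gens T.K) \<Longrightarrow> T'.\<tau> (lin tens_map v) = lin (word_map \<omega>) (T.\<tau> v)"
  "v' \<in> span_of (gens T'.K) \<Longrightarrow> T.\<tau> (lin tens_map' v') = lin (word_map \<omega>') (T'.\<tau> v')"
  unfolding T.\<tau>_lin T'.\<tau>_lin T.\<tau>_def[of v] T'.\<tau>_def[of v'] lin_lin lin_bas tens_map_def tens_map'_def
  by (rule lin_cong_span, assumption, simp add: \<tau>_unword map_shape word_shape flip: T.\<tau>_lin T'.\<tau>_lin lin_lin)+

lemma lin_inverse_tens: "lin_inverse (gens T.K) (gens T'.K) tens_map tens_map'"
  unfolding lin_inverse_def
proof (intro conjI ballI tens_map_closed)
  fix z assume z: "z \<in> gens T.K"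
  show "lin tens_map' (tens_map z) = bas z"
  proof (rule T.\<tau>_inj)
    show "lin tens_map' (tens_map z) \<in> span_of (gens T.K)"
      by (rule lin_in_span[OF tens_map_closed(1)[OF z] tens_map_closed(2)])
    have "T'.\<tau> (tens_map z) = word_map \<omega> (T.word z)"
      using \<tau>_tens_map(1)[of "bas z"] z by (simp add: T.\<tau>_bas)
    then show "T.\<tau> (lin tens_map' (tens_map z)) = T.\<tau> (bas z)"
      using \<tau>_tens_map(2)[OF tens_map_closed(1)[OF z]] map_inverse(1)[OF word_shape(1)[OF z]] by (simp add: T.\<tau>_bas)
  qed (simp add: z)
next
  fix z assume z: "z \<in> gens T'.K"
  show "lin tens_map (tens_map' z) = bas z"
  proof (rule T'.\<tau>_inj)
    show "lin tens_map (tens_map' z) \<in> span_of (gens T'.K)"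
      by (rule lin_in_span[OF tens_map_closed(2)[OF z] tens_map_closed(1)])
    have "T.\<tau> (tens_map' z) = word_map \<omega>' (T'.word z)"
      using \<tau>_tens_map(2)[of "bas z"] z by (simp add: T'.\<tau>_bas)
    then show "T'.\<tau> (lin tens_map (tens_map' z)) = T'.\<tau> (bas z)"
      using \<tau>_tens_map(1)[OF tens_map_closed(2)[OF z]] map_inverse(2)[OF word_shape(2)[OF z]] by (simp add: T'.\<tau>_bas)
  qed (simp add: z)
qed

sublocale KB: adapted_basis "lin_bimod T'.K" "gens T.K" "gens T'.K" tens_deg "lin tens_map"
  by (rule adapted_basis_lin[OF lin_inverse_tens]) (simp_all add: lin_bimod_def span_of_def)

lemma transport_homog:
  assumes v: "v \<in> span_of (gens T.K)" and \<tau>v: "T.\<tau> v \<in> span_of (W.words P)"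
  shows "v \<in> span_of {z \<in> gens T.K. P (tens_deg z)}"
proof -
  have "T.\<tau> v \<in> span_of (Sh \<inter> W.words P)"
    using \<tau>_shape(1)[OF v] \<tau>v by (simp add: span_of_def)
  then have "lin (\<lambda>l. bas (T.unword l)) (T.\<tau> v) \<in> span_of {z \<in> gens T.K. P (tens_deg z)}"
    by (rule lin_in_span) (simp add: unword_shape tens_deg_def W.words_def)
  moreover have "lin (\<lambda>l. bas (T.unword l)) (T.\<tau> v) = v"
    by (rule T.\<tau>_inj) (simp_all add: v unword_in_span \<tau>_shape \<tau>_unword)
  ultimately show ?thesis by simp
qed

text \<open>The remainder \<open>r\<close> is known as a combination of words. The inverse change of
  basis, applied to the difference, yields an element \<open>x\<close> of the tensor product whose
  word form is \<open>r\<close>, since letterwise substitution is invertible; the degree bound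
  passes from \<open>r\<close> to \<open>x\<close>.\<close>

lemma transport_lower:
  assumes v: "v \<in> span_of (gens T.K)" and w: "w \<in> span_of (gens T'.K)"
    and r: "r \<in> span_of (W.words (\<lambda>e. e < d))" "T'.\<tau> w = lin (word_map \<omega>) (T.\<tau> v) + lin (word_map \<omega>) r"
  shows "w + lin tens_map v \<in> KB.fil (d - 1)"
proof -
  let ?w = "w + lin tens_map v"
  have w': "?w \<in> span_of (gens T'.K)"
    using w lin_in_span[OF v tens_map_closed(1)] by auto
  have \<tau>w: "T'.\<tau> ?w = lin (word_map \<omega>) r"
    by (simp add: T'.\<tau>_add r(2) \<tau>_tens_map v add_ac)
  define x where "x = lin tens_map' ?w"
  have x: "x \<in> span_of (gens T.K)"
    unfolding x_def by (rule lin_in_span[OF w' tens_map_closed(2)])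
  have "lin (word_map \<omega>') (lin (word_map \<omega>) r) = lin bas r"
    unfolding lin_lin
    by (rule lin_cong_span[OF r(1)], rule word_map_inverse) (auto simp: W.words_def letter_inverse)
  then have "T.\<tau> x = r" by (simp add: x_def \<tau>_tens_map(2)[OF w'] \<tau>w)
  then have xd: "x \<in> span_of {z \<in> gens T.K. tens_deg z < d}"
    using transport_homog[OF x, of "\<lambda>e. e < d"] r(1) by simp
  have "lin tens_map x = lin bas ?w"
    unfolding x_def lin_lin by (rule lin_cong_span[OF w']) (use lin_inverse_tens in \<open>simp add: lin_inverse_def\<close>)
  then have "lin tens_map v + w = lin tens_map x" by (simp add: add.commute)
  then show ?thesis by (rule KB.fil_witness[OF xd])
qed

lemma consw_lin: "consw (lin f v) w = lin (\<lambda>x. consw (f x) w) v" "consw v (lin g z) = lin (\<lambda>x. consw v (g x)) z"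
proof -
  show "consw (lin f v) w = lin (\<lambda>x. consw (f x) w) v" by (simp add: consw_def lin_lin)
  show "consw v (lin g z) = lin (\<lambda>x. consw v (g x)) z"
    unfolding consw_def lin_lin by (rule lin_lin_swap)
qed

text \<open>The image \<open>\<psi> a\<close> of a generator is in general a sum of generators, so
  its action on words is a sum of derivations. That sum is the derivation belonging to the summed
  letter map.\<close>

lemma ext_lin: "lin (\<lambda>b. T'.leibniz_ext (\<theta> b) l) c = T'.leibniz_ext (\<lambda>s. lin (\<lambda>b. \<theta> b s) c) l"
proof (induction l)
  case (Cons s l)
  show ?case
    using consw_lin(2)[of "bas s" "\<lambda>b. T'.leibniz_ext (\<theta> b) l" c] by (simp add: lin_fun_add Cons.IH consw_lin(1))
qed simp

lemma \<tau>_Lop: "w \<in> span_of (gens T'.K) \<Longrightarrow>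
    T'.\<tau> (Lop T'.K c w) = lin (T'.leibniz_ext (\<lambda>s. lin (\<lambda>b. T'.left_letter b s) c)) (T'.\<tau> w)"
proof -
  assume w: "w \<in> span_of (gens T'.K)"
  have "T'.\<tau> (Lop T'.K c w) = lin (\<lambda>b. T'.\<tau> (Lop T'.K (bas b) w)) c"
    by (simp add: Lop_def T'.\<tau>_lin)
  also have "\<dots> = lin (\<lambda>b. lin (T'.leibniz_ext (T'.left_letter b)) (T'.\<tau> w)) c"
    by (simp add: T'.\<tau>_L[OF w])
  also have "\<dots> = lin (\<lambda>l. lin (\<lambda>b. T'.leibniz_ext (T'.left_letter b) l) c) (T'.\<tau> w)"
    by (rule lin_lin_swap)
  finally show ?thesis by (simp add: ext_lin)
qed

lemma \<tau>_Rop: "w \<in> span_of (gens T'.K) \<Longrightarrow>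
    T'.\<tau> (Rop T'.K w c) = lin (T'.leibniz_ext (\<lambda>s. lin (\<lambda>b. T'.right_letter b s) c)) (T'.\<tau> w)"
proof -
  assume w: "w \<in> span_of (gens T'.K)"
  have "Rop T'.K w c = lin (\<lambda>b. Rop T'.K w (bas b)) c"
    unfolding Rop_def lin_bas by (rule lin_lin_swap)
  then have "T'.\<tau> (Rop T'.K w c) = lin (\<lambda>b. T'.\<tau> (Rop T'.K w (bas b))) c"
    by (simp add: T'.\<tau>_lin)
  also have "\<dots> = lin (\<lambda>b. lin (T'.leibniz_ext (T'.right_letter b)) (T'.\<tau> w)) c"
    by (simp add: T'.\<tau>_R[OF w])
  also have "\<dots> = lin (\<lambda>l. lin (\<lambda>b. T'.leibniz_ext (T'.right_letter b) l) c) (T'.\<tau> w)"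
    by (rule lin_lin_swap)
  finally show ?thesis by (simp add: ext_lin)
qed

lemma act_letters:
  "lin (\<lambda>s. lin (\<lambda>b. T'.left_letter b s) c) (lin (\<lambda>x. bas (LM x)) v) = lin (\<lambda>x. bas (LM x)) (Lop M' c v)"
  "lin (\<lambda>s. lin (\<lambda>b. T'.left_letter b s) c) (lin (\<lambda>x. bas (LA x)) a) = 0"
  "lin (\<lambda>s. lin (\<lambda>b. T'.left_letter b s) c) (lin (\<lambda>x. bas (LN x)) w) = 0"
  "lin (\<lambda>s. lin (\<lambda>b. T'.right_letter b s) c) (lin (\<lambda>x. bas (LN x)) w) = lin (\<lambda>x. bas (LN x)) (Rop N' w c)"
  "lin (\<lambda>s. lin (\<lambda>b. T'.right_letter b s) c) (lin (\<lambda>x. bas (LA x)) a) = 0"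
  "lin (\<lambda>s. lin (\<lambda>b. T'.right_letter b s) c) (lin (\<lambda>x. bas (LM x)) v) = 0"
proof -
  have "lin (\<lambda>s. lin (\<lambda>b. T'.left_letter b s) c) (lin (\<lambda>x. bas (LM x)) v) =
      lin (\<lambda>x. lin (\<lambda>b. lin (\<lambda>x. bas (LM x)) (coef M' [b] x [])) c) v"
    by (simp add: lin_lin)
  also have "\<dots> = lin (\<lambda>b. lin (\<lambda>x. lin (\<lambda>x. bas (LM x)) (coef M' [b] x [])) v) c"
    by (rule lin_lin_swap)
  finally show "lin (\<lambda>s. lin (\<lambda>b. T'.left_letter b s) c) (lin (\<lambda>x. bas (LM x)) v) = lin (\<lambda>x. bas (LM x)) (Lop M' c v)"
    by (simp add: Lop_def lin_lin)
qed (simp_all add: lin_lin Rop_def)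

lemma left_homog: "a \<in> agens B \<Longrightarrow> s \<in> T.letters \<Longrightarrow> T.left_letter a s \<in> span_of {t \<in> T.letters. ldeg t = ldeg s + degA a}"
  using M.L_homog[of a] by (cases s) (auto simp: letters_mem add.commute intro!: lin_letters_homog)

lemma right_homog: "a \<in> agens B \<Longrightarrow> s \<in> T.letters \<Longrightarrow> T.right_letter a s \<in> span_of {t \<in> T.letters. ldeg t = ldeg s + degA a}"
  using N.R_homog[of a] by (cases s) (auto simp: letters_mem intro!: lin_letters_homog)

lemma left_lower:
  assumes a: "a \<in> agens B" and s: "s \<in> T.letters"
  shows "\<exists>r\<in>span_of {t \<in> T.letters. ldeg t < ldeg s + degA a}.
    lin (\<lambda>s. lin (\<lambda>b. T'.left_letter b s) (\<psi> a)) (\<omega> s) = lin \<omega> (T.left_letter a s) + lin \<omega> r"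
proof (cases s)
  case s': (LM x)
  have "Lop M' (\<psi> a) (p x) + lin p (coef M [a] x []) \<in> M.mod.fil (degA a + degM x - 1)"
    using M.L_lower[OF a, of x] s by (auto simp: s' letters_mem)
  from M.mod.fil_witnessE[OF this] obtain r where r: "r \<in> span_of {y \<in> gens M. degM y < degA a + degM x}"
    "Lop M' (\<psi> a) (p x) = lin p (coef M [a] x []) + lin p r" by blast
  have "lin (\<lambda>x. bas (LM x)) r \<in> span_of {t \<in> T.letters. ldeg t < ldeg s + degA a}"
    by (rule lin_in_span[OF r(1)]) (simp add: s' letters_mem)
  then show ?thesis
    by (intro bexI[of _ "lin (\<lambda>x. bas (LM x)) r"])
      (simp only: s' letter_map.simps T.left_letter.simps act_letters r(2), simp add: lin_lin lin_add)
next
  case s': (LA b)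
  show ?thesis by (intro bexI[of _ 0]) (simp_all only: s' letter_map.simps act_letters, simp_all)
next
  case s': (LN b)
  show ?thesis by (intro bexI[of _ 0]) (simp_all only: s' letter_map.simps act_letters, simp_all)
qed

lemma right_lower:
  assumes a: "a \<in> agens B" and s: "s \<in> T.letters"
  shows "\<exists>r\<in>span_of {t \<in> T.letters. ldeg t < ldeg s + degA a}.
    lin (\<lambda>s. lin (\<lambda>b. T'.right_letter b s) (\<psi> a)) (\<omega> s) = lin \<omega> (T.right_letter a s) + lin \<omega> r"
proof (cases s)
  case s': (LN x)
  have "Rop N' (q x) (\<psi> a) + lin q (coef N [] x [a]) \<in> N.mod.fil (degN x + degA a - 1)"
    using N.R_lower[OF a, of x] s by (auto simp: s' letters_mem)
  from N.mod.fil_witnessE[OF this] obtain r where r: "r \<in> span_of {y \<in> gens N. degN y < degN x + degA a}"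
    "Rop N' (q x) (\<psi> a) = lin q (coef N [] x [a]) + lin q r" by blast
  have "lin (\<lambda>x. bas (LN x)) r \<in> span_of {t \<in> T.letters. ldeg t < ldeg s + degA a}"
    by (rule lin_in_span[OF r(1)]) (simp add: s' letters_mem)
  then show ?thesis
    by (intro bexI[of _ "lin (\<lambda>x. bas (LN x)) r"])
      (simp only: s' letter_map.simps T.right_letter.simps act_letters r(2), simp add: lin_lin lin_add)
next
  case s': (LA b)
  show ?thesis by (intro bexI[of _ 0]) (simp_all only: s' letter_map.simps act_letters, simp_all)
next
  case s': (LM b)
  show ?thesis by (intro bexI[of _ 0]) (simp_all only: s' letter_map.simps act_letters, simp_all)
qed

text \<open>The degree of a tensor is the sum over its letters, and the statements of
  \<open>bar_map\<close> about words are carried back to generators by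
  \<open>transport_homog\<close> and \<open>transport_lower\<close>.\<close>

lemma filtered_dg_tensor: "filtered_dg B u B' u' degA (lin \<psi>) T.K T'.K tens_deg (lin tens_map)"
proof -
  interpret KT: dg_bimod B u T.K by (rule T.dg_bimod_tensor)
  interpret KT': dg_bimod B' u' T'.K by (rule T'.dg_bimod_tensor)
  show ?thesis
  proof (rule filtered_dg.intro[OF M.filtered_alg_axioms KT.dg_bimod_axioms KT'.dg_bimod_axioms KB.adapted_basis_axioms],
      rule filtered_dg_axioms.intro)
    fix z assume z: "z \<in> gens T.K"
    have zw: "T.word z \<in> lists T.letters" by (rule T.word_letters[OF z])
    have p': "tens_map z \<in> span_of (gens T'.K)" by (rule tens_map_closed(1)[OF z])
    have \<tau>p: "T'.\<tau> (tens_map z) = word_map \<omega> (T.word z)"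
      using \<tau>_tens_map(1)[of "bas z"] z by (simp add: T.\<tau>_bas)
    have \<tau>D: "T.\<tau> (coef T.K [] z []) = T.bar (T.word z)"
      using T.\<tau>_Dop[of "bas z"] z by (simp add: op_bas T.\<tau>_bas)
    show "coef T.K [] z [] \<in> span_of {y \<in> gens T.K. tens_deg y = tens_deg z}"
      by (rule transport_homog[OF KT.D_closed[OF z]]) (simp add: \<tau>D tens_deg_def W.bar_homog zw del: in_lists_conv_set)
    obtain r where r: "r \<in> span_of (W.words (\<lambda>d. d < tens_deg z))"
      "lin T'.bar (word_map \<omega> (T.word z)) = lin (word_map \<omega>) (T.bar (T.word z)) + lin (word_map \<omega>) r"
      using W.bar_lower[OF zw] unfolding tens_deg_def by blast
    show "Dop T'.K (lin tens_map (bas z)) + lin tens_map (coef T.K [] z []) \<in> KB.fil (tens_deg z - 1)"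
      by (rule transport_lower[OF KT.D_closed[OF z] _ r(1)])
        (simp_all add: KT'.Dop_closed p' T'.\<tau>_Dop \<tau>p \<tau>D r(2))
    fix a assume a: "a \<in> agens B"
    have \<psi>a: "\<psi> a \<in> span_of (agens B')" using inverse_A a by (simp add: lin_inverse_def)
    have \<tau>L: "T.\<tau> (coef T.K [a] z []) = T.leibniz_ext (T.left_letter a) (T.word z)"
      using T.\<tau>_L[of "bas z" a] z by (simp add: op_bas T.\<tau>_bas)
    have \<tau>R: "T.\<tau> (coef T.K [] z [a]) = T.leibniz_ext (T.right_letter a) (T.word z)"
      using T.\<tau>_R[of "bas z" a] z by (simp add: op_bas T.\<tau>_bas)
    show "coef T.K [a] z [] \<in> span_of {y \<in> gens T.K. tens_deg y = degA a + tens_deg z}"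
      using W.ext_homog[OF left_homog[OF a] zw]
      by (intro transport_homog[OF KT.L_closed[OF a z]]) (simp add: \<tau>L tens_deg_def add.commute)
    show "coef T.K [] z [a] \<in> span_of {y \<in> gens T.K. tens_deg y = tens_deg z + degA a}"
      using W.ext_homog[OF right_homog[OF a] zw]
      by (intro transport_homog[OF KT.R_closed[OF a z]]) (simp add: \<tau>R tens_deg_def)
    obtain r where r: "r \<in> span_of (W.words (\<lambda>d. d < tens_deg z + degA a))"
      "lin (T'.leibniz_ext (\<lambda>s. lin (\<lambda>b. T'.left_letter b s) (\<psi> a))) (word_map \<omega> (T.word z)) =
        lin (word_map \<omega>) (T.leibniz_ext (T.left_letter a) (T.word z)) + lin (word_map \<omega>) r"
      using W.ext_lower[OF left_lower[OF a] zw] unfolding tens_deg_def by blast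
    have "Lop T'.K (\<psi> a) (tens_map z) + lin tens_map (coef T.K [a] z []) \<in> KB.fil ((tens_deg z + degA a) - 1)"
      by (rule transport_lower[OF KT.L_closed[OF a z] _ r(1)])
        (simp_all add: KT'.Lop_closed p' \<psi>a \<tau>_Lop \<tau>p \<tau>L r(2))
    then show "Lop T'.K (lin \<psi> (bas a)) (lin tens_map (bas z)) + lin tens_map (coef T.K [a] z []) \<in> KB.fil (degA a + tens_deg z - 1)"
      by (simp add: add.commute)
    obtain r' where r': "r' \<in> span_of (W.words (\<lambda>d. d < tens_deg z + degA a))"
      "lin (T'.leibniz_ext (\<lambda>s. lin (\<lambda>b. T'.right_letter b s) (\<psi> a))) (word_map \<omega> (T.word z)) =
        lin (word_map \<omega>) (T.leibniz_ext (T.right_letter a) (T.word z)) + lin (word_map \<omega>) r'"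
      using W.ext_lower[OF right_lower[OF a] zw] unfolding tens_deg_def by blast
    have "Rop T'.K (tens_map z) (\<psi> a) + lin tens_map (coef T.K [] z [a]) \<in> KB.fil ((tens_deg z + degA a) - 1)"
      by (rule transport_lower[OF KT.R_closed[OF a z] _ r'(1)])
        (simp_all add: KT'.Rop_closed p' \<psi>a \<tau>_Rop \<tau>p \<tau>R r'(2))
    then show "Rop T'.K (lin tens_map (bas z)) (lin \<psi> (bas a)) + lin tens_map (coef T.K [] z [a]) \<in> KB.fil (tens_deg z + degA a - 1)"
      by simp
  qed
qed

end

section \<open>The change of basis from Khovanov to Floer\<close>

text \<open>The axioms with explicit remainders \<open>r\<close>, the form in which a case check on
  generators delivers them.\<close>

lemma (in filtered_alg) filtered_dgI:
  assumes K: "dg_bimod B u K" "dg_bimod B' u' K'" "lin_inverse (gens K) (gens K') p p'"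
    and "\<And>x. x \<in> gens K \<Longrightarrow> coef K [] x [] \<in> span_of {y \<in> gens K. deg y = deg x}"
    and D: "\<And>x. x \<in> gens K \<Longrightarrow> \<exists>r\<in>span_of {y \<in> gens K. deg y < deg x}. Dop K' (p x) = lin p (coef K [] x []) + lin p r"
    and "\<And>a x. a \<in> agens B \<Longrightarrow> x \<in> gens K \<Longrightarrow> coef K [a] x [] \<in> span_of {y \<in> gens K. deg y = degA a + deg x}"
    and L: "\<And>a x. a \<in> agens B \<Longrightarrow> x \<in> gens K \<Longrightarrow> \<exists>r\<in>span_of {y \<in> gens K. deg y < degA a + deg x}.
      Lop K' (\<psi> (bas a)) (p x) = lin p (coef K [a] x []) + lin p r"
    and "\<And>a x. a \<in> agens B \<Longrightarrow> x \<in> gens K \<Longrightarrow> coef K [] x [a] \<in> span_of {y \<in> gens K. deg y = deg x + degA a}"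
    and R: "\<And>a x. a \<in> agens B \<Longrightarrow> x \<in> gens K \<Longrightarrow> \<exists>r\<in>span_of {y \<in> gens K. deg y < deg x + degA a}.
      Rop K' (p x) (\<psi> (bas a)) = lin p (coef K [] x [a]) + lin p r"
  shows "filtered_dg B u B' u' degA \<psi> K K' deg (lin p)"
proof -
  interpret K: adapted_basis "lin_bimod K'" "gens K" "gens K'" deg "lin p"
    by (rule adapted_basis_lin[OF K(3)]) (simp_all add: lin_bimod_def span_of_def)
  have wit: "a + lin p v \<in> K.fil (d - 1)" if "\<exists>r\<in>span_of {y \<in> gens K. deg y < d}. a = lin p v + lin p r" for a v d
    using that by (auto intro!: K.fil_witness simp flip: add.assoc)
  show ?thesis
    by (rule filtered_dg.intro[OF filtered_alg_axioms K(1,2) K.adapted_basis_axioms], rule filtered_dg_axioms.intro)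
      (simp_all add: assms wit[OF D] wit[OF L] wit[OF R])
qed

text \<open>
  In the basis \<open>psi\<close> the only product of the Floer algebra that differs from the one of the Khovanov algebra
  is \<open>x x = x\<close>, a product of degree \<open>2\<close> landing in degree \<open>1\<close>.
\<close>
fun psi :: "kh_gen \<Rightarrow> hf_gen vec" where
  "psi (One i j) = (if i = j then bas (HOne i) else bas (Rho i j) + bas (Sig i j))"
| "psi (X i j) = bas (Rho i j)"

fun psi' :: "hf_gen \<Rightarrow> kh_gen vec" where
  "psi' (HOne i) = bas (One i i)"
| "psi' (Rho i j) = bas (X i j)"
| "psi' (Sig i j) = bas (One i j) + bas (X i j)"

fun kh_deg :: "kh_gen \<Rightarrow> int" where
  "kh_deg (One i j) = 0"
| "kh_deg (X i j) = 1"

lemma kh_agens_cases':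
  assumes "b \<in> agens (kh_alg m)"
  obtains i where "b = One i i" "i \<le> m" | i j where "b = One i j" "j < i" "i \<le> m" | i j where "b = X i j" "j < i" "i \<le> m"
  using assms by (cases b) (auto simp: le_less)

lemma lin_inverse_psi: "lin_inverse (agens (kh_alg m)) (agens (hf_alg m)) psi psi'"
  unfolding lin_inverse_def
proof (intro conjI ballI)
  fix x assume x: "x \<in> agens (kh_alg m)"
  show "psi x \<in> span_of (agens (hf_alg m))" "lin psi' (psi x) = bas x"
    by (rule kh_agens_cases'[OF x]; simp add: span_of_add lin_add add_ac)+
next
  fix y assume y: "y \<in> agens (hf_alg m)"
  show "psi' y \<in> span_of (agens (kh_alg m))" "lin psi (psi' y) = bas y"
    by (rule hf_agens_cases[OF y]; simp add: span_of_add lin_add add_ac)+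
qed

text \<open>The remainder of the product: the Floer side adds x whenever two composable x are
  multiplied.\<close>

fun low_mul :: "kh_gen \<Rightarrow> kh_gen \<Rightarrow> kh_gen vec" where
  "low_mul (X i j) (X j' k) = (if j = j' then bas (X i k) else 0)"
| "low_mul _ _ = 0"

lemma amul_psi:
  assumes a: "a \<in> agens (kh_alg m)" and b: "b \<in> agens (kh_alg m)"
  shows "amul (hf_alg m) (psi a) (psi b) = lin psi (kh_mul a b) + lin psi (low_mul a b)"
  by (rule kh_agens_cases'[OF a]; rule kh_agens_cases'[OF b])
    (simp_all add: amul_def lin_add acoef_hf_alg add_ac)

lemma kh_mul_homog:
  assumes a: "a \<in> agens (kh_alg m)" and b: "b \<in> agens (kh_alg m)"
  shows "kh_mul a b \<in> span_of {c \<in> agens (kh_alg m). kh_deg c = kh_deg a + kh_deg b}"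
    "low_mul a b \<in> span_of {c \<in> agens (kh_alg m). kh_deg c < kh_deg a + kh_deg b}"
  by (rule kh_agens_cases'[OF a]; rule kh_agens_cases'[OF b]; simp)+

lemma filtered_alg_psi: "filtered_alg (kh_alg m) (kh_unit m) (hf_alg m) (hf_unit m) kh_deg (lin psi)"
proof -
  interpret A: adapted_basis "lin_alg (hf_alg m)" "agens (kh_alg m)" "agens (hf_alg m)" kh_deg "lin psi"
    by (rule adapted_basis_lin[OF lin_inverse_psi]) (simp_all add: lin_alg_def span_of_def)
  show ?thesis
  proof (rule filtered_alg.intro[OF based_algebra_kh based_algebra_hf A.adapted_basis_axioms], rule filtered_alg_axioms.intro)
    fix a b assume ab: "a \<in> agens (kh_alg m)" "b \<in> agens (kh_alg m)"
    show "acoef (kh_alg m) [a, b] \<in> span_of {c \<in> agens (kh_alg m). kh_deg c = kh_deg a + kh_deg b}"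
      using kh_mul_homog(1)[OF ab] by (simp add: acoef_kh_alg)
    show "amul (hf_alg m) (lin psi (bas a)) (lin psi (bas b)) + lin psi (acoef (kh_alg m) [a, b]) \<in> A.fil (kh_deg a + kh_deg b - 1)"
      by (rule A.fil_witness[OF kh_mul_homog(2)[OF ab]]) (simp add: amul_psi[OF ab] acoef_kh_alg flip: add.assoc)
  qed
qed

text \<open>Only the algebra generators change basis; those of the outer tensor product are common
  to both sides. The value on \<open>Tens\<close> is a default, since elementary bimodules have no
  such generators.\<close>

fun elem_map :: "('g \<Rightarrow> 'h vec) \<Rightarrow> 'g mgen \<Rightarrow> 'h mgen vec" where
  "elem_map \<psi> (Alg a) = lin (\<lambda>b. bas (Alg b)) (\<psi> a)"
| "elem_map \<psi> (PP p q) = bas (PP p q)"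
| "elem_map \<psi> (Tens x as y) = 0"

lemma lin_elem_map_Alg: "lin (elem_map \<psi>) (lin (\<lambda>b. bas (Alg b)) v) = lin (\<lambda>b. bas (Alg b)) (lin \<psi> v)"
  by (simp add: lin_lin)

lemma lin_inverse_elem:
  assumes "lin_inverse A A' \<psi> \<psi>'"
  shows "lin_inverse (Alg ` A \<union> case_prod PP ` R) (Alg ` A' \<union> case_prod PP ` R) (elem_map \<psi>) (elem_map \<psi>')"
  unfolding lin_inverse_def
proof (intro conjI ballI)
  fix x :: "'a mgen" assume "x \<in> Alg ` A \<union> case_prod PP ` R"
  then consider a where "x = Alg a" "a \<in> A" | p q where "x = PP p q" "(p, q) \<in> R" by auto
  then show "elem_map \<psi> x \<in> span_of (Alg ` A' \<union> case_prod PP ` R)" "lin (elem_map \<psi>') (elem_map \<psi> x) = bas x"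
    by (cases; use assms in \<open>force simp: lin_inverse_def lin_elem_map_Alg intro: lin_in_span[of _ A']\<close>)+
next
  fix x :: "'b mgen" assume "x \<in> Alg ` A' \<union> case_prod PP ` R"
  then consider a where "x = Alg a" "a \<in> A'" | p q where "x = PP p q" "(p, q) \<in> R" by auto
  then show "elem_map \<psi>' x \<in> span_of (Alg ` A \<union> case_prod PP ` R)" "lin (elem_map \<psi>) (elem_map \<psi>' x) = bas x"
    by (cases; use assms in \<open>force simp: lin_inverse_def lin_elem_map_Alg intro: lin_in_span[of _ A]\<close>)+
qed

lemma gens_cone_outer: "gens (diagonal B) \<union> gens (outer_bimod l r) = Alg ` agens B \<union> range (case_prod PP)"
  by (simp add: diagonal_def outer_bimod_def)

lemma lin_inverse_cone:
  "lin_inverse A A' \<psi> \<psi>' \<Longrightarrow>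
    lin_inverse (Alg ` A \<union> range (case_prod PP)) (Alg ` A' \<union> range (case_prod PP)) (elem_map \<psi>) (elem_map \<psi>')"
  by (rule lin_inverse_elem) auto

lemma kh_cone_cases':
  assumes "x \<in> gens (diagonal (kh_alg m)) \<union> gens (outer_bimod l r)"
  obtains i where "x = Alg (One i i)" "i \<le> m" | i j where "x = Alg (One i j)" "j < i" "i \<le> m"
  | i j where "x = Alg (X i j)" "j < i" "i \<le> m" | "x = PP Ustar U" | "x = PP Ustar V" | "x = PP Vstar U" | "x = PP Vstar V"
  by (rule cone_cases[OF assms]) (auto elim!: kh_agens_cases' that)

section \<open>Lower-degree remainders of the elementary bimodules\<close>

fun low_left :: "(kh_gen \<Rightarrow> left_gen \<Rightarrow> right_gen \<Rightarrow> kh_gen vec) \<Rightarrow> kh_gen \<Rightarrow> kh_gen mgen \<Rightarrow> kh_gen mgen vec" where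
  "low_left bl a (Alg b) = lin (\<lambda>c. bas (Alg c)) (low_mul a b)"
| "low_left bl a (PP p q) = lin (\<lambda>c. bas (Alg c)) (bl a p q)"
| "low_left bl a (Tens x as y) = 0"

fun low_right :: "(left_gen \<Rightarrow> right_gen \<Rightarrow> kh_gen \<Rightarrow> kh_gen vec) \<Rightarrow> kh_gen mgen \<Rightarrow> kh_gen \<Rightarrow> kh_gen mgen vec" where
  "low_right br (Alg b) a = lin (\<lambda>c. bas (Alg c)) (low_mul b a)"
| "low_right br (PP p q) a = lin (\<lambda>c. bas (Alg c)) (br p q a)"
| "low_right br (Tens x as y) a = 0"

text \<open>The Floer map reacts to \<open>\<rho>\<close> on these two generators, both when
  \<open>\<rho>\<close> occurs in 1 = \<open>\<rho>\<close> + \<open>\<sigma>\<close> and when it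
  stands for x. The first gives the Khovanov term, the second is extra and one degree below the sum
  of the degrees of its inputs.\<close>

fun low_beta_left :: "nat \<Rightarrow> kh_gen \<Rightarrow> left_gen \<Rightarrow> right_gen \<Rightarrow> kh_gen vec" where
  "low_beta_left k (X i j) Ustar U = (if j = k \<and> i \<ge> k + 1 then bas (X i k) else 0)"
| "low_beta_left k (X i j) Vstar V = (if j = k - 1 \<and> i \<ge> k then bas (X i (k - 1)) else 0)"
| "low_beta_left k _ _ _ = 0"

fun low_beta_right :: "nat \<Rightarrow> left_gen \<Rightarrow> right_gen \<Rightarrow> kh_gen \<Rightarrow> kh_gen vec" where
  "low_beta_right k Ustar U (X i j) = (if i = k \<and> j + 1 \<le> k then bas (X k j) else 0)"
| "low_beta_right k Vstar V (X i j) = (if i = k - 1 \<and> j + 2 \<le> k then bas (X (k - 1) j) else 0)"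
| "low_beta_right k _ _ _ = 0"

text \<open>
  The degree on \<open>P\<^sub>k \<otimes> \<^sub>kP\<close> is normalised by \<open>c\<close>: the maps to and from it have degree \<open>0\<close> for \<open>c = 0\<close>
  on \<open>\<sigma>\<^sub>k\<^sup>-\<close> and for \<open>c = 1\<close> on \<open>\<sigma>\<^sub>k\<^sup>+\<close>.
\<close>
fun elem_deg :: "int \<Rightarrow> kh_gen mgen \<Rightarrow> int" where
  "elem_deg c (Alg a) = kh_deg a"
| "elem_deg c (PP Ustar U) = c"
| "elem_deg c (PP Vstar V) = c"
| "elem_deg c (PP Vstar U) = c - 1"
| "elem_deg c (PP Ustar V) = c + 1"
| "elem_deg c (Tens x as y) = 0"

text \<open>Multiplication by x raises the degree by one, which fixes the differences of degrees on
  the outer tensor product, and \<open>gamma\<close> sends idempotents of degree 0 to generators of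
  degree 0. The only remainder is the one of the algebra product on the diagonal summand.\<close>

lemma filtered_dg_neg:
  assumes "1 \<le> k" "k \<le> m"
  shows "filtered_dg (kh_alg m) (kh_unit m) (hf_alg m) (hf_unit m) kh_deg (lin psi)
    (kh_elementary m (SgInv k)) (hf_elementary m (SgInv k)) (elem_deg 0) (lin (elem_map psi))"
proof -
  obtain k' where k': "k = Suc k'" using assms by (cases k) auto
  note assms' = assms[unfolded k']
  let ?K = "kh_elementary m (SgInv k)" and ?K' = "hf_elementary m (SgInv k)"
  let ?l = "low_left (\<lambda>_ _ _. 0)" and ?r = "low_right (\<lambda>_ _ _. 0)"
  note ops = k' Dop_add Lop_add Rop_add op_bas kh_simps hf_simps lin_add
  show ?thesis
  proof (rule filtered_alg.filtered_dgI[OF filtered_alg_psi dg_bimod_kh_neg[OF assms] dg_bimod_hf_neg[OF assms]])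
    show "lin_inverse (gens ?K) (gens ?K') (elem_map psi) (elem_map psi')"
      by (simp add: gens_cone_outer lin_inverse_cone lin_inverse_psi)
    fix x assume "x \<in> gens ?K"
    then have x: "x \<in> gens (diagonal (kh_alg m)) \<union> gens (outer_bimod (kh_left k) (kh_right k))" by auto
    show "coef ?K [] x [] \<in> span_of {y \<in> gens ?K. elem_deg 0 y = elem_deg 0 x}"
      by (rule kh_cone_cases'[OF x]; insert assms'; simp add: ops span_of_add)
    have "Dop ?K' (elem_map psi x) = lin (elem_map psi) (coef ?K [] x [])"
      by (rule kh_cone_cases'[OF x]; insert assms'; simp add: ops add_ac)
    then show "\<exists>r\<in>span_of {y \<in> gens ?K. elem_deg 0 y < elem_deg 0 x}. Dop ?K' (elem_map psi x) = lin (elem_map psi) (coef ?K [] x []) + lin (elem_map psi) r"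
      by (intro bexI[of _ 0]) simp_all
    fix a assume a: "a \<in> agens (kh_alg m)"
    show "coef ?K [a] x [] \<in> span_of {y \<in> gens ?K. elem_deg 0 y = kh_deg a + elem_deg 0 x}"
      by (rule kh_cone_cases'[OF x]; rule kh_agens_cases'[OF a]; insert assms'; simp add: ops span_of_add)
    show "coef ?K [] x [a] \<in> span_of {y \<in> gens ?K. elem_deg 0 y = elem_deg 0 x + kh_deg a}"
      by (rule kh_cone_cases'[OF x]; rule kh_agens_cases'[OF a]; insert assms'; simp add: ops span_of_add)
    have "?l a x \<in> span_of {y \<in> gens ?K. elem_deg 0 y < kh_deg a + elem_deg 0 x}"
      by (rule kh_cone_cases'[OF x]; rule kh_agens_cases'[OF a]; insert assms'; simp add: ops)
    moreover have "Lop ?K' (psi a) (elem_map psi x) = lin (elem_map psi) (coef ?K [a] x []) + lin (elem_map psi) (?l a x)"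
      by (rule kh_cone_cases'[OF x]; rule kh_agens_cases'[OF a]; insert assms'; simp add: ops add_ac)
    ultimately show "\<exists>r\<in>span_of {y \<in> gens ?K. elem_deg 0 y < kh_deg a + elem_deg 0 x}.
        Lop ?K' (lin psi (bas a)) (elem_map psi x) = lin (elem_map psi) (coef ?K [a] x []) + lin (elem_map psi) r"
      by (intro bexI[of _ "?l a x"]) (simp_all only: lin_bas)
    have "?r x a \<in> span_of {y \<in> gens ?K. elem_deg 0 y < elem_deg 0 x + kh_deg a}"
      by (rule kh_cone_cases'[OF x]; rule kh_agens_cases'[OF a]; insert assms'; simp add: ops)
    moreover have "Rop ?K' (elem_map psi x) (psi a) = lin (elem_map psi) (coef ?K [] x [a]) + lin (elem_map psi) (?r x a)"
      by (rule kh_cone_cases'[OF x]; rule kh_agens_cases'[OF a]; insert assms'; simp add: ops add_ac)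
    ultimately show "\<exists>r\<in>span_of {y \<in> gens ?K. elem_deg 0 y < elem_deg 0 x + kh_deg a}.
        Rop ?K' (elem_map psi x) (lin psi (bas a)) = lin (elem_map psi) (coef ?K [] x [a]) + lin (elem_map psi) r"
      by (intro bexI[of _ "?r x a"]) (simp_all only: lin_bas)
  qed
qed

text \<open>Here \<open>beta\<close> takes a 1 acting on \<open>PP Ustar U\<close> or
  \<open>PP Vstar V\<close> to an x, which forces degree 1 on these generators. Besides the
  remainder of the product there are those of \<open>beta\<close> itself.\<close>

lemma filtered_dg_pos:
  assumes "1 \<le> k" "k \<le> m"
  shows "filtered_dg (kh_alg m) (kh_unit m) (hf_alg m) (hf_unit m) kh_deg (lin psi)
    (kh_elementary m (Sg k)) (hf_elementary m (Sg k)) (elem_deg 1) (lin (elem_map psi))"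
proof -
  obtain k' where k': "k = Suc k'" using assms by (cases k) auto
  note assms' = assms[unfolded k']
  let ?K = "kh_elementary m (Sg k)" and ?K' = "hf_elementary m (Sg k)"
  let ?l = "low_left (low_beta_left k)" and ?r = "low_right (low_beta_right k)"
  note ops = k' Dop_add Lop_add Rop_add op_bas kh_simps hf_simps lin_add
  show ?thesis
  proof (rule filtered_alg.filtered_dgI[OF filtered_alg_psi dg_bimod_kh_pos[OF assms] dg_bimod_hf_pos[OF assms]])
    show "lin_inverse (gens ?K) (gens ?K') (elem_map psi) (elem_map psi')"
      by (simp add: gens_cone_outer Un_commute[of "gens (outer_bimod _ _)"] lin_inverse_cone lin_inverse_psi)
    fix x assume "x \<in> gens ?K"
    then have x: "x \<in> gens (diagonal (kh_alg m)) \<union> gens (outer_bimod (kh_left k) (kh_right k))" by auto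
    show "coef ?K [] x [] \<in> span_of {y \<in> gens ?K. elem_deg 1 y = elem_deg 1 x}"
      by (rule kh_cone_cases'[OF x]; insert assms'; simp add: ops span_of_add)
    have "Dop ?K' (elem_map psi x) = lin (elem_map psi) (coef ?K [] x [])"
      by (rule kh_cone_cases'[OF x]; insert assms'; simp add: ops add_ac)
    then show "\<exists>r\<in>span_of {y \<in> gens ?K. elem_deg 1 y < elem_deg 1 x}. Dop ?K' (elem_map psi x) = lin (elem_map psi) (coef ?K [] x []) + lin (elem_map psi) r"
      by (intro bexI[of _ 0]) simp_all
    fix a assume a: "a \<in> agens (kh_alg m)"
    show "coef ?K [a] x [] \<in> span_of {y \<in> gens ?K. elem_deg 1 y = kh_deg a + elem_deg 1 x}"
      by (rule kh_cone_cases'[OF x]; rule kh_agens_cases'[OF a]; insert assms'; simp add: ops span_of_add)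
    show "coef ?K [] x [a] \<in> span_of {y \<in> gens ?K. elem_deg 1 y = elem_deg 1 x + kh_deg a}"
      by (rule kh_cone_cases'[OF x]; rule kh_agens_cases'[OF a]; insert assms'; simp add: ops span_of_add)
    have "?l a x \<in> span_of {y \<in> gens ?K. elem_deg 1 y < kh_deg a + elem_deg 1 x}"
      by (rule kh_cone_cases'[OF x]; rule kh_agens_cases'[OF a]; insert assms'; simp add: ops)
    moreover have "Lop ?K' (psi a) (elem_map psi x) = lin (elem_map psi) (coef ?K [a] x []) + lin (elem_map psi) (?l a x)"
      by (rule kh_cone_cases'[OF x]; rule kh_agens_cases'[OF a]; insert assms'; simp add: ops add_ac)
    ultimately show "\<exists>r\<in>span_of {y \<in> gens ?K. elem_deg 1 y < kh_deg a + elem_deg 1 x}.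
        Lop ?K' (lin psi (bas a)) (elem_map psi x) = lin (elem_map psi) (coef ?K [a] x []) + lin (elem_map psi) r"
      by (intro bexI[of _ "?l a x"]) (simp_all only: lin_bas)
    have "?r x a \<in> span_of {y \<in> gens ?K. elem_deg 1 y < elem_deg 1 x + kh_deg a}"
      by (rule kh_cone_cases'[OF x]; rule kh_agens_cases'[OF a]; insert assms'; simp add: ops)
    moreover have "Rop ?K' (elem_map psi x) (psi a) = lin (elem_map psi) (coef ?K [] x [a]) + lin (elem_map psi) (?r x a)"
      by (rule kh_cone_cases'[OF x]; rule kh_agens_cases'[OF a]; insert assms'; simp add: ops add_ac)
    ultimately show "\<exists>r\<in>span_of {y \<in> gens ?K. elem_deg 1 y < elem_deg 1 x + kh_deg a}.
        Rop ?K' (elem_map psi x) (lin psi (bas a)) = lin (elem_map psi) (coef ?K [] x [a]) + lin (elem_map psi) r"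
      by (intro bexI[of _ "?r x a"]) (simp_all only: lin_bas)
  qed
qed

lemma filtered_dg_diagonal:
  "filtered_dg (kh_alg m) (kh_unit m) (hf_alg m) (hf_unit m) kh_deg (lin psi)
    (diagonal (kh_alg m)) (diagonal (hf_alg m)) (elem_deg 0) (lin (elem_map psi))"
proof (rule filtered_alg.filtered_dgI[OF filtered_alg_psi based_algebra.dg_bimod_diagonal[OF based_algebra_kh]
      based_algebra.dg_bimod_diagonal[OF based_algebra_hf]])
  let ?K = "diagonal (kh_alg m)" and ?K' = "diagonal (hf_alg m)"
  show "lin_inverse (gens ?K) (gens ?K') (elem_map psi) (elem_map psi')"
    using lin_inverse_elem[OF lin_inverse_psi[of m], of "{}"] by (simp add: diagonal_def)
  have cl: "lin (\<lambda>c. bas (Alg c)) v \<in> span_of {y \<in> gens ?K. P (elem_deg 0 y)}"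
    if "v \<in> span_of {c \<in> agens (kh_alg m). P (kh_deg c)}" for v P
    by (rule lin_in_span[OF that]) simp
  have D: "coef (diagonal (kh_alg m)) [] x [] = 0" "coef (diagonal (hf_alg m)) [] y [] = 0" for x y
    by (cases x; cases y; simp add: diagonal_def acoef_kh_alg acoef_hf_alg)+
  have LR: "Lop ?K' v (lin (\<lambda>c. bas (Alg c)) w) = lin (\<lambda>c. bas (Alg c)) (amul (hf_alg m) v w)"
    "Rop ?K' (lin (\<lambda>c. bas (Alg c)) v) w = lin (\<lambda>c. bas (Alg c)) (amul (hf_alg m) v w)" for v w
    by (simp_all add: Lop_def Rop_def amul_def lin_lin coef_diagonal)
  fix x assume "x \<in> gens ?K"
  then obtain b where b: "x = Alg b" "b \<in> agens (kh_alg m)" by (auto simp: diagonal_def)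
  show "coef ?K [] x [] \<in> span_of {y \<in> gens ?K. elem_deg 0 y = elem_deg 0 x}" by (simp add: D)
  show "\<exists>r\<in>span_of {y \<in> gens ?K. elem_deg 0 y < elem_deg 0 x}. Dop ?K' (elem_map psi x) = lin (elem_map psi) (coef ?K [] x []) + lin (elem_map psi) r"
    by (intro bexI[of _ 0]) (simp_all add: D Dop_def)
  fix a assume a: "a \<in> agens (kh_alg m)"
  show "coef ?K [a] x [] \<in> span_of {y \<in> gens ?K. elem_deg 0 y = kh_deg a + elem_deg 0 x}"
    using cl[of _ "\<lambda>d. d = kh_deg a + kh_deg b", OF kh_mul_homog(1)[OF a b(2)]] by (simp add: b coef_diagonal acoef_kh_alg)
  show "coef ?K [] x [a] \<in> span_of {y \<in> gens ?K. elem_deg 0 y = elem_deg 0 x + kh_deg a}"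
    using cl[of _ "\<lambda>d. d = kh_deg b + kh_deg a", OF kh_mul_homog(1)[OF b(2) a]] by (simp add: b coef_diagonal acoef_kh_alg)
  show "\<exists>r\<in>span_of {y \<in> gens ?K. elem_deg 0 y < kh_deg a + elem_deg 0 x}.
      Lop ?K' (lin psi (bas a)) (elem_map psi x) = lin (elem_map psi) (coef ?K [a] x []) + lin (elem_map psi) r"
  proof (rule bexI)
    show "lin (\<lambda>c. bas (Alg c)) (low_mul a b) \<in> span_of {y \<in> gens ?K. elem_deg 0 y < kh_deg a + elem_deg 0 x}"
      using cl[of _ "\<lambda>d. d < kh_deg a + kh_deg b", OF kh_mul_homog(2)[OF a b(2)]] by (simp add: b)
  qed (simp add: b LR amul_psi[OF a b(2)] coef_diagonal acoef_kh_alg lin_elem_map_Alg lin_add)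
  show "\<exists>r\<in>span_of {y \<in> gens ?K. elem_deg 0 y < elem_deg 0 x + kh_deg a}.
      Rop ?K' (elem_map psi x) (lin psi (bas a)) = lin (elem_map psi) (coef ?K [] x [a]) + lin (elem_map psi) r"
  proof (rule bexI)
    show "lin (\<lambda>c. bas (Alg c)) (low_mul b a) \<in> span_of {y \<in> gens ?K. elem_deg 0 y < elem_deg 0 x + kh_deg a}"
      using cl[of _ "\<lambda>d. d < kh_deg b + kh_deg a", OF kh_mul_homog(2)[OF b(2) a]] by (simp add: b)
  qed (simp add: b LR amul_psi[OF b(2) a] coef_diagonal acoef_kh_alg lin_elem_map_Alg lin_add)
qed

section \<open>Arbitrary words and degree bounds\<close>

lemma elem_deg_bound:
  assumes "x \<in> Alg ` S \<union> range (case_prod PP)" "0 \<le> c"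
  shows "- 1 \<le> elem_deg c x"
proof -
  have "0 \<le> kh_deg a" for a by (cases a) simp_all
  then have "- 1 \<le> kh_deg a" for a by (meson dual_order.trans neg_le_0_iff_le zero_le_one)
  moreover have "- 1 \<le> elem_deg c (PP p q)" for p q using assms(2) by (cases p; cases q) simp_all
  ultimately show ?thesis using assms(1) by auto
qed

text \<open>The induction carries more than the comparison: the inverse change of basis, which the
  next tensor product asks for, and a lower bound for all degrees, which makes the final filtration
  bounded below.\<close>

lemma filtered_dg_word:
  "w \<in> braid_words m \<Longrightarrow> \<exists>deg p p' c.
    filtered_dg (kh_alg m) (kh_unit m) (hf_alg m) (hf_unit m) kh_deg (lin psi)
      (word_bimod (kh_alg m) (kh_elementary m) w) (word_bimod (hf_alg m) (hf_elementary m) w) deg (lin p) \<and>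
    lin_inverse (gens (word_bimod (kh_alg m) (kh_elementary m) w)) (gens (word_bimod (hf_alg m) (hf_elementary m) w)) p p' \<and>
    (\<forall>x\<in>gens (word_bimod (kh_alg m) (kh_elementary m) w). c \<le> deg x)"
  (is "_ \<Longrightarrow> ?P w")
proof -
  have gens: "gens (kh_elementary m s) = Alg ` agens (kh_alg m) \<union> range (case_prod PP)"
    "gens (hf_elementary m s) = Alg ` agens (hf_alg m) \<union> range (case_prod PP)" for s
    by (cases s; simp add: diagonal_def outer_bimod_def Un_commute)+
  have inv: "lin_inverse (gens (kh_elementary m s)) (gens (hf_elementary m s)) (elem_map psi) (elem_map psi')" for s
    unfolding gens by (rule lin_inverse_cone[OF lin_inverse_psi])
  have single: "\<exists>c\<ge>0. filtered_dg (kh_alg m) (kh_unit m) (hf_alg m) (hf_unit m) kh_deg (lin psi)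
      (kh_elementary m s) (hf_elementary m s) (elem_deg c) (lin (elem_map psi))"
    if "s \<in> Sg ` {1..m} \<union> SgInv ` {1..m}" for s
    using that
  proof (elim UnE imageE)
    fix k assume "s = Sg k" "k \<in> {1..m}"
    then show ?thesis using filtered_dg_pos[of k m] by (intro exI[of _ 1]) (simp del: kh_elementary.simps hf_elementary.simps)
  next
    fix k assume "s = SgInv k" "k \<in> {1..m}"
    then show ?thesis using filtered_dg_neg[of k m] by (intro exI[of _ 0]) (simp del: kh_elementary.simps hf_elementary.simps)
  qed
  show "w \<in> braid_words m \<Longrightarrow> ?P w"
  proof (induction w rule: induct_list012)
    case 1
    have "lin_inverse (gens (diagonal (kh_alg m))) (gens (diagonal (hf_alg m))) (elem_map psi) (elem_map psi')"
      using lin_inverse_elem[OF lin_inverse_psi[of m], of "{}"] by (simp add: diagonal_def)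
    moreover have "\<forall>x\<in>gens (diagonal (kh_alg m)). - 1 \<le> elem_deg 0 x"
      using elem_deg_bound[of _ "agens (kh_alg m)" 0] by (auto simp: diagonal_def)
    ultimately show ?case using filtered_dg_diagonal[of m] unfolding word_bimod.simps by blast
  next
    case (2 s)
    then have "s \<in> Sg ` {1..m} \<union> SgInv ` {1..m}" by (simp add: braid_words_def)
    from single[OF this] obtain c where c: "c \<ge> 0" "filtered_dg (kh_alg m) (kh_unit m) (hf_alg m) (hf_unit m) kh_deg (lin psi)
      (kh_elementary m s) (hf_elementary m s) (elem_deg c) (lin (elem_map psi))" by blast
    have "\<forall>x\<in>gens (kh_elementary m s). - 1 \<le> elem_deg c x"
      unfolding gens using elem_deg_bound[OF _ c(1)] by blast
    then show ?case using c(2) inv[of s] unfolding word_bimod.simps by blast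
  next
    case (3 s t w)
    then have s: "s \<in> Sg ` {1..m} \<union> SgInv ` {1..m}" "t # w \<in> braid_words m" by (simp_all add: braid_words_def)
    from single[OF s(1)] obtain c where c: "c \<ge> 0" "filtered_dg (kh_alg m) (kh_unit m) (hf_alg m) (hf_unit m) kh_deg (lin psi)
      (kh_elementary m s) (hf_elementary m s) (elem_deg c) (lin (elem_map psi))" by blast
    have cb: "- 1 \<le> elem_deg c x" if "x \<in> gens (kh_elementary m s)" for x
      using that unfolding gens by (rule elem_deg_bound[OF _ c(1)])
    from 3(2)[OF s(2)] obtain deg p p' d where d: "filtered_dg (kh_alg m) (kh_unit m) (hf_alg m) (hf_unit m) kh_deg (lin psi)
        (word_bimod (kh_alg m) (kh_elementary m) (t # w)) (word_bimod (hf_alg m) (hf_elementary m) (t # w)) deg (lin p)"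
      "lin_inverse (gens (word_bimod (kh_alg m) (kh_elementary m) (t # w))) (gens (word_bimod (hf_alg m) (hf_elementary m) (t # w))) p p'"
      "\<And>x. x \<in> gens (word_bimod (kh_alg m) (kh_elementary m) (t # w)) \<Longrightarrow> d \<le> deg x"
      by blast
    interpret FT: filtered_tensor "kh_alg m" "kh_unit m" "hf_alg m" "hf_unit m" kh_deg psi
      "kh_elementary m s" "hf_elementary m s" "elem_deg c" "elem_map psi"
      "word_bimod (kh_alg m) (kh_elementary m) (t # w)" "word_bimod (hf_alg m) (hf_elementary m) (t # w)" deg p
      psi' "elem_map psi'" p'
      by (rule filtered_tensor.intro[OF c(2) d(1)], rule filtered_tensor_axioms.intro[OF lin_inverse_psi inv d(2)])
    \<comment> \<open>Generators contain arbitrarily many algebra letters, but these have degree at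
      least 0. The bound is therefore the sum of the bounds -1 and d for the outer factors.\<close>
    have "d - 1 \<le> FT.tens_deg z" if z: "z \<in> gens FT.T.K" for z
    proof -
      obtain x as y where z: "z = Tens x as y" "x \<in> gens (kh_elementary m s)" "y \<in> gens (word_bimod (kh_alg m) (kh_elementary m) (t # w))"
        using z unfolding FT.T.gens_K by blast
      have "0 \<le> kh_deg a" for a by (cases a) simp_all
      then have "deg y \<le> wdeg FT.ldeg (map LA as @ [LN y])" by (induction as) (simp_all add: add_increasing)
      then show ?thesis using cb[OF z(2)] d(3)[OF z(3)] by (simp add: z(1) FT.tens_deg_def FT.T.word_def)
    qed
    then show ?case
      unfolding word_bimod.simps using FT.filtered_dg_tensor FT.lin_inverse_tens by blast
  qed
qed

section \<open>Agreement with the given filtration and isomorphism\<close>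

lemma strict_ainf_iso_cong:
  assumes \<phi>: "strict_ainf_iso A A' \<phi>" and eq: "\<And>a. a \<in> carrier A \<Longrightarrow> \<phi>' a = \<phi> a"
  shows "strict_ainf_iso A A' \<phi>'"
proof -
  have A: "ainf_algebra A" and iso: "\<phi> \<in> iso A A'"
    and aop: "\<And>as. as \<in> lists (carrier A) \<Longrightarrow> as \<noteq> [] \<Longrightarrow> \<phi> (aop A as) = aop A' (map \<phi> as)"
    using \<phi> by (auto simp: strict_ainf_iso_def)
  interpret A: alg_base A by unfold_locales (rule A)
  interpret G: comm_group A using A by (simp add: ainf_algebra_def f2_space_def)
  have "\<phi>' \<in> iso A A'"
    using iso bij_betw_cong[of "carrier A" \<phi>' \<phi>] eq by (auto simp: iso_def hom_def Pi_iff)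
  moreover have "\<phi>' (aop A as) = aop A' (map \<phi>' as)" if as: "as \<in> lists (carrier A)" "as \<noteq> []" for as
  proof -
    have "map \<phi>' as = map \<phi> as" using as(1) eq by auto
    then show ?thesis by (simp only: aop[OF as] eq[OF A.aop_closed[OF as]])
  qed
  ultimately show ?thesis using \<phi> by (simp add: strict_ainf_iso_def)
qed

text \<open>In degree 0 lie the generators \<open>One i j\<close>, whose images under
  \<open>psi\<close> are the spanning vectors of the definition. From degree 1 on all generators are
  included, and below 0 there are none.\<close>

lemma F_HF_eq: "F_HF m = adapted_basis.fil (agens (kh_alg m)) kh_deg (lin psi)"
proof
  fix i :: int
  interpret A: filtered_alg "kh_alg m" "kh_unit m" "hf_alg m" "hf_unit m" kh_deg "lin psi"
    by (rule filtered_alg_psi)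
  interpret V: comm_group "lin_alg (hf_alg m)" by (rule A.alg.comm_group_V)
  have deg: "kh_deg x = 0 \<or> kh_deg x = 1" for x by (cases x) simp_all
  let ?S = "{bas (HOne i) | i. i \<le> m} \<union> {bas (Rho i j) + bas (Sig i j) | i j. j < i \<and> i \<le> m}"
  have S: "psi x \<in> ?S" if "x \<in> agens (kh_alg m)" "kh_deg x \<le> 0" for x
    by (rule kh_agens_cases'[OF that(1)]) (use that in auto)
  consider "i < 0" | "i = 0" | "i \<ge> 1" by linarith
  then show "F_HF m i = A.alg.fil i"
  proof cases
    case 1
    have "i < kh_deg x" for x using 1 by (cases x) simp_all
    then show ?thesis using A.alg.fil_bot[of i] 1 by (simp add: F_HF_def)
  next
    case 2
    have "generate (lin_alg (hf_alg m)) ?S \<subseteq> A.alg.fil 0"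
    proof (rule V.generate_subgroup_incl[OF _ A.alg.subgroup_fil], rule subsetI)
      fix v assume "v \<in> ?S"
      then obtain x where "x \<in> agens (kh_alg m)" "kh_deg x \<le> 0" "v = psi x"
      proof (elim UnE CollectE exE conjE)
        fix i assume "v = bas (HOne i)" "i \<le> m"
        then show ?thesis using that[of "One i i"] by simp
      next
        fix i j assume "v = bas (Rho i j) + bas (Sig i j)" "j < i" "i \<le> m"
        then show ?thesis using that[of "One i j"] by simp
      qed
      then show "v \<in> A.alg.fil 0" by (auto simp: A.alg.fil_def A.alg.low_def intro!: image_eqI[of _ _ "bas x"])
    qed
    moreover have "lin psi v \<in> generate (lin_alg (hf_alg m)) ?S" if "v \<in> A.alg.low 0" for v
      using that unfolding A.alg.low_def
    proof (induction v rule: span_of_induct)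
      case zero
      show ?case using generate.one[of "lin_alg (hf_alg m)" ?S] by (simp add: A.A1.lin_alg_simps)
    next
      case (bas_add x v)
      have "psi x \<in> ?S" using S[of x] bas_add(1) by blast
      from generate.eng[OF generate.incl[OF this] bas_add.IH] show ?case
        by (simp add: A.A1.lin_alg_simps lin_add)
    qed
    ultimately show ?thesis
      using 2 by (auto simp: F_HF_def B_HF_def A.alg.fil_def)
  next
    case 3
    have "{x \<in> agens (kh_alg m). kh_deg x \<le> i} = agens (kh_alg m)"
      using deg 3 by (auto; metis order_trans zero_le_one)
    then have "A.alg.fil i = lin psi ` span_of (agens (kh_alg m))"
      by (simp add: A.alg.fil_def A.alg.low_def)
    also have "\<dots> = span_of (agens (hf_alg m))"
      using lin_inverse_bij[OF lin_inverse_psi[of m]] by (simp add: bij_betw_def)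
    finally show ?thesis using 3 by (simp add: F_HF_def B_HF_def A.A1.lin_alg_simps)
  qed
qed

text \<open>Both sides agree on generators and are sums over the support. The restriction on
  \<open>v\<close> keeps every summand in the carrier, where finite products of the group are
  additive in the index set.\<close>

lemma gr_iso_eq:
  assumes v: "v \<in> span_of (agens (kh_alg m))"
  shows "gr_iso m v = adapted_basis.\<Theta> (lin_alg (hf_alg m)) (agens (kh_alg m)) kh_deg (lin psi) v"
proof -
  interpret A: filtered_alg "kh_alg m" "kh_unit m" "hf_alg m" "hf_unit m" kh_deg "lin psi"
    by (rule filtered_alg_psi)
  interpret V: comm_group "gr_space (lin_alg (hf_alg m)) A.alg.fil" by (rule A.alg.comm_group_gr_space)
  have gen: "gr_iso_gen m g = A.alg.\<Theta> (bas g)" for g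
    by (rule ext, cases g)
      (auto simp: F_HF_eq B_HF_def gr_class_def A.alg.\<Theta>_def homog_bas A.alg.cst_zero)
  have gen': "gr_iso_gen m = (\<lambda>g. A.alg.\<Theta> (bas g))" by (rule ext) (rule gen)
  have one: "A.alg.\<Theta> 0 = \<one>\<^bsub>gr_space (lin_alg (hf_alg m)) A.alg.fil\<^esub>"
    by (auto simp: A.alg.\<Theta>_def A.alg.cst_zero gr_space_def A.alg.one_gr_piece restrict_def)
  have "vsum (gr_space (lin_alg (hf_alg m)) A.alg.fil) (gr_iso_gen m) X = A.alg.\<Theta> (\<Sum>x\<in>X. bas x)"
    if "finite X" "X \<subseteq> agens (kh_alg m)" for X
    using that
  proof (induction X rule: finite_induct)
    case (insert x X)
    have "gr_iso_gen m \<in> X \<rightarrow> carrier (gr_space (lin_alg (hf_alg m)) A.alg.fil)"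
      "gr_iso_gen m x \<in> carrier (gr_space (lin_alg (hf_alg m)) A.alg.fil)"
      using insert.prems by (auto simp: gen' subset_iff intro!: A.alg.\<Theta>_closed)
    then show ?case using insert by (simp add: A.alg.\<Theta>_add gen')
  qed (simp add: one)
  from this[of "keys v"] show ?thesis
    using v by (simp add: gr_iso_def F_HF_eq B_HF_def vec_sum_bas span_of_def)
qed

lemma braid_rel_words: "(w, w') \<in> braid_rel m \<Longrightarrow> w \<in> braid_words m \<and> w' \<in> braid_words m"
  by (induction rule: braid_rel.induct) (auto simp: braid_words_def)

theorem theorem6p1:
  fixes m :: nat and \<sigma> :: "artin list set" and w :: "artin list"
  assumes "m \<ge> 1"
    and "\<sigma> \<in> braid_group m"
    and "w \<in> \<sigma>"
  shows "strict_ainf_iso (B_Kh m) (gr_alg (B_HF m) (F_HF m)) (gr_iso m) \<and>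
    (\<exists>G. filtered_bimodule (B_HF m) (F_HF m) (M_HF m w) G \<and>
         exhaustive (M_HF m w) G \<and> bounded_below (M_HF m w) G \<and>
         quasi_isomorphic (B_Kh m) (gr_M_HF m w G) (M_Kh m w) \<and>
         (\<exists>E. E1_page m w G E) \<and>
         (\<forall>E. E1_page m w G E \<longrightarrow> D_inf_isomorphic (B_Kh m) E (M_Kh m w)) \<and>
         (\<exists>E. Einf_page m w E) \<and>
         (\<forall>E. Einf_page m w E \<longrightarrow> D_inf_isomorphic (B_HF m) E (M_HF m w)))"
proof -
  \<comment> \<open>A braid is a class of words, and the relation relates only admissible words, so
    any representative can be used.\<close>
  have w: "w \<in> braid_words m"
    using assms(2,3) braid_rel_words by (auto simp: braid_group_def quotient_def)
  obtain deg p p' c where *: "filtered_dg (kh_alg m) (kh_unit m) (hf_alg m) (hf_unit m) kh_deg (lin psi)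
      (word_bimod (kh_alg m) (kh_elementary m) w) (word_bimod (hf_alg m) (hf_elementary m) w) deg (lin p)"
    and c: "\<And>x. x \<in> gens (word_bimod (kh_alg m) (kh_elementary m) w) \<Longrightarrow> c \<le> deg x"
    using filtered_dg_word[OF w] by blast
  interpret FD: filtered_dg "kh_alg m" "kh_unit m" "hf_alg m" "hf_unit m" kh_deg "lin psi"
    "word_bimod (kh_alg m) (kh_elementary m) w" "word_bimod (hf_alg m) (hf_elementary m) w" deg "lin p"
    by (rule *)
  note unfolds = B_Kh_def B_HF_def M_Kh_def M_HF_def F_HF_eq gr_M_HF_def E1_page_def Einf_page_def
  note Kh = FD.K0.bimod_model_lin_bimod
  \<comment> \<open>The associated graded, with scalars restricted along \<open>gr_iso\<close>, and
    \<open>M_Kh\<close> now are models with the same projection, \<open>total_op\<close> and unit.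
    Quasi-isomorphism and first page both come from this.\<close>
  interpret GR: bimod_model "lin_alg (kh_alg m)" "restrict_scalars (gr_iso m) FD.gM" FD.\<Theta>inv
    "FD.mod.\<Theta> \<circ> FD.K0.pr" "strict FD.K0.pr" FD.K0.total_op "kh_unit m"
    by (rule FD.bimod_model_gr) (rule gr_iso_eq)
  interpret HF: bimod_model "lin_alg (hf_alg m)" "lin_bimod (word_bimod (hf_alg m) (hf_elementary m) w)" id
    "id \<circ> FD.K1.pr" "strict FD.K1.pr" FD.K1.total_op "hf_unit m"
    by (rule FD.K1.bimod_model_lin_bimod)
  have "strict_ainf_iso (B_Kh m) (gr_alg (B_HF m) (F_HF m)) (gr_iso m)"
    unfolding unfolds
    by (rule strict_ainf_iso_cong[OF FD.strict_ainf_iso_gr]) (simp add: gr_iso_eq FD.A0.lin_alg_simps)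
  moreover have "exhaustive (M_HF m w) FD.G"
    unfolding unfolds by (rule FD.mod.fil_exhaustive)
  moreover have "bounded_below (M_HF m w) FD.G"
  proof -
    \<comment> \<open>No generator has degree below c.\<close>
    have "FD.G (c - 1) = {0}" by (rule FD.mod.fil_bot) (use c in force)
    then show ?thesis unfolding unfolds bounded_below_def FD.mod.V(3) by blast
  qed
  moreover have "filtered_bimodule (B_HF m) (F_HF m) (M_HF m w) FD.G"
    unfolding unfolds by (rule FD.filtered_bimodule_fil)
  moreover have "quasi_isomorphic (B_Kh m) (gr_M_HF m w FD.G) (M_Kh m w)"
    unfolding unfolds by (rule GR.quasi_isomorphic_model[OF Kh])
  moreover have "\<exists>E. E1_page m w FD.G E"
    unfolding unfolds by (rule GR.minimal_models_nonempty)
  moreover have "D_inf_isomorphic (B_Kh m) E (M_Kh m w)" if "E1_page m w FD.G E" for E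
    using that unfolding unfolds by (rule GR.D_inf_isomorphic_minimal_model[OF Kh])
  moreover have "\<exists>E. Einf_page m w E"
    unfolding unfolds by (rule HF.minimal_models_nonempty)
  \<comment> \<open>For the last page the bimodule serves both as the source of the transfer and as
    the target of the comparison.\<close>
  moreover have "D_inf_isomorphic (B_HF m) E (M_HF m w)" if "Einf_page m w E" for E
    using that unfolding unfolds by (rule HF.D_inf_isomorphic_minimal_model[OF HF.bimod_model_axioms])
  ultimately show ?thesis by blast
qed

end
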